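(* Let $\mathcal X\subset\mathbb C\setminus\{0,1\}$ be a small simply connected open set. Consider a continuous family, parameterized by $x\in\mathcal X$, of solutions $$\hat u(X,Y)=2\frac{\partial^2}{\partial X^2}\ln\theta(XU+YV+z_0)+c$$ of the Boussinesq equation $3\hat u_{YY}+(6\hat u\hat u_X+\hat u_{XXX})_X=0$, constructed on the Riemann surfaces $\mathcal L(x)$ with selected points $Q_0=Q_0(x)\in\mathcal L(x)$ (not ramification points), where $$U=-\frac1{2\pi \mathrm i}\oint_b W^{(0)}(\cdot,Q_0),\qquad V=-\frac1{\pi \mathrm i}\oint_b W^{(1)}(\cdot,Q_0).$$ Let $y_0=y_0(x)=u(Q_0(x))$. (i) If the period $U$ (the wave number) is the same for all solutions in the family, then $y_0$ as a function of $x$ satisfies the equation $(E_n)$ of the context with $n=0$. (ii) If the period $V$ (the frequency) is the same for all solutions in the family, then $y_0$ as a function of $x$ satisfies the equation $(E_n)$ of the context with $n=1$.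
   Context: For $x\in\mathbb C\setminus\{0,1\}$, $\mathcal L(x)$ is the compact genus one Riemann surface of the curve $v^2=u(u-1)(u-x)$, with points $P=(u(P),v(P))$; the covering $u:\mathcal L(x)\to\mathbb{CP}^1$ is ramified at $(0,0)$, $(1,0)$, $(x,0)$, $(\infty,\infty)$. A canonical homology basis $\{a,b\}$ is chosen consistently for $x\in\mathcal X$ (with $u(a),u(b)$ independent of $x$). $\omega$ is the holomorphic differential with $\oint_a\omega=1$ and $\tau=\oint_b\omega$. $\theta(z)=\sum_{m\in\mathbb Z}\exp(\pi \mathrm i m^2\tau+2\pi \mathrm i mz)$ is the theta function associated with $\mathcal L(x)$, and $z_0,c\in\mathbb C$ are constants (with respect to $X,Y$). For $Q_0$ not a ramification point and $y_0=u(Q_0)$, $W^{(n)}(P,Q_0)$ is the unique Abelian differential of the second kind in $P$ with zero $a$-period and only pole at $P=Q_0$, where $W^{(n)}(P,Q_0)=\left((u(P)-y_0)^{-n-2}+\mathcal O(1)\right)du(P)$. For integers $k\ge1$, $\Sigma_k=\frac1{(-y_0)^k}+\frac1{(1-y_0)^k}+\frac1{(x-y_0)^k}$, and for $l\ge0$ $$L_l=\sum_{\substack{p_1+2p_2+\dots+lp_l=l\\ p_j\ge0}}\frac{l!\,\Sigma_1^{p_1}\cdots\Sigma_l^{p_l}}{2^{p_1+\dots+p_l}\prod_{k=1}^l p_k!\prod_{k=1}^l k^{p_k}},\qquad L_0=1.$$ Equation $(E_n)$ (at points where $L_{n+1}\ne0$; empty sums are zero; prime is $d/dx$) is $$\begin{aligned}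 y_0''=&-(y_0')^2\frac{L_{n+2}}{L_{n+1}}-y_0'\left(\frac1x+\frac1{x-1}+\frac1{y_0-x}\right)+y_0'\,\frac{(n+1)!}{(x-y_0)^{n+2}L_{n+1}}\sum_{s=0}^{n}\frac{L_s(x-y_0)^s}{s!}\\ &+\frac{n!\left(\frac1x+\frac1{x-1}+\frac2{y_0-x}\right)}{2(x-y_0)^{n+1}L_{n+1}}\sum_{s=0}^{n-1}\frac{L_s(x-y_0)^s}{s!}-\frac{n!}{2(x-y_0)^{n+2}L_{n+1}}\sum_{s=0}^{n-1}\frac{(n-s)L_s(x-y_0)^s}{s!}\\ &-\frac{n!}{4(x-y_0)^{n+2}L_{n+1}}\sum_{s=1}^{n-1}\sum_{k=0}^{s-1}\frac{L_k(x-y_0)^k}{k!}\\ &-\frac{L_n}{4L_{n+1}}\left(\frac{2}{y_0-x}\left(\frac1x+\frac1{x-1}\right)+\frac{3}{(y_0-x)^2}+\frac1{x-1}-\frac1x\right). \end{aligned}$$ Here $Q_0(x)$ is a continuous section with $y_0(x)$ holomorphic in $x$. *)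

theory Defs
  imports "HOL-Complex_Analysis.Complex_Analysis" "HOL-Homology.Homology"
begin

definition affine_curve :: "complex \<Rightarrow> (complex \<times> complex) set" where
  "affine_curve x = {(u, v). v\<^sup>2 = u * (u - 1) * (u - x)}"

text \<open>The compact surface: \<^term>\<open>Some (u, v)\<close> is an affine point and \<^term>\<open>None\<close> is the
  point \<open>(\<infinity>, \<infinity>)\<close>.\<close>

definition surface :: "complex \<Rightarrow> (complex \<times> complex) option topology" where
  "surface x = Alexandroff_compactification (top_of_set (affine_curve x))"

text \<open>The covering \<^term>\<open>u\<close> is ramified exactly at \<open>(0,0)\<close>, \<open>(1,0)\<close>, \<open>(x,0)\<close> and at infinity,
  so the condition \<^term>\<open>v \<noteq> 0\<close> singles out the points at which \<^term>\<open>u\<close> is a local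
  coordinate.\<close>

definition unramified :: "complex \<Rightarrow> (complex \<times> complex) set" where
  "unramified x = {(u, v). (u, v) \<in> affine_curve x \<and> v \<noteq> 0}"

text \<open>The complex structure. A local parametrization centred at \<^term>\<open>P\<close> (which may be a
  ramification point or infinity) is an injective holomorphic map of a punctured disc that tends
  to \<^term>\<open>P\<close> at the centre; it then extends to the inverse of a chart. The discs are taken
  small enough to contain no ramification point except possibly \<^term>\<open>P\<close>.\<close>

definition local_param ::
  "complex \<Rightarrow> (complex \<times> complex) option \<Rightarrow> (complex \<Rightarrow> complex \<times> complex) \<Rightarrow> real \<Rightarrow> bool" where
  "local_param x P \<phi> r \<longleftrightarrow>
     r > 0 \<and>
     (\<lambda>t. fst (\<phi> t)) holomorphic_on (ball 0 r - {0}) \<and>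
     (\<lambda>t. snd (\<phi> t)) holomorphic_on (ball 0 r - {0}) \<and>
     inj_on \<phi> (ball 0 r - {0}) \<and>
     \<phi> ` (ball 0 r - {0}) \<subseteq> unramified x \<and>
     limitin (surface x) (\<lambda>t. Some (\<phi> t)) P (at 0)"

text \<open>A differential is represented by its coefficient \<^term>\<open>f\<close> with respect to \<open>du\<close>, a function
  of the point \<open>(u, v)\<close>; the values of \<^term>\<open>f\<close> at ramification points are irrelevant. The
  differential \<open>f du\<close> is holomorphic on a set of points of the surface if its expression in
  every local parameter centred at a point of the set extends holomorphically over the centre.\<close>

definition holomorphic_differential_on ::
  "complex \<Rightarrow> (complex \<times> complex) option set \<Rightarrow> (complex \<times> complex \<Rightarrow> complex) \<Rightarrow> bool" where
  "holomorphic_differential_on x S f \<longleftrightarrow>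
     (\<forall>P\<in>S. \<forall>\<phi> r. local_param x P \<phi> r \<and> (\<forall>t\<in>ball 0 r - {0}. Some (\<phi> t) \<in> S) \<longrightarrow>
        (\<exists>g. g holomorphic_on ball 0 r \<and>
             (\<forall>t\<in>ball 0 r - {0}. f (\<phi> t) * deriv (\<lambda>s. fst (\<phi> s)) t = g t)))"

definition surface_loop :: "complex \<Rightarrow> (real \<Rightarrow> complex \<times> complex) \<Rightarrow> bool" where
  "surface_loop x c \<longleftrightarrow>
     valid_path c \<and> pathfinish c = pathstart c \<and> path_image c \<subseteq> unramified x"

definition loop_chain :: "(real \<Rightarrow> complex \<times> complex) \<Rightarrow> (complex \<times> complex) option chain" where
  "loop_chain c = frag_of (restrict (\<lambda>t. Some (c (t 1))) (standard_simplex 1))"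

definition homologous_loops ::
  "complex \<Rightarrow> (real \<Rightarrow> complex \<times> complex) \<Rightarrow> (real \<Rightarrow> complex \<times> complex) \<Rightarrow> bool" where
  "homologous_loops x c c' \<longleftrightarrow>
     homologous_rel 1 (surface x) {} (loop_chain c) (loop_chain c')"

definition has_loop_integral ::
  "(complex \<times> complex \<Rightarrow> complex) \<Rightarrow> complex \<Rightarrow> (real \<Rightarrow> complex \<times> complex) \<Rightarrow> bool" where
  "has_loop_integral f I c \<longleftrightarrow>
     ((\<lambda>t. f (c t) * vector_derivative (\<lambda>s. fst (c s)) (at t within {0..1}))
        has_integral I) {0..1}"

text \<open>Periods belong to homology classes on the compact surface: the period of \<open>f du\<close> (a
  differential without residues, with poles in \<^term>\<open>S\<close>) over the class of \<^term>\<open>c\<close> is computed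
  on a representative of this class that avoids the poles. The loop \<^term>\<open>c\<close> itself is
  allowed to pass through poles.\<close>

definition has_period ::
  "complex \<Rightarrow> (complex \<times> complex) set \<Rightarrow> (complex \<times> complex \<Rightarrow> complex) \<Rightarrow>
     (real \<Rightarrow> complex \<times> complex) \<Rightarrow> complex \<Rightarrow> bool" where
  "has_period x S f c I \<longleftrightarrow>
     (\<exists>c'. surface_loop x c' \<and> path_image c' \<inter> S = {} \<and> homologous_loops x c' c \<and>
           has_loop_integral f I c')"

definition homology_basis ::
  "complex \<Rightarrow> (real \<Rightarrow> complex \<times> complex) \<Rightarrow> (real \<Rightarrow> complex \<times> complex) \<Rightarrow> bool" where
  "homology_basis x a b \<longleftrightarrow>
     (\<forall>z. singular_relcycle 1 (surface x) {} z \<longrightarrow>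
        (\<exists>!mn. homologous_rel 1 (surface x) {} z
                 (frag_cmul (fst mn) (loop_chain a) + frag_cmul (snd mn) (loop_chain b))))"

text \<open>The intersection index of two loops that cross transversally. At the crossing points the
  local coordinate \<^term>\<open>u\<close> defines the orientation; a crossing counts as \<open>+1\<close> if the tangent
  vectors of \<^term>\<open>a\<close> and \<^term>\<open>b\<close>, in this order, are positively oriented.\<close>

definition crossings ::
  "(real \<Rightarrow> complex \<times> complex) \<Rightarrow> (real \<Rightarrow> complex \<times> complex) \<Rightarrow> (real \<times> real) set" where
  "crossings a b = {(s, t). s \<in> {0..1} \<and> t \<in> {0..1} \<and> a s = b t}"

definition crossing_det ::
  "(real \<Rightarrow> complex \<times> complex) \<Rightarrow> (real \<Rightarrow> complex \<times> complex) \<Rightarrow> real \<times> real \<Rightarrow> real" where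
  "crossing_det a b = (\<lambda>(s, t).
     Im (cnj (vector_derivative (\<lambda>s. fst (a s)) (at s)) *
         vector_derivative (\<lambda>t. fst (b t)) (at t)))"

definition transversal_loops ::
  "(real \<Rightarrow> complex \<times> complex) \<Rightarrow> (real \<Rightarrow> complex \<times> complex) \<Rightarrow> bool" where
  "transversal_loops a b \<longleftrightarrow>
     finite (crossings a b) \<and>
     (\<forall>(s, t) \<in> crossings a b. s \<in> {0<..<1} \<and> t \<in> {0<..<1} \<and>
        (\<lambda>s. fst (a s)) differentiable (at s) \<and> (\<lambda>t. fst (b t)) differentiable (at t) \<and>
        crossing_det a b (s, t) \<noteq> 0)"

definition intersection_index ::
  "(real \<Rightarrow> complex \<times> complex) \<Rightarrow> (real \<Rightarrow> complex \<times> complex) \<Rightarrow> real" where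
  "intersection_index a b = (\<Sum>p\<in>crossings a b. sgn (crossing_det a b p))"

definition canonical_basis ::
  "complex \<Rightarrow> (real \<Rightarrow> complex \<times> complex) \<Rightarrow> (real \<Rightarrow> complex \<times> complex) \<Rightarrow> bool" where
  "canonical_basis x a b \<longleftrightarrow>
     surface_loop x a \<and> surface_loop x b \<and> homology_basis x a b \<and>
     transversal_loops a b \<and> intersection_index a b = 1"

definition consistent_canonical_bases ::
  "complex set \<Rightarrow> (complex \<Rightarrow> real \<Rightarrow> complex \<times> complex) \<Rightarrow>
     (complex \<Rightarrow> real \<Rightarrow> complex \<times> complex) \<Rightarrow> bool" where
  "consistent_canonical_bases \<X> a b \<longleftrightarrow>
     (\<forall>x\<in>\<X>. canonical_basis x (a x) (b x)) \<and>
     continuous_on (\<X> \<times> {0..1}) (\<lambda>(x, t). a x t) \<and>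
     continuous_on (\<X> \<times> {0..1}) (\<lambda>(x, t). b x t) \<and>
     (\<forall>x\<in>\<X>. \<forall>x'\<in>\<X>. \<forall>t\<in>{0..1}. fst (a x t) = fst (a x' t) \<and> fst (b x t) = fst (b x' t))"

definition normalized_holomorphic ::
  "complex \<Rightarrow> (real \<Rightarrow> complex \<times> complex) \<Rightarrow> (complex \<times> complex \<Rightarrow> complex) \<Rightarrow> bool" where
  "normalized_holomorphic x a f \<longleftrightarrow>
     holomorphic_differential_on x (topspace (surface x)) f \<and> has_period x {} f a 1"

text \<open>The condition on \<open>W\<^sup>(\<^sup>n\<^sup>)(P, Q)\<close> as a differential in \<open>P\<close>, with \<open>f = W / du\<close>.\<close>

definition normalized_second_kind ::
  "nat \<Rightarrow> complex \<Rightarrow> (real \<Rightarrow> complex \<times> complex) \<Rightarrow> complex \<times> complex \<Rightarrow>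
     (complex \<times> complex \<Rightarrow> complex) \<Rightarrow> bool" where
  "normalized_second_kind n x a Q f \<longleftrightarrow>
     holomorphic_differential_on x (topspace (surface x) - {Some Q}) f \<and>
     (\<lambda>P. f P - 1 / (fst P - fst Q) ^ (n + 2)) \<in> O[at Q within affine_curve x](\<lambda>_. 1) \<and>
     has_period x {Q} f a 0"

definition theta :: "complex \<Rightarrow> complex \<Rightarrow> complex" where
  "theta \<tau> z =
     (\<Sum>\<^sub>\<infinity>m::int. exp (of_real pi * \<i> * of_int m ^ 2 * \<tau> + 2 * of_real pi * \<i> * of_int m * z))"

text \<open>The second logarithmic derivative of \<open>\<theta>(XU + YV + z\<^sub>0)\<close> is written as the derivative of
  the logarithmic derivative, which needs no branch of the logarithm.\<close>

definition boussinesq_wave ::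
  "complex \<Rightarrow> complex \<Rightarrow> complex \<Rightarrow> complex \<Rightarrow> complex \<Rightarrow> complex \<Rightarrow> complex \<Rightarrow> complex" where
  "boussinesq_wave \<tau> U V z0 c X Y =
     2 * deriv (\<lambda>X1. deriv (\<lambda>X2. theta \<tau> (X2 * U + Y * V + z0)) X1
                       / theta \<tau> (X1 * U + Y * V + z0)) X + c"

definition boussinesq_at :: "(complex \<Rightarrow> complex \<Rightarrow> complex) \<Rightarrow> complex \<Rightarrow> complex \<Rightarrow> bool" where
  "boussinesq_at w X Y \<longleftrightarrow>
     3 * (deriv ^^ 2) (\<lambda>Y1. w X Y1) Y
     + deriv (\<lambda>X1. 6 * w X1 Y * deriv (\<lambda>X2. w X2 Y) X1 + (deriv ^^ 3) (\<lambda>X2. w X2 Y) X1) X = 0"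

definition Sigma_sum :: "nat \<Rightarrow> complex \<Rightarrow> complex \<Rightarrow> complex" where
  "Sigma_sum k x y = 1 / (- y) ^ k + 1 / (1 - y) ^ k + 1 / (x - y) ^ k"

definition weighted_partitions :: "nat \<Rightarrow> (nat \<Rightarrow> nat) set" where
  "weighted_partitions l = {p. (\<forall>j. j \<notin> {1..l} \<longrightarrow> p j = 0) \<and> (\<Sum>j=1..l. j * p j) = l}"

definition L_coeff :: "nat \<Rightarrow> complex \<Rightarrow> complex \<Rightarrow> complex" where
  "L_coeff l x y =
     (\<Sum>p\<in>weighted_partitions l.
        fact l * (\<Prod>k=1..l. Sigma_sum k x y ^ p k) /
        (2 ^ (\<Sum>k=1..l. p k) * (\<Prod>k=1..l. fact (p k)) * (\<Prod>k=1..l. of_nat k ^ p k)))"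

text \<open>The right-hand side of the equation for \<open>y''\<close>, with \<open>d\<close> standing for \<open>y'\<close>.\<close>

definition E_rhs :: "nat \<Rightarrow> complex \<Rightarrow> complex \<Rightarrow> complex \<Rightarrow> complex" where
  "E_rhs n x y d =
     (let L = (\<lambda>l. L_coeff l x y) in
      - d\<^sup>2 * (L (n + 2) / L (n + 1))
      - d * (1 / x + 1 / (x - 1) + 1 / (y - x))
      + d * (fact (n + 1) / ((x - y) ^ (n + 2) * L (n + 1)))
          * (\<Sum>s=0..n. L s * (x - y) ^ s / fact s)
      + fact n * (1 / x + 1 / (x - 1) + 2 / (y - x)) / (2 * (x - y) ^ (n + 1) * L (n + 1))
          * (\<Sum>s=0..<n. L s * (x - y) ^ s / fact s)
      - fact n / (2 * (x - y) ^ (n + 2) * L (n + 1))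
          * (\<Sum>s=0..<n. of_nat (n - s) * L s * (x - y) ^ s / fact s)
      - fact n / (4 * (x - y) ^ (n + 2) * L (n + 1))
          * (\<Sum>s=1..<n. \<Sum>k=0..<s. L k * (x - y) ^ k / fact k)
      - L n / (4 * L (n + 1))
          * (2 / (y - x) * (1 / x + 1 / (x - 1)) + 3 / (y - x)\<^sup>2 + 1 / (x - 1) - 1 / x))"

definition satisfies_E :: "nat \<Rightarrow> complex set \<Rightarrow> (complex \<Rightarrow> complex) \<Rightarrow> bool" where
  "satisfies_E n \<X> y \<longleftrightarrow>
     (\<forall>x\<in>\<X>. L_coeff (n + 1) x (y x) \<noteq> 0 \<longrightarrow>
        deriv (deriv y) x = E_rhs n x (y x) (deriv y x))"

end

theory Submission
  imports Defs
begin

text \<open>Let \<open>Q\<^sub>0 = (y\<^sub>0, v\<^sub>0)\<close>. Up to the differential of an explicit function with a pole at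
  \<open>Q\<^sub>0\<close>, the form \<open>W\<^sup>(\<^sup>n\<^sup>)\<close> equals \<open>(\<kappa> + \<beta> u) du / v\<close>, where \<open>\<beta> = 1 / (4 v\<^sub>0)\<close> for
  \<open>n = 0\<close> and \<open>\<beta> = L\<^sub>1 / (8 v\<^sub>0)\<close> for \<open>n = 1\<close>. As the \<open>a\<close>-period vanishes, the Legendre relation
  shows that the \<open>b\<close>-period is a nonzero constant times \<open>\<beta> / A\<close>, where \<open>A\<close> is the \<open>a\<close>-period of
  \<open>du / v\<close>. If it does not depend on \<open>x\<close>, then \<open>\<beta>\<close> is a multiple of \<open>A\<close> and so satisfies the
  Picard-Fuchs equation \<open>x (x - 1) \<beta>'' + (2 x - 1) \<beta>' + \<beta> / 4 = 0\<close>, which is the claimed equation for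
  \<open>y\<^sub>0\<close>.\<close>

section \<open>Calculus on the curve\<close>

text \<open>Periods belong to homology classes of the compact surface, and a homology may sweep
  across branch points and infinity, where \<open>u\<close> is not a coordinate and
  \<open>u du / v\<close> has a double pole. Invariance is therefore proved on singular chains: the
  forms \<open>(\<alpha> + \<beta> u) du / v\<close> have a single-valued primitive, possibly with a
  pole, near every point of the surface, and a sufficiently subdivided 2-chain fits into such
  neighbourhoods. The Legendre constant K is never evaluated; it is nonzero because a form of this
  shape with both periods zero would have a global primitive, which a Liouville argument on the
  curve excludes. The explicit function is a combination of \<open>v / (u - y)\<close>,
  \<open>v / (u - y)\<^sup>2\<close> and \<open>1 / (u - y) ^ (n + 1)\<close>. Cancelling its poles
  at the opposite point \<open>(y, - v)\<close> fixes the coefficients, and \<beta> is half the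
  coefficient of \<open>v / (u - y)\<close>, the only term whose differential contributes
  \<open>u du / v\<close> at infinity. The relation finally used is
  \<open>A * I = \<beta> * K\<close> for the b-period I, so nothing is ever divided by
  \<open>A\<close>.\<close>

abbreviation cubic :: "complex \<Rightarrow> complex \<Rightarrow> complex" where
  "cubic x u \<equiv> u * (u - 1) * (u - x)"

text \<open>\<open>D\<close> is the coefficient of \<open>dk\<close> with respect to \<open>du\<close> at \<open>P\<close>. Stating this as a
  Frechet derivative within the curve makes the rules for sums, products and compositions
  available without choosing a branch of \<open>v\<close>.\<close>

definition curve_deriv ::
  "complex \<Rightarrow> (complex \<times> complex \<Rightarrow> complex) \<Rightarrow> complex \<Rightarrow> complex \<times> complex \<Rightarrow> bool" where
  "curve_deriv x k D P \<longleftrightarrow> (k has_derivative (\<lambda>h. D * fst h)) (at P within affine_curve x)"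

lemma affine_curve_iff: "(u, v) \<in> affine_curve x \<longleftrightarrow> v\<^sup>2 = cubic x u"
  by (simp add: affine_curve_def)

lemma unramified_iff: "(u, v) \<in> unramified x \<longleftrightarrow> v\<^sup>2 = cubic x u \<and> v \<noteq> 0"
  by (simp add: unramified_def affine_curve_def)

lemma unramified_iff': "(u, v) \<in> unramified x \<longleftrightarrow> v\<^sup>2 = cubic x u \<and> u \<notin> {0, 1, x}"
  by (auto simp: unramified_iff)

lemma unramified_subset: "unramified x \<subseteq> affine_curve x"
  by (auto simp: unramified_def)

lemma closed_affine_curve: "closed (affine_curve x)"
proof -
  have "affine_curve x = (\<lambda>P. (snd P)\<^sup>2 - cubic x (fst P)) -` {0}"
    by (auto simp: affine_curve_def)
  moreover have "closed ((\<lambda>P. (snd P)\<^sup>2 - cubic x (fst P)) -` {0})"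
    by (intro closed_vimage continuous_intros)
  ultimately show ?thesis by simp
qed

lemma openin_unramified: "openin (top_of_set (affine_curve x)) (unramified x)"
proof -
  have "unramified x = affine_curve x \<inter> snd -` (- {0})"
    by (auto simp: unramified_def)
  moreover have "open (snd -` (- {0}) :: (complex \<times> complex) set)"
    by (intro open_vimage continuous_intros)
  ultimately show ?thesis by (simp add: openin_open_Int)
qed

section \<open>Branches of \<open>v\<close> near an unramified point\<close>

lemma ball_holomorphic_sqrt:
  fixes F :: "complex \<Rightarrow> complex"
  assumes "F holomorphic_on ball a r" "\<And>z. z \<in> ball a r \<Longrightarrow> F z \<noteq> 0"
  obtains g where "g holomorphic_on ball a r" "\<And>z. z \<in> ball a r \<Longrightarrow> F z = (g z)\<^sup>2"
  by (rule contractible_imp_holomorphic_sqrt[OF assms(1) convex_imp_contractible[OF convex_ball] assms(2)])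
     (use that in auto)

text \<open>A disc without branch points carries a holomorphic square root of the cubic; its sign is
  adjusted at the centre so that the branch passes through the given point.\<close>

lemma branch_exists:
  assumes "(u0, v0) \<in> unramified x" "ball u0 \<rho> \<inter> {0, 1, x} = {}" "\<rho> > 0"
  obtains w where "w holomorphic_on ball u0 \<rho>" "w u0 = v0"
    "\<And>u. u \<in> ball u0 \<rho> \<Longrightarrow> (w u)\<^sup>2 = cubic x u"
    "\<And>u. u \<in> ball u0 \<rho> \<Longrightarrow> w u \<noteq> 0"
proof -
  obtain g where g: "g holomorphic_on ball u0 \<rho>" "\<And>u. u \<in> ball u0 \<rho> \<Longrightarrow> cubic x u = (g u)\<^sup>2"
  proof (rule ball_holomorphic_sqrt[of "cubic x" u0 \<rho>])
    show "cubic x holomorphic_on ball u0 \<rho>" by (intro holomorphic_intros)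
    show "cubic x z \<noteq> 0" if "z \<in> ball u0 \<rho>" for z using assms(2) that by auto
  qed blast
  have nz: "g u \<noteq> 0" if "u \<in> ball u0 \<rho>" for u
    using g(2)[OF that] assms(2) that by auto
  have "(g u0)\<^sup>2 = v0\<^sup>2"
    using g(2)[of u0] assms(1,3) by (simp add: unramified_iff)
  then consider "g u0 = v0" | "- g u0 = v0"
    by (metis minus_minus power2_eq_iff)
  then show ?thesis
  proof cases
    case 1
    then show ?thesis using that[of g] g nz by simp
  next
    case 2
    then show ?thesis using that[of "\<lambda>u. - g u"] g nz by (auto intro: holomorphic_intros)
  qed
qed

text \<open>The two sheets are separated: if both \<open>w u\<close> and \<open>- w u\<close> were
  within \<open>norm (w u0)\<close> of \<open>w u0\<close>, the triangle inequality would give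
  \<open>2 * norm (w u0) < 2 * norm (w u0)\<close>. So near an unramified point the curve is the
  graph of one branch.\<close>

lemma near_branch:
  assumes "w holomorphic_on ball u0 \<rho>" "\<rho> > 0" "w u0 \<noteq> 0"
    and "\<And>u. u \<in> ball u0 \<rho> \<Longrightarrow> (w u)\<^sup>2 = cubic x u"
  obtains \<delta> where "\<delta> > 0"
    "\<And>u v. (u, v) \<in> affine_curve x \<Longrightarrow> dist (u, v) (u0, w u0) < \<delta> \<Longrightarrow> u \<in> ball u0 \<rho> \<and> v = w u"
proof -
  have "isCont w u0"
    using assms(1,2) by (meson centre_in_ball continuous_on_eq_continuous_at holomorphic_on_imp_continuous_on open_ball)
  then obtain d where d: "d > 0" "\<And>u. dist u u0 < d \<Longrightarrow> dist (w u) (w u0) < norm (w u0)"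
    using assms(3) unfolding continuous_at_eps_delta by (metis zero_less_norm_iff)
  define \<delta> where "\<delta> = min (min d \<rho>) (norm (w u0))"
  have "u \<in> ball u0 \<rho> \<and> v = w u"
    if uv: "(u, v) \<in> affine_curve x" "dist (u, v) (u0, w u0) < \<delta>" for u v
  proof -
    have du: "dist u u0 < \<delta>" and dv: "dist v (w u0) < \<delta>"
      using uv(2) dist_fst_le[of "(u, v)" "(u0, w u0)"] dist_snd_le[of "(u, v)" "(u0, w u0)"] by auto
    then have u: "u \<in> ball u0 \<rho>" by (simp add: \<delta>_def dist_commute)
    have "v\<^sup>2 = (w u)\<^sup>2" using uv(1) assms(4)[OF u] by (simp add: affine_curve_iff)
    then have "v = w u \<or> v = - w u" by (simp add: power2_eq_iff)
    moreover have "v \<noteq> - w u"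
    proof
      assume v: "v = - w u"
      have "dist (w u) (w u0) < norm (w u0)" using d(2) du by (simp add: \<delta>_def)
      moreover have "dist (- w u) (w u0) < norm (w u0)" using dv v by (simp add: \<delta>_def)
      ultimately have "norm (w u - w u0) + norm (- w u - w u0) < 2 * norm (w u0)"
        by (simp add: dist_norm)
      moreover have "norm ((w u - w u0) + (- w u - w u0)) \<le> norm (w u - w u0) + norm (- w u - w u0)"
        by (rule norm_triangle_ineq)
      moreover have "(w u - w u0) + (- w u - w u0) = - 2 * w u0" by simp
      ultimately show False by (simp add: norm_mult)
    qed
    ultimately show ?thesis using u by blast
  qed
  moreover have "\<delta> > 0" using d(1) assms by (simp add: \<delta>_def)
  ultimately show ?thesis using that by blast
qed

text \<open>The map \<open>\<lambda>u. (u, w u)\<close> parametrizes the curve, so composing with it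
  turns the Frechet derivative within the curve into an ordinary complex derivative. Together with
  the converse \<open>curve_derivI_branch\<close> this gives access to one-variable complex
  analysis.\<close>

lemma curve_deriv_branch:
  assumes "curve_deriv x k D (u0, w u0)" "(w has_field_derivative w') (at u0)"
    and "\<forall>\<^sub>F u in nhds u0. (u, w u) \<in> affine_curve x"
  shows "((\<lambda>u. k (u, w u)) has_field_derivative D) (at u0)"
proof -
  obtain S where S: "open S" "u0 \<in> S" "\<And>u. u \<in> S \<Longrightarrow> (u, w u) \<in> affine_curve x"
    using assms(3) by (auto simp: eventually_nhds)
  have "((\<lambda>u. (u, w u)) has_derivative (\<lambda>h. (h, w' * h))) (at u0 within S)"
    by (intro has_derivative_Pair has_derivative_ident has_derivative_at_withinI[OF assms(2)[unfolded has_field_derivative_def]])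
  moreover have "(k has_derivative (\<lambda>h. D * fst h)) (at (u0, w u0) within (\<lambda>u. (u, w u)) ` S)"
    using assms(1) S unfolding curve_deriv_def by (auto intro: has_derivative_subset)
  ultimately have "((\<lambda>u. k (u, w u)) has_derivative (\<lambda>h. D * fst (h, w' * h))) (at u0 within S)"
    by (rule has_derivative_in_compose)
  then show ?thesis
    unfolding has_field_derivative_def at_within_open[OF S(2,1)] by simp
qed

lemma curve_derivI_branch:
  assumes "((\<lambda>u. k (u, w u)) has_field_derivative D) (at u0)"
    and "\<forall>\<^sub>F P in at (u0, w u0) within affine_curve x. k P = k (fst P, w (fst P))"
    and "(u0, w u0) \<in> affine_curve x"
  shows "curve_deriv x k D (u0, w u0)"
proof -
  have "((\<lambda>P. k (fst P, w (fst P))) has_derivative (\<lambda>h. D * fst h)) (at (u0, w u0) within affine_curve x)"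
    by (rule has_derivative_compose[where f = fst and g = "\<lambda>u. k (u, w u)"])
       (use assms(1) in \<open>auto intro!: derivative_eq_intros simp: has_field_derivative_def\<close>)
  then show ?thesis
    unfolding curve_deriv_def
    by (rule has_derivative_transform_eventually) (use assms(2,3) in \<open>auto elim: eventually_mono\<close>)
qed

lemma eventually_on_branch:
  assumes "w holomorphic_on ball u0 \<rho>" "\<rho> > 0" "w u0 \<noteq> 0"
    and "\<And>u. u \<in> ball u0 \<rho> \<Longrightarrow> (w u)\<^sup>2 = cubic x u"
  shows "\<forall>\<^sub>F P in at (u0, w u0) within affine_curve x. fst P \<in> ball u0 \<rho> \<and> snd P = w (fst P)"
proof -
  obtain \<delta> where \<delta>: "\<delta> > 0"
    "\<And>u v. (u, v) \<in> affine_curve x \<Longrightarrow> dist (u, v) (u0, w u0) < \<delta> \<Longrightarrow> u \<in> ball u0 \<rho> \<and> v = w u"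
    using near_branch[OF assms] by blast
  show ?thesis
    unfolding eventually_at by (rule exI[of _ \<delta>]) (use \<delta> in auto)
qed

section \<open>Differentiation rules on the curve\<close>

lemma curve_deriv_const: "curve_deriv x (\<lambda>_. c) 0 P"
  by (simp add: curve_deriv_def)

lemma curve_deriv_fst: "curve_deriv x fst 1 P"
  unfolding curve_deriv_def by (auto intro!: derivative_eq_intros)

lemma curve_deriv_add:
  assumes "curve_deriv x f D P" "curve_deriv x g E P"
  shows "curve_deriv x (\<lambda>P. f P + g P) (D + E) P"
  using has_derivative_add[OF assms[unfolded curve_deriv_def]]
  by (simp add: curve_deriv_def algebra_simps)

lemma curve_deriv_diff:
  assumes "curve_deriv x f D P" "curve_deriv x g E P"
  shows "curve_deriv x (\<lambda>P. f P - g P) (D - E) P"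
  using has_derivative_diff[OF assms[unfolded curve_deriv_def]]
  by (simp add: curve_deriv_def algebra_simps)

lemma curve_deriv_mult:
  assumes "curve_deriv x f D P" "curve_deriv x g E P"
  shows "curve_deriv x (\<lambda>P. f P * g P) (f P * E + D * g P) P"
  using has_derivative_mult[OF assms[unfolded curve_deriv_def]]
  by (simp add: curve_deriv_def algebra_simps)

lemma curve_deriv_compose:
  assumes "curve_deriv x f D P" "(F has_field_derivative E) (at (f P))"
  shows "curve_deriv x (\<lambda>P. F (f P)) (E * D) P"
  using has_derivative_compose[OF assms(1)[unfolded curve_deriv_def] assms(2)[unfolded has_field_derivative_def]]
  by (simp add: curve_deriv_def mult.assoc)

lemma curve_deriv_divide:
  assumes "curve_deriv x f D P" "curve_deriv x g E P" "g P \<noteq> 0"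
  shows "curve_deriv x (\<lambda>P. f P / g P) ((D * g P - f P * E) / (g P)\<^sup>2) P"
proof -
  have "(inverse has_field_derivative - inverse ((g P)\<^sup>2)) (at (g P))"
    using assms(3) by (auto intro!: derivative_eq_intros simp: power2_eq_square)
  from curve_deriv_mult[OF assms(1) curve_deriv_compose[OF assms(2) this]] show ?thesis
    using assms(3) by (simp add: divide_inverse algebra_simps power2_eq_square)
qed

lemma curve_deriv_transform:
  assumes "curve_deriv x f D P" "P \<in> affine_curve x"
    and "\<forall>\<^sub>F P' in at P within affine_curve x. f P' = g P'" "f P = g P"
  shows "curve_deriv x g D P"
  using has_derivative_transform_eventually[OF assms(1)[unfolded curve_deriv_def] assms(3,4,2)]
  by (simp add: curve_deriv_def)

text \<open>A Frechet derivative within a set need not be unique; at an unramified point the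
  coefficient is, because it is an ordinary derivative along a branch. Later this lets unknown
  derivatives be found by differentiating one function in two ways.\<close>

lemma curve_deriv_unique_branch:
  assumes P: "(u0, v0) \<in> unramified x"
    and "curve_deriv x k D (u0, v0)" "curve_deriv x k E (u0, v0)"
  shows "D = E"
proof -
  have "open (- {0, 1, x})" by (simp add: finite_imp_closed open_Compl)
  then obtain \<rho> where \<rho>: "\<rho> > 0" "ball u0 \<rho> \<inter> {0, 1, x} = {}"
    using P unfolding unramified_iff' by (meson ComplI disjoint_eq_subset_Compl openE)
  obtain w where w: "w holomorphic_on ball u0 \<rho>" "w u0 = v0"
    "\<And>u. u \<in> ball u0 \<rho> \<Longrightarrow> (w u)\<^sup>2 = cubic x u"
    using branch_exists[OF P \<rho>(2,1)] by blast
  obtain w' where w': "(w has_field_derivative w') (at u0)"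
    using w(1) \<rho>(1) holomorphic_on_imp_differentiable_at[of w "ball u0 \<rho>" u0]
    by (auto simp: field_differentiable_def)
  have ev: "\<forall>\<^sub>F u in nhds u0. (u, w u) \<in> affine_curve x"
    using eventually_nhds_ball[OF \<rho>(1), of u0] by eventually_elim (auto simp: affine_curve_iff w(3))
  show ?thesis
    using curve_deriv_branch[OF _ w' ev, of k D] curve_deriv_branch[OF _ w' ev, of k E] assms(2,3)
      DERIV_unique w(2) by blast
qed

lemma unramified_nbhd:
  assumes "(u0, v0) \<in> unramified x"
  obtains \<rho> w where "\<rho> > 0" "ball u0 \<rho> \<inter> {0, 1, x} = {}" "w holomorphic_on ball u0 \<rho>" "w u0 = v0"
    "\<And>u. u \<in> ball u0 \<rho> \<Longrightarrow> (w u)\<^sup>2 = cubic x u" "\<And>u. u \<in> ball u0 \<rho> \<Longrightarrow> w u \<noteq> 0"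
proof -
  have "open (- {0, 1, x})" by (simp add: finite_imp_closed open_Compl)
  then obtain \<rho> where \<rho>: "\<rho> > 0" "ball u0 \<rho> \<inter> {0, 1, x} = {}"
    using assms unfolding unramified_iff' by (meson ComplI disjoint_eq_subset_Compl openE)
  obtain w where "w holomorphic_on ball u0 \<rho>" "w u0 = v0"
    "\<And>u. u \<in> ball u0 \<rho> \<Longrightarrow> (w u)\<^sup>2 = cubic x u" "\<And>u. u \<in> ball u0 \<rho> \<Longrightarrow> w u \<noteq> 0"
    using branch_exists[OF assms \<rho>(2,1)] by blast
  with \<rho> show ?thesis using that by blast
qed

text \<open>Implicit differentiation of \<open>(w u)\<^sup>2 = cubic x u\<close>; the numerator is
  the derivative of the cubic.\<close>

lemma branch_deriv:
  assumes "w holomorphic_on ball u0 \<rho>"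
    and "\<And>u. u \<in> ball u0 \<rho> \<Longrightarrow> (w u)\<^sup>2 = cubic x u" "\<And>u. u \<in> ball u0 \<rho> \<Longrightarrow> w u \<noteq> 0"
    and "u \<in> ball u0 \<rho>"
  shows "(w has_field_derivative (3 * u\<^sup>2 - 2 * (1 + x) * u + x) / (2 * w u)) (at u)"
proof -
  have w': "(w has_field_derivative deriv w u) (at u)"
    using assms(1,4) by (meson holomorphic_derivI open_ball)
  have "((\<lambda>u. (w u)\<^sup>2) has_field_derivative 2 * w u * deriv w u) (at u)"
    by (rule derivative_eq_intros w' refl | simp)+
  moreover have "((\<lambda>u. (w u)\<^sup>2) has_field_derivative 3 * u\<^sup>2 - 2 * (1 + x) * u + x) (at u)"
  proof (rule has_field_derivative_transform_within_open[of "cubic x" _ u "ball u0 \<rho>"])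
    show "(cubic x has_field_derivative 3 * u\<^sup>2 - 2 * (1 + x) * u + x) (at u)"
      by (rule derivative_eq_intros refl | simp)+ (simp add: algebra_simps power2_eq_square)
  qed (use assms in auto)
  ultimately have "2 * w u * deriv w u = 3 * u\<^sup>2 - 2 * (1 + x) * u + x"
    by (rule DERIV_unique)
  then have "deriv w u = (3 * u\<^sup>2 - 2 * (1 + x) * u + x) / (2 * w u)"
    using assms(3)[OF assms(4)] by (simp add: field_simps)
  then show ?thesis using w' by simp
qed

lemma curve_deriv_snd:
  assumes "(u, v) \<in> unramified x"
  shows "curve_deriv x snd ((3 * u\<^sup>2 - 2 * (1 + x) * u + x) / (2 * v)) (u, v)"
proof -
  obtain \<rho> w where w: "\<rho> > 0" "w holomorphic_on ball u \<rho>" "w u = v"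
    "\<And>z. z \<in> ball u \<rho> \<Longrightarrow> (w z)\<^sup>2 = cubic x z" "\<And>z. z \<in> ball u \<rho> \<Longrightarrow> w z \<noteq> 0"
    by (rule unramified_nbhd[OF assms]) blast
  have nz: "w u \<noteq> 0" using w(5)[of u] w(1) by simp
  have "curve_deriv x snd ((3 * u\<^sup>2 - 2 * (1 + x) * u + x) / (2 * w u)) (u, w u)"
  proof (rule curve_derivI_branch)
    show "((\<lambda>u. snd (u, w u)) has_field_derivative (3 * u\<^sup>2 - 2 * (1 + x) * u + x) / (2 * w u)) (at u)"
      using branch_deriv[OF w(2,4,5)] w(1) by simp
    show "\<forall>\<^sub>F P in at (u, w u) within affine_curve x. snd P = snd (fst P, w (fst P))"
      using eventually_on_branch[OF w(2,1) nz w(4)] by (auto elim: eventually_mono)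
    show "(u, w u) \<in> affine_curve x"
      using w(4)[of u] w(1) by (simp add: affine_curve_iff)
  qed
  then show ?thesis using w(3) by simp
qed

definition curve_holomorphic ::
  "complex \<Rightarrow> (complex \<times> complex) set \<Rightarrow> (complex \<times> complex \<Rightarrow> complex) \<Rightarrow> bool" where
  "curve_holomorphic x M f \<longleftrightarrow> (\<forall>P\<in>M. \<exists>D. curve_deriv x f D P)"

lemma local_graph:
  assumes "(u0, v0) \<in> M" "M \<subseteq> unramified x" "openin (top_of_set (affine_curve x)) M"
  obtains \<rho> w where "\<rho> > 0" "ball u0 \<rho> \<inter> {0, 1, x} = {}" "w holomorphic_on ball u0 \<rho>" "w u0 = v0"
    "\<And>u. u \<in> ball u0 \<rho> \<Longrightarrow> (w u)\<^sup>2 = cubic x u" "\<And>u. u \<in> ball u0 \<rho> \<Longrightarrow> w u \<noteq> 0"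
    "\<And>u. u \<in> ball u0 \<rho> \<Longrightarrow> (u, w u) \<in> M"
proof -
  obtain \<rho>1 w where w: "\<rho>1 > 0" "ball u0 \<rho>1 \<inter> {0, 1, x} = {}" "w holomorphic_on ball u0 \<rho>1" "w u0 = v0"
    "\<And>u. u \<in> ball u0 \<rho>1 \<Longrightarrow> (w u)\<^sup>2 = cubic x u" "\<And>u. u \<in> ball u0 \<rho>1 \<Longrightarrow> w u \<noteq> 0"
    using unramified_nbhd[of u0 v0 x] assms(1,2) by blast
  obtain T where T: "open T" "M = affine_curve x \<inter> T"
    using assms(3) by (auto simp: openin_open)
  have "continuous_on (ball u0 \<rho>1) (\<lambda>u. (u, w u))"
    using w(3) by (intro continuous_intros holomorphic_on_imp_continuous_on)
  then have "open (ball u0 \<rho>1 \<inter> (\<lambda>u. (u, w u)) -` T)"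
    using T(1) by (intro continuous_open_preimage) auto
  moreover have "u0 \<in> ball u0 \<rho>1 \<inter> (\<lambda>u. (u, w u)) -` T"
    using w(1,4) assms(1) T(2) by auto
  ultimately obtain \<rho>2 where \<rho>2: "\<rho>2 > 0" "ball u0 \<rho>2 \<subseteq> ball u0 \<rho>1 \<inter> (\<lambda>u. (u, w u)) -` T"
    by (rule openE)
  show ?thesis
  proof (rule that[of "min \<rho>1 \<rho>2" w])
    show "w holomorphic_on ball u0 (min \<rho>1 \<rho>2)"
      using w(3) by (rule holomorphic_on_subset) auto
    show "(u, w u) \<in> M" if "u \<in> ball u0 (min \<rho>1 \<rho>2)" for u
      using that w(5)[of u] \<rho>2(2) T(2) by (auto simp: affine_curve_iff)
  qed (use w \<rho>2 in auto)
qed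

lemma curve_holomorphic_branch:
  assumes "curve_holomorphic x M f" "w holomorphic_on ball u0 \<rho>"
    and "\<And>u. u \<in> ball u0 \<rho> \<Longrightarrow> (w u)\<^sup>2 = cubic x u" "\<And>u. u \<in> ball u0 \<rho> \<Longrightarrow> (u, w u) \<in> M"
  shows "(\<lambda>u. f (u, w u)) holomorphic_on ball u0 \<rho>"
proof -
  have "(\<lambda>u. f (u, w u)) field_differentiable at u" if u: "u \<in> ball u0 \<rho>" for u
  proof -
    obtain D where "curve_deriv x f D (u, w u)"
      using assms(1,4) u by (auto simp: curve_holomorphic_def)
    moreover have "(w has_field_derivative deriv w u) (at u)"
      using assms(2) u by (meson holomorphic_derivI open_ball)
    moreover have "\<forall>\<^sub>F u in nhds u. (u, w u) \<in> affine_curve x"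
      unfolding eventually_nhds
      by (rule exI[of _ "ball u0 \<rho>"]) (use u assms(3) in \<open>auto simp: affine_curve_iff\<close>)
    ultimately show ?thesis
      unfolding field_differentiable_def by (blast intro: curve_deriv_branch)
  qed
  then show ?thesis
    by (simp add: holomorphic_on_open field_differentiable_def)
qed

text \<open>On a small disc the form pulls back along the branch to a holomorphic function of
  \<open>u\<close>, which has a primitive \<open>F\<close>. The primitive on the curve is
  \<open>F (fst P)\<close>; it is correct only on the sheet of the branch, which is why the radius
  comes from \<open>near_branch\<close>.\<close>

lemma local_primitive:
  assumes "curve_holomorphic x M f" "M \<subseteq> unramified x" "openin (top_of_set (affine_curve x)) M" "P \<in> M"
  obtains r H where "r > 0"
    "\<And>P'. P' \<in> affine_curve x \<Longrightarrow> dist P' P < r \<Longrightarrow> P' \<in> M \<and> curve_deriv x H (f P') P'"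
proof -
  obtain u0 v0 where P: "P = (u0, v0)" by (cases P)
  obtain \<rho> w where w: "\<rho> > 0" "w holomorphic_on ball u0 \<rho>" "w u0 = v0"
    "\<And>u. u \<in> ball u0 \<rho> \<Longrightarrow> (w u)\<^sup>2 = cubic x u" "\<And>u. u \<in> ball u0 \<rho> \<Longrightarrow> w u \<noteq> 0"
    "\<And>u. u \<in> ball u0 \<rho> \<Longrightarrow> (u, w u) \<in> M"
    by (rule local_graph[OF assms(4)[unfolded P] assms(2,3)]) blast
  have hol: "(\<lambda>u. f (u, w u)) holomorphic_on ball u0 \<rho>"
    by (rule curve_holomorphic_branch[OF assms(1) w(2)]) (use w in blast)+
  obtain F where F: "\<And>u. u \<in> ball u0 \<rho> \<Longrightarrow> (F has_field_derivative f (u, w u)) (at u within ball u0 \<rho>)"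
    using holomorphic_convex_primitive'[OF convex_ball open_ball hol] by blast
  obtain r where r: "r > 0"
    "\<And>u v. (u, v) \<in> affine_curve x \<Longrightarrow> dist (u, v) (u0, w u0) < r \<Longrightarrow> u \<in> ball u0 \<rho> \<and> v = w u"
    using near_branch[OF w(2,1) _ w(4)] w(1,5) centre_in_ball by blast
  show ?thesis
  proof (rule that[OF r(1)])
    fix P' assume P': "P' \<in> affine_curve x" "dist P' P < r"
    then obtain u where u: "P' = (u, w u)" "u \<in> ball u0 \<rho>"
      using r(2) P w(3) by (cases P') auto
    have "(F has_field_derivative f (u, w u)) (at u)"
      using F[OF u(2)] unfolding at_within_open[OF u(2) open_ball] .
    then have "curve_deriv x (\<lambda>P. F (fst P)) (f P' * 1) P'"
      using curve_deriv_compose[OF curve_deriv_fst, of F "f P'" P'] u by simp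
    then show "P' \<in> M \<and> curve_deriv x (\<lambda>P. F (fst P)) (f P') P'"
      using w(6) u by simp
  qed
qed

section \<open>Integrals along paths on the curve\<close>

definition curve_integrand ::
  "(complex \<times> complex \<Rightarrow> complex) \<Rightarrow> (real \<Rightarrow> complex \<times> complex) \<Rightarrow> real \<Rightarrow> complex" where
  "curve_integrand f c = (\<lambda>t. f (c t) * vector_derivative (\<lambda>s. fst (c s)) (at t within {0..1}))"

lemma has_loop_integral_iff:
  "has_loop_integral f I c \<longleftrightarrow> (curve_integrand f c has_integral I) {0..1}"
  by (simp add: has_loop_integral_def curve_integrand_def)

text \<open>Fundamental theorem of calculus, stated for subintervals so that a path can be treated
  piecewise with primitives that exist only locally. The finitely many corners of the path are
  harmless because the primitive stays continuous there.\<close>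

lemma curve_integral_primitive:
  assumes c: "valid_path c" and st: "0 \<le> s" "s \<le> t" "t \<le> 1"
    and H: "\<And>r. r \<in> {s..t} \<Longrightarrow> c r \<in> affine_curve x \<and> curve_deriv x H (f (c r)) (c r)"
  shows "(curve_integrand f c has_integral H (c t) - H (c s)) {s..t}"
proof -
  obtain S where S: "finite S" "c C1_differentiable_on {0..1} - S"
    using c by (auto simp: valid_path_def piecewise_C1_differentiable_on_def)
  have contc: "continuous_on {s..t} c"
    using valid_path_imp_path[OF c] st by (auto simp: path_def intro: continuous_on_subset)
  have Hc: "(H has_derivative (\<lambda>h. f (c r) * fst h)) (at (c r) within c ` {s..t})" if "r \<in> {s..t}" for r
    by (rule has_derivative_subset[of _ _ _ "affine_curve x"]) (use H that in \<open>auto simp: curve_deriv_def\<close>)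
  show ?thesis
  proof (rule fundamental_theorem_of_calculus_interior_strong[OF S(1) st(2), of "\<lambda>r. H (c r)"])
    fix r assume r: "r \<in> {s<..<t} - S"
    then have r': "r \<in> {s..t}" "r \<in> {0..1} - S" using st by auto
    obtain D where D: "(c has_vector_derivative D) (at r)"
      using S(2) r'(2) unfolding C1_differentiable_on_def by blast
    have "((\<lambda>r. fst (c r)) has_vector_derivative fst D) (at r)"
      using has_derivative_fst[OF D[unfolded has_vector_derivative_def]] by (simp add: has_vector_derivative_def)
    then have vd: "vector_derivative (\<lambda>r. fst (c r)) (at r within {0..1}) = fst D"
      using r'(2) by (intro vector_derivative_at_within_ivl) auto
    have "((\<lambda>r. H (c r)) has_derivative (\<lambda>h. f (c r) * fst (h *\<^sub>R D))) (at r within {s..t})"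
      using has_derivative_in_compose[OF has_derivative_at_withinI[OF D[unfolded has_vector_derivative_def]] Hc[OF r'(1)]] .
    moreover have "at r within {s..t} = at r"
      using r by (intro at_within_interior) auto
    ultimately show "((\<lambda>r. H (c r)) has_vector_derivative curve_integrand f c r) (at r)"
      by (simp add: has_vector_derivative_def curve_integrand_def vd scaleR_conv_of_real mult_ac)
  next
    have "continuous (at P within c ` {s..t}) H" if "P \<in> c ` {s..t}" for P
      using that has_derivative_continuous[OF Hc] by auto
    then have "continuous_on (c ` {s..t}) H"
      by (simp add: continuous_on_eq_continuous_within)
    from continuous_on_compose2[OF this contc] show "continuous_on {s..t} (\<lambda>r. H (c r))"
      by blast
  qed
qed

locale curve_form =
  fixes x :: complex and M :: "(complex \<times> complex) set" and f :: "complex \<times> complex \<Rightarrow> complex"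
  assumes holo: "curve_holomorphic x M f" and sub: "M \<subseteq> unramified x"
    and opn: "openin (top_of_set (affine_curve x)) M"
begin

definition curve_path :: "(real \<Rightarrow> complex \<times> complex) \<Rightarrow> bool" where
  "curve_path c \<longleftrightarrow> valid_path c \<and> path_image c \<subseteq> M"

lemma path_local_primitive:
  assumes "curve_path c" "r \<in> {0..1}"
  obtains d H where "d > 0"
    "\<And>r'. r' \<in> {0..1} \<Longrightarrow> \<bar>r' - r\<bar> < d \<Longrightarrow> c r' \<in> affine_curve x \<and> curve_deriv x H (f (c r')) (c r')"
proof -
  have cM: "c r' \<in> M" if "r' \<in> {0..1}" for r'
    using assms(1) that by (auto simp: curve_path_def path_image_def)
  obtain e H where e: "e > 0"
    "\<And>P'. P' \<in> affine_curve x \<Longrightarrow> dist P' (c r) < e \<Longrightarrow> P' \<in> M \<and> curve_deriv x H (f P') P'"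
    using local_primitive[OF holo sub opn cM[OF assms(2)]] by blast
  have "continuous_on {0..1} c"
    using assms(1) valid_path_imp_path by (auto simp: curve_path_def path_def)
  then obtain d where d: "d > 0" "\<And>r'. r' \<in> {0..1} \<Longrightarrow> dist r' r < d \<Longrightarrow> dist (c r') (c r) < e"
    using assms(2) e(1) unfolding continuous_on_iff by meson
  show ?thesis
  proof (rule that[OF d(1)])
    fix r' assume r': "r' \<in> {0..1}" "\<bar>r' - r\<bar> < d"
    have "c r' \<in> affine_curve x" using cM[OF r'(1)] sub unramified_subset by blast
    then show "c r' \<in> affine_curve x \<and> curve_deriv x H (f (c r')) (c r')"
      using e(2) d(2)[OF r'(1)] r'(2) by (auto simp: dist_real_def)
  qed
qed

text \<open>Short pieces are integrable because a local primitive exists there, and integrability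
  passes to the union of adjacent intervals; the bisection principle \<open>Bolzano\<close> combines
  the two.\<close>

lemma curve_integrable:
  assumes c: "curve_path c" and "0 \<le> s" "s \<le> t" "t \<le> 1"
  shows "curve_integrand f c integrable_on {s..t}"
proof -
  have "{s..t} \<subseteq> {0..1} \<longrightarrow> curve_integrand f c integrable_on {s..t}"
    using \<open>s \<le> t\<close>
  proof (induction rule: Bolzano)
    case (trans p q r)
    then show ?case by (auto intro: Henstock_Kurzweil_Integration.integrable_combine[of p q r])
  next
    case (local r)
    then have r: "r \<in> {0..1}" using assms by auto
    obtain d H where d: "d > 0"
      "\<And>r'. r' \<in> {0..1} \<Longrightarrow> \<bar>r' - r\<bar> < d \<Longrightarrow> c r' \<in> affine_curve x \<and> curve_deriv x H (f (c r')) (c r')"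
      using path_local_primitive[OF c r] by blast
    have "curve_integrand f c integrable_on {p..q}"
      if "p \<le> r \<and> r \<le> q \<and> q - p < d" "{p..q} \<subseteq> {0..1}" for p q
    proof -
      have "(curve_integrand f c has_integral H (c q) - H (c p)) {p..q}"
      proof (rule curve_integral_primitive)
        fix r' assume "r' \<in> {p..q}"
        then show "c r' \<in> affine_curve x \<and> curve_deriv x H (f (c r')) (c r')"
          using that by (intro d(2)) auto
      qed (use that c in \<open>auto simp: curve_path_def\<close>)
      then show ?thesis by blast
    qed
    with d(1) show ?case by blast
  qed
  then show ?thesis using assms by auto
qed

text \<open>The primitive continued along one path, as a function of the parameter. It makes sense
  even if the form has no primitive on \<open>M\<close>, where different paths to the same point may
  give different values.\<close>

definition path_prim :: "(real \<Rightarrow> complex \<times> complex) \<Rightarrow> real \<Rightarrow> complex" where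
  "path_prim c t = integral {0..t} (curve_integrand f c)"

lemma path_prim_diff_le:
  assumes c: "curve_path c" and "0 \<le> p" "p \<le> q" "q \<le> 1"
    and "\<And>r. r \<in> {p..q} \<Longrightarrow> curve_deriv x H (f (c r)) (c r)"
  shows "path_prim c q - path_prim c p = H (c q) - H (c p)"
proof -
  have "c r \<in> affine_curve x" if "r \<in> {p..q}" for r
    using c that assms(2-4) sub unramified_subset by (force simp: curve_path_def path_image_def)
  then have "integral {p..q} (curve_integrand f c) = H (c q) - H (c p)"
    using assms c by (intro integral_unique curve_integral_primitive) (auto simp: curve_path_def)
  moreover have "path_prim c p + integral {p..q} (curve_integrand f c) = path_prim c q"
    unfolding path_prim_def using assms
    by (intro Henstock_Kurzweil_Integration.integral_combine curve_integrable) auto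
  ultimately show ?thesis by (metis add_diff_cancel_left')
qed

lemma path_prim_diff:
  assumes c: "curve_path c" and "p \<in> {0..1}" "q \<in> {0..1}"
    and "\<And>r. r \<in> {min p q..max p q} \<Longrightarrow> curve_deriv x H (f (c r)) (c r)"
  shows "path_prim c q - path_prim c p = H (c q) - H (c p)"
proof (cases "p \<le> q")
  case True
  then show ?thesis using assms by (intro path_prim_diff_le) auto
next
  case False
  then have "path_prim c p - path_prim c q = H (c p) - H (c q)"
    using assms by (intro path_prim_diff_le) auto
  then show ?thesis by (simp add: algebra_simps)
qed

text \<open>Affine changes of parameter of either orientation are enough for joining
  (\<open>m = 2\<close>) and reversing (\<open>m = - 1\<close>). On short pieces both sides are
  increments of the same local primitive, so no substitution rule is involved.\<close>

lemma curve_integral_reparam: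
  assumes c: "curve_path c" and c': "curve_path c'" and st: "0 \<le> s" "s \<le> t" "t \<le> 1"
    and eq: "\<And>r. r \<in> {s..t} \<Longrightarrow> m * r + k \<in> {0..1} \<and> c r = c' (m * r + k)"
  shows "(curve_integrand f c has_integral path_prim c' (m * t + k) - path_prim c' (m * s + k)) {s..t}"
proof -
  \<comment> \<open>Bisection generalizes over the endpoints, but \<open>eq\<close> is known only on
    the original interval, so that interval is frozen under the name \<open>K\<close>.\<close>
  define K where "K = {s..t}"
  have "{s..t} \<subseteq> K \<longrightarrow>
    (curve_integrand f c has_integral path_prim c' (m * t + k) - path_prim c' (m * s + k)) {s..t}"
    using \<open>s \<le> t\<close>
  proof (induction rule: Bolzano)
    case (trans p q r)
    show ?case
    proof
      assume "{p..r} \<subseteq> K"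
      then have "{p..q} \<subseteq> K" "{q..r} \<subseteq> K" using trans(3,4) by auto
      then have "(curve_integrand f c has_integral path_prim c' (m * q + k) - path_prim c' (m * p + k)) {p..q}"
        and "(curve_integrand f c has_integral path_prim c' (m * r + k) - path_prim c' (m * q + k)) {q..r}"
        using trans(1,2) by blast+
      from has_integral_combine[OF trans(3,4) this]
      show "(curve_integrand f c has_integral path_prim c' (m * r + k) - path_prim c' (m * p + k)) {p..r}"
        by simp
    qed
  next
    case (local r)
    obtain d H where d: "d > 0" "\<And>r'. r' \<in> {0..1} \<Longrightarrow> \<bar>r' - (m * r + k)\<bar> < d \<Longrightarrow>
        c' r' \<in> affine_curve x \<and> curve_deriv x H (f (c' r')) (c' r')"
      using path_local_primitive[OF c', of "m * r + k"] eq local by auto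
    \<comment> \<open>The affine map stretches distances by the factor \<open>\<bar>m\<bar>\<close>;
      adding 1 keeps the quotient meaningful for \<open>m = 0\<close>.\<close>
    define e where "e = d / (\<bar>m\<bar> + 1)"
    have e: "e > 0" using d(1) by (simp add: e_def)
    have loc: "(curve_integrand f c has_integral path_prim c' (m * q + k) - path_prim c' (m * p + k)) {p..q}"
      if pq': "p \<le> r \<and> r \<le> q \<and> q - p < e" "{p..q} \<subseteq> K" for p q
    proof -
      note pq = pq'[unfolded K_def]
      have near: "\<bar>(m * r' + k) - (m * r + k)\<bar> < d" if "r' \<in> {p..q}" for r'
      proof -
        have "\<bar>r' - r\<bar> < e" using that pq(1) by auto
        then have "(\<bar>m\<bar> + 1) * \<bar>r' - r\<bar> < (\<bar>m\<bar> + 1) * e" by (intro mult_strict_left_mono) auto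
        then have "(\<bar>m\<bar> + 1) * \<bar>r' - r\<bar> < d" by (simp add: e_def)
        moreover have "\<bar>m * (r' - r)\<bar> \<le> (\<bar>m\<bar> + 1) * \<bar>r' - r\<bar>"
          by (simp add: abs_mult mult_right_mono)
        ultimately show ?thesis by (simp add: algebra_simps)
      qed
      have p: "p \<in> {s..t}" and q: "q \<in> {s..t}" using pq by auto
      have "(curve_integrand f c has_integral H (c q) - H (c p)) {p..q}"
      proof (rule curve_integral_primitive)
        fix r' assume r': "r' \<in> {p..q}"
        then have "r' \<in> {s..t}" using pq(2) by blast
        then show "c r' \<in> affine_curve x \<and> curve_deriv x H (f (c r')) (c r')"
          using d(2)[OF _ near[OF r']] eq by simp
      qed (use pq st c in \<open>auto simp: curve_path_def\<close>)
      moreover have "path_prim c' (m * q + k) - path_prim c' (m * p + k) = H (c' (m * q + k)) - H (c' (m * p + k))"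
      proof (rule path_prim_diff[OF c'])
        fix z assume z: "z \<in> {min (m * p + k) (m * q + k)..max (m * p + k) (m * q + k)}"
        have "m * p + k \<in> {0..1}" "m * q + k \<in> {0..1}" using eq p q by auto
        then have "z \<in> {0..1}" using z by auto
        moreover have "\<bar>z - (m * r + k)\<bar> < d"
          using z near[of p] near[of q] pq by (auto simp: min_def max_def split: if_splits)
        ultimately show "curve_deriv x H (f (c' z)) (c' z)" using d(2) by blast
      qed (use eq p q in auto)
      ultimately show ?thesis using eq p q by simp
    qed
    show ?case
      by (rule exI[of _ e], rule conjI, rule e, intro allI impI, rule loc)
  qed
  then show ?thesis by (simp add: K_def)
qed

lemma path_prim_0 [simp]: "path_prim c 0 = 0"
  by (simp add: path_prim_def)

lemma curve_path_join:
  assumes "curve_path c1" "curve_path c2" "pathfinish c1 = pathstart c2"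
  shows "curve_path (c1 +++ c2)"
  using assms by (auto simp: curve_path_def path_image_join intro: valid_path_join)

lemma path_prim_join:
  assumes c: "curve_path c1" "curve_path c2" "pathfinish c1 = pathstart c2"
  shows "path_prim (c1 +++ c2) 1 = path_prim c1 1 + path_prim c2 1"
proof -
  have c12: "curve_path (c1 +++ c2)" using curve_path_join[OF c] .
  have "(curve_integrand f (c1 +++ c2) has_integral path_prim c1 (2 * (1/2) + 0) - path_prim c1 (2 * 0 + 0)) {0..1/2}"
    by (rule curve_integral_reparam[OF c12 c(1)]) (auto simp: joinpaths_def)
  moreover have "(curve_integrand f (c1 +++ c2) has_integral path_prim c2 (2 * 1 + -1) - path_prim c2 (2 * (1/2) + -1)) {1/2..1}"
  proof (rule curve_integral_reparam[OF c12 c(2)])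
    fix r :: real assume "r \<in> {1/2..1}"
    then show "2 * r + - 1 \<in> {0..1} \<and> (c1 +++ c2) r = c2 (2 * r + - 1)"
    proof (cases "r = 1/2")
      case True
      show ?thesis unfolding True using c(3) by (simp add: joinpaths_def pathfinish_def pathstart_def)
    qed (auto simp: joinpaths_def)
  qed auto
  ultimately have "(curve_integrand f (c1 +++ c2) has_integral path_prim c1 1 + path_prim c2 1) {0..1}"
    using has_integral_combine[of 0 "1/2" 1 "curve_integrand f (c1 +++ c2)"] by simp
  then show ?thesis by (simp add: path_prim_def integral_unique)
qed

lemma curve_path_reverse: "curve_path c \<Longrightarrow> curve_path (reversepath c)"
  by (simp add: curve_path_def valid_path_imp_reverse)

lemma path_prim_reverse:
  assumes c: "curve_path c"
  shows "path_prim (reversepath c) 1 = - path_prim c 1"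
proof -
  have "(curve_integrand f (reversepath c) has_integral path_prim c (-1 * 1 + 1) - path_prim c (-1 * 0 + 1)) {0..1}"
    by (rule curve_integral_reparam[OF curve_path_reverse[OF c] c]) (auto simp: reversepath_def)
  then show ?thesis by (simp add: path_prim_def integral_unique)
qed

text \<open>The primitive at \<open>P\<close> is the integral from a base point chosen on each path component, so
  that connectedness of the domain is not needed.\<close>

lemma global_primitive:
  assumes "\<And>c. curve_path c \<Longrightarrow> pathfinish c = pathstart c \<Longrightarrow> path_prim c 1 = 0"
  obtains g where "\<And>P. P \<in> M \<Longrightarrow> curve_deriv x g (f P) P"
proof -
  define conn where "conn P Q \<longleftrightarrow> (\<exists>c. curve_path c \<and> pathstart c = P \<and> pathfinish c = Q)" for P Q
  have conn_refl: "conn P P" if "P \<in> M" for P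
    unfolding conn_def using that by (intro exI[of _ "linepath P P"]) (auto simp: curve_path_def)
  have conn_sym: "conn Q P" if "conn P Q" for P Q
    using that unfolding conn_def by (metis curve_path_reverse pathfinish_reversepath pathstart_reversepath)
  have conn_trans: "conn P R" if "conn P Q" "conn Q R" for P Q R
    using that unfolding conn_def by (metis curve_path_join pathfinish_join pathstart_join)
  define base where "base P = (SOME Q. conn P Q)" for P
  have base: "conn (base P) P" if "P \<in> M" for P
    unfolding base_def using conn_refl[OF that] by (rule conn_sym[OF someI])
  have base_eq: "base P = base Q" if "conn P Q" for P Q
  proof -
    have "conn P = conn Q" using that conn_sym conn_trans by blast
    then show ?thesis by (simp add: base_def)
  qed
  define arc where "arc P = (SOME c. curve_path c \<and> pathstart c = base P \<and> pathfinish c = P)" for P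
  have arc: "curve_path (arc P) \<and> pathstart (arc P) = base P \<and> pathfinish (arc P) = P" if "P \<in> M" for P
    unfolding arc_def using base[OF that] unfolding conn_def by (rule someI_ex)
  define g where "g P = path_prim (arc P) 1" for P
  have step: "g Q - g P = path_prim c 1" if c: "curve_path c" "pathstart c = P" "pathfinish c = Q" for c P Q
  proof -
    have PM: "P \<in> M" "Q \<in> M"
      using c pathstart_in_path_image[of c] pathfinish_in_path_image[of c] by (auto simp: curve_path_def)
    have b: "base P = base Q" using base_eq c unfolding conn_def by blast
    note aP = arc[OF PM(1)] and aQ = arc[OF PM(2)]
    \<comment> \<open>Both arcs start at the common base point, so this path is closed and its
      integral vanishes by assumption; this is the path independence of \<open>g\<close>.\<close>
    let ?l = "(arc P +++ c) +++ reversepath (arc Q)"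
    have 1: "curve_path (arc P +++ c)" using aP c by (intro curve_path_join) auto
    have 2: "curve_path (reversepath (arc Q))" using aQ curve_path_reverse by blast
    have 3: "pathfinish (arc P +++ c) = pathstart (reversepath (arc Q))" using c aQ by simp
    have "path_prim ?l 1 = 0"
      using curve_path_join[OF 1 2 3] aP aQ b by (intro assms) auto
    then have "path_prim (arc P) 1 + path_prim c 1 - path_prim (arc Q) 1 = 0"
      using path_prim_join[OF 1 2 3] path_prim_join[of "arc P" c] path_prim_reverse[of "arc Q"] aP aQ c by simp
    then show ?thesis by (simp add: g_def algebra_simps)
  qed
  have "curve_deriv x g (f P) P" if P: "P \<in> M" for P
  proof -
    obtain u0 v0 where uv: "P = (u0, v0)" by (cases P)
    obtain \<rho> w where w: "\<rho> > 0" "w holomorphic_on ball u0 \<rho>" "w u0 = v0"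
      "\<And>u. u \<in> ball u0 \<rho> \<Longrightarrow> (w u)\<^sup>2 = cubic x u" "\<And>u. u \<in> ball u0 \<rho> \<Longrightarrow> w u \<noteq> 0"
      "\<And>u. u \<in> ball u0 \<rho> \<Longrightarrow> (u, w u) \<in> M"
      by (rule local_graph[OF P[unfolded uv] sub opn]) blast
    have hol: "(\<lambda>u. f (u, w u)) holomorphic_on ball u0 \<rho>"
      by (rule curve_holomorphic_branch[OF holo w(2)]) (use w in blast)+
    obtain F where F: "\<And>u. u \<in> ball u0 \<rho> \<Longrightarrow> (F has_field_derivative f (u, w u)) (at u within ball u0 \<rho>)"
      using holomorphic_convex_primitive'[OF convex_ball open_ball hol] by blast
    have F': "(F has_field_derivative f (u, w u)) (at u)" if "u \<in> ball u0 \<rho>" for u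
      using F[OF that] unfolding at_within_open[OF that open_ball] .
    have H: "curve_deriv x (\<lambda>P. F (fst P)) (f (u, w u)) (u, w u)" if "u \<in> ball u0 \<rho>" for u
      using curve_deriv_compose[OF curve_deriv_fst, of F "f (u, w u)" "(u, w u)"] F'[OF that] by simp
    have gF: "g (u, w u) - g (u0, w u0) = F u - F u0" if u: "u \<in> ball u0 \<rho>" for u
    proof -
      \<comment> \<open>The straight segment from \<open>u0\<close> to \<open>u\<close>, lifted to
        the curve by the branch. Its integral is computed both by \<open>g\<close> and by the local
        primitive \<open>F\<close>.\<close>
      define c where "c = (\<lambda>t. (linepath u0 u t, w (linepath u0 u t)))"
      have inb: "linepath u0 u t \<in> ball u0 \<rho>" if "t \<in> {0..1}" for t
        using that u w(1) by (metis centre_in_ball convex_ball convex_contains_segment linepath_in_path in_mono)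
      have "c C1_differentiable_on {0..1}"
        unfolding C1_differentiable_on_def
      proof (intro exI conjI ballI)
        fix t :: real assume t: "t \<in> {0..1}"
        have l: "(linepath u0 u has_vector_derivative u - u0) (at t)"
          by (rule has_vector_derivative_linepath_within)
        have "(w has_field_derivative deriv w (linepath u0 u t)) (at (linepath u0 u t))"
          using w(2) inb[OF t] by (meson holomorphic_derivI open_ball)
        from field_vector_diff_chain_at[OF l this]
        show "(c has_vector_derivative (u - u0, (u - u0) * deriv w (linepath u0 u t))) (at t)"
          unfolding c_def using l by (intro has_vector_derivative_Pair) (simp_all add: o_def)
      next
        have "continuous_on (linepath u0 u ` {0..1}) (deriv w)"
          by (rule holomorphic_on_imp_continuous_on, rule holomorphic_on_subset[OF holomorphic_deriv[OF w(2) open_ball]])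
             (use inb in blast)
        then have "continuous_on {0..1} (\<lambda>t. deriv w (linepath u0 u t))"
          by (rule continuous_on_compose2) (auto intro: continuous_on_linepath)
        then show "continuous_on {0..1} (\<lambda>t. (u - u0, (u - u0) * deriv w (linepath u0 u t)))"
          by (intro continuous_on_Pair continuous_on_mult continuous_on_const)
      qed
      then have "valid_path c"
        by (simp add: valid_path_def C1_differentiable_imp_piecewise)
      then have c: "curve_path c"
        using w(6) inb by (auto simp: curve_path_def c_def path_image_def)
      have "path_prim c 1 - path_prim c 0 = F (fst (c 1)) - F (fst (c 0))"
      proof (rule path_prim_diff[OF c])
        fix r assume "r \<in> {min 0 1..max 0 (1::real)}"
        then have "linepath u0 u r \<in> ball u0 \<rho>" by (intro inb) auto
        from H[OF this] show "curve_deriv x (\<lambda>P. F (fst P)) (f (c r)) (c r)"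
          by (simp add: c_def)
      qed auto
      moreover have "g (u, w u) - g (u0, w u0) = path_prim c 1"
        by (rule step[OF c]) (simp_all add: c_def pathstart_def pathfinish_def linepath_def)
      ultimately show ?thesis by (simp add: c_def linepath_def)
    qed
    have "curve_deriv x (\<lambda>P. F (fst P) + (g (u0, w u0) - F u0)) (f (u0, w u0) + 0) (u0, w u0)"
      by (intro curve_deriv_add curve_deriv_const H) (use w in auto)
    then have "curve_deriv x g (f (u0, w u0) + 0) (u0, w u0)"
    proof (rule curve_deriv_transform)
      show "\<forall>\<^sub>F P' in at (u0, w u0) within affine_curve x. F (fst P') + (g (u0, w u0) - F u0) = g P'"
      proof (rule eventually_mono[OF eventually_on_branch[OF w(2,1)]])
        fix P' :: "complex \<times> complex" assume "fst P' \<in> ball u0 \<rho> \<and> snd P' = w (fst P')"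
        then show "F (fst P') + (g (u0, w u0) - F u0) = g P'"
          using gF[of "fst P'"] by (cases P') (auto simp: algebra_simps)
      qed (use w in auto)
    qed (use w sub unramified_subset in force)+
    then show ?thesis using uv w(3) by simp
  qed
  then show ?thesis using that by blast
qed

end

section \<open>Homology invariance of the periods\<close>

text \<open>These forms are the span of the holomorphic differential \<open>du / v\<close> and of
  \<open>u du / v\<close>, which has a double pole at infinity and no residue. They represent the
  two-dimensional first cohomology of the surface.\<close>

definition basic_form :: "complex \<Rightarrow> complex \<Rightarrow> complex \<times> complex \<Rightarrow> complex" where
  "basic_form \<alpha> \<beta> P = (\<alpha> + \<beta> * fst P) / snd P"

lemma curve_form_basic: "curve_form x (unramified x) (basic_form \<alpha> \<beta>)"
proof
  show "curve_holomorphic x (unramified x) (basic_form \<alpha> \<beta>)"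
    unfolding curve_holomorphic_def
  proof
    fix P assume P: "P \<in> unramified x"
    obtain u v where uv: "P = (u, v)" by (cases P)
    have "curve_deriv x (\<lambda>P. \<alpha> + \<beta> * fst P) (0 + (\<beta> * 1 + 0 * fst P)) P"
      by (intro curve_deriv_add curve_deriv_mult curve_deriv_const curve_deriv_fst)
    moreover have "snd P \<noteq> 0" using P by (auto simp: unramified_def)
    ultimately have "\<exists>D. curve_deriv x (\<lambda>P. (\<alpha> + \<beta> * fst P) / snd P) D P"
      using curve_deriv_divide[OF _ curve_deriv_snd[OF P[unfolded uv]]] uv by blast
    then show "\<exists>D. curve_deriv x (basic_form \<alpha> \<beta>) D P"
      unfolding basic_form_def .
  qed
qed (use openin_unramified in auto)

lemma unramified_snd: "P \<in> unramified x \<Longrightarrow> snd P \<noteq> 0"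
  by (auto simp: unramified_def)

text \<open>After the simple zero at \<open>e\<close> is split off, the remaining factor of the
  cubic has no zero on a small disc and so has a holomorphic square root \<open>m\<close>. The
  quotient \<open>v / m u\<close> is then a square root of \<open>u - e\<close>.\<close>

lemma ramification_chart:
  assumes x: "x \<notin> {0, 1}" and e: "e \<in> {0, 1, x}"
  obtains \<rho> m where "\<rho> > 0" "ball e \<rho> \<inter> {0, 1, x} = {e}" "m holomorphic_on ball e \<rho>"
    "\<And>u. u \<in> ball e \<rho> \<Longrightarrow> m u \<noteq> 0" "\<And>u. u \<in> ball e \<rho> \<Longrightarrow> (u - e) * (m u)\<^sup>2 = cubic x u"
proof -
  have "open (- ({0, 1, x} - {e}))" by (intro open_Compl finite_imp_closed) simp
  moreover have "e \<in> - ({0, 1, x} - {e})" by simp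
  ultimately obtain \<rho> where \<rho>: "\<rho> > 0" "ball e \<rho> \<subseteq> - ({0, 1, x} - {e})"
    by (rule openE)
  have sep: "u = e \<or> u \<notin> {0, 1, x}" if "u \<in> ball e \<rho>" for u
    using subsetD[OF \<rho>(2) that] by blast
  have "\<exists>k. k holomorphic_on UNIV \<and> (\<forall>u. (u - e) * k u = cubic x u) \<and> k e \<noteq> 0"
  proof -
    consider "e = 0" | "e = 1" | "e = x" using e by auto
    then show ?thesis
    proof cases
      case 1
      show ?thesis using x unfolding 1 by (intro exI[of _ "\<lambda>u. (u - 1) * (u - x)"]) (auto intro!: holomorphic_intros)
    next
      case 2
      show ?thesis using x unfolding 2 by (intro exI[of _ "\<lambda>u. u * (u - x)"]) (auto intro!: holomorphic_intros)
    next
      case 3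
      show ?thesis using x unfolding 3 by (intro exI[of _ "\<lambda>u. u * (u - 1)"]) (auto intro!: holomorphic_intros)
    qed
  qed
  then obtain k where k: "k holomorphic_on UNIV" "\<And>u. (u - e) * k u = cubic x u" "k e \<noteq> 0" by blast
  have knz: "k u \<noteq> 0" if "u \<in> ball e \<rho>" for u
    using sep[OF that] k(2)[of u] k(3) by auto
  have kh: "k holomorphic_on ball e \<rho>" using k(1) holomorphic_on_subset by blast
  obtain m where m: "m holomorphic_on ball e \<rho>" "\<And>u. u \<in> ball e \<rho> \<Longrightarrow> k u = (m u)\<^sup>2"
    using ball_holomorphic_sqrt[OF kh knz] by blast
  show ?thesis
  proof (rule that[OF \<rho>(1) _ m(1)])
    show "ball e \<rho> \<inter> {0, 1, x} = {e}"
    proof (intro equalityI subsetI)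
      fix u assume "u \<in> ball e \<rho> \<inter> {0, 1, x}"
      then show "u \<in> {e}" using sep[of u] by blast
    qed (use e \<rho>(1) in auto)
    show "m u \<noteq> 0" if "u \<in> ball e \<rho>" for u using knz[OF that] m(2)[OF that] by auto
    show "(u - e) * (m u)\<^sup>2 = cubic x u" if "u \<in> ball e \<rho>" for u using k(2)[of u] m(2)[OF that] by simp
  qed
qed

text \<open>With \<open>s = 1 / u\<close> the cubic equals
  \<open>u ^ 3 * ((1 - s) * (1 - x * s))\<close>; the second factor is nonzero near
  \<open>s = 0\<close>, and \<open>m\<close> is its square root.\<close>

lemma infinity_chart:
  obtains \<rho> m where "\<rho> > 0" "m holomorphic_on ball 0 \<rho>"
    "\<And>s. s \<in> ball 0 \<rho> \<Longrightarrow> m s \<noteq> 0" "\<And>s. s \<in> ball 0 \<rho> \<Longrightarrow> (m s)\<^sup>2 = (1 - s) * (1 - x * s)"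
proof -
  have "open ((\<lambda>s. (1 - s) * (1 - x * s)) -` (- {0}))"
    by (intro open_vimage continuous_intros)
  moreover have "0 \<in> (\<lambda>s. (1 - s) * (1 - x * s)) -` (- {0})" by simp
  ultimately obtain \<rho> where \<rho>: "\<rho> > 0" "ball 0 \<rho> \<subseteq> (\<lambda>s. (1 - s) * (1 - x * s)) -` (- {0})"
    by (rule openE)
  have h: "(\<lambda>s. (1 - s) * (1 - x * s)) holomorphic_on ball 0 \<rho>" by (intro holomorphic_intros)
  have nz: "(1 - s) * (1 - x * s) \<noteq> 0" if "s \<in> ball 0 \<rho>" for s using \<rho>(2) that by blast
  obtain m where m: "m holomorphic_on ball 0 \<rho>" "\<And>s. s \<in> ball 0 \<rho> \<Longrightarrow> (1 - s) * (1 - x * s) = (m s)\<^sup>2"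
    using ball_holomorphic_sqrt[OF h nz] by blast
  show ?thesis
  proof (rule that[OF \<rho>(1) m(1)])
    show "m s \<noteq> 0" if "s \<in> ball 0 \<rho>" for s using nz[OF that] m(2)[OF that] by auto
  qed (use m(2) in simp)
qed

subsection \<open>Local primitives around all points of the compact surface\<close>

definition special_points :: "complex \<Rightarrow> (complex \<times> complex) option set" where
  "special_points x = {None, Some (0, 0), Some (1, 0), Some (x, 0)}"

text \<open>A primitive on a patch is not required to be continuous at the special points. Since no
  two patches share such a point, its increments along paths are still well defined.\<close>

definition patch ::
  "complex \<Rightarrow> (complex \<times> complex \<Rightarrow> complex) \<Rightarrow> (complex \<times> complex) option \<Rightarrow>
     (complex \<times> complex) option set \<Rightarrow> (complex \<times> complex \<Rightarrow> complex) \<Rightarrow> bool" where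
  "patch x f p U H \<longleftrightarrow> p \<in> U \<and> openin (surface x) U \<and> U \<inter> special_points x \<subseteq> {p} \<and>
     (\<forall>P. Some P \<in> U \<longrightarrow> snd P \<noteq> 0 \<longrightarrow> curve_deriv x H (f P) P)"

lemma topspace_surface: "topspace (surface x) = insert None (Some ` affine_curve x)"
  by (simp add: surface_def)

lemma openin_surface_image:
  "open S \<Longrightarrow> openin (surface x) (Some ` (affine_curve x \<inter> S))"
  by (simp add: surface_def openin_open_Int)

lemma openin_surface_vimage:
  assumes "openin (surface x) V"
  shows "openin (top_of_set (affine_curve x)) {P. Some P \<in> V}"
proof -
  from assms consider S where "openin (top_of_set (affine_curve x)) S" "V = Some ` S"
    | C where "closedin (top_of_set (affine_curve x)) C" "V = insert None (Some ` (affine_curve x - C))"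
    unfolding surface_def openin_Alexandroff_compactification by auto
  then show ?thesis
  proof cases
    case 1
    then have "{P. Some P \<in> V} = S" by auto
    then show ?thesis using 1 by simp
  next
    case 2
    then have "{P. Some P \<in> V} = topspace (top_of_set (affine_curve x)) - C" by auto
    then show ?thesis using 2(1) openin_diff by (metis openin_topspace)
  qed
qed

text \<open>On the curve a bound for \<open>u\<close> bounds \<open>v\<close>, since
  \<open>v\<^sup>2\<close> is a polynomial in \<open>u\<close>. The complements of these compact
  sets serve as neighbourhoods of infinity.\<close>

lemma compact_curve_part: "compact {P \<in> affine_curve x. norm (fst P) \<le> R}"
proof -
  have "compact ((\<lambda>u. cubic x u) ` cball 0 R)"
    by (intro compact_continuous_image continuous_intros) auto
  then obtain B where B: "\<And>u. norm u \<le> R \<Longrightarrow> norm (cubic x u) \<le> B"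
    using compact_imp_bounded bounded_iff by (metis (no_types, lifting) imageI mem_cball_0)
  have "{P \<in> affine_curve x. norm (fst P) \<le> R} \<subseteq> cball 0 R \<times> cball 0 (1 + \<bar>B\<bar>)"
  proof (clarsimp simp: affine_curve_iff)
    fix u v :: complex assume uv: "v\<^sup>2 = cubic x u" "norm u \<le> R"
    have "(norm v)\<^sup>2 \<le> \<bar>B\<bar>" using B[OF uv(2)] unfolding uv(1)[symmetric] by (simp add: norm_power)
    also have "\<dots> \<le> (1 + \<bar>B\<bar>)\<^sup>2" by (simp add: power2_eq_square algebra_simps)
    finally show "norm v \<le> 1 + \<bar>B\<bar>" by (rule power2_le_imp_le) simp
  qed
  then have "bounded {P \<in> affine_curve x. norm (fst P) \<le> R}"
    by (rule bounded_subset[rotated]) (intro bounded_Times bounded_cball)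
  moreover have "closed (affine_curve x \<inter> {P. norm (fst P) \<le> R})"
    by (intro closed_Int closed_affine_curve closed_Collect_le continuous_intros)
  ultimately show ?thesis by (simp add: compact_eq_bounded_closed Collect_conj_eq)
qed

lemma openin_surface_infinity:
  "openin (surface x) (insert None (Some ` {P \<in> affine_curve x. norm (fst P) > R}))"
proof -
  let ?C = "{P \<in> affine_curve x. norm (fst P) \<le> R}"
  have "compactin (top_of_set (affine_curve x)) ?C" "closedin (top_of_set (affine_curve x)) ?C"
    using compact_curve_part[of x R] compact_imp_closed[OF compact_curve_part[of x R]]
    by (auto simp: compactin_subtopology closed_subset)
  moreover have "{P \<in> affine_curve x. norm (fst P) > R} = affine_curve x - ?C" by auto
  ultimately show ?thesis
    unfolding surface_def openin_Alexandroff_compactification by auto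
qed

lemma patch_unramified:
  assumes P: "P \<in> unramified x" and f: "curve_form x (unramified x) f"
  shows "\<exists>U H. patch x f (Some P) U H"
proof -
  interpret curve_form x "unramified x" f by (rule f)
  obtain r H where r: "r > 0"
    "\<And>P'. P' \<in> affine_curve x \<Longrightarrow> dist P' P < r \<Longrightarrow> P' \<in> unramified x \<and> curve_deriv x H (f P') P'"
    using local_primitive[OF holo sub opn P] by blast
  let ?U = "Some ` (affine_curve x \<inter> ball P r)"
  have "Q \<in> unramified x \<and> curve_deriv x H (f Q) Q" if "Some Q \<in> ?U" for Q
    using that r(2) by (auto simp: dist_commute)
  moreover have "Some P \<in> ?U" using subsetD[OF unramified_subset P] r(1) by (intro imageI) simp
  moreover have "(e, 0) \<notin> unramified x" for e by (simp add: unramified_iff)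
  ultimately have "patch x f (Some P) ?U H"
    unfolding patch_def special_points_def using openin_surface_image[of "ball P r" x] by blast
  then show ?thesis by blast
qed

text \<open>In the uniformizer \<open>t = v / m(u)\<close>, with \<open>t\<^sup>2 = u - e\<close>, the form becomes
  \<open>2 (\<alpha> + \<beta> u) / m(u) dt\<close>.\<close>

lemma patch_ramified:
  assumes x: "x \<notin> {0, 1}" and e: "e \<in> {0, 1, x}"
  shows "\<exists>U H. patch x (basic_form \<alpha> \<beta>) (Some (e, 0)) U H"
proof -
  obtain \<rho> m where m: "\<rho> > 0" "ball e \<rho> \<inter> {0, 1, x} = {e}" "m holomorphic_on ball e \<rho>"
    "\<And>u. u \<in> ball e \<rho> \<Longrightarrow> m u \<noteq> 0" "\<And>u. u \<in> ball e \<rho> \<Longrightarrow> (u - e) * (m u)\<^sup>2 = cubic x u"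
    using ramification_chart[OF x e] by blast
  have sq: "e + t\<^sup>2 \<in> ball e \<rho>" if "t \<in> ball 0 (sqrt \<rho>)" for t :: complex
    using that real_sqrt_less_iff[of "(norm t)\<^sup>2" \<rho>] by (simp add: dist_norm norm_power)
  define k where "k t = 2 * (\<alpha> + \<beta> * (e + t\<^sup>2)) / m (e + t\<^sup>2)" for t
  have mc: "(\<lambda>t. m (e + t\<^sup>2)) holomorphic_on ball 0 (sqrt \<rho>)"
    by (rule holomorphic_on_compose_gen[OF _ m(3), unfolded o_def]) (auto intro!: holomorphic_intros sq)
  have "k holomorphic_on ball 0 (sqrt \<rho>)"
    unfolding k_def by (intro holomorphic_intros mc) (use m(4) sq in auto)
  then obtain F where F: "\<And>t. t \<in> ball 0 (sqrt \<rho>) \<Longrightarrow> (F has_field_derivative k t) (at t within ball 0 (sqrt \<rho>))"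
    using holomorphic_convex_primitive'[OF convex_ball open_ball] by blast
  define T where "T P = snd P / m (fst P)" for P
  let ?U = "Some ` (affine_curve x \<inter> {P. fst P \<in> ball e \<rho>})"
  have "open {P :: complex \<times> complex. fst P \<in> ball e \<rho>}"
    using open_vimage_fst[OF open_ball, of e \<rho>] by (simp add: vimage_def)
  then have opU: "openin (surface x) ?U" by (rule openin_surface_image)
  have "curve_deriv x (\<lambda>P. F (T P)) (basic_form \<alpha> \<beta> (u, v)) (u, v)"
    if uv: "(u, v) \<in> affine_curve x" "u \<in> ball e \<rho>" "v \<noteq> 0" for u v
  proof -
    have un: "(u, v) \<in> unramified x" using uv by (simp add: affine_curve_iff unramified_iff)
    have T2: "(T P)\<^sup>2 = fst P - e" if "P \<in> affine_curve x" "fst P \<in> ball e \<rho>" for P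
      using that m(5)[of "fst P"] m(4)[of "fst P"]
      by (cases P) (auto simp: T_def affine_curve_iff power_divide divide_eq_eq)
    have "(m has_field_derivative deriv m u) (at u)"
      using m(3) uv(2) by (meson holomorphic_derivI open_ball)
    then have "curve_deriv x (\<lambda>P. m (fst P)) (deriv m u * 1) (u, v)"
      by (intro curve_deriv_compose curve_deriv_fst) simp
    from curve_deriv_divide[OF curve_deriv_snd[OF un] this] obtain D where D: "curve_deriv x T D (u, v)"
      using m(4)[OF uv(2)] unfolding T_def by auto
    \<comment> \<open>Differentiating \<open>T * T = fst - e\<close> in two ways gives
      \<open>2 * T * D = 1\<close> by uniqueness, without computing \<open>D\<close>.\<close>
    have "curve_deriv x (\<lambda>P. T P * T P) (T (u, v) * D + D * T (u, v)) (u, v)"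
      by (intro curve_deriv_mult D)
    then have "curve_deriv x (\<lambda>P. fst P - e) (T (u, v) * D + D * T (u, v)) (u, v)"
    proof (rule curve_deriv_transform)
      have "\<forall>\<^sub>F P in at (u, v) within affine_curve x. P \<in> affine_curve x \<and> P \<in> {P. fst P \<in> ball e \<rho>}"
        using \<open>open {P. fst P \<in> ball e \<rho>}\<close> uv(2) by (auto simp: eventually_at_topological)
      then show "\<forall>\<^sub>F P in at (u, v) within affine_curve x. T P * T P = fst P - e"
        by eventually_elim (use T2 in \<open>auto simp: power2_eq_square\<close>)
      show "T (u, v) * T (u, v) = fst (u, v) - e" using T2[of "(u, v)"] uv by (simp add: power2_eq_square)
    qed fact
    moreover have "curve_deriv x (\<lambda>P. fst P - e) (1 - 0) (u, v)"
      by (intro curve_deriv_diff curve_deriv_fst curve_deriv_const)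
    ultimately have "T (u, v) * D + D * T (u, v) = 1"
      using curve_deriv_unique_branch[OF un] by fastforce
    then have TD: "2 * T (u, v) * D = 1" by (simp add: algebra_simps)
    have T2': "e + (T (u, v))\<^sup>2 = u" using T2[of "(u, v)"] uv by simp
    have "norm (T (u, v)) ^ 2 < \<rho>"
      using T2[of "(u, v)"] uv by (simp add: norm_power[symmetric] dist_norm norm_minus_commute)
    then have "norm (T (u, v)) < sqrt \<rho>" by (simp add: real_less_rsqrt)
    then have Tb: "T (u, v) \<in> ball 0 (sqrt \<rho>)" by simp
    have "curve_deriv x (\<lambda>P. F (T P)) (k (T (u, v)) * D) (u, v)"
      using F[OF Tb] unfolding at_within_open[OF Tb open_ball] by (intro curve_deriv_compose D)
    moreover have "k (T (u, v)) * D = basic_form \<alpha> \<beta> (u, v)"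
    proof -
      have Tv: "T (u, v) * m u = v" using m(4)[OF uv(2)] by (simp add: T_def)
      have km: "k (T (u, v)) * m u = 2 * (\<alpha> + \<beta> * u)"
        using m(4)[OF uv(2)] by (simp add: k_def T2')
      have "k (T (u, v)) * D * v = k (T (u, v)) * D * (T (u, v) * m u)"
        by (simp only: Tv)
      also have "\<dots> = (k (T (u, v)) * m u) * (T (u, v) * D)"
        by (simp only: mult_ac)
      finally have "k (T (u, v)) * D * v = (k (T (u, v)) * m u) * (T (u, v) * D)" .
      then have "k (T (u, v)) * D * v = (\<alpha> + \<beta> * u) * (2 * T (u, v) * D)"
        unfolding km by (simp only: mult_ac)
      then show ?thesis using TD uv(3) by (simp add: basic_form_def eq_divide_eq)
    qed
    ultimately show ?thesis by simp
  qed
  moreover have "?U \<inter> special_points x \<subseteq> {Some (e, 0)}"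
  proof
    fix q assume "q \<in> ?U \<inter> special_points x"
    then obtain e' where e': "q = Some (e', 0)" "e' \<in> {0, 1, x}" "e' \<in> ball e \<rho>"
      unfolding special_points_def by auto
    then have "e' \<in> {e}" using m(2) by blast
    then show "q \<in> {Some (e, 0)}" using e'(1) by simp
  qed
  moreover have "Some (e, 0) \<in> ?U" using m(1) e by (auto simp: affine_curve_iff)
  ultimately have "patch x (basic_form \<alpha> \<beta>) (Some (e, 0)) ?U (\<lambda>P. F (T P))"
    unfolding patch_def using opU by auto
  then show ?thesis by blast
qed

text \<open>In the uniformizer \<open>t = u m(1/u) / v\<close>, with \<open>t\<^sup>2 = 1/u\<close>, the form becomes
  \<open>- 2 (\<alpha> + \<beta> / t\<^sup>2) / m(t\<^sup>2) dt\<close>; since it is even in \<open>t\<close> it has no residue.\<close>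

lemma infinity_primitive:
  obtains \<rho> m F T where "\<rho> > 0" "m holomorphic_on ball 0 \<rho>"
    "\<And>s. s \<in> ball 0 \<rho> \<Longrightarrow> m s \<noteq> 0" "\<And>s. s \<in> ball 0 \<rho> \<Longrightarrow> (m s)\<^sup>2 = (1 - s) * (1 - x * s)"
    "\<And>t. t \<in> ball 0 (sqrt \<rho>) - {0} \<Longrightarrow> (F has_field_derivative - 2 * (\<alpha> + \<beta> / t\<^sup>2) / m (t\<^sup>2)) (at t)"
    "\<exists>C. \<forall>t. 0 < norm t \<and> norm t \<le> sqrt \<rho> / 2 \<longrightarrow> norm (F t) \<le> C / norm t"
proof -
  obtain \<rho> m where m: "\<rho> > 0" "m holomorphic_on ball 0 \<rho>"
    "\<And>s. s \<in> ball 0 \<rho> \<Longrightarrow> m s \<noteq> 0" "\<And>s. s \<in> ball 0 \<rho> \<Longrightarrow> (m s)\<^sup>2 = (1 - s) * (1 - x * s)"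
    using infinity_chart by blast
  define q where "q s = 1 / m s" for s
  \<comment> \<open>The difference quotient of \<open>q\<close> at 0 separates the polar part:
    \<open>q (t\<^sup>2) / t\<^sup>2 = \<psi> (t\<^sup>2) + q 0 / t\<^sup>2\<close>, with a
    holomorphic first term and a second term that has the explicit primitive
    \<open>- q 0 / t\<close>.\<close>
  define \<psi> where "\<psi> s = (if s = 0 then deriv q 0 else (q s - q 0) / (s - 0))" for s
  have q: "q holomorphic_on ball 0 \<rho>" unfolding q_def by (intro holomorphic_intros m)
  have \<psi>: "\<psi> holomorphic_on ball 0 \<rho>" unfolding \<psi>_def by (rule pole_lemma_open[OF q open_ball])
  have sq: "t\<^sup>2 \<in> ball 0 \<rho>" if "t \<in> ball 0 (sqrt \<rho>)" for t :: complex
    using that real_sqrt_less_iff[of "(norm t)\<^sup>2" \<rho>] by (simp add: norm_power)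
  define k where "k t = \<alpha> * q (t\<^sup>2) + \<beta> * \<psi> (t\<^sup>2)" for t
  have "(\<lambda>t. q (t\<^sup>2)) holomorphic_on ball 0 (sqrt \<rho>)" "(\<lambda>t. \<psi> (t\<^sup>2)) holomorphic_on ball 0 (sqrt \<rho>)"
    by (rule holomorphic_on_compose_gen[OF _ q, unfolded o_def] holomorphic_on_compose_gen[OF _ \<psi>, unfolded o_def];
        auto intro!: holomorphic_intros sq)+
  then have "k holomorphic_on ball 0 (sqrt \<rho>)"
    unfolding k_def by (intro holomorphic_intros)
  then obtain G where G: "\<And>t. t \<in> ball 0 (sqrt \<rho>) \<Longrightarrow> (G has_field_derivative k t) (at t within ball 0 (sqrt \<rho>))"
    using holomorphic_convex_primitive'[OF convex_ball open_ball] by blast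
  have G': "(G has_field_derivative k t) (at t)" if "t \<in> ball 0 (sqrt \<rho>)" for t
    using G[OF that] unfolding at_within_open[OF that open_ball] .
  define F where "F t = - 2 * (G t - \<beta> * q 0 / t)" for t
  have "compact (G ` cball 0 (sqrt \<rho> / 2))"
  proof (intro compact_continuous_image continuous_at_imp_continuous_on ballI)
    fix t :: complex assume "t \<in> cball 0 (sqrt \<rho> / 2)"
    moreover have "0 < sqrt \<rho>" using m(1) by simp
    ultimately have "norm t < sqrt \<rho>" unfolding mem_cball_0 by linarith
    then have "t \<in> ball 0 (sqrt \<rho>)" by simp
    then show "isCont G t" using G' DERIV_isCont by blast
  qed simp
  then obtain B where B: "\<And>t. norm t \<le> sqrt \<rho> / 2 \<Longrightarrow> norm (G t) \<le> B"
    using compact_imp_bounded bounded_iff by (metis (no_types, lifting) imageI mem_cball_0)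
  \<comment> \<open>The simple pole of the primitive is recorded as a bound of order
    \<open>1 / norm t\<close>, which later controls its growth in \<open>u\<close>.\<close>
  have bnd: "norm (F t) \<le> (2 * (\<bar>B\<bar> * sqrt \<rho> + norm (\<beta> * q 0))) / norm t"
    if t: "0 < norm t" "norm t \<le> sqrt \<rho> / 2" for t :: complex
  proof -
    have "norm (G t - \<beta> * q 0 / t) \<le> norm (G t) + norm (\<beta> * q 0 / t)" by (rule norm_triangle_ineq4)
    also have "norm (G t) \<le> \<bar>B\<bar>" using B[OF t(2)] by simp
    also have "\<bar>B\<bar> \<le> (\<bar>B\<bar> * sqrt \<rho>) / norm t"
    proof -
      have "norm t \<le> sqrt \<rho>" using t m(1) by (smt (verit) field_sum_of_halves)
      then have "\<bar>B\<bar> * norm t \<le> \<bar>B\<bar> * sqrt \<rho>" by (rule mult_left_mono) simp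
      then show ?thesis using t(1) by (simp add: pos_le_divide_eq)
    qed
    finally have "norm (G t - \<beta> * q 0 / t) \<le> (\<bar>B\<bar> * sqrt \<rho> + norm (\<beta> * q 0)) / norm t"
      by (simp add: norm_divide add_divide_distrib)
    moreover have "norm (F t) = 2 * norm (G t - \<beta> * q 0 / t)"
      unfolding F_def norm_mult by simp
    ultimately show ?thesis unfolding times_divide_eq_right[symmetric] by linarith
  qed
  show ?thesis
  proof (rule that[OF m])
    fix t :: complex assume t: "t \<in> ball 0 (sqrt \<rho>) - {0}"
    have "(F has_field_derivative - 2 * (k t - (- (\<beta> * q 0) / t\<^sup>2))) (at t)"
      unfolding F_def using t
      by (auto intro!: derivative_eq_intros G' simp: power2_eq_square)
    moreover have "k t - (- (\<beta> * q 0) / t\<^sup>2) = (\<alpha> + \<beta> / t\<^sup>2) / m (t\<^sup>2)"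
    proof -
      have "\<psi> (t\<^sup>2) = (q (t\<^sup>2) - q 0) / t\<^sup>2" using t by (simp add: \<psi>_def)
      then have "k t - (- (\<beta> * q 0) / t\<^sup>2) = \<alpha> * q (t\<^sup>2) + (\<beta> * ((q (t\<^sup>2) - q 0) / t\<^sup>2) + \<beta> * q 0 / t\<^sup>2)"
        by (simp add: k_def)
      also have "\<dots> = (\<alpha> + \<beta> / t\<^sup>2) * q (t\<^sup>2)"
        by (simp add: algebra_simps diff_divide_distrib)
      finally show ?thesis by (simp add: q_def)
    qed
    ultimately show "(F has_field_derivative - 2 * (\<alpha> + \<beta> / t\<^sup>2) / m (t\<^sup>2)) (at t)"
      by (simp only: times_divide_eq_right)
  next
    show "\<exists>C. \<forall>t. 0 < norm t \<and> norm t \<le> sqrt \<rho> / 2 \<longrightarrow> norm (F t) \<le> C / norm t"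
      using bnd by blast
  qed
qed

lemma patch_infinity:
  shows "\<exists>U H. patch x (basic_form \<alpha> \<beta>) None U H"
proof -
  obtain \<rho> m F where m: "\<rho> > 0" "m holomorphic_on ball 0 \<rho>"
    "\<And>s. s \<in> ball 0 \<rho> \<Longrightarrow> m s \<noteq> 0" "\<And>s. s \<in> ball 0 \<rho> \<Longrightarrow> (m s)\<^sup>2 = (1 - s) * (1 - x * s)"
    and F: "\<And>t. t \<in> ball 0 (sqrt \<rho>) - {0} \<Longrightarrow> (F has_field_derivative - 2 * (\<alpha> + \<beta> / t\<^sup>2) / m (t\<^sup>2)) (at t)"
    using infinity_primitive[of x \<alpha> \<beta>] by metis
  \<comment> \<open>The first entry puts \<open>1 / u\<close> into the disc of the chart, the second
    keeps all finite branch points out of the patch.\<close>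
  define R where "R = max (1 / \<rho>) (1 + norm x)"
  define T where "T P = fst P * m (1 / fst P) / snd P" for P
  let ?U = "insert None (Some ` {P \<in> affine_curve x. norm (fst P) > R})"
  have R: "1 / \<rho> \<le> R" "1 + norm x \<le> R" by (simp_all add: R_def)
  then have R0: "R > 0" using norm_ge_zero[of x] by linarith
  have inv: "1 / u \<in> ball 0 \<rho> \<and> u \<noteq> 0" if "norm u > R" for u :: complex
  proof -
    have "norm u > 1 / \<rho>" "norm u > 0" using that R R0 by linarith+
    then show ?thesis using m(1) by (auto simp: norm_divide divide_less_eq mult.commute)
  qed
  have op: "open {P :: complex \<times> complex. norm (fst P) > R}"
    by (intro open_Collect_less continuous_intros)
  have "curve_deriv x (\<lambda>P. F (T P)) (basic_form \<alpha> \<beta> (u, v)) (u, v)"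
    if uv: "(u, v) \<in> affine_curve x" "norm u > R" "v \<noteq> 0" for u v
  proof -
    have un: "(u, v) \<in> unramified x" using uv by (simp add: affine_curve_iff unramified_iff)
    note iu = inv[OF uv(2)]
    have T2: "(T P)\<^sup>2 = 1 / fst P" if P: "P \<in> affine_curve x" "norm (fst P) > R" "snd P \<noteq> 0" for P
    proof -
      have P0: "fst P \<noteq> 0" "1 / fst P \<in> ball 0 \<rho>" using inv[OF P(2)] by auto
      have "(snd P)\<^sup>2 = cubic x (fst P)" using P(1) by (cases P) (simp add: affine_curve_iff)
      also have "\<dots> = fst P ^ 3 * ((1 - 1 / fst P) * (1 - x * (1 / fst P)))"
        using P0(1) by (simp add: field_simps power3_eq_cube)
      also have "\<dots> = fst P ^ 3 * (m (1 / fst P))\<^sup>2"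
        unfolding m(4)[OF P0(2)] ..
      finally show ?thesis using P0(1) m(3)[OF P0(2)] P(3) by (simp add: T_def power_divide power_mult_distrib field_simps power2_eq_square power3_eq_cube)
    qed
    have "(m has_field_derivative deriv m (1 / u)) (at (1 / u))"
      using m(2) iu by (meson holomorphic_derivI open_ball)
    moreover have "curve_deriv x (\<lambda>P. 1 / fst P) ((0 * fst (u, v) - 1 * 1) / (fst (u, v))\<^sup>2) (u, v)"
      by (intro curve_deriv_divide curve_deriv_const curve_deriv_fst) (use iu in auto)
    ultimately have "\<exists>D. curve_deriv x (\<lambda>P. fst P * m (1 / fst P)) D (u, v)"
      using curve_deriv_mult[OF curve_deriv_fst curve_deriv_compose] by fastforce
    then obtain D where D: "curve_deriv x T D (u, v)"
      using curve_deriv_divide[OF _ curve_deriv_snd[OF un]] uv(3) unfolding T_def by fastforce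
    \<comment> \<open>As at the finite branch points, \<open>D\<close> is found by differentiating
      \<open>T * T = 1 / u\<close> in two ways.\<close>
    have "curve_deriv x (\<lambda>P. T P * T P) (T (u, v) * D + D * T (u, v)) (u, v)"
      by (intro curve_deriv_mult D)
    then have "curve_deriv x (\<lambda>P. 1 / fst P) (T (u, v) * D + D * T (u, v)) (u, v)"
    proof (rule curve_deriv_transform)
      have "open {P :: complex \<times> complex. norm (fst P) > R \<and> snd P \<noteq> 0}"
        by (intro open_Collect_conj op open_Collect_neq continuous_intros)
      then have "\<forall>\<^sub>F P in at (u, v) within affine_curve x. P \<in> affine_curve x \<and> norm (fst P) > R \<and> snd P \<noteq> 0"
        using uv by (auto simp: eventually_at_topological)
      then show "\<forall>\<^sub>F P in at (u, v) within affine_curve x. T P * T P = 1 / fst P"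
        by eventually_elim (use T2 in \<open>auto simp: power2_eq_square\<close>)
      show "T (u, v) * T (u, v) = 1 / fst (u, v)" using T2[of "(u, v)"] uv by (simp add: power2_eq_square)
    qed fact
    moreover have "curve_deriv x (\<lambda>P. 1 / fst P) ((0 * fst (u, v) - 1 * 1) / (fst (u, v))\<^sup>2) (u, v)" by fact
    ultimately have "T (u, v) * D + D * T (u, v) = - 1 / u\<^sup>2"
      using curve_deriv_unique_branch[OF un] by fastforce
    then have TD: "2 * T (u, v) * D = - 1 / u\<^sup>2" by (simp add: algebra_simps)
    have T2': "(T (u, v))\<^sup>2 = 1 / u" using T2[of "(u, v)"] uv by simp
    then have T0: "T (u, v) \<noteq> 0" using iu by auto
    have "norm (T (u, v)) ^ 2 < \<rho>"
      using iu by (simp add: norm_power[symmetric] T2')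
    then have "norm (T (u, v)) < sqrt \<rho>" by (simp add: real_less_rsqrt)
    then have Tb: "T (u, v) \<in> ball 0 (sqrt \<rho>) - {0}" using T0 by simp
    have "curve_deriv x (\<lambda>P. F (T P)) (- 2 * (\<alpha> + \<beta> / (T (u, v))\<^sup>2) / m ((T (u, v))\<^sup>2) * D) (u, v)"
      by (intro curve_deriv_compose D F Tb)
    moreover have "- 2 * (\<alpha> + \<beta> / (T (u, v))\<^sup>2) / m ((T (u, v))\<^sup>2) * D = basic_form \<alpha> \<beta> (u, v)"
    proof -
      have mz: "m (1 / u) \<noteq> 0" using m(3) iu by blast
      have Tv: "T (u, v) * v = u * m (1 / u)" using uv(3) by (simp add: T_def)
      have e1: "- 2 * (\<alpha> + \<beta> / (T (u, v))\<^sup>2) / m ((T (u, v))\<^sup>2) * D = - 2 * (\<alpha> + \<beta> * u) / m (1 / u) * D"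
        by (simp add: T2')
      have e2: "- 2 * (\<alpha> + \<beta> * u) / m (1 / u) * D * v = (\<alpha> + \<beta> * u)"
      proof -
        have "D * v * (2 * T (u, v) * T (u, v)) = (2 * T (u, v) * D) * (T (u, v) * v)"
          by (simp only: mult_ac)
        then have "D * v * (2 * T (u, v) * T (u, v)) = - 1 / u\<^sup>2 * (T (u, v) * v)"
          unfolding TD .
        then have "D * v * (2 * (1 / u)) = - 1 / u\<^sup>2 * (u * m (1 / u))"
          using T2' Tv by (simp add: power2_eq_square mult.assoc)
        then have "2 * (D * v) = - m (1 / u)" using iu by (simp add: field_simps power2_eq_square)
        then have Dv: "- 2 * (D * v) = m (1 / u)" by (metis minus_minus mult_minus_left)
        have "- 2 * (\<alpha> + \<beta> * u) / m (1 / u) * D * v = (\<alpha> + \<beta> * u) / m (1 / u) * (- 2 * (D * v))"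
          by (simp add: divide_inverse algebra_simps)
        then show ?thesis unfolding Dv using mz by simp
      qed
      show ?thesis
        unfolding e1 basic_form_def fst_conv snd_conv eq_divide_eq using e2 uv(3) by simp
    qed
    ultimately show ?thesis by simp
  qed
  moreover have "1 \<le> R" "norm x < R" using R norm_ge_zero[of x] by linarith+
  then have "?U \<inter> special_points x \<subseteq> {None}"
    by (auto simp: special_points_def)
  ultimately have "patch x (basic_form \<alpha> \<beta>) None ?U (\<lambda>P. F (T P))"
    unfolding patch_def using openin_surface_infinity[of x R] by auto
  then show ?thesis by blast
qed

lemma patch_exists:
  assumes "x \<notin> {0, 1}" "p \<in> topspace (surface x)"
  shows "\<exists>U H. patch x (basic_form \<alpha> \<beta>) p U H"
proof (cases p)
  case None
  then show ?thesis using patch_infinity by simp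
next
  case (Some P)
  then have P: "P \<in> affine_curve x" using assms(2) by (auto simp: topspace_surface)
  show ?thesis
  proof (cases "snd P = 0")
    case True
    then obtain e where "P = (e, 0)" by (cases P) auto
    moreover from this have "e \<in> {0, 1, x}" using P by (auto simp: affine_curve_iff)
    ultimately show ?thesis using patch_ramified[OF assms(1)] Some by simp
  next
    case False
    then have "P \<in> unramified x" using P by (cases P) (simp add: affine_curve_iff unramified_iff)
    then show ?thesis using patch_unramified[OF _ curve_form_basic] Some by simp
  qed
qed

subsection \<open>Cochains on small simplices\<close>

definition cochain_sum :: "(((nat \<Rightarrow> real) \<Rightarrow> 'a) \<Rightarrow> complex) \<Rightarrow> 'a chain \<Rightarrow> complex" where
  "cochain_sum \<phi> z = (\<Sum>\<sigma>\<in>Poly_Mapping.keys z. of_int (Poly_Mapping.lookup z \<sigma>) * \<phi> \<sigma>)"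

lemma cochain_sum_superset:
  assumes "finite S" "Poly_Mapping.keys z \<subseteq> S"
  shows "cochain_sum \<phi> z = (\<Sum>\<sigma>\<in>S. of_int (Poly_Mapping.lookup z \<sigma>) * \<phi> \<sigma>)"
  unfolding cochain_sum_def using assms
  by (intro sum.mono_neutral_left) (auto simp: in_keys_iff)

lemma cochain_sum_0 [simp]: "cochain_sum \<phi> 0 = 0"
  by (simp add: cochain_sum_def)

lemma cochain_sum_of [simp]: "cochain_sum \<phi> (frag_of \<sigma>) = \<phi> \<sigma>"
  by (simp add: cochain_sum_def)

lemma cochain_sum_add: "cochain_sum \<phi> (y + z) = cochain_sum \<phi> y + cochain_sum \<phi> z"
proof -
  let ?S = "Poly_Mapping.keys y \<union> Poly_Mapping.keys z"
  have "cochain_sum \<phi> (y + z) = (\<Sum>\<sigma>\<in>?S. of_int (Poly_Mapping.lookup (y + z) \<sigma>) * \<phi> \<sigma>)"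
    using Poly_Mapping.keys_add[of y z] by (intro cochain_sum_superset) auto
  also have "\<dots> = (\<Sum>\<sigma>\<in>?S. of_int (Poly_Mapping.lookup y \<sigma>) * \<phi> \<sigma>) + (\<Sum>\<sigma>\<in>?S. of_int (Poly_Mapping.lookup z \<sigma>) * \<phi> \<sigma>)"
    by (simp add: lookup_add ring_distribs sum.distrib)
  also have "\<dots> = cochain_sum \<phi> y + cochain_sum \<phi> z"
    by (simp add: cochain_sum_superset[of ?S])
  finally show ?thesis .
qed

lemma cochain_sum_cmul: "cochain_sum \<phi> (frag_cmul k z) = of_int k * cochain_sum \<phi> z"
proof -
  have "cochain_sum \<phi> (frag_cmul k z) = (\<Sum>\<sigma>\<in>Poly_Mapping.keys z. of_int (Poly_Mapping.lookup (frag_cmul k z) \<sigma>) * \<phi> \<sigma>)"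
    using keys_cmul by (intro cochain_sum_superset) auto
  then show ?thesis by (simp add: cochain_sum_def sum_distrib_left mult.assoc)
qed

lemma cochain_sum_diff: "cochain_sum \<phi> (y - z) = cochain_sum \<phi> y - cochain_sum \<phi> z"
  using cochain_sum_add[of \<phi> "y - z" z] by simp

lemma cochain_sum_sum: "finite I \<Longrightarrow> cochain_sum \<phi> (\<Sum>i\<in>I. z i) = (\<Sum>i\<in>I. cochain_sum \<phi> (z i))"
  by (induction I rule: finite_induct) (auto simp: cochain_sum_add)

text \<open>Stokes' theorem in cochain form. Closedness is demanded only on the simplices occurring
  in \<open>z\<close>, because the cochain built from local primitives is closed only on small
  simplices.\<close>

lemma cochain_sum_chain_boundary:
  assumes "p > 0"
    and "\<And>\<sigma>. \<sigma> \<in> Poly_Mapping.keys z \<Longrightarrow> (\<Sum>k\<le>p. (- 1) ^ k * \<phi> (singular_face p k \<sigma>)) = 0"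
  shows "cochain_sum \<phi> (chain_boundary p z) = 0"
proof -
  have "cochain_sum \<phi> (chain_boundary p z) =
    (\<Sum>\<sigma>\<in>Poly_Mapping.keys z. of_int (Poly_Mapping.lookup z \<sigma>) * (\<Sum>k\<le>p. (- 1) ^ k * \<phi> (singular_face p k \<sigma>)))"
    using assms(1) by (simp add: chain_boundary_def frag_extend_def cochain_sum_sum cochain_sum_cmul)
  then show ?thesis using assms(2) by simp
qed

definition vertex :: "nat \<Rightarrow> nat \<Rightarrow> real" where
  "vertex i = (\<lambda>j. if j = i then 1 else 0)"

lemma vertex_in_simplex: "i \<le> p \<Longrightarrow> vertex i \<in> standard_simplex p"
  by (simp add: vertex_def)

lemma simplical_face_vertex: "simplical_face k (vertex i) = vertex (if i < k then i else Suc i)"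
  by (auto simp: simplical_face_def vertex_def fun_eq_iff)

lemma singular_face_vertex:
  "i \<le> 1 \<Longrightarrow> singular_face 2 k \<sigma> (vertex i) = \<sigma> (vertex (if i < k then i else Suc i))"
  using vertex_in_simplex[of i 1] by (simp add: singular_face_def simplical_face_vertex)

text \<open>The piece of \<open>c\<close> from parameter \<open>s\<close> to \<open>t\<close> as a
  singular 1-simplex. The case \<open>s > t\<close> is needed, since barycentric subdivision also
  produces pieces that run backwards.\<close>

definition path_simplex :: "(real \<Rightarrow> complex \<times> complex) \<Rightarrow> real \<Rightarrow> real \<Rightarrow> (nat \<Rightarrow> real) \<Rightarrow> (complex \<times> complex) option" where
  "path_simplex c s t = restrict (\<lambda>q. Some (c (s * q 0 + t * q 1))) (standard_simplex 1)"

lemma loop_chain_eq: "loop_chain c = frag_of (path_simplex c 0 1)"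
  by (simp add: loop_chain_def path_simplex_def)

lemma standard_simplex_1:
  "q \<in> standard_simplex 1 \<Longrightarrow> 0 \<le> q 0 \<and> 0 \<le> q 1 \<and> q 0 + q 1 = 1"
  by (auto simp: standard_simplex_def)

lemma path_simplex_param:
  assumes "q \<in> standard_simplex 1" "s \<in> {0..1}" "t \<in> {0..1}"
  shows "s * q 0 + t * q 1 \<in> {0..1}" "\<bar>s * q 0 + t * q 1 - s\<bar> \<le> \<bar>t - s\<bar>"
proof -
  have q: "0 \<le> q 0" "0 \<le> q 1" "q 0 + q 1 = 1" using standard_simplex_1[OF assms(1)] by auto
  have q0: "q 0 = 1 - q 1" using q(3) by linarith
  have eq: "s * q 0 + t * q 1 = s + (t - s) * q 1" unfolding q0 by (simp add: algebra_simps)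
  have "s * q 0 + t * q 1 \<le> 1 * q 0 + 1 * q 1" using assms q by (intro add_mono mult_right_mono) auto
  then show "s * q 0 + t * q 1 \<in> {0..1}" using assms q by simp
  show "\<bar>s * q 0 + t * q 1 - s\<bar> \<le> \<bar>t - s\<bar>"
    unfolding eq using q by (simp add: abs_mult mult_left_le)
qed

lemma singular_simplex_path:
  assumes c: "path c" "path_image c \<subseteq> affine_curve x" and st: "s \<in> {0..1}" "t \<in> {0..1}"
  shows "singular_simplex 1 (surface x) (path_simplex c s t)"
proof -
  let ?X = "subtopology (powertop_real UNIV) (standard_simplex 1)"
  let ?g = "\<lambda>q :: nat \<Rightarrow> real. s * q 0 + t * q 1"
  have "continuous_map ?X euclideanreal ?g"
    by (intro continuous_intros continuous_map_from_subtopology continuous_map_product_projection) auto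
  then have "continuous_map ?X (top_of_set {0..1}) ?g"
    using path_simplex_param[OF _ st] by (auto simp: continuous_map_in_subtopology)
  moreover have "continuous_map (top_of_set {0..1}) (top_of_set (affine_curve x)) c"
    using c by (auto simp: path_def path_image_def)
  moreover have "continuous_map (top_of_set (affine_curve x)) (surface x) Some"
    using embedding_map_Some[of "top_of_set (affine_curve x)"]
    unfolding surface_def embedding_map_def
    by (meson continuous_map_in_subtopology homeomorphic_imp_continuous_map)
  ultimately have "continuous_map ?X (surface x) (Some \<circ> (c \<circ> ?g))"
    by (intro continuous_map_compose)
  then have "continuous_map ?X (surface x) (path_simplex c s t)"
    by (rule continuous_map_eq) (auto simp: path_simplex_def)
  then show ?thesis
    by (simp add: singular_simplex_def path_simplex_def)
qed

text \<open>The barycentric subdivision of an edge is the cone from its midpoint \<open>b\<close>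
  over its boundary, that is \<open>[b, vertex 1] - [b, vertex 0]\<close>; in parameters,
  \<open>b\<close> becomes \<open>(s + t) / 2\<close>.\<close>

lemma singular_subdivision_path_simplex:
  "singular_subdivision 1 (frag_of (path_simplex c s t)) =
     frag_of (path_simplex c ((s + t) / 2) t) - frag_of (path_simplex c ((s + t) / 2) s)"
proof -
  define b :: "nat \<Rightarrow> real" where "b = (\<lambda>i. (vertex 0 i + vertex 1 i) / 2)"
  let ?id = "restrict id (standard_simplex 1) :: (nat \<Rightarrow> real) \<Rightarrow> nat \<Rightarrow> real"
  \<comment> \<open>Subdivision is defined through the identity simplex; written as an oriented
    simplex it is open to the formulas for faces and cones.\<close>
  have id: "?id = oriented_simplex 1 vertex"
    by (auto simp: oriented_simplex_def vertex_def standard_simplex_def fun_eq_iff restrict_def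
        intro: not_less_eq_eq split: if_splits)
  have face: "singular_face 1 k ?id = oriented_simplex 0 (\<lambda>_. vertex (if k = 0 then 1 else 0))" if "k \<le> 1" for k
    unfolding id using that singular_face_oriented_simplex[of 1 k vertex]
    by (auto simp: oriented_simplex_def fun_eq_iff restrict_def)
  have bd: "chain_boundary 1 (frag_of ?id) =
      frag_of (oriented_simplex 0 (\<lambda>_. vertex 1)) - frag_of (oriented_simplex 0 (\<lambda>_. vertex 0))"
    using face[of 0] face[of 1] by (simp add: chain_boundary_of)
  have bary: "(\<lambda>i. (\<Sum>j\<le>1. simplicial_vertex j ?id i) / real (Suc 1)) = b"
    by (auto simp: simplicial_vertex_def b_def vertex_def fun_eq_iff)
  have cone: "simplex_cone 0 b (oriented_simplex 0 (\<lambda>_. l)) = oriented_simplex 1 (\<lambda>i. if i = 0 then b else l)" for l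
    using simplex_cone[of 0 b "\<lambda>_. l"] by simp
  have sub: "simplicial_subdivision 1 (frag_of ?id) =
      frag_of (oriented_simplex 1 (\<lambda>i. if i = 0 then b else vertex 1)) -
      frag_of (oriented_simplex 1 (\<lambda>i. if i = 0 then b else vertex 0))"
  proof -
    have "simplicial_subdivision 1 (frag_of ?id) =
        simplicial_cone (1 - 1) (\<lambda>i. (\<Sum>j\<le>1. simplicial_vertex j ?id i) / real (Suc 1))
          (simplicial_subdivision (1 - 1) (chain_boundary 1 (frag_of ?id)))"
      by (subst simplicial_subdivision_of) (simp only: if_False one_neq_zero)
    also have "\<dots> = simplicial_cone 0 b (chain_boundary 1 (frag_of ?id))"
      by (simp only: bary diff_self_eq_0 simplicial_subdivision.simps(1) id_apply)
    also have "\<dots> = frag_of (oriented_simplex 1 (\<lambda>i. if i = 0 then b else vertex 1)) -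
        frag_of (oriented_simplex 1 (\<lambda>i. if i = 0 then b else vertex 0))"
      by (simp only: bd simplicial_cone_def frag_extend_diff frag_extend_of o_apply cone)
    finally show ?thesis .
  qed
  have map: "simplex_map 1 (path_simplex c s t) (oriented_simplex 1 (\<lambda>i. if i = 0 then b else vertex j)) =
      path_simplex c ((s + t) / 2) (if j = 0 then s else t)" if "j \<le> 1" for j
  proof -
    have "path_simplex c s t (oriented_simplex 1 (\<lambda>i. if i = 0 then b else vertex j) q) =
        Some (c ((s + t) / 2 * q 0 + (if j = 0 then s else t) * q 1))" if q: "q \<in> standard_simplex 1" for q
    proof -
      let ?o = "oriented_simplex 1 (\<lambda>i. if i = 0 then b else vertex j) q"
      have j01: "j = 0 \<or> j = 1" using \<open>j \<le> 1\<close> by auto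
      have o: "?o = (\<lambda>i. b i * q 0 + vertex j i * q 1)"
        using q by (simp add: oriented_simplex_def)
      have q': "0 \<le> q 0" "0 \<le> q 1" "q 0 + q 1 = 1" using standard_simplex_1[OF q] by auto
      have "?o \<in> standard_simplex 1"
        using q' j01 unfolding o unfolding standard_simplex_def b_def vertex_def
        by (elim disjE) auto
      moreover have "s * ?o 0 + t * ?o 1 = (s + t) / 2 * q 0 + (if j = 0 then s else t) * q 1"
        using j01 unfolding o unfolding b_def vertex_def by (elim disjE) (auto simp: algebra_simps add_divide_distrib)
      ultimately show ?thesis by (simp add: path_simplex_def)
    qed
    then show ?thesis
      by (auto simp: simplex_map_def path_simplex_def[of _ "(s + t) / 2"] fun_eq_iff restrict_def)
  qed
  show ?thesis
    using map[of 0] map[of 1]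
    by (simp only: singular_subdivision_def frag_extend_of sub chain_map_diff chain_map_of) simp
qed

text \<open>After \<open>n\<close> subdivisions each piece has parameter length
  \<open>\<bar>t - s\<bar> / 2 ^ n\<close>, and the increments of \<open>G\<close> telescope; the
  pieces that run backwards enter with a minus sign.\<close>

lemma cochain_sum_subdivided_path:
  assumes "s \<in> {0..1}" "t \<in> {0..1}"
    and "\<And>s' t'. s' \<in> {0..1} \<Longrightarrow> t' \<in> {0..1} \<Longrightarrow> \<bar>t' - s'\<bar> \<le> \<bar>t - s\<bar> / 2 ^ n \<Longrightarrow> \<phi> (path_simplex c s' t') = G t' - G s'"
  shows "cochain_sum \<phi> ((singular_subdivision 1 ^^ n) (frag_of (path_simplex c s t))) = G t - G s"
  using assms
proof (induction n arbitrary: s t)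
  case 0
  then show ?case by simp
next
  case (Suc n)
  let ?m = "(s + t) / 2"
  have m: "?m \<in> {0..1}" using Suc.prems(1,2) by auto
  have "\<bar>t - ?m\<bar> = \<bar>t - s\<bar> / 2" "\<bar>s - ?m\<bar> = \<bar>t - s\<bar> / 2" by (auto simp: abs_if field_simps)
  then have IH: "cochain_sum \<phi> ((singular_subdivision 1 ^^ n) (frag_of (path_simplex c ?m t))) = G t - G ?m"
    "cochain_sum \<phi> ((singular_subdivision 1 ^^ n) (frag_of (path_simplex c ?m s))) = G s - G ?m"
    using m Suc.prems by (intro Suc.IH; simp add: field_simps)+
  have "(singular_subdivision 1 ^^ Suc n) (frag_of (path_simplex c s t)) =
      (singular_subdivision 1 ^^ n) (frag_of (path_simplex c ?m t)) -
      (singular_subdivision 1 ^^ n) (frag_of (path_simplex c ?m s))"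
    by (simp only: funpow_Suc_right o_apply singular_subdivision_path_simplex singular_subdivision_power_diff)
  then show ?case by (simp only: cochain_sum_diff IH) simp
qed

lemma chain_boundary_iterated_subdivision:
  assumes "singular_chain p X z"
  shows "chain_boundary p ((singular_subdivision p ^^ n) z) = (singular_subdivision (p - 1) ^^ n) (chain_boundary p z)
    \<and> singular_chain p X ((singular_subdivision p ^^ n) z)"
proof (induction n)
  case (Suc n)
  then show ?case
    by (auto simp: chain_boundary_singular_subdivision singular_chain_singular_subdivision)
qed (use assms in auto)

lemma iterated_subdivision_lincomb:
  "(singular_subdivision p ^^ n) (frag_cmul i y + frag_cmul j z) =
     frag_cmul i ((singular_subdivision p ^^ n) y) + frag_cmul j ((singular_subdivision p ^^ n) z)"
  by (induction n) (auto simp: singular_subdivision_def frag_extend_add frag_extend_cmul)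

subsection \<open>The periods of a form with local primitives\<close>

text \<open>The loops of interest avoid the special points, but the 2-chains between them may not.
  Primitives near every point of the compact surface are what makes the integral an invariant of
  homology classes there.\<close>

locale patched_form = curve_form x "unramified x" f for x f +
  fixes U :: "(complex \<times> complex) option \<Rightarrow> (complex \<times> complex) option set"
    and H :: "(complex \<times> complex) option \<Rightarrow> complex \<times> complex \<Rightarrow> complex"
  assumes patch: "p \<in> topspace (surface x) \<Longrightarrow> patch x f p (U p) (H p)"
begin

text \<open>A patch contains no special point except possibly its own centre, so patches with
  distinct centres meet only where both primitives are differentiable.\<close>

lemma overlap_unramified:
  assumes "p \<in> topspace (surface x)" "q \<in> topspace (surface x)" "p \<noteq> q"
  shows "U p \<inter> U q \<subseteq> Some ` unramified x"
proof
  fix r assume r: "r \<in> U p \<inter> U q"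
  then have "r \<in> topspace (surface x)"
    using patch[OF assms(1)] openin_subset unfolding patch_def by blast
  moreover have "r \<notin> special_points x"
    using r patch[OF assms(1)] patch[OF assms(2)] assms(3) unfolding patch_def by blast
  ultimately obtain P where P: "r = Some P" "P \<in> affine_curve x" "r \<notin> special_points x"
    by (auto simp: topspace_surface special_points_def)
  then have "P \<in> unramified x"
    by (cases P) (auto simp: special_points_def unramified_iff' affine_curve_iff)
  then show "r \<in> Some ` unramified x" using P(1) by simp
qed

text \<open>The difference \<open>D\<close> of the primitives has derivative zero on the overlap and
  is locally constant. If it took two values on \<open>C\<close>, the set where it equals
  \<open>D P\<close> and the set where it does not would be open and disconnect
  \<open>C\<close>.\<close>

lemma primitives_differ_by_constant:
  assumes pq: "p \<in> topspace (surface x)" "q \<in> topspace (surface x)" "p \<noteq> q"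
    and C: "connectedin (surface x) C" "C \<subseteq> U p \<inter> U q" "Some P \<in> C" "Some Q \<in> C"
  shows "H p Q - H q Q = H p P - H q P"
proof (rule ccontr)
  assume neq: "H p Q - H q Q \<noteq> H p P - H q P"
  define N where "N = {R. Some R \<in> U p \<inter> U q}"
  define D where "D R = H p R - H q R" for R
  have N: "U p \<inter> U q = Some ` N" "N \<subseteq> unramified x"
    using overlap_unramified[OF pq] by (auto simp: N_def)
  have Nop: "openin (top_of_set (affine_curve x)) N"
    unfolding N_def using patch[OF pq(1)] patch[OF pq(2)]
    by (intro openin_surface_vimage openin_Int) (auto simp: patch_def)
  have D0: "curve_deriv x D 0 R" if R: "R \<in> N" for R
  proof -
    have "R \<in> unramified x" using R N(2) by blast
    then have "Some R \<in> U p" "Some R \<in> U q" "snd R \<noteq> 0"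
      using R unramified_snd[of R x] by (auto simp: N_def)
    then have "curve_deriv x (H p) (f R) R" "curve_deriv x (H q) (f R) R"
      using patch[OF pq(1)] patch[OF pq(2)] unfolding patch_def by blast+
    from curve_deriv_diff[OF this] show ?thesis by (simp add: D_def[abs_def])
  qed
  have loc: "\<exists>T. openin (top_of_set (affine_curve x)) T \<and> R \<in> T \<and> (\<forall>R'\<in>T. R' \<in> N \<and> D R' = D R)" if R: "R \<in> N" for R
  proof -
    obtain u0 v0 where uv: "R = (u0, v0)" by (cases R)
    obtain \<rho> w where w: "\<rho> > 0" "w holomorphic_on ball u0 \<rho>" "w u0 = v0"
      "\<And>u. u \<in> ball u0 \<rho> \<Longrightarrow> (w u)\<^sup>2 = cubic x u" "\<And>u. u \<in> ball u0 \<rho> \<Longrightarrow> w u \<noteq> 0"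
      "\<And>u. u \<in> ball u0 \<rho> \<Longrightarrow> (u, w u) \<in> N"
      by (rule local_graph[OF R[unfolded uv] N(2) Nop]) blast
    have w0: "w u0 \<noteq> 0" using w(1) w(5)[of u0] by simp
    obtain \<delta> where \<delta>: "\<delta> > 0"
      "\<And>u v. (u, v) \<in> affine_curve x \<Longrightarrow> dist (u, v) (u0, w u0) < \<delta> \<Longrightarrow> u \<in> ball u0 \<rho> \<and> v = w u"
      using near_branch[OF w(2,1) w0 w(4)] by blast
    have "((\<lambda>u. D (u, w u)) has_field_derivative 0) (at u within ball u0 \<rho>)" if u: "u \<in> ball u0 \<rho>" for u
    proof -
      have wd: "(w has_field_derivative deriv w u) (at u)"
        using w(2) u by (meson holomorphic_derivI open_ball)
      have ev: "\<forall>\<^sub>F u in nhds u. (u, w u) \<in> affine_curve x"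
        unfolding eventually_nhds
        by (rule exI[of _ "ball u0 \<rho>"]) (use u w(4) in \<open>auto simp: affine_curve_iff\<close>)
      show ?thesis
        by (rule has_field_derivative_at_within[OF curve_deriv_branch[OF D0[OF w(6)[OF u]] wd ev]])
    qed
    from has_field_derivative_zero_constant[OF convex_ball this]
    obtain k where k: "\<And>u. u \<in> ball u0 \<rho> \<Longrightarrow> D (u, w u) = k" by blast
    let ?T = "affine_curve x \<inter> ball R \<delta>"
    have "R' \<in> N \<and> D R' = D R" if "R' \<in> ?T" for R'
    proof -
      obtain u v where R': "R' = (u, v)" by (cases R')
      then have u: "u \<in> ball u0 \<rho> \<and> v = w u"
        using that w(3) uv by (intro \<delta>(2)) (auto simp: dist_commute)
      then show ?thesis using k[of u] k[of u0] w(1,3) w(6)[of u] uv R' by simp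
    qed
    moreover have "R \<in> ?T" using R N(2) unramified_subset \<delta>(1) by auto
    ultimately show ?thesis by (meson open_ball openin_open_Int)
  qed
  define A where "A = {R \<in> N. D R = D P}"
  define B where "B = {R \<in> N. D R \<noteq> D P}"
  have "openin (top_of_set (affine_curve x)) {R \<in> N. Q (D R)}" for Q
  proof (subst openin_subopen, intro ballI)
    fix R assume R: "R \<in> {R \<in> N. Q (D R)}"
    then obtain T where T: "openin (top_of_set (affine_curve x)) T" "R \<in> T" "\<forall>R'\<in>T. R' \<in> N \<and> D R' = D R"
      using loc[of R] by blast
    have "T \<subseteq> {R \<in> N. Q (D R)}"
    proof
      fix R' assume "R' \<in> T"
      then have "R' \<in> N \<and> D R' = D R" using T(3) by blast
      then show "R' \<in> {R \<in> N. Q (D R)}" using R by simp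
    qed
    then show "\<exists>T. openin (top_of_set (affine_curve x)) T \<and> R \<in> T \<and> T \<subseteq> {R \<in> N. Q (D R)}"
      using T(1,2) by blast
  qed
  from this[of "\<lambda>d. d = D P"] this[of "\<lambda>d. d \<noteq> D P"]
  have "openin (top_of_set (affine_curve x)) A" "openin (top_of_set (affine_curve x)) B"
    unfolding A_def B_def by auto
  then have "openin (surface x) (Some ` A)" "openin (surface x) (Some ` B)"
    by (simp_all add: surface_def)
  moreover have "C \<subseteq> Some ` A \<union> Some ` B" using C(2) N(1) by (auto simp: A_def B_def)
  moreover have "Some ` A \<inter> Some ` B \<inter> C = {}" by (auto simp: A_def B_def)
  moreover have "Some ` A \<inter> C \<noteq> {}" using C(2,3) by (auto simp: A_def N_def)
  moreover have "Some ` B \<inter> C \<noteq> {}" using C(2,4) neq by (auto simp: B_def N_def D_def)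
  ultimately show False using C(1) unfolding connectedin by blast
qed

text \<open>At \<open>None\<close> the selector \<open>the\<close> yields an unspecified but fixed
  argument, so contributions of a vertex at infinity still cancel as long as all increments use the
  same patch.\<close>

definition increment :: "((nat \<Rightarrow> real) \<Rightarrow> (complex \<times> complex) option) \<Rightarrow> (complex \<times> complex) option \<Rightarrow> complex" where
  "increment \<sigma> p = H p (the (\<sigma> (vertex 1))) - H p (the (\<sigma> (vertex 0)))"

text \<open>The patch is an arbitrary one that contains the simplex; the value is meaningful only
  for simplices small enough to lie in some patch.\<close>

definition cochain :: "((nat \<Rightarrow> real) \<Rightarrow> (complex \<times> complex) option) \<Rightarrow> complex" where
  "cochain \<sigma> = increment \<sigma> (SOME p. p \<in> topspace (surface x) \<and> \<sigma> ` standard_simplex 1 \<subseteq> U p)"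

text \<open>The image of the simplex is connected. If it lies in two different patches, it consists
  of unramified points and the two primitives differ on it by a constant, which drops out of the
  increment.\<close>

lemma cochain_eq:
  assumes \<sigma>: "singular_simplex 1 (surface x) \<sigma>" and p: "p \<in> topspace (surface x)" "\<sigma> ` standard_simplex 1 \<subseteq> U p"
  shows "cochain \<sigma> = increment \<sigma> p"
proof -
  define q where "q = (SOME p. p \<in> topspace (surface x) \<and> \<sigma> ` standard_simplex 1 \<subseteq> U p)"
  have q: "q \<in> topspace (surface x) \<and> \<sigma> ` standard_simplex 1 \<subseteq> U q"
    unfolding q_def by (rule someI[of _ p]) (use p in blast)
  show ?thesis
  proof (cases "p = q")
    case True
    then show ?thesis by (simp add: cochain_def q_def)
  next
    case False
    have con: "connectedin (surface x) (\<sigma> ` standard_simplex 1)"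
      using \<sigma> unfolding singular_simplex_def
      by (intro connectedin_continuous_map_image) (auto simp: connectedin_subtopology connectedin_standard_simplex)
    have sub: "\<sigma> ` standard_simplex 1 \<subseteq> U p \<inter> U q" using p q by blast
    have "Some (the (\<sigma> (vertex i))) \<in> \<sigma> ` standard_simplex 1" if "i \<le> 1" for i
    proof -
      have v: "\<sigma> (vertex i) \<in> \<sigma> ` standard_simplex 1" using vertex_in_simplex[OF that] by blast
      then obtain R where "\<sigma> (vertex i) = Some R"
        using sub overlap_unramified[OF p(1) _ False] q by blast
      with v show ?thesis by simp
    qed
    from primitives_differ_by_constant[OF p(1) _ False con sub this[of 0] this[of 1]] q
    have "increment \<sigma> p = increment \<sigma> q" by (simp add: increment_def algebra_simps)
    then show ?thesis by (simp add: cochain_def q_def)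
  qed
qed

text \<open>All three faces can be evaluated with the primitive of the one patch that contains the
  triangle, and the vertex values cancel in pairs.\<close>

lemma cochain_boundary_small:
  assumes \<sigma>: "singular_simplex 2 (surface x) \<sigma>" and p: "p \<in> topspace (surface x)" "\<sigma> ` standard_simplex 2 \<subseteq> U p"
  shows "(\<Sum>k\<le>2. (- 1) ^ k * cochain (singular_face 2 k \<sigma>)) = 0"
proof -
  have face: "cochain (singular_face 2 k \<sigma>) = increment (singular_face 2 k \<sigma>) p" if "k \<le> 2" for k
  proof (rule cochain_eq[OF _ p(1)])
    show "singular_simplex 1 (surface x) (singular_face 2 k \<sigma>)"
      using singular_simplex_singular_face[OF \<sigma> _ that] by simp
    show "singular_face 2 k \<sigma> ` standard_simplex 1 \<subseteq> U p"
      using p(2) simplical_face_in_standard_simplex[of 2 k] that by (auto simp: singular_face_def)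
  qed
  have "{..2::nat} = {0, 1, 2}" by auto
  then have "(\<Sum>k\<le>2. (- 1) ^ k * cochain (singular_face 2 k \<sigma>)) =
    increment (singular_face 2 0 \<sigma>) p - increment (singular_face 2 1 \<sigma>) p + increment (singular_face 2 2 \<sigma>) p"
    by (simp add: face)
  also have "\<dots> = 0"
    by (simp add: increment_def singular_face_vertex numeral_2_eq_2[symmetric])
  finally show ?thesis .
qed

text \<open>Once the pieces of the loop are shorter than a Lebesgue number of the cover by patches,
  each lies in one patch, where the cochain and \<open>path_prim\<close> have the same increments;
  the sum telescopes.\<close>

lemma cochain_sum_loop:
  assumes c: "curve_path c"
  obtains N where "\<And>n. n \<ge> N \<Longrightarrow> cochain_sum cochain ((singular_subdivision 1 ^^ n) (loop_chain c)) = path_prim c 1"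
proof -
  have pc: "path c" "continuous_on {0..1} c" and im: "path_image c \<subseteq> unramified x"
    using c valid_path_imp_path by (auto simp: curve_path_def path_def)
  have cu: "c r \<in> unramified x" if "r \<in> {0..1}" for r
    using im that by (auto simp: path_image_def)
  have top: "Some (c r) \<in> topspace (surface x)" if "r \<in> {0..1}" for r
    using cu[OF that] unramified_subset by (auto simp: topspace_surface)
  have "\<exists>d>0. \<forall>r'\<in>{0..1}. dist r' r < d \<longrightarrow> Some (c r') \<in> U (Some (c r))" if r: "r \<in> {0..1}" for r
  proof -
    have "openin (top_of_set (affine_curve x)) {P. Some P \<in> U (Some (c r))}"
      using patch[OF top[OF r]] by (intro openin_surface_vimage) (auto simp: patch_def)
    then obtain T where T: "open T" "{P. Some P \<in> U (Some (c r))} = affine_curve x \<inter> T"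
      by (auto simp: openin_open)
    have "c r \<in> T" using patch[OF top[OF r]] T(2) by (auto simp: patch_def)
    then obtain e where e: "e > 0" "ball (c r) e \<subseteq> T" using T(1) by (metis openE)
    obtain d where d: "d > 0" "\<And>r'. r' \<in> {0..1} \<Longrightarrow> dist r' r < d \<Longrightarrow> dist (c r') (c r) < e"
      using pc(2) r e(1) unfolding continuous_on_iff by meson
    have "Some (c r') \<in> U (Some (c r))" if r': "r' \<in> {0..1}" "dist r' r < d" for r'
    proof -
      have "c r' \<in> T" using d(2)[OF r'] e(2) by (auto simp: dist_commute)
      moreover have "c r' \<in> affine_curve x" using cu[OF r'(1)] unramified_subset by blast
      ultimately show ?thesis using T(2) by blast
    qed
    with d(1) show ?thesis by blast
  qed
  then obtain d where d: "\<And>r. r \<in> {0..1} \<Longrightarrow> d r > 0"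
    "\<And>r r'. r \<in> {0..1} \<Longrightarrow> r' \<in> {0..1} \<Longrightarrow> dist r' r < d r \<Longrightarrow> Some (c r') \<in> U (Some (c r))"
    by metis
  \<comment> \<open>The Lebesgue number of the cover of the parameter interval.\<close>
  obtain \<epsilon> where \<epsilon>: "\<epsilon> > 0" "\<And>r. r \<in> {0..1} \<Longrightarrow> \<exists>G \<in> (\<lambda>r. ball r (d r)) ` {0..1}. ball r \<epsilon> \<subseteq> G"
  proof (rule Heine_Borel_lemma[of "{0..1::real}" "(\<lambda>r. ball r (d r)) ` {0..1}"])
    show "{0..1} \<subseteq> \<Union> ((\<lambda>r. ball r (d r)) ` {0..1})" using d(1) by force
  qed (use that in auto)
  obtain N where N: "1 / 2 ^ N < \<epsilon>"
    using real_arch_pow_inv[of \<epsilon> "1/2"] \<epsilon>(1) by (auto simp: power_one_over)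
  have small: "cochain (path_simplex c s t) = path_prim c t - path_prim c s"
    if st: "s \<in> {0..1}" "t \<in> {0..1}" "\<bar>t - s\<bar> < \<epsilon>" for s t
  proof -
    obtain r where r: "r \<in> {0..1}" "ball s \<epsilon> \<subseteq> ball r (d r)" using \<epsilon>(2)[OF st(1)] by blast
    let ?p = "Some (c r)"
    have inU: "Some (c z) \<in> U ?p" if "z \<in> {0..1}" "\<bar>z - s\<bar> \<le> \<bar>t - s\<bar>" for z
    proof -
      have "z \<in> ball s \<epsilon>" using that st(3) by (simp add: dist_real_def abs_minus_commute)
      then have "dist z r < d r" using r(2) by (auto simp: dist_commute)
      then show ?thesis using d(2)[OF r(1) that(1)] by blast
    qed
    have "cochain (path_simplex c s t) = increment (path_simplex c s t) ?p"
    proof (rule cochain_eq[OF _ top[OF r(1)]])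
      show "singular_simplex 1 (surface x) (path_simplex c s t)"
        using singular_simplex_path[OF pc(1) _ st(1,2)] im unramified_subset by blast
      show "path_simplex c s t ` standard_simplex 1 \<subseteq> U ?p"
        using inU path_simplex_param[OF _ st(1,2)] by (auto simp: path_simplex_def)
    qed
    also have "\<dots> = H ?p (c t) - H ?p (c s)"
      using vertex_in_simplex[of 0 1] vertex_in_simplex[of 1 1]
      by (simp add: increment_def path_simplex_def) (simp add: vertex_def)
    also have "\<dots> = path_prim c t - path_prim c s"
    proof (rule path_prim_diff[OF c st(1,2), symmetric])
      fix z assume z: "z \<in> {min s t..max s t}"
      then have "z \<in> {0..1}" "\<bar>z - s\<bar> \<le> \<bar>t - s\<bar>" using st by (auto simp: min_def max_def split: if_splits)
      then show "curve_deriv x (H ?p) (f (c z)) (c z)"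
        using inU patch[OF top[OF r(1)]] cu unramified_snd unfolding patch_def by blast
    qed
    finally show ?thesis .
  qed
  show ?thesis
  proof (rule that)
    fix n assume n: "n \<ge> N"
    have "cochain_sum cochain ((singular_subdivision 1 ^^ n) (frag_of (path_simplex c 0 1))) = path_prim c 1 - path_prim c 0"
    proof (rule cochain_sum_subdivided_path)
      fix s t :: real assume st: "s \<in> {0..1}" "t \<in> {0..1}" "\<bar>t - s\<bar> \<le> \<bar>1 - 0\<bar> / 2 ^ n"
      have "1 / 2 ^ n \<le> 1 / (2 :: real) ^ N" using n by (simp add: frac_le power_increasing)
      then have "\<bar>t - s\<bar> < \<epsilon>" using st(3) N by simp
      with st show "cochain (path_simplex c s t) = path_prim c t - path_prim c s" by (intro small)
    qed auto
    then show "cochain_sum cochain ((singular_subdivision 1 ^^ n) (loop_chain c)) = path_prim c 1"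
      by (simp add: loop_chain_eq)
  qed
qed

text \<open>The homology is the boundary of a 2-chain. Subdividing until every triangle lies in one
  patch makes the cochain vanish on the boundary; subdivision commutes with the boundary and does
  not change the values on the three loops.\<close>

theorem path_prim_homologous:
  assumes paths: "curve_path c" "curve_path a" "curve_path b"
    and hom: "homologous_rel 1 (surface x) {} (loop_chain c) (frag_cmul m (loop_chain a) + frag_cmul n (loop_chain b))"
  shows "path_prim c 1 = of_int m * path_prim a 1 + of_int n * path_prim b 1"
proof -
  let ?S = "\<lambda>k. singular_subdivision 1 ^^ k :: (complex \<times> complex) option chain \<Rightarrow> _"
  obtain z where z: "singular_chain 2 (surface x) z"
    "chain_boundary 2 z = loop_chain c - (frag_cmul m (loop_chain a) + frag_cmul n (loop_chain b))"
    using hom unfolding homologous_rel_def singular_boundary by (auto simp: numeral_2_eq_2)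
  have cover: "topspace (surface x) \<subseteq> \<Union> (U ` topspace (surface x))"
    using patch by (auto simp: patch_def)
  have opU: "openin (surface x) V" if "V \<in> U ` topspace (surface x)" for V
    using that patch by (auto simp: patch_def)
  obtain Nz where Nz: "\<And>k \<sigma>. Nz \<le> k \<Longrightarrow> \<sigma> \<in> Poly_Mapping.keys ((singular_subdivision 2 ^^ k) z) \<Longrightarrow>
      \<exists>V\<in>U ` topspace (surface x). \<sigma> \<in> standard_simplex 2 \<rightarrow> V"
    using sufficient_iterated_singular_subdivision_exists[OF opU cover z(1)] by blast
  obtain Nc where Nc: "\<And>k. k \<ge> Nc \<Longrightarrow> cochain_sum cochain (?S k (loop_chain c)) = path_prim c 1"
    using cochain_sum_loop[OF paths(1)] by blast
  obtain Na where Na: "\<And>k. k \<ge> Na \<Longrightarrow> cochain_sum cochain (?S k (loop_chain a)) = path_prim a 1"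
    using cochain_sum_loop[OF paths(2)] by blast
  obtain Nb where Nb: "\<And>k. k \<ge> Nb \<Longrightarrow> cochain_sum cochain (?S k (loop_chain b)) = path_prim b 1"
    using cochain_sum_loop[OF paths(3)] by blast
  \<comment> \<open>One number of subdivisions that serves the 2-chain and all three loops.\<close>
  define k where "k = max (max Nz Nc) (max Na Nb)"
  have k: "k \<ge> Nz" "k \<ge> Nc" "k \<ge> Na" "k \<ge> Nb" by (auto simp: k_def)
  have chain: "chain_boundary 2 ((singular_subdivision 2 ^^ k) z) = ?S k (chain_boundary 2 z)"
    "singular_chain 2 (surface x) ((singular_subdivision 2 ^^ k) z)"
    using chain_boundary_iterated_subdivision[OF z(1), of k] by auto
  have "cochain_sum cochain (chain_boundary 2 ((singular_subdivision 2 ^^ k) z)) = 0"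
  proof (rule cochain_sum_chain_boundary)
    fix \<sigma> assume \<sigma>: "\<sigma> \<in> Poly_Mapping.keys ((singular_subdivision 2 ^^ k) z)"
    then obtain p where "p \<in> topspace (surface x)" "\<sigma> ` standard_simplex 2 \<subseteq> U p"
      using Nz[OF k(1)] by fastforce
    moreover have "singular_simplex 2 (surface x) \<sigma>"
      using chain(2) \<sigma> by (auto simp: singular_chain_def)
    ultimately show "(\<Sum>k\<le>2. (- 1) ^ k * cochain (singular_face 2 k \<sigma>)) = 0"
      by (intro cochain_boundary_small)
  qed simp
  then show ?thesis
    unfolding chain z(2) singular_subdivision_power_diff iterated_subdivision_lincomb
      cochain_sum_diff cochain_sum_add cochain_sum_cmul Nc[OF k(2)] Na[OF k(3)] Nb[OF k(4)]
    by simp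
qed

end

lemma basic_form_patched:
  assumes "x \<notin> {0, 1}"
  obtains U H where "patched_form x (basic_form \<alpha> \<beta>) U H"
proof -
  have "\<forall>p. \<exists>UH. p \<in> topspace (surface x) \<longrightarrow> patch x (basic_form \<alpha> \<beta>) p (fst UH) (snd UH)"
    using patch_exists[OF assms] by fastforce
  from choice[OF this] obtain g where
    "\<And>p. p \<in> topspace (surface x) \<Longrightarrow> patch x (basic_form \<alpha> \<beta>) p (fst (g p)) (snd (g p))"
    by blast
  then have "patched_form x (basic_form \<alpha> \<beta>) (\<lambda>p. fst (g p)) (\<lambda>p. snd (g p))"
    by (intro patched_form.intro curve_form_basic patched_form_axioms.intro)
  then show ?thesis using that by blast
qed

section \<open>Periods depending on the modulus\<close>

text \<open>Differentiation under the integral sign; the endpoints are fixed, so no boundary terms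
  arise.\<close>

lemma linepath_integral_parameter_derivative:
  fixes g g' :: "complex \<Rightarrow> complex \<Rightarrow> complex"
  assumes U: "convex U" "x0 \<in> U" and V: "convex V" "p \<in> V" "q \<in> V"
    and der: "\<And>x z. x \<in> U \<Longrightarrow> z \<in> V \<Longrightarrow> ((\<lambda>x. g x z) has_field_derivative g' x z) (at x within U)"
    and cont: "continuous_on (U \<times> V) (\<lambda>(x, z). g x z)" and cont': "continuous_on (U \<times> V) (\<lambda>(x, z). g' x z)"
  shows "((\<lambda>x. contour_integral (linepath p q) (g x)) has_field_derivative
            contour_integral (linepath p q) (g' x0)) (at x0 within U)"
proof -
  have inV: "linepath p q t \<in> V" if "t \<in> {0..1}" for t
    using that V by (metis convex_contains_segment linepath_in_path in_mono)
  have eq: "contour_integral (linepath p q) h = integral (cbox 0 1) (\<lambda>t. h (linepath p q t) * (q - p))" for h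
    by (simp add: contour_integral_integral)
  have comp: "continuous_on (U \<times> cbox 0 1) (\<lambda>(x, t). h x (linepath p q t) * (q - p))"
    if "continuous_on (U \<times> V) (\<lambda>(x, z). h x z)" for h :: "complex \<Rightarrow> complex \<Rightarrow> complex"
  proof -
    have "continuous_on (U \<times> cbox 0 1) (\<lambda>y. (fst y, linepath p q (snd y)))"
      unfolding linepath_def by (intro continuous_intros)
    then have "continuous_on (U \<times> cbox 0 1) (\<lambda>y. (\<lambda>(x, z). h x z) (fst y, linepath p q (snd y)))"
      by (rule continuous_on_compose2[OF that]) (auto intro: inV)
    then show ?thesis by (simp add: case_prod_unfold continuous_on_mult_right)
  qed
  show ?thesis
    unfolding eq
  proof (rule leibniz_rule_field_derivative[OF _ _ comp[OF cont'] U(2,1)])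
    fix x and t :: real assume xt: "x \<in> U" "t \<in> cbox 0 1"
    then have "linepath p q t \<in> V" using inV by simp
    then show "((\<lambda>x. g x (linepath p q t) * (q - p)) has_field_derivative g' x (linepath p q t) * (q - p)) (at x within U)"
      using der[OF xt(1)] by (intro DERIV_cmult_right)
  next
    fix x assume "x \<in> U"
    then have "continuous_on (cbox 0 1) (\<lambda>t. (\<lambda>(x, t). g x (linepath p q t) * (q - p)) (x, t))"
      by (intro continuous_on_compose2[OF comp[OF cont]] continuous_intros) auto
    then show "(\<lambda>t. g x (linepath p q t) * (q - p)) integrable_on cbox 0 1"
      by (intro integrable_continuous) simp
  qed
qed

text \<open>The quotient of \<open>cubic x z\<close> by its value at the base point is 1 there and
  stays in the right half plane nearby, off the cut of \<open>csqrt\<close>. So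
  \<open>v1 * csqrt\<close> of the quotient is one branch, jointly continuous in \<open>x\<close>
  and \<open>z\<close>. Its derivative in \<open>x\<close> comes from the factor
  \<open>z - x\<close> of the cubic.\<close>

lemma branch_family:
  assumes v1: "(u1, v1) \<in> unramified x0" and X: "open X" "x0 \<in> X"
  obtains \<delta> W where "\<delta> > 0" "ball x0 \<delta> \<subseteq> X" "W x0 u1 = v1"
    "\<And>x z. x \<in> ball x0 \<delta> \<Longrightarrow> z \<in> ball u1 \<delta> \<Longrightarrow> (W x z)\<^sup>2 = cubic x z \<and> W x z \<noteq> 0"
    "continuous_on (ball x0 \<delta> \<times> ball u1 \<delta>) (\<lambda>(x, z). W x z)"
    "\<And>x. x \<in> ball x0 \<delta> \<Longrightarrow> W x holomorphic_on ball u1 \<delta>"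
    "\<And>x z. x \<in> ball x0 \<delta> \<Longrightarrow> z \<in> ball u1 \<delta> \<Longrightarrow>
       ((\<lambda>x. W x z) has_field_derivative - W x z / (2 * (z - x))) (at x)"
proof -
  have nz: "cubic x0 u1 \<noteq> 0" and v1': "v1\<^sup>2 = cubic x0 u1" "v1 \<noteq> 0"
    using v1 unfolding unramified_iff by auto
  define \<kappa> where "\<kappa> x z = cubic x z / cubic x0 u1" for x z
  let ?S = "{y. 0 < Re (\<kappa> (fst y) (snd y))}"
  have "open ?S"
    unfolding \<kappa>_def using nz by (intro open_Collect_less continuous_intros) auto
  moreover have "(x0, u1) \<in> ?S" using nz by (simp add: \<kappa>_def)
  ultimately obtain A B where AB: "open A" "x0 \<in> A" "open B" "u1 \<in> B" "A \<times> B \<subseteq> ?S"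
    by (rule open_prod_elim) auto
  obtain d1 where d1: "d1 > 0" "ball x0 d1 \<subseteq> A \<inter> X"
    using openE[of "A \<inter> X" x0] AB(1,2) X by blast
  obtain d2 where d2: "d2 > 0" "ball u1 d2 \<subseteq> B"
    using openE[of B u1] AB(3,4) by blast
  define \<delta> where "\<delta> = min d1 d2"
  have pos: "0 < Re (\<kappa> x z)" if "x \<in> ball x0 \<delta>" "z \<in> ball u1 \<delta>" for x z
  proof -
    have "x \<in> A" "z \<in> B" using that d1(2) d2(2) by (auto simp: \<delta>_def)
    then have "(x, z) \<in> ?S" using AB(5) by blast
    then show ?thesis by simp
  qed
  have nR: "\<kappa> x z \<notin> \<real>\<^sub>\<le>\<^sub>0" if "x \<in> ball x0 \<delta>" "z \<in> ball u1 \<delta>" for x z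
    using pos[OF that] by (auto simp: complex_nonpos_Reals_iff)
  define W where "W x z = v1 * csqrt (\<kappa> x z)" for x z
  have W2: "(W x z)\<^sup>2 = cubic x z" for x z
    using nz by (simp add: W_def power_mult_distrib v1' \<kappa>_def)
  show ?thesis
  proof (rule that[of \<delta> W])
    show "\<delta> > 0" using d1 d2 by (simp add: \<delta>_def)
    show "ball x0 \<delta> \<subseteq> X" using d1 by (auto simp: \<delta>_def)
    show "W x0 u1 = v1" using nz by (simp add: W_def \<kappa>_def)
    show "(W x z)\<^sup>2 = cubic x z \<and> W x z \<noteq> 0" if "x \<in> ball x0 \<delta>" "z \<in> ball u1 \<delta>" for x z
    proof
      have "\<kappa> x z \<noteq> 0" using pos[OF that] by auto
      then show "W x z \<noteq> 0" using v1'(2) by (simp add: W_def)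
    qed (rule W2)
    have "continuous_on (ball x0 \<delta> \<times> ball u1 \<delta>) (\<lambda>y. v1 * csqrt (\<kappa> (fst y) (snd y)))"
    proof (intro continuous_on_mult continuous_on_const continuous_on_compose2[OF continuous_on_csqrt])
      show "continuous_on (ball x0 \<delta> \<times> ball u1 \<delta>) (\<lambda>y. \<kappa> (fst y) (snd y))"
        unfolding \<kappa>_def using nz by (intro continuous_intros) auto
    qed (use nR in auto)
    then show "continuous_on (ball x0 \<delta> \<times> ball u1 \<delta>) (\<lambda>(x, z). W x z)"
      by (simp add: W_def case_prod_unfold)
    show "W x holomorphic_on ball u1 \<delta>" if "x \<in> ball x0 \<delta>" for x
    proof -
      have "\<kappa> x holomorphic_on ball u1 \<delta>"
        unfolding \<kappa>_def[abs_def] using nz by (intro holomorphic_intros) auto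
      then show ?thesis unfolding W_def[abs_def] by (intro holomorphic_intros) (use nR[OF that] in auto)
    qed
    show "((\<lambda>x. W x z) has_field_derivative - W x z / (2 * (z - x))) (at x)"
      if xz: "x \<in> ball x0 \<delta>" "z \<in> ball u1 \<delta>" for x z
    proof -
      let ?k = "- (z * (z - 1)) / cubic x0 u1"
      have "((\<lambda>x. \<kappa> x z) has_field_derivative ?k) (at x)"
        unfolding \<kappa>_def using nz by (auto intro!: derivative_eq_intros)
      then have "((\<lambda>x. W x z) has_field_derivative v1 * (?k / (2 * csqrt (\<kappa> x z)))) (at x)"
        unfolding W_def by (intro DERIV_cmult has_field_derivative_csqrt' nR[OF xz])
      moreover have "v1 * (?k / (2 * csqrt (\<kappa> x z))) = - W x z / (2 * (z - x))"
      proof -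
        have k0: "\<kappa> x z \<noteq> 0" using pos[OF xz] by auto
        then have zx: "z - x \<noteq> 0" by (auto simp: \<kappa>_def)
        define s where "s = csqrt (\<kappa> x z)"
        have s0: "s \<noteq> 0" using k0 by (simp add: s_def)
        have "?k * (z - x) = - (s\<^sup>2)" by (simp add: \<kappa>_def s_def)
        then have "?k = - (s\<^sup>2) / (z - x)" by (rule iffD2[OF nonzero_eq_divide_eq[OF zx]])
        then show ?thesis
          unfolding W_def s_def[symmetric] using s0 zx by (simp only:) (simp add: field_simps power2_eq_square)
      qed
      ultimately show ?thesis by simp
    qed
  qed
qed

text \<open>Up to constants these are the derivatives of \<open>du / v\<close> with respect to
  \<open>x\<close> at fixed \<open>u\<close>: each differentiation raises \<open>j\<close> by one
  and contributes the factor \<open>j + 1 / 2\<close>.\<close>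

definition power_form :: "nat \<Rightarrow> complex \<Rightarrow> complex \<times> complex \<Rightarrow> complex" where
  "power_form j x P = 1 / (snd P * (fst P - x) ^ j)"

lemma curve_form_power: "curve_form x (unramified x) (power_form j x)"
proof
  show "curve_holomorphic x (unramified x) (power_form j x)"
    unfolding curve_holomorphic_def
  proof
    fix P assume P: "P \<in> unramified x"
    obtain u v where uv: "P = (u, v)" by (cases P)
    have "u \<noteq> x" "v \<noteq> 0" using P uv unramified_iff' unramified_iff by auto
    have "((\<lambda>u. (u - x) ^ j) has_field_derivative of_nat j * (u - x) ^ (j - 1)) (at (fst P))"
      using uv by (auto intro!: derivative_eq_intros)
    note D = curve_deriv_mult[OF curve_deriv_snd[OF P[unfolded uv]] curve_deriv_compose[OF curve_deriv_fst this, unfolded uv]]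
    have nz: "snd (u, v) * (fst (u, v) - x) ^ j \<noteq> 0" using \<open>u \<noteq> x\<close> \<open>v \<noteq> 0\<close> by simp
    from curve_deriv_divide[OF curve_deriv_const D nz]
    show "\<exists>D. curve_deriv x (power_form j x) D P"
      unfolding power_form_def[abs_def] uv by (rule exI)
  qed
qed (use openin_unramified in auto)

section \<open>Differentiating periods along a family of loops\<close>

definition loop_period :: "(complex \<times> complex \<Rightarrow> complex) \<Rightarrow> (real \<Rightarrow> complex \<times> complex) \<Rightarrow> complex" where
  "loop_period f c = integral {0..1} (curve_integrand f c)"

text \<open>All loops of the family have the same projection to the \<open>u\<close>-plane, so the
  parameter enters a period only through the integrand and the sheet of \<open>v\<close>.\<close>

locale loop_family =
  fixes X :: "complex set" and c :: "complex \<Rightarrow> real \<Rightarrow> complex \<times> complex"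
  assumes X: "open X" "X \<subseteq> - {0, 1}"
    and loop: "\<And>x. x \<in> X \<Longrightarrow> surface_loop x (c x)"
    and cont: "continuous_on (X \<times> {0..1}) (\<lambda>(x, t). c x t)"
    and fst_eq: "\<And>x x' t. x \<in> X \<Longrightarrow> x' \<in> X \<Longrightarrow> t \<in> {0..1} \<Longrightarrow> fst (c x t) = fst (c x' t)"
begin

lemma c_unramified: "x \<in> X \<Longrightarrow> t \<in> {0..1} \<Longrightarrow> c x t \<in> unramified x"
  using loop[of x] unfolding surface_loop_def path_image_def by blast

lemma c_valid: "x \<in> X \<Longrightarrow> valid_path (c x)"
  using loop by (auto simp: surface_loop_def)

text \<open>A single branch family \<open>W\<close> describes the loops for all nearby
  \<open>x\<close> and \<open>t\<close>: joint continuity prevents a change of sheet.\<close>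

lemma local_branch_family:
  assumes x0: "x0 \<in> X" and r: "r \<in> {0..1}"
  obtains \<delta> d W where "\<delta> > 0" "d > 0" "ball x0 \<delta> \<subseteq> X"
    "\<And>x z. x \<in> ball x0 \<delta> \<Longrightarrow> z \<in> ball (fst (c x0 r)) \<delta> \<Longrightarrow> (W x z)\<^sup>2 = cubic x z \<and> W x z \<noteq> 0"
    "continuous_on (ball x0 \<delta> \<times> ball (fst (c x0 r)) \<delta>) (\<lambda>(x, z). W x z)"
    "\<And>x. x \<in> ball x0 \<delta> \<Longrightarrow> W x holomorphic_on ball (fst (c x0 r)) \<delta>"
    "\<And>x z. x \<in> ball x0 \<delta> \<Longrightarrow> z \<in> ball (fst (c x0 r)) \<delta> \<Longrightarrow>
       ((\<lambda>x. W x z) has_field_derivative - W x z / (2 * (z - x))) (at x)"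
    "\<And>x t. x \<in> ball x0 \<delta> \<Longrightarrow> t \<in> {0..1} \<Longrightarrow> \<bar>t - r\<bar> < d \<Longrightarrow>
       fst (c x0 t) \<in> ball (fst (c x0 r)) \<delta> \<and> c x t = (fst (c x0 t), W x (fst (c x0 t)))"
proof -
  obtain u1 v1 where uv: "c x0 r = (u1, v1)" by (cases "c x0 r")
  have un: "(u1, v1) \<in> unramified x0" using c_unramified[OF x0 r] uv by simp
  obtain \<delta> W where W: "\<delta> > 0" "ball x0 \<delta> \<subseteq> X" "W x0 u1 = v1"
    "\<And>x z. x \<in> ball x0 \<delta> \<Longrightarrow> z \<in> ball u1 \<delta> \<Longrightarrow> (W x z)\<^sup>2 = cubic x z \<and> W x z \<noteq> 0"
    "continuous_on (ball x0 \<delta> \<times> ball u1 \<delta>) (\<lambda>(x, z). W x z)"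
    "\<And>x. x \<in> ball x0 \<delta> \<Longrightarrow> W x holomorphic_on ball u1 \<delta>"
    "\<And>x z. x \<in> ball x0 \<delta> \<Longrightarrow> z \<in> ball u1 \<delta> \<Longrightarrow>
       ((\<lambda>x. W x z) has_field_derivative - W x z / (2 * (z - x))) (at x)"
    by (rule branch_family[OF un X(1) x0]) blast
  have cont0: "continuous_on {0..1} (c x0)"
    using valid_path_imp_path[OF c_valid[OF x0]] by (simp add: path_def)
  then have "continuous_on {0..1} (\<lambda>t. fst (c x0 t))" by (rule continuous_on_fst)
  then obtain d where d: "d > 0" "\<And>t. t \<in> {0..1} \<Longrightarrow> dist t r < d \<Longrightarrow> dist (fst (c x0 t)) (fst (c x0 r)) < \<delta>"
    using r W(1) unfolding continuous_on_iff by meson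
  define I where "I = {0..1} \<inter> ball r d"
  have I: "fst (c x0 t) \<in> ball u1 \<delta>" if "t \<in> I" for t
    using that d(2)[of t] uv by (auto simp: I_def dist_commute)
  \<comment> \<open>This quotient compares the sheet of the loop with that of \<open>W\<close>. It
    takes only the values 1 and -1, is continuous on a connected set and equals 1 at
    \<open>(x0, r)\<close>, so it is 1 throughout.\<close>
  define \<sigma> where "\<sigma> y = snd (c (fst y) (snd y)) / W (fst y) (fst (c x0 (snd y)))" for y
  let ?K = "ball x0 \<delta> \<times> I"
  have "connected ?K"
    by (intro connected_Times convex_connected) (auto simp: I_def intro: convex_Int)
  moreover have "continuous_on ?K \<sigma>"
  proof -
    have 1: "continuous_on ?K (\<lambda>y. (\<lambda>(x, t). c x t) (fst y, snd y))"
      using W(2) by (intro continuous_on_compose2[OF cont] continuous_intros) (auto simp: I_def)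
    have 2: "continuous_on ?K (\<lambda>y. c x0 (snd y))"
      by (intro continuous_on_compose2[OF cont0] continuous_intros) (auto simp: I_def)
    have 3: "continuous_on ?K (\<lambda>y. (\<lambda>(x, z). W x z) (fst y, fst (c x0 (snd y))))"
      by (intro continuous_on_compose2[OF W(5)] continuous_on_Pair continuous_on_fst continuous_on_id 2) (use I in auto)
    show ?thesis
      unfolding \<sigma>_def using 1 3 W(4) I by (intro continuous_on_divide continuous_on_snd) (auto simp: case_prod_unfold)
  qed
  moreover have \<sigma>2: "\<sigma> y = 1 \<or> \<sigma> y = -1" if "y \<in> ?K" for y
  proof -
    obtain x t where "y = (x, t)" by (cases y)
    with that have y: "y = (x, t)" "x \<in> ball x0 \<delta>" "t \<in> I" by auto
    have xX: "x \<in> X" using W(2) y by blast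
    have t: "t \<in> {0..1}" using y by (simp add: I_def)
    have "fst (c x t) = fst (c x0 t)" using fst_eq[OF xX x0 t] .
    then have "(snd (c x t))\<^sup>2 = cubic x (fst (c x0 t))"
      using c_unramified[OF xX t] by (cases "c x t") (auto simp: unramified_iff)
    then have "(snd (c x t))\<^sup>2 = (W x (fst (c x0 t)))\<^sup>2" using W(4)[OF y(2) I[OF y(3)]] by simp
    moreover have "W x (fst (c x0 t)) \<noteq> 0" using W(4)[OF y(2) I[OF y(3)]] by blast
    ultimately have "(\<sigma> y)\<^sup>2 = 1" by (simp add: \<sigma>_def y(1) power_divide)
    then show ?thesis by (simp add: power2_eq_1_iff)
  qed
  ultimately have "\<sigma> constant_on ?K"
    by (intro continuous_finite_range_constant finite_subset[of "\<sigma> ` ?K" "{1, -1}"]) auto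
  then obtain k where k: "\<And>y. y \<in> ?K \<Longrightarrow> \<sigma> y = k" by (auto simp: constant_on_def)
  have "(x0, r) \<in> ?K" using W(1) d(1) r by (simp add: I_def)
  moreover have "\<sigma> (x0, r) = 1" using W(3) un uv by (simp add: \<sigma>_def unramified_iff)
  ultimately have k1: "k = 1" using k by metis
  show ?thesis
  proof (rule that[of \<delta> d W])
    fix x t assume xt: "x \<in> ball x0 \<delta>" "t \<in> {0..1}" "\<bar>t - r\<bar> < d"
    then have tI: "t \<in> I" by (simp add: I_def dist_real_def abs_minus_commute)
    have xX: "x \<in> X" using W(2) xt by blast
    have "\<sigma> (x, t) = 1" using k[of "(x, t)"] k1 xt(1) tI by simp
    then have "snd (c x t) = W x (fst (c x0 t))"
      using W(4)[OF xt(1) I[OF tI]] by (simp add: \<sigma>_def)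
    moreover have "fst (c x t) = fst (c x0 t)" using fst_eq[OF xX x0 xt(2)] .
    ultimately show "fst (c x0 t) \<in> ball (fst (c x0 r)) \<delta> \<and> c x t = (fst (c x0 t), W x (fst (c x0 t)))"
      using I[OF tI] uv by (metis fst_conv prod.collapse)
  qed (use W d uv in auto)
qed

definition part_period :: "nat \<Rightarrow> complex \<Rightarrow> real \<Rightarrow> real \<Rightarrow> complex" where
  "part_period j x s t = integral {s..t} (curve_integrand (power_form j x) (c x))"

lemma part_integrable:
  assumes "x \<in> X" "0 \<le> s" "s \<le> t" "t \<le> 1"
  shows "curve_integrand (power_form j x) (c x) integrable_on {s..t}"
proof -
  interpret curve_form x "unramified x" "power_form j x" by (rule curve_form_power)
  have "curve_path (c x)" using loop[OF assms(1)] by (auto simp: curve_path_def surface_loop_def)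
  then show ?thesis using curve_integrable assms by blast
qed

text \<open>By bisection it is enough to treat short pieces. In the factor, \<open>j\<close> comes
  from the power of \<open>u - x\<close> and \<open>1 / 2\<close> from \<open>1 / v\<close>.\<close>

lemma part_period_deriv:
  assumes x0: "x0 \<in> X" and st: "0 \<le> s" "s \<le> t" "t \<le> 1"
  shows "((\<lambda>x. part_period j x s t) has_field_derivative (of_nat j + 1 / 2) * part_period (Suc j) x0 s t) (at x0)"
proof -
  have "{s..t} \<subseteq> {0..1} \<longrightarrow>
    ((\<lambda>x. part_period j x s t) has_field_derivative (of_nat j + 1 / 2) * part_period (Suc j) x0 s t) (at x0)"
    using \<open>s \<le> t\<close>
  proof (induction rule: Bolzano)
    case (trans p q r)
    show ?case
    proof
      assume pr: "{p..r} \<subseteq> {0..1}"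
      then have 01: "0 \<le> p" "r \<le> 1" using trans(3,4) by auto
      have "{p..q} \<subseteq> {0..1}" "{q..r} \<subseteq> {0..1}" using pr trans(3,4) by auto
      then have "((\<lambda>x. part_period j x p q + part_period j x q r) has_field_derivative
          (of_nat j + 1 / 2) * part_period (Suc j) x0 p q + (of_nat j + 1 / 2) * part_period (Suc j) x0 q r) (at x0)"
        using trans(1,2) by (intro DERIV_add) auto
      moreover have sum: "part_period i x p q + part_period i x q r = part_period i x p r" if "x \<in> X" for i x
        unfolding part_period_def
        by (intro Henstock_Kurzweil_Integration.integral_combine part_integrable that) (use trans 01 in auto)
      ultimately have "((\<lambda>x. part_period j x p q + part_period j x q r) has_field_derivative
          (of_nat j + 1 / 2) * part_period (Suc j) x0 p r) (at x0)"
        using sum[OF x0, of "Suc j"] by (simp add: distrib_left[symmetric])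
      then show "((\<lambda>x. part_period j x p r) has_field_derivative (of_nat j + 1 / 2) * part_period (Suc j) x0 p r) (at x0)"
        by (rule has_field_derivative_transform_within_open[OF _ X(1) x0]) (rule sum)
    qed
  next
    case (local r)
    then have r: "r \<in> {0..1}" using st by auto
    let ?u = "\<lambda>t. fst (c x0 t)"
    obtain \<delta> d W where W: "\<delta> > 0" "d > 0" "ball x0 \<delta> \<subseteq> X"
      "\<And>x z. x \<in> ball x0 \<delta> \<Longrightarrow> z \<in> ball (?u r) \<delta> \<Longrightarrow> (W x z)\<^sup>2 = cubic x z \<and> W x z \<noteq> 0"
      "continuous_on (ball x0 \<delta> \<times> ball (?u r) \<delta>) (\<lambda>(x, z). W x z)"
      "\<And>x. x \<in> ball x0 \<delta> \<Longrightarrow> W x holomorphic_on ball (?u r) \<delta>"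
      "\<And>x z. x \<in> ball x0 \<delta> \<Longrightarrow> z \<in> ball (?u r) \<delta> \<Longrightarrow>
         ((\<lambda>x. W x z) has_field_derivative - W x z / (2 * (z - x))) (at x)"
      "\<And>x t. x \<in> ball x0 \<delta> \<Longrightarrow> t \<in> {0..1} \<Longrightarrow> \<bar>t - r\<bar> < d \<Longrightarrow>
         ?u t \<in> ball (?u r) \<delta> \<and> c x t = (?u t, W x (?u t))"
      by (rule local_branch_family[OF x0 r]) blast
    let ?B = "ball x0 \<delta>" and ?V = "ball (?u r) \<delta>"
    have zx: "z - x \<noteq> 0" if "x \<in> ?B" "z \<in> ?V" for x z
      using W(4)[OF that] by auto
    define g where "g i x z = power_form i x (z, W x z)" for i x z
    have gh: "g i x holomorphic_on ?V" if "x \<in> ?B" for i x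
      unfolding g_def[abs_def] power_form_def fst_conv snd_conv
      by (intro holomorphic_intros W(6) that) (use W(4)[OF that] zx[OF that] in auto)
    have gd: "((\<lambda>x. g j x z) has_field_derivative (of_nat j + 1 / 2) * g (Suc j) x z) (at x within ?B)"
      if xz: "x \<in> ?B" "z \<in> ?V" for x z
    proof -
      note nz = zx[OF xz] and Wnz = conjunct2[OF W(4)[OF xz]]
      have pd: "((\<lambda>x. (z - x) ^ j) has_field_derivative - (of_nat j * (z - x) ^ j / (z - x))) (at x)"
      proof -
        have "((\<lambda>x. (z - x) ^ j) has_field_derivative of_nat j * (z - x) ^ (j - 1) * (- 1)) (at x)"
          by (auto intro!: derivative_eq_intros)
        moreover have "of_nat j * (z - x) ^ (j - 1) * (- 1) = - (of_nat j * (z - x) ^ j / (z - x))"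
          by (cases j) (use nz in auto)
        ultimately show ?thesis by simp
      qed
      have "((\<lambda>x. W x z * (z - x) ^ j) has_field_derivative
          (- W x z / (2 * (z - x))) * (z - x) ^ j + (- (of_nat j * (z - x) ^ j / (z - x))) * W x z) (at x)"
        by (rule DERIV_mult[OF W(7)[OF xz] pd])
      moreover have "(- W x z / (2 * (z - x))) * (z - x) ^ j + (- (of_nat j * (z - x) ^ j / (z - x))) * W x z
          = - (of_nat j + 1 / 2) * (W x z * (z - x) ^ j) / (z - x)"
      proof -
        have "(- w / (2 * s)) * Q + (- (n * Q / s)) * w = - (n + 1 / 2) * (w * Q) / s"
          if "s \<noteq> 0" for w s Q n :: complex
          using that by (simp add: field_simps)
        from this[OF nz] show ?thesis .
      qed
      ultimately have Hd: "((\<lambda>x. W x z * (z - x) ^ j) has_field_derivative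
          - (of_nat j + 1 / 2) * (W x z * (z - x) ^ j) / (z - x)) (at x)"
        by (simp only:)
      have inv: "((\<lambda>x. 1 / h x) has_field_derivative - D / (h x)\<^sup>2) (at x)"
        if "(h has_field_derivative D) (at x)" "h x \<noteq> 0" for h :: "complex \<Rightarrow> complex" and D
        using that by (auto intro!: derivative_eq_intros simp: power2_eq_square)
      have "W x z * (z - x) ^ j \<noteq> 0" using nz Wnz by simp
      from inv[OF Hd this] have "((\<lambda>x. 1 / (W x z * (z - x) ^ j)) has_field_derivative
          - (- (of_nat j + 1 / 2) * (W x z * (z - x) ^ j) / (z - x)) / (W x z * (z - x) ^ j)\<^sup>2) (at x)" .
      moreover have "- (- (of_nat j + 1 / 2) * (W x z * (z - x) ^ j) / (z - x)) / (W x z * (z - x) ^ j)\<^sup>2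
          = (of_nat j + 1 / 2) * g (Suc j) x z"
      proof -
        define w where "w = W x z * (z - x) ^ j"
        have w0: "w \<noteq> 0" using nz Wnz by (simp add: w_def)
        have geq: "g (Suc j) x z = 1 / (w * (z - x))" by (simp add: g_def power_form_def w_def mult_ac)
        have "- (- n * y / s) / y\<^sup>2 = n * (1 / (y * s))" if "y \<noteq> 0" "s \<noteq> 0" for n y s :: complex
          using that by (simp add: field_simps power2_eq_square)
        from this[OF w0 nz] show ?thesis unfolding w_def[symmetric] geq .
      qed
      ultimately show ?thesis
        unfolding g_def[of j] power_form_def by (simp add: has_field_derivative_at_within)
    qed
    have gc: "continuous_on (?B \<times> ?V) (\<lambda>(x, z). g i x z)" for i
    proof -
      have "continuous_on (?B \<times> ?V) (\<lambda>y. 1 / ((\<lambda>(x, z). W x z) y * (snd y - fst y) ^ i))"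
        by (intro continuous_intros W(5)) (use W(4) zx in auto)
      then show ?thesis by (simp add: g_def power_form_def case_prod_unfold)
    qed
    \<comment> \<open>On the disc \<open>?V\<close> the integrand has a primitive, so the piece of
      path may be replaced by the segment between its endpoints. The segment is the same for all
      \<open>x\<close>, which makes differentiation under the integral applicable.\<close>
    have part: "part_period i x p q = contour_integral (linepath (?u p) (?u q)) (g i x)"
      if pq: "p \<le> r \<and> r \<le> q \<and> q - p < d" "{p..q} \<subseteq> {0..1}" and x: "x \<in> ?B" for p q i x
    proof -
      obtain F where F: "\<And>z. z \<in> ?V \<Longrightarrow> (F has_field_derivative g i x z) (at z within ?V)"
        using holomorphic_convex_primitive'[OF convex_ball open_ball gh[OF x]] by blast
      have near: "?u t' \<in> ?V \<and> c x t' = (?u t', W x (?u t'))" if "t' \<in> {p..q}" for t'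
        using that pq by (intro W(8)[OF x]) auto
      have xX: "x \<in> X" using W(3) x by blast
      have "(curve_integrand (power_form i x) (c x) has_integral F (fst (c x q)) - F (fst (c x p))) {p..q}"
      proof (rule curve_integral_primitive[OF c_valid[OF xX]])
        fix t' assume t': "t' \<in> {p..q}"
        have c1: "c x t' \<in> affine_curve x"
          using c_unramified[OF xX, of t'] unramified_subset t' pq(2) by blast
        have "(F has_field_derivative g i x (?u t')) (at (fst (c x t')))"
          using F[of "?u t'"] near[OF t'] by (simp add: at_within_open[of "?u t'" ?V])
        then have "curve_deriv x (\<lambda>P. F (fst P)) (g i x (?u t') * 1) (c x t')"
          by (intro curve_deriv_compose curve_deriv_fst)
        then show "c x t' \<in> affine_curve x \<and> curve_deriv x (\<lambda>P. F (fst P)) (power_form i x (c x t')) (c x t')"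
          using c1 near[OF t'] by (simp add: g_def)
      qed (use pq in auto)
      then have "part_period i x p q = F (?u q) - F (?u p)"
        using near[of p] near[of q] pq by (simp add: part_period_def integral_unique)
      moreover have "(g i x has_contour_integral F (pathfinish (linepath (?u p) (?u q))) - F (pathstart (linepath (?u p) (?u q)))) (linepath (?u p) (?u q))"
      proof (rule contour_integral_primitive[OF F])
        show "path_image (linepath (?u p) (?u q)) \<subseteq> ?V"
          using near[of p] near[of q] pq by (simp add: closed_segment_subset)
      qed auto
      ultimately show ?thesis by (simp add: contour_integral_unique)
    qed
    have "((\<lambda>x. part_period j x p q) has_field_derivative (of_nat j + 1 / 2) * part_period (Suc j) x0 p q) (at x0)"
      if pq: "p \<le> r \<and> r \<le> q \<and> q - p < d" "{p..q} \<subseteq> {0..1}" for p q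
    proof -
      have x0B: "x0 \<in> ?B" using W(1) by simp
      have uV: "?u p \<in> ?V" "?u q \<in> ?V"
        using W(8)[OF x0B, of p] W(8)[OF x0B, of q] pq by auto
      have "((\<lambda>x. contour_integral (linepath (?u p) (?u q)) (g j x)) has_field_derivative
          contour_integral (linepath (?u p) (?u q)) (\<lambda>z. (of_nat j + 1 / 2) * g (Suc j) x0 z)) (at x0 within ?B)"
      proof (rule linepath_integral_parameter_derivative[OF convex_ball x0B convex_ball uV gd gc])
        show "continuous_on (?B \<times> ?V) (\<lambda>(x, z). (of_nat j + 1 / 2) * g (Suc j) x z)"
          using gc[of "Suc j"] by (simp add: case_prod_unfold continuous_on_mult_left)
      qed
      moreover have "contour_integral (linepath (?u p) (?u q)) (\<lambda>z. (of_nat j + 1 / 2) * g (Suc j) x0 z)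
          = (of_nat j + 1 / 2) * part_period (Suc j) x0 p q"
      proof -
        have "continuous_on (closed_segment (?u p) (?u q)) (g (Suc j) x0)"
          using gh[OF x0B] uV closed_segment_subset[OF uV convex_ball]
          by (meson continuous_on_subset holomorphic_on_imp_continuous_on)
        then have "g (Suc j) x0 contour_integrable_on linepath (?u p) (?u q)"
          by (rule contour_integrable_continuous_linepath)
        then show ?thesis unfolding part[OF pq x0B] by (rule contour_integral_lmul)
      qed
      ultimately have "((\<lambda>x. contour_integral (linepath (?u p) (?u q)) (g j x)) has_field_derivative
          (of_nat j + 1 / 2) * part_period (Suc j) x0 p q) (at x0)"
        unfolding at_within_open[OF x0B open_ball] by simp
      then show ?thesis
        by (rule has_field_derivative_transform_within_open[OF _ open_ball x0B]) (use part[OF pq] in auto)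
    qed
    with W(2) show ?case by blast
  qed
  then show ?thesis using st by auto
qed

lemma loop_period_deriv:
  "x \<in> X \<Longrightarrow> ((\<lambda>x. loop_period (power_form j x) (c x)) has_field_derivative
     (of_nat j + 1 / 2) * loop_period (power_form (Suc j) x) (c x)) (at x)"
  using part_period_deriv[of x 0 1 j] by (simp add: part_period_def loop_period_def)

end

subsection \<open>Exact forms and the Picard-Fuchs equation\<close>

lemma loop_period_exact:
  assumes c: "surface_loop x c" and H: "\<And>P. P \<in> unramified x \<Longrightarrow> curve_deriv x H (f P) P"
  shows "loop_period f c = 0"
proof -
  have "(curve_integrand f c has_integral H (c 1) - H (c 0)) {0..1}"
  proof (rule curve_integral_primitive)
    fix r :: real assume "r \<in> {0..1}"
    then have "c r \<in> unramified x" using c unfolding surface_loop_def path_image_def by blast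
    then show "c r \<in> affine_curve x \<and> curve_deriv x H (f (c r)) (c r)"
      using H unramified_subset by blast
  qed (use c in \<open>auto simp: surface_loop_def\<close>)
  moreover have "c 1 = c 0" using c by (simp add: surface_loop_def pathfinish_def pathstart_def)
  ultimately show ?thesis by (simp add: loop_period_def integral_unique)
qed

lemma loop_integrable:
  assumes "curve_form x (unramified x) f" "surface_loop x c"
  shows "curve_integrand f c integrable_on {0..1}"
proof -
  interpret curve_form x "unramified x" f by fact
  have "curve_path c" using assms(2) by (auto simp: curve_path_def surface_loop_def)
  then show ?thesis using curve_integrable[of c 0 1] by simp
qed

lemma loop_period_lincomb:
  assumes "curve_form x (unramified x) f" "curve_form x (unramified x) g" "surface_loop x c"
  shows "loop_period (\<lambda>P. \<alpha> * f P + \<beta> * g P) c = \<alpha> * loop_period f c + \<beta> * loop_period g c"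
    and "curve_integrand (\<lambda>P. \<alpha> * f P + \<beta> * g P) c integrable_on {0..1}"
proof -
  have "(curve_integrand f c has_integral loop_period f c) {0..1}" "(curve_integrand g c has_integral loop_period g c) {0..1}"
    using loop_integrable[OF assms(1,3)] loop_integrable[OF assms(2,3)]
    by (simp_all add: loop_period_def integrable_integral)
  then have "((\<lambda>t. \<alpha> * curve_integrand f c t + \<beta> * curve_integrand g c t) has_integral
      \<alpha> * loop_period f c + \<beta> * loop_period g c) {0..1}"
    by (intro has_integral_add has_integral_mult_right)
  moreover have "(\<lambda>t. \<alpha> * curve_integrand f c t + \<beta> * curve_integrand g c t) = curve_integrand (\<lambda>P. \<alpha> * f P + \<beta> * g P) c"
    by (auto simp: curve_integrand_def fun_eq_iff algebra_simps)
  ultimately have "(curve_integrand (\<lambda>P. \<alpha> * f P + \<beta> * g P) c has_integral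
      \<alpha> * loop_period f c + \<beta> * loop_period g c) {0..1}" by simp
  then show "loop_period (\<lambda>P. \<alpha> * f P + \<beta> * g P) c = \<alpha> * loop_period f c + \<beta> * loop_period g c"
    "curve_integrand (\<lambda>P. \<alpha> * f P + \<beta> * g P) c integrable_on {0..1}"
    by (auto simp: loop_period_def[of "\<lambda>P. \<alpha> * f P + \<beta> * g P"] integral_unique)
qed

lemma curve_form_lincomb:
  assumes "curve_form x M f" "curve_form x M g"
  shows "curve_form x M (\<lambda>P. \<alpha> * f P + \<beta> * g P)"
proof -
  interpret f: curve_form x M f by fact
  interpret g: curve_form x M g by fact
  have "\<exists>D. curve_deriv x (\<lambda>P. \<alpha> * f P + \<beta> * g P) D P" if P: "P \<in> M" for P
  proof -
    obtain D E where "curve_deriv x f D P" "curve_deriv x g E P"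
      using f.holo g.holo P unfolding curve_holomorphic_def by blast
    from curve_deriv_add[OF curve_deriv_mult[OF curve_deriv_const this(1)] curve_deriv_mult[OF curve_deriv_const this(2)]]
    show ?thesis by blast
  qed
  then show ?thesis using f.sub f.opn by unfold_locales (auto simp: curve_holomorphic_def)
qed

lemma loop_period_basic:
  assumes "surface_loop x c"
  shows "loop_period (basic_form \<alpha> \<beta>) c = \<alpha> * loop_period (power_form 0 x) c + \<beta> * loop_period (basic_form 0 1) c"
proof -
  have "basic_form \<alpha> \<beta> = (\<lambda>P. \<alpha> * power_form 0 x P + \<beta> * basic_form 0 1 P)"
    by (auto simp: basic_form_def power_form_def fun_eq_iff add_divide_distrib)
  then show ?thesis
    using loop_period_lincomb(1)[OF curve_form_power curve_form_basic assms] by simp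
qed

lemma curve_deriv_quotient_power:
  assumes un: "(u, v) \<in> unramified x" and k: "k > 0"
  shows "curve_deriv x (\<lambda>P. snd P / (fst P - x) ^ k)
    (((3 * u\<^sup>2 - 2 * (1 + x) * u + x) / (2 * v) * (u - x) - of_nat k * v) / (u - x) ^ (k + 1)) (u, v)"
proof -
  have nz: "u - x \<noteq> 0" using un by (simp add: unramified_iff')
  have "((\<lambda>u. (u - x) ^ k) has_field_derivative of_nat k * (u - x) ^ (k - 1)) (at (fst (u, v)))"
    by (auto intro!: derivative_eq_intros)
  from curve_deriv_divide[OF curve_deriv_snd[OF un] curve_deriv_compose[OF curve_deriv_fst this]]
  have "curve_deriv x (\<lambda>P. snd P / (fst P - x) ^ k)
    (((3 * u\<^sup>2 - 2 * (1 + x) * u + x) / (2 * v) * (u - x) ^ k - v * (of_nat k * (u - x) ^ (k - 1))) / ((u - x) ^ k)\<^sup>2) (u, v)"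
    using nz by simp
  moreover have "((3 * u\<^sup>2 - 2 * (1 + x) * u + x) / (2 * v) * (u - x) ^ k - v * (of_nat k * (u - x) ^ (k - 1))) / ((u - x) ^ k)\<^sup>2
     = ((3 * u\<^sup>2 - 2 * (1 + x) * u + x) / (2 * v) * (u - x) - of_nat k * v) / (u - x) ^ (k + 1)"
  proof -
    obtain n where n: "k = Suc n" using k by (cases k) auto
    have alg: "(D * (s * Q) - v * (n' * Q)) / (s * Q)\<^sup>2 = (D * s - n' * v) / (s * (s * Q))"
      if "s \<noteq> 0" "Q \<noteq> 0" for D s Q n' :: complex
      using that by (simp add: divide_simps power2_eq_square) (simp add: algebra_simps)
    have "(u - x) ^ k = (u - x) * (u - x) ^ n" "(u - x) ^ (k - 1) = (u - x) ^ n"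
      "(u - x) ^ (k + 1) = (u - x) * ((u - x) * (u - x) ^ n)" by (simp_all add: n)
    note e = this
    show ?thesis unfolding e by (rule alg) (use nz in auto)
  qed
  ultimately show ?thesis by simp
qed

text \<open>The next two lemmas come from \<open>d (v / (u - x))\<close> and \<open>d (v / (u - x)\<^sup>2)\<close>.\<close>

lemma period_relation_1:
  assumes c: "surface_loop x c"
  shows "loop_period (basic_form 0 1) c = x * loop_period (power_form 0 x) c + x * (x - 1) * loop_period (power_form 1 x) c"
proof -
  let ?g = "\<lambda>P. 1 * basic_form 0 1 P + (- x) * power_form 0 x P"
  let ?f = "\<lambda>P. (- (x * (x - 1)) / 2) * power_form 1 x P + (1 / 2) * ?g P"
  have "loop_period ?f c = 0"
  proof (rule loop_period_exact[OF c])
    fix P assume P: "P \<in> unramified x"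
    obtain u v where uv: "P = (u, v)" by (cases P)
    define s where "s = u - x"
    have u: "u = s + x" by (simp add: s_def)
    have v: "v\<^sup>2 = cubic x u" "v \<noteq> 0" "s \<noteq> 0"
      using P uv unramified_iff unramified_iff' by (auto simp: s_def)
    \<comment> \<open>Writing \<open>v\<close> as \<open>cubic x u / v\<close> turns every term into
      a multiple of \<open>1 / v\<close>, so that the exact form can be expanded in powers of
      \<open>s = u - x\<close>.\<close>
    have vv: "v = (s + x) * (s + x - 1) * s / v"
      using v by (simp add: u nonzero_eq_divide_eq power2_eq_square)
    have "((3 * u\<^sup>2 - 2 * (1 + x) * u + x) / (2 * v) * (u - x) - of_nat 1 * v) / (u - x) ^ (1 + 1)
      = ((3 * (s + x)\<^sup>2 - 2 * (1 + x) * (s + x) + x) / (2 * v) * s - (s + x) * (s + x - 1) * s / v) / s\<^sup>2"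
      unfolding vv[symmetric] by (simp add: u power2_eq_square)
    also have "\<dots> = ?f P"
      unfolding uv power_form_def basic_form_def u fst_conv snd_conv using v
      by (simp add: divide_simps) (simp add: algebra_simps power2_eq_square)
    finally show "curve_deriv x (\<lambda>P. snd P / (fst P - x) ^ 1) (?f P) P"
      using curve_deriv_quotient_power[of u v x 1] P uv by simp
  qed
  then have "0 = (- (x * (x - 1)) / 2) * loop_period (power_form 1 x) c +
      (1 / 2) * (1 * loop_period (basic_form 0 1) c + (- x) * loop_period (power_form 0 x) c)"
    by (subst (asm) loop_period_lincomb(1)[OF curve_form_power curve_form_lincomb[OF curve_form_basic curve_form_power] c],
        subst (asm) loop_period_lincomb(1)[OF curve_form_basic curve_form_power c]) (rule sym)
  moreover have "p = x * i0 + x * (x - 1) * i1"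
    if "0 = (- (x * (x - 1)) / 2) * i1 + (1 / 2) * (1 * p + (- x) * i0)" for p i0 i1
  proof -
    have "p - (x * i0 + x * (x - 1) * i1) = 2 * ((- (x * (x - 1)) / 2) * i1 + (1 / 2) * (1 * p + (- x) * i0))"
      by (simp add: field_simps)
    then show ?thesis unfolding that[symmetric] by simp
  qed
  ultimately show ?thesis by blast
qed

lemma period_relation_2:
  assumes c: "surface_loop x c"
  shows "3 / 2 * x * (x - 1) * loop_period (power_form 2 x) c + (2 * x - 1) * loop_period (power_form 1 x) c
    + 1 / 2 * loop_period (power_form 0 x) c = 0"
proof -
  let ?g = "\<lambda>P. (- (2 * x - 1)) * power_form 1 x P + (- 1 / 2) * power_form 0 x P"
  let ?f = "\<lambda>P. (- (3 / 2 * x * (x - 1))) * power_form 2 x P + 1 * ?g P"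
  have "loop_period ?f c = 0"
  proof (rule loop_period_exact[OF c])
    fix P assume P: "P \<in> unramified x"
    obtain u v where uv: "P = (u, v)" by (cases P)
    define s where "s = u - x"
    have u: "u = s + x" by (simp add: s_def)
    have v: "v\<^sup>2 = cubic x u" "v \<noteq> 0" "s \<noteq> 0"
      using P uv unramified_iff unramified_iff' by (auto simp: s_def)
    have vv: "v = (s + x) * (s + x - 1) * s / v"
      using v by (simp add: u nonzero_eq_divide_eq power2_eq_square)
    have "((3 * u\<^sup>2 - 2 * (1 + x) * u + x) / (2 * v) * (u - x) - of_nat 2 * v) / (u - x) ^ (2 + 1)
      = ((3 * (s + x)\<^sup>2 - 2 * (1 + x) * (s + x) + x) / (2 * v) * s - 2 * ((s + x) * (s + x - 1) * s / v)) / s ^ 3"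
      unfolding vv[symmetric] by (simp add: u)
    also have "\<dots> = ?f P"
      unfolding uv power_form_def basic_form_def u fst_conv snd_conv using v
      by (simp add: divide_simps) (simp add: algebra_simps power2_eq_square power3_eq_cube)
    finally show "curve_deriv x (\<lambda>P. snd P / (fst P - x) ^ 2) (?f P) P"
      using curve_deriv_quotient_power[of u v x 2] P uv by simp
  qed
  moreover have "loop_period ?f c = (- (3 / 2 * x * (x - 1))) * loop_period (power_form 2 x) c +
      1 * ((- (2 * x - 1)) * loop_period (power_form 1 x) c + (- 1 / 2) * loop_period (power_form 0 x) c)"
    by (subst loop_period_lincomb(1)[OF curve_form_power curve_form_lincomb[OF curve_form_power curve_form_power] c],
        subst loop_period_lincomb(1)[OF curve_form_power curve_form_power c], rule refl)
  ultimately show ?thesis by (simp add: algebra_simps)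
qed

context loop_family
begin

abbreviation per :: "nat \<Rightarrow> complex \<Rightarrow> complex" where
  "per j x \<equiv> loop_period (power_form j x) (c x)"

lemma per_deriv_0: "x \<in> X \<Longrightarrow> (per 0 has_field_derivative per 1 x / 2) (at x)"
  using loop_period_deriv[of x 0] by simp

lemma per_deriv_1: "x \<in> X \<Longrightarrow> (per 1 has_field_derivative 3 / 2 * per 2 x) (at x)"
  using loop_period_deriv[of x 1] by (simp add: numeral_2_eq_2)

text \<open>Here \<open>per 1 x / 2\<close> and \<open>3 / 4 * per 2 x\<close> are the first two
  derivatives of \<open>per 0\<close>. The relation is the hypergeometric equation of the complete
  elliptic integral, and half of \<open>period_relation_2\<close>.\<close>

lemma picard_fuchs:
  assumes "x \<in> X"
  shows "x * (x - 1) * (3 / 4 * per 2 x) + (2 * x - 1) * (per 1 x / 2) + per 0 x / 4 = 0"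
proof -
  have "x * (x - 1) * (3 / 4 * per 2 x) + (2 * x - 1) * (per 1 x / 2) + per 0 x / 4 =
    1 / 2 * (3 / 2 * x * (x - 1) * per 2 x + (2 * x - 1) * per 1 x + 1 / 2 * per 0 x)"
  proof -
    have "y * (3 / 4 * p2) + z * (p1 / 2) + p0 / 4 = 1 / 2 * (3 / 2 * y * p2 + z * p1 + 1 / 2 * p0)"
      for y z p0 p1 p2 :: complex by (simp add: field_simps)
    then show ?thesis by (simp add: mult.assoc)
  qed
  then show ?thesis unfolding period_relation_2[OF loop[OF assms]] by simp
qed

end

text \<open>By \<open>period_relation_1\<close> the expression is
  \<open>x * (x - 1) * (A * per 1 b - B * per 1 a)\<close>, with A and B the periods of
  \<open>du / v\<close>. As \<open>per 1\<close> is twice the derivative of \<open>per 0\<close>,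
  this is \<open>2 * x * (x - 1)\<close> times the Wronskian of A and B, which the Picard-Fuchs
  equation makes constant by Abel's identity.\<close>

lemma legendre_constant:
  assumes a: "loop_family X a" and b: "loop_family X b" and con: "connected X"
  obtains K where "\<And>x. x \<in> X \<Longrightarrow> loop_period (power_form 0 x) (a x) * loop_period (basic_form 0 1) (b x)
    - loop_period (power_form 0 x) (b x) * loop_period (basic_form 0 1) (a x) = K"
proof -
  interpret a: loop_family X a by (rule a)
  interpret b: loop_family X b by (rule b)
  \<comment> \<open>This is the expression with \<open>u du / v\<close> already eliminated; the
    derivative of \<open>w\<close> is a combination of the two instances of
    \<open>period_relation_2\<close>.\<close>
  define w where "w x = x * (x - 1) * (a.per 0 x * b.per 1 x - b.per 0 x * a.per 1 x)" for x
  have "(w has_field_derivative 0) (at x)" if x: "x \<in> X" for x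
  proof -
    have "(w has_field_derivative ((2 * x - 1) * (a.per 0 x * b.per 1 x - b.per 0 x * a.per 1 x) +
        x * (x - 1) * ((a.per 1 x / 2 * b.per 1 x + a.per 0 x * (3 / 2 * b.per 2 x)) -
        (b.per 1 x / 2 * a.per 1 x + b.per 0 x * (3 / 2 * a.per 2 x))))) (at x)"
      unfolding w_def
      by (rule derivative_eq_intros a.per_deriv_0[OF x] a.per_deriv_1[OF x] b.per_deriv_0[OF x] b.per_deriv_1[OF x] refl)+
         (simp add: algebra_simps)
    moreover have "(2 * x - 1) * (a.per 0 x * b.per 1 x - b.per 0 x * a.per 1 x) +
        x * (x - 1) * ((a.per 1 x / 2 * b.per 1 x + a.per 0 x * (3 / 2 * b.per 2 x)) -
        (b.per 1 x / 2 * a.per 1 x + b.per 0 x * (3 / 2 * a.per 2 x))) =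
        a.per 0 x * (3 / 2 * x * (x - 1) * b.per 2 x + (2 * x - 1) * b.per 1 x + 1 / 2 * b.per 0 x)
        - b.per 0 x * (3 / 2 * x * (x - 1) * a.per 2 x + (2 * x - 1) * a.per 1 x + 1 / 2 * a.per 0 x)"
      by (simp add: algebra_simps)
    ultimately show ?thesis
      using period_relation_2[OF a.loop[OF x]] period_relation_2[OF b.loop[OF x]] by simp
  qed
  then have "w constant_on X"
    by (rule has_field_derivative_0_imp_constant_on[OF _ con a.X(1)])
  then obtain K where K: "\<And>x. x \<in> X \<Longrightarrow> w x = K" by (auto simp: constant_on_def)
  show ?thesis
  proof (rule that[of K])
    fix x assume x: "x \<in> X"
    have "loop_period (power_form 0 x) (a x) * loop_period (basic_form 0 1) (b x)
      - loop_period (power_form 0 x) (b x) * loop_period (basic_form 0 1) (a x) = w x"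
      unfolding period_relation_1[OF a.loop[OF x]] period_relation_1[OF b.loop[OF x]] w_def
      by (simp add: algebra_simps)
    then show "loop_period (power_form 0 x) (a x) * loop_period (basic_form 0 1) (b x)
      - loop_period (power_form 0 x) (b x) * loop_period (basic_form 0 1) (a x) = K"
      using K[OF x] by simp
  qed
qed

section \<open>Functions on the curve\<close>

text \<open>Chain rule \<open>dk = D du\<close> and \<open>du = d dt\<close>; it transports
  derivatives to charts at branch points and infinity, where \<open>u\<close> is not the
  parameter.\<close>

lemma curve_deriv_param:
  assumes k: "curve_deriv x k D (\<phi> t)"
    and f: "((\<lambda>t. fst (\<phi> t)) has_field_derivative d) (at t)"
    and s: "((\<lambda>t. snd (\<phi> t)) has_field_derivative d') (at t)"
    and ev: "\<forall>\<^sub>F s in nhds t. \<phi> s \<in> affine_curve x"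
  shows "((\<lambda>t. k (\<phi> t)) has_field_derivative D * d) (at t)"
proof -
  obtain S where S: "open S" "t \<in> S" "\<And>s. s \<in> S \<Longrightarrow> \<phi> s \<in> affine_curve x"
    using ev by (auto simp: eventually_nhds)
  have "((\<lambda>t. (fst (\<phi> t), snd (\<phi> t))) has_derivative (\<lambda>h. (d * h, d' * h))) (at t within S)"
    by (intro has_derivative_Pair has_derivative_at_withinI[OF f[unfolded has_field_derivative_def]]
        has_derivative_at_withinI[OF s[unfolded has_field_derivative_def]])
  then have "(\<phi> has_derivative (\<lambda>h. (d * h, d' * h))) (at t within S)" by simp
  moreover have "(k has_derivative (\<lambda>h. D * fst h)) (at (\<phi> t) within \<phi> ` S)"
    by (rule has_derivative_subset[OF k[unfolded curve_deriv_def]]) (use S(3) in auto)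
  ultimately have "((\<lambda>t. k (\<phi> t)) has_derivative (\<lambda>h. D * fst (d * h, d' * h))) (at t within S)"
    by (rule has_derivative_in_compose)
  moreover have "(\<lambda>h. D * fst (d * h, d' * h)) = (*) (D * d)" by (auto simp: fun_eq_iff)
  ultimately show ?thesis
    unfolding has_field_derivative_def at_within_open[OF S(2,1)] by simp
qed

text \<open>Exchanging the sheets preserves the curve and leaves \<open>u\<close>, hence
  \<open>du\<close>, unchanged, so the coefficient carries over.\<close>

lemma curve_deriv_involution:
  assumes "curve_deriv x k D (u, - v)"
  shows "curve_deriv x (\<lambda>P. k (fst P, - snd P)) D (u, v)"
proof -
  let ?J = "\<lambda>P :: complex \<times> complex. (fst P, - snd P)"
  have "(?J has_derivative (\<lambda>h. (fst h, - snd h))) (at (u, v) within affine_curve x)"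
    by (auto intro!: derivative_eq_intros)
  moreover have "?J ` affine_curve x \<subseteq> affine_curve x"
    by (auto simp: affine_curve_def)
  then have "(k has_derivative (\<lambda>h. D * fst h)) (at (?J (u, v)) within ?J ` affine_curve x)"
    using has_derivative_subset[OF assms[unfolded curve_deriv_def]] by simp
  ultimately have "((\<lambda>P. k (?J P)) has_derivative (\<lambda>h. D * fst (fst h, - snd h))) (at (u, v) within affine_curve x)"
    by (rule has_derivative_in_compose)
  then show ?thesis by (simp add: curve_deriv_def)
qed

lemma unramified_involution: "(u, - v) \<in> unramified x \<longleftrightarrow> (u, v) \<in> unramified x"
  by (simp add: unramified_iff)

text \<open>Boundedness makes the singularities in \<open>S\<close> removable, and Liouville's
  theorem with polynomial growth applies to the entire extension.\<close>

lemma entire_polynomial_bound: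
  fixes F :: "complex \<Rightarrow> complex"
  assumes S: "finite S" and F: "\<And>u. u \<notin> S \<Longrightarrow> F field_differentiable at u"
    and bnd: "\<And>e. e \<in> S \<Longrightarrow> \<exists>B r. r > 0 \<and> (\<forall>u. u \<notin> S \<longrightarrow> norm (u - e) < r \<longrightarrow> norm (F u) \<le> B)"
    and inf: "\<And>u. u \<notin> S \<Longrightarrow> norm u > R \<Longrightarrow> norm (F u) \<le> C * norm u ^ n"
  obtains q where "\<And>u. u \<notin> S \<Longrightarrow> F u = (\<Sum>k\<le>n. q k * u ^ k)"
proof -
  have hol: "F holomorphic_on (UNIV - S)"
    using F by (auto simp: holomorphic_on_def intro: field_differentiable_at_within)
  have "F \<in> O[at e](\<lambda>_. 1)" if e: "e \<in> S" for e
  proof -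
    obtain B r where B: "r > 0" "\<And>u. u \<notin> S \<Longrightarrow> norm (u - e) < r \<Longrightarrow> norm (F u) \<le> B"
      using bnd[OF e] by blast
    have "\<forall>\<^sub>F u in at e. u \<notin> S"
      using islimpt_finite[OF S] unfolding islimpt_iff_eventually by (auto simp: eventually_mono frequently_def)
    moreover have "\<forall>\<^sub>F u in at e. norm (u - e) < r"
      using B(1) by (auto simp: eventually_at dist_norm)
    ultimately have "\<forall>\<^sub>F u in at e. norm (F u) \<le> B * norm (1 :: complex)"
      by eventually_elim (use B(2) in auto)
    then show ?thesis by (rule bigoI)
  qed
  then obtain G where G: "G holomorphic_on UNIV" "\<And>u. u \<in> UNIV - S \<Longrightarrow> G u = F u"
    using removable_singularities[OF S _ hol] by auto
  obtain M where M: "\<And>s. s \<in> S \<Longrightarrow> norm s \<le> M"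
    using finite_imp_bounded[OF S] unfolding bounded_iff by blast
  have "norm (G u) \<le> C * norm u ^ n" if u: "max R M + 1 \<le> norm u" for u
  proof -
    have "R < norm u" "M < norm u" using u by auto
    then have "u \<notin> S" using M by force
    then show ?thesis using inf[of u] G(2)[of u] \<open>R < norm u\<close> by simp
  qed
  from Liouville_polynomial[OF G(1) this]
  have "G u = (\<Sum>k\<le>n. (deriv ^^ k) G 0 / fact k * u ^ k)" for u .
  then show ?thesis
    using that[of "\<lambda>k. (deriv ^^ k) G 0 / fact k"] G(2) by auto
qed

lemma norm_cubic_le:
  assumes "norm u \<ge> 1" "norm u \<ge> norm x"
  shows "norm (cubic x u) \<le> 4 * norm u ^ 3"
proof -
  have "norm (u - 1) \<le> 2 * norm u" using norm_triangle_ineq4[of u 1] assms by simp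
  moreover have "norm (u - x) \<le> 2 * norm u" using norm_triangle_ineq4[of u x] assms by simp
  ultimately have "norm u * norm (u - 1) * norm (u - x) \<le> norm u * (2 * norm u) * (2 * norm u)"
    by (intro mult_mono) auto
  then show ?thesis by (simp add: norm_mult power3_eq_cube)
qed

text \<open>The true order is \<open>3 / 2\<close>; rounding it up to 2 keeps the exponents integral
  and is good enough for the Liouville arguments.\<close>

lemma norm_snd_le:
  assumes "(u, v) \<in> affine_curve x" "norm u \<ge> 1" "norm u \<ge> norm x"
  shows "norm v \<le> 2 * norm u ^ 2"
proof -
  have "(norm v)\<^sup>2 \<le> 4 * norm u ^ 3"
    using norm_cubic_le[OF assms(2,3)] assms(1) by (simp add: affine_curve_iff norm_power[symmetric])
  also have "\<dots> \<le> 4 * norm u ^ 4" using assms(2) by (simp add: power_increasing)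
  also have "\<dots> = (2 * norm u ^ 2)\<^sup>2" by (simp add: power_mult_distrib power_mult[symmetric])
  finally show ?thesis by (rule power2_le_imp_le) simp
qed

text \<open>\<open>h\<close> descends to the plane if it is invariant under the covering involution; the values are
  computed with an arbitrary square root.\<close>

lemma plane_function_differentiable:
  assumes S: "finite S" "{0, 1, x} \<subseteq> S"
    and even: "\<And>u v. (u, v) \<in> unramified x \<Longrightarrow> u \<notin> S \<Longrightarrow> h (u, - v) = h (u, v)"
    and hol: "\<And>u v. (u, v) \<in> unramified x \<Longrightarrow> u \<notin> S \<Longrightarrow> \<exists>D. curve_deriv x h D (u, v)"
    and u0: "u0 \<notin> S"
  shows "(\<lambda>u. h (u, csqrt (cubic x u))) field_differentiable at u0"
proof -
  define v0 where "v0 = csqrt (cubic x u0)"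
  have un: "(u0, v0) \<in> unramified x" using u0 S(2) by (auto simp: unramified_iff' v0_def)
  obtain \<rho> w where w: "\<rho> > 0" "w holomorphic_on ball u0 \<rho>" "w u0 = v0"
    "\<And>u. u \<in> ball u0 \<rho> \<Longrightarrow> (w u)\<^sup>2 = cubic x u" "\<And>u. u \<in> ball u0 \<rho> \<Longrightarrow> w u \<noteq> 0"
    by (rule unramified_nbhd[OF un]) blast
  obtain D where D: "curve_deriv x h D (u0, w u0)" using hol[OF un u0] w(3) by auto
  have op: "open (- S)" using S(1) by (simp add: finite_imp_closed open_Compl)
  have "(w has_field_derivative deriv w u0) (at u0)"
    using w(1,2) by (meson centre_in_ball holomorphic_derivI open_ball)
  moreover have "\<forall>\<^sub>F u in nhds u0. (u, w u) \<in> affine_curve x"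
    using eventually_nhds_ball[OF w(1), of u0] by eventually_elim (auto simp: affine_curve_iff w(4))
  ultimately have "((\<lambda>u. h (u, w u)) has_field_derivative D) (at u0)"
    using D by (intro curve_deriv_branch)
  then have "((\<lambda>u. h (u, csqrt (cubic x u))) has_field_derivative D) (at u0)"
  proof (rule has_field_derivative_transform_within_open)
    show "open (ball u0 \<rho> \<inter> - S)" using op by blast
    show "u0 \<in> ball u0 \<rho> \<inter> - S" using w(1) u0 by simp
    fix u assume u: "u \<in> ball u0 \<rho> \<inter> - S"
    then have wu: "(u, w u) \<in> unramified x" using w(4,5)[of u] by (simp add: unramified_iff)
    have "(w u)\<^sup>2 = (csqrt (cubic x u))\<^sup>2" using w(4)[of u] u by simp
    \<comment> \<open>The principal square root may lie on either sheet and jump between them near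
      \<open>u0\<close>; evenness of \<open>h\<close> makes the choice irrelevant.\<close>
    then have "csqrt (cubic x u) = w u \<or> csqrt (cubic x u) = - w u" by (metis power2_eq_iff minus_minus)
    then show "h (u, w u) = h (u, csqrt (cubic x u))" using even[OF wu] u by auto
  qed
  then show ?thesis by (auto simp: field_differentiable_def)
qed

lemma quadratic_zero:
  fixes q :: "nat \<Rightarrow> complex"
  assumes "x \<notin> {0, 1}" and "\<And>e. e \<in> {0, 1, x} \<Longrightarrow> (\<Sum>k\<le>2. q k * e ^ k) = 0"
  shows "(\<Sum>k\<le>2. q k * u ^ k) = 0"
proof -
  have s: "(\<Sum>k\<le>2. q k * e ^ k) = q 0 + q 1 * e + q 2 * e\<^sup>2" for e
    by (simp add: numeral_2_eq_2)
  have 0: "q 0 = 0" using assms(2)[of 0] unfolding s by simp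
  have 1: "q 1 = - q 2" using assms(2)[of 1] 0 unfolding s by (simp add: eq_neg_iff_add_eq_0)
  have "q 2 * (x * (x - 1)) = 0" using assms(2)[of x] 0 1 unfolding s by (simp add: algebra_simps power2_eq_square)
  then have "q 2 = 0" using assms(1) by auto
  then show ?thesis using 0 1 unfolding s by simp
qed

text \<open>An odd function \<open>h\<close> with these bounds makes \<open>h v\<close> a polynomial of degree at most two in
  \<open>u\<close> that vanishes at the three finite branch points.\<close>

lemma odd_function_zero:
  assumes x: "x \<notin> {0, 1}" and S: "finite S" "{0, 1, x} \<subseteq> S"
    and odd: "\<And>u v. (u, v) \<in> unramified x \<Longrightarrow> u \<notin> S \<Longrightarrow> h (u, - v) = - h (u, v)"
    and hol: "\<And>u v. (u, v) \<in> unramified x \<Longrightarrow> u \<notin> S \<Longrightarrow> \<exists>D. curve_deriv x h D (u, v)"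
    and bnd: "\<And>e. e \<in> S \<Longrightarrow> \<exists>B r. r > 0 \<and>
      (\<forall>u v. (u, v) \<in> unramified x \<longrightarrow> u \<notin> S \<longrightarrow> norm (u - e) < r \<longrightarrow> norm (h (u, v)) \<le> B)"
    and inf: "\<And>u v. (u, v) \<in> unramified x \<Longrightarrow> u \<notin> S \<Longrightarrow> norm u > R \<Longrightarrow> norm (h (u, v) * v) \<le> C * norm u ^ 2"
    and uv: "(u, v) \<in> unramified x" "u \<notin> S"
  shows "h (u, v) = 0"
proof -
  define F where "F u = h (u, csqrt (cubic x u)) * csqrt (cubic x u)" for u
  have un: "(u, csqrt (cubic x u)) \<in> unramified x" if "u \<notin> S" for u
    using that S(2) by (auto simp: unramified_iff')
  have cub: "\<exists>B r. r > 0 \<and> (\<forall>u. norm (u - e) < r \<longrightarrow> norm (csqrt (cubic x u)) \<le> B)" for e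
  proof -
    have "continuous_on (cball e 1) (\<lambda>u. cubic x u)" by (intro continuous_intros)
    then have "bounded ((\<lambda>u. cubic x u) ` cball e 1)"
      using compact_continuous_image compact_cball compact_imp_bounded by blast
    then obtain B where B: "\<And>u. u \<in> cball e 1 \<Longrightarrow> norm (cubic x u) \<le> B" unfolding bounded_iff by blast
    have "norm (csqrt (cubic x u)) \<le> sqrt B" if "norm (u - e) < 1" for u
      using B[of u] that by (simp add: dist_norm norm_minus_commute)
    then show ?thesis by (intro exI[of _ "sqrt B"] exI[of _ 1]) auto
  qed
  obtain q where q: "\<And>u. u \<notin> S \<Longrightarrow> F u = (\<Sum>k\<le>2. q k * u ^ k)"
  proof (rule entire_polynomial_bound[OF S(1), of F R C 2])
    fix u assume u: "u \<notin> S"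
    have "(\<lambda>u. (\<lambda>P. h P * snd P) (u, csqrt (cubic x u))) field_differentiable at u"
    proof (rule plane_function_differentiable[OF S _ _ u])
      fix u v assume uv: "(u, v) \<in> unramified x" "u \<notin> S"
      show "h (u, - v) * snd (u, - v) = h (u, v) * snd (u, v)" using odd[OF uv] by simp
      obtain D where "curve_deriv x h D (u, v)" using hol[OF uv] by blast
      from curve_deriv_mult[OF this curve_deriv_snd[OF uv(1)]]
      show "\<exists>D. curve_deriv x (\<lambda>P. h P * snd P) D (u, v)" by blast
    qed
    then show "F field_differentiable at u" by (simp add: F_def[abs_def])
  next
    fix e assume e: "e \<in> S"
    obtain B r where B: "r > 0" "\<And>u v. (u, v) \<in> unramified x \<Longrightarrow> u \<notin> S \<Longrightarrow> norm (u - e) < r \<Longrightarrow> norm (h (u, v)) \<le> B"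
      using bnd[OF e] by blast
    obtain B' r' where B': "r' > 0" "\<And>u. norm (u - e) < r' \<Longrightarrow> norm (csqrt (cubic x u)) \<le> B'"
      using cub[of e] by blast
    have "norm (F u) \<le> \<bar>B\<bar> * \<bar>B'\<bar>" if u: "u \<notin> S" "norm (u - e) < min r r'" for u
      unfolding F_def norm_mult using B(2)[OF un[OF u(1)] u(1)] B'(2)[of u] u(2)
      by (intro mult_mono) auto
    then show "\<exists>B r. r > 0 \<and> (\<forall>u. u \<notin> S \<longrightarrow> norm (u - e) < r \<longrightarrow> norm (F u) \<le> B)"
      using B(1) B'(1) by (intro exI[of _ "\<bar>B\<bar> * \<bar>B'\<bar>"] exI[of _ "min r r'"]) auto
  next
    fix u assume "u \<notin> S" "norm u > R"
    then show "norm (F u) \<le> C * norm u ^ 2"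
      unfolding F_def by (intro inf un)
  qed blast
  \<comment> \<open>Near \<open>e\<close> the function \<open>h\<close> is bounded while the square
    root of the cubic tends to 0, so the polynomial vanishes at \<open>e\<close>.\<close>
  have zero: "(\<Sum>k\<le>2. q k * e ^ k) = 0" if e: "e \<in> {0, 1, x}" for e
  proof -
    have eS: "e \<in> S" using e S(2) by blast
    obtain B r where B: "r > 0" "\<And>u v. (u, v) \<in> unramified x \<Longrightarrow> u \<notin> S \<Longrightarrow> norm (u - e) < r \<Longrightarrow> norm (h (u, v)) \<le> B"
      using bnd[OF eS] by blast
    have ev: "\<forall>\<^sub>F u in at e. u \<notin> S"
      using islimpt_finite[OF S(1)] unfolding islimpt_iff_eventually by (auto simp: eventually_mono frequently_def)
    have ev2: "\<forall>\<^sub>F u in at e. norm (u - e) < r"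
      using B(1) by (auto simp: eventually_at dist_norm)
    have "((\<lambda>u. \<bar>B\<bar> * sqrt (norm (cubic x u))) \<longlongrightarrow> \<bar>B\<bar> * sqrt (norm (cubic x e))) (at e)"
      by (intro tendsto_intros)
    then have lim: "((\<lambda>u. \<bar>B\<bar> * sqrt (norm (cubic x u))) \<longlongrightarrow> 0) (at e)" using e by auto
    have "\<forall>\<^sub>F u in at e. norm (\<Sum>k\<le>2. q k * u ^ k) \<le> \<bar>B\<bar> * sqrt (norm (cubic x u))"
      using ev ev2
    proof eventually_elim
      case (elim u)
      have "norm (h (u, csqrt (cubic x u))) \<le> \<bar>B\<bar>" using B(2)[OF un[OF elim(1)] elim] by simp
      then have "norm (F u) \<le> \<bar>B\<bar> * sqrt (norm (cubic x u))"
        unfolding F_def norm_mult norm_csqrt by (intro mult_right_mono) auto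
      then show ?case using q[OF elim(1)] by simp
    qed
    from Lim_null_comparison[OF this lim] have "((\<lambda>u. \<Sum>k\<le>2. q k * u ^ k) \<longlongrightarrow> 0) (at e)" .
    moreover have "((\<lambda>u. \<Sum>k\<le>2. q k * u ^ k) \<longlongrightarrow> (\<Sum>k\<le>2. q k * e ^ k)) (at e)"
      by (intro tendsto_intros)
    ultimately show ?thesis using tendsto_unique[of "at e"] by (simp add: trivial_limit_at)
  qed
  have "F u = 0" using q[OF uv(2)] quadratic_zero[OF x zero] by simp
  moreover have "csqrt (cubic x u) \<noteq> 0" using un[OF uv(2)] by (simp add: unramified_iff)
  ultimately have h0: "h (u, csqrt (cubic x u)) = 0" by (simp add: F_def)
  have "v\<^sup>2 = (csqrt (cubic x u))\<^sup>2" using uv(1) by (simp add: unramified_iff)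
  then have "v = csqrt (cubic x u) \<or> v = - csqrt (cubic x u)" by (rule power2_eq_iff[THEN iffD1])
  then show ?thesis using h0 odd[OF un[OF uv(2)] uv(2)] by auto
qed

text \<open>Liouville's theorem on the compact surface, reduced to the plane by splitting
  \<open>h\<close> under the exchange of sheets. The odd part vanishes by
  \<open>odd_function_zero\<close>; the even part is a bounded function of \<open>u\<close> with
  removable singularities.\<close>

lemma bounded_function_constant:
  assumes x: "x \<notin> {0, 1}" and S: "finite S" "{0, 1, x} \<subseteq> S"
    and hol: "\<And>u v. (u, v) \<in> unramified x \<Longrightarrow> u \<notin> S \<Longrightarrow> \<exists>D. curve_deriv x h D (u, v)"
    and bnd: "\<And>e. e \<in> S \<Longrightarrow> \<exists>B r. r > 0 \<and>
      (\<forall>u v. (u, v) \<in> unramified x \<longrightarrow> u \<notin> S \<longrightarrow> norm (u - e) < r \<longrightarrow> norm (h (u, v)) \<le> B)"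
    and inf: "\<And>u v. (u, v) \<in> unramified x \<Longrightarrow> u \<notin> S \<Longrightarrow> norm u > R \<Longrightarrow> norm (h (u, v)) \<le> C"
  obtains k where "\<And>u v. (u, v) \<in> unramified x \<Longrightarrow> u \<notin> S \<Longrightarrow> h (u, v) = k"
proof -
  define o' where "o' P = h P - h (fst P, - snd P)" for P
  define e' where "e' P = h P + h (fst P, - snd P)" for P
  have hol': "\<exists>D. curve_deriv x (\<lambda>P. h (fst P, - snd P)) D (u, v)" if "(u, v) \<in> unramified x" "u \<notin> S" for u v
    using hol[of u "- v"] that curve_deriv_involution unramified_involution by blast
  have oh: "\<exists>D. curve_deriv x o' D (u, v)" if "(u, v) \<in> unramified x" "u \<notin> S" for u v
    using curve_deriv_diff hol[OF that] hol'[OF that] unfolding o'_def[abs_def] by blast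
  have eh: "\<exists>D. curve_deriv x e' D (u, v)" if "(u, v) \<in> unramified x" "u \<notin> S" for u v
    using curve_deriv_add hol[OF that] hol'[OF that] unfolding e'_def[abs_def] by blast
  have le: "norm (o' (u, v)) \<le> 2 * B \<and> norm (e' (u, v)) \<le> 2 * B"
    if "norm (h (u, v)) \<le> B" "norm (h (u, - v)) \<le> B" for u v B
    using norm_triangle_ineq4[of "h (u, v)" "h (u, - v)"] norm_triangle_ineq[of "h (u, v)" "h (u, - v)"] that
    by (simp add: o'_def e'_def)
  have near: "\<exists>B r. r > 0 \<and> (\<forall>u v. (u, v) \<in> unramified x \<longrightarrow> u \<notin> S \<longrightarrow> norm (u - e) < r \<longrightarrow>
      norm (o' (u, v)) \<le> B \<and> norm (e' (u, v)) \<le> B)" if e: "e \<in> S" for e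
  proof -
    obtain B r where B: "r > 0" "\<And>u v. (u, v) \<in> unramified x \<Longrightarrow> u \<notin> S \<Longrightarrow> norm (u - e) < r \<Longrightarrow> norm (h (u, v)) \<le> B"
      using bnd[OF e] by blast
    show ?thesis
      by (intro exI[of _ "2 * B"] exI[of _ r] conjI B(1) allI impI le[THEN conjunct1] le[THEN conjunct2] B(2))
         (simp_all add: unramified_involution)
  qed
  have o0: "o' (u, v) = 0" if "(u, v) \<in> unramified x" "u \<notin> S" for u v
  \<comment> \<open>The odd part is bounded by \<open>2 * \<bar>C\<bar>\<close>; the other factor 2
    comes from \<open>norm v \<le> 2 * norm u ^ 2\<close>.\<close>
  proof (rule odd_function_zero[OF x S _ _ _ _ that, of o' "max R (max 1 (norm x))" "2 * (2 * \<bar>C\<bar>)"])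
    fix u v assume uv: "(u, v) \<in> unramified x" "u \<notin> S"
    show "o' (u, - v) = - o' (u, v)" by (simp add: o'_def)
    show "\<exists>D. curve_deriv x o' D (u, v)" using oh[OF uv] .
    assume R: "max R (max 1 (norm x)) < norm u"
    have "norm (h (u, v)) \<le> \<bar>C\<bar>" "norm (h (u, - v)) \<le> \<bar>C\<bar>"
      using inf[of u v] inf[of u "- v"] uv R unramified_involution by fastforce+
    then have "norm (o' (u, v)) \<le> 2 * \<bar>C\<bar>" using le by blast
    moreover have "norm v \<le> 2 * norm u ^ 2"
      using uv(1) unramified_subset R by (intro norm_snd_le[of u v x]) auto
    ultimately have "norm (o' (u, v)) * norm v \<le> (2 * \<bar>C\<bar>) * (2 * norm u ^ 2)"
      by (intro mult_mono) auto
    then show "norm (o' (u, v) * v) \<le> 2 * (2 * \<bar>C\<bar>) * norm u ^ 2" by (simp add: norm_mult)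
  next
    fix e assume "e \<in> S"
    then show "\<exists>B r. r > 0 \<and> (\<forall>u v. (u, v) \<in> unramified x \<longrightarrow> u \<notin> S \<longrightarrow> norm (u - e) < r \<longrightarrow> norm (o' (u, v)) \<le> B)"
      using near by meson
  qed
  define F where "F u = e' (u, csqrt (cubic x u))" for u
  have un: "(u, csqrt (cubic x u)) \<in> unramified x" if "u \<notin> S" for u
    using that S(2) by (auto simp: unramified_iff')
  have e'even: "e' (u, - v) = e' (u, v)" for u v by (simp add: e'_def add.commute)
  obtain q where q: "\<And>u. u \<notin> S \<Longrightarrow> F u = (\<Sum>k\<le>0. q k * u ^ k)"
  proof (rule entire_polynomial_bound[OF S(1), of F R "2 * C" 0])
    fix u assume "u \<notin> S"
    then show "F field_differentiable at u"
      unfolding F_def[abs_def] by (intro plane_function_differentiable[OF S] e'even eh)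
  next
    fix e assume e: "e \<in> S"
    then obtain B r where "r > 0" "\<forall>u v. (u, v) \<in> unramified x \<longrightarrow> u \<notin> S \<longrightarrow> norm (u - e) < r \<longrightarrow>
        norm (o' (u, v)) \<le> B \<and> norm (e' (u, v)) \<le> B" using near by blast
    then show "\<exists>B r. r > 0 \<and> (\<forall>u. u \<notin> S \<longrightarrow> norm (u - e) < r \<longrightarrow> norm (F u) \<le> B)"
      using un unfolding F_def by blast
  next
    fix u assume u: "u \<notin> S" "norm u > R"
    have "norm (F u) \<le> 2 * C"
      unfolding F_def using inf[OF un[OF u(1)] u] inf[of u "- csqrt (cubic x u)"] u un[OF u(1)] unramified_involution le by blast
    then show "norm (F u) \<le> 2 * C * norm u ^ 0" by simp
  qed blast
  have "h (u, v) = q 0 / 2" if uv: "(u, v) \<in> unramified x" "u \<notin> S" for u v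
  proof -
    have "v\<^sup>2 = (csqrt (cubic x u))\<^sup>2" using uv(1) by (simp add: unramified_iff)
    then have "v = csqrt (cubic x u) \<or> v = - csqrt (cubic x u)" by (rule power2_eq_iff[THEN iffD1])
    then have "e' (u, v) = F u" using e'even unfolding F_def by metis
    then have "e' (u, v) = q 0" using q[OF uv(2)] by simp
    moreover have "e' (u, v) = 2 * h (u, v)" using o0[OF uv] by (simp add: e'_def o'_def)
    ultimately show ?thesis by (metis nonzero_mult_div_cancel_left zero_neq_numeral)
  qed
  then show ?thesis using that by blast
qed

section \<open>Charts at the ramification points\<close>

text \<open>The inverse of the uniformizer \<open>t = v / m u\<close>, for which
  \<open>t\<^sup>2 = u - e\<close>.\<close>

definition ramified_chart :: "complex \<Rightarrow> (complex \<Rightarrow> complex) \<Rightarrow> complex \<Rightarrow> complex \<times> complex" where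
  "ramified_chart e m t = (e + t\<^sup>2, t * m (e + t\<^sup>2))"

text \<open>The inverse of the uniformizer \<open>t = u * m (1 / u) / v\<close>, for which
  \<open>t\<^sup>2 = 1 / u\<close>.\<close>

definition infinity_chart_map :: "(complex \<Rightarrow> complex) \<Rightarrow> complex \<Rightarrow> complex \<times> complex" where
  "infinity_chart_map m t = (1 / t\<^sup>2, m (t\<^sup>2) / t ^ 3)"

lemma norm_less_sqrt: "norm (t :: complex) < sqrt r \<longleftrightarrow> norm t ^ 2 < r"
  by (metis norm_ge_zero real_less_rsqrt real_sqrt_less_iff real_sqrt_unique)

lemma compact_norm_bound:
  fixes f :: "complex \<Rightarrow> complex"
  assumes "f holomorphic_on ball a r" "r' < r"
  obtains B where "\<And>z. norm (z - a) \<le> r' \<Longrightarrow> norm (f z) \<le> B"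
proof -
  have "continuous_on (cball a r') f"
    using assms by (intro holomorphic_on_imp_continuous_on) (auto elim!: holomorphic_on_subset)
  then have "bounded (f ` cball a r')"
    by (intro compact_imp_bounded compact_continuous_image compact_cball)
  then obtain B where B: "\<And>y. y \<in> f ` cball a r' \<Longrightarrow> norm y \<le> B" unfolding bounded_iff by blast
  show ?thesis
  proof (rule that)
    fix z assume "norm (z - a) \<le> r'"
    then have "f z \<in> f ` cball a r'" by (intro imageI) (simp add: dist_norm norm_minus_commute)
    then show "norm (f z) \<le> B" by (rule B)
  qed
qed

locale ramification_data =
  fixes x e :: complex and \<rho> :: real and m :: "complex \<Rightarrow> complex"
  assumes \<rho>: "\<rho> > 0" and e: "ball e \<rho> \<inter> {0, 1, x} = {e}" and m: "m holomorphic_on ball e \<rho>"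
    and nz: "\<And>u. u \<in> ball e \<rho> \<Longrightarrow> m u \<noteq> 0"
    and eq: "\<And>u. u \<in> ball e \<rho> \<Longrightarrow> (u - e) * (m u)\<^sup>2 = cubic x u"
begin

abbreviation "\<phi> \<equiv> ramified_chart e m"

lemma in_ball: "norm t ^ 2 < \<rho> \<Longrightarrow> e + t\<^sup>2 \<in> ball e \<rho>"
  by (simp add: dist_norm norm_power)

lemma chart_unramified:
  assumes "norm t ^ 2 < \<rho>" "t \<noteq> 0"
  shows "\<phi> t \<in> unramified x"
proof -
  note b = in_ball[OF assms(1)]
  have "t * m (e + t\<^sup>2) \<noteq> 0" using nz[OF b] assms(2) by simp
  moreover have "(t * m (e + t\<^sup>2))\<^sup>2 = cubic x (e + t\<^sup>2)"
    using eq[OF b] by (simp only: power_mult_distrib add_diff_cancel_left')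
  ultimately show ?thesis unfolding ramified_chart_def unramified_iff by blast
qed

lemma chart_onto:
  assumes "(u, v) \<in> unramified x" "norm (u - e) < \<rho>"
  obtains t where "t \<noteq> 0" "norm t ^ 2 = norm (u - e)" "\<phi> t = (u, v)"
proof -
  have b: "u \<in> ball e \<rho>" using assms(2) by (simp add: dist_norm norm_minus_commute)
  define t where "t = v / m u"
  have v: "v\<^sup>2 = cubic x u" "v \<noteq> 0" using assms(1) by (auto simp: unramified_iff)
  have t2: "t\<^sup>2 = u - e"
    unfolding t_def power_divide v(1) eq[OF b, symmetric] using nz[OF b] by simp
  then have "norm t ^ 2 = norm (u - e)" by (simp add: norm_power[symmetric])
  moreover have "\<phi> t = (u, v)" using t2 nz[OF b] by (simp add: ramified_chart_def t_def)
  moreover have "t \<noteq> 0" using v(2) nz[OF b] by (simp add: t_def)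
  ultimately show ?thesis using that by blast
qed

lemma chart_deriv:
  assumes "norm t ^ 2 < \<rho>"
  shows "((\<lambda>t. fst (\<phi> t)) has_field_derivative 2 * t) (at t)"
    and "\<exists>d. ((\<lambda>t. snd (\<phi> t)) has_field_derivative d) (at t)"
proof -
  show "((\<lambda>t. fst (\<phi> t)) has_field_derivative 2 * t) (at t)"
    unfolding ramified_chart_def by (auto intro!: derivative_eq_intros)
  have "(m has_field_derivative deriv m (e + t\<^sup>2)) (at (e + t\<^sup>2))"
    using m in_ball[OF assms] by (meson holomorphic_derivI open_ball)
  moreover have "((\<lambda>t. e + t\<^sup>2) has_field_derivative 2 * t) (at t)"
    by (auto intro!: derivative_eq_intros)
  ultimately have "((\<lambda>t. m (e + t\<^sup>2)) has_field_derivative deriv m (e + t\<^sup>2) * (2 * t)) (at t)"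
    by (rule DERIV_chain2)
  then show "\<exists>d. ((\<lambda>t. snd (\<phi> t)) has_field_derivative d) (at t)"
    unfolding ramified_chart_def snd_conv using DERIV_mult[OF DERIV_ident] by blast
qed

lemma open_domain: "open {t :: complex. norm t ^ 2 < \<rho> \<and> t \<noteq> 0}"
  by (intro open_Collect_conj open_Collect_less open_Collect_neq continuous_intros)

lemma curve_deriv_chart:
  assumes "norm t ^ 2 < \<rho>" "t \<noteq> 0" "curve_deriv x g D (\<phi> t)"
  shows "((\<lambda>t. g (\<phi> t)) has_field_derivative D * (2 * t)) (at t)"
proof -
  obtain d where "((\<lambda>t. snd (\<phi> t)) has_field_derivative d) (at t)" using chart_deriv(2)[OF assms(1)] by blast
  moreover have "\<forall>\<^sub>F s in nhds t. \<phi> s \<in> affine_curve x"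
    unfolding eventually_nhds
    by (rule exI[of _ "{t. norm t ^ 2 < \<rho> \<and> t \<noteq> 0}"])
       (use assms open_domain chart_unramified unramified_subset in blast)
  ultimately show ?thesis by (rule curve_deriv_param[OF assms(3) chart_deriv(1)[OF assms(1)]])
qed

end

locale infinity_data =
  fixes x :: complex and \<rho> :: real and m :: "complex \<Rightarrow> complex"
  assumes \<rho>: "\<rho> > 0" and m: "m holomorphic_on ball 0 \<rho>"
    and nz: "\<And>s. s \<in> ball 0 \<rho> \<Longrightarrow> m s \<noteq> 0"
    and eq: "\<And>s. s \<in> ball 0 \<rho> \<Longrightarrow> (m s)\<^sup>2 = (1 - s) * (1 - x * s)"
begin

abbreviation "\<phi> \<equiv> infinity_chart_map m"

lemma in_ball: "norm t ^ 2 < \<rho> \<Longrightarrow> t\<^sup>2 \<in> ball 0 \<rho>" for t :: complex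
  by (simp add: norm_power)

lemma cubic_inverse:
  assumes "u \<noteq> 0" "1 / u \<in> ball 0 \<rho>"
  shows "cubic x u = u ^ 3 * (m (1 / u))\<^sup>2"
  unfolding eq[OF assms(2)] using assms(1) by (simp add: field_simps power3_eq_cube)

lemma chart_unramified:
  assumes "norm t ^ 2 < \<rho>" "t \<noteq> 0"
  shows "\<phi> t \<in> unramified x"
proof -
  note b = in_ball[OF assms(1)]
  have "m (t\<^sup>2) / t ^ 3 \<noteq> 0" using nz[OF b] assms(2) by simp
  moreover have "cubic x (1 / t\<^sup>2) = (1 / t\<^sup>2) ^ 3 * (m (t\<^sup>2))\<^sup>2"
    using cubic_inverse[of "1 / t\<^sup>2"] b assms(2) by simp
  then have "(m (t\<^sup>2) / t ^ 3)\<^sup>2 = cubic x (1 / t\<^sup>2)"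
    by (simp add: power_divide power_mult[symmetric])
  ultimately show ?thesis unfolding infinity_chart_map_def unramified_iff by blast
qed

lemma chart_onto:
  assumes "(u, v) \<in> unramified x" "norm u > 1 / \<rho>"
  obtains t where "t \<noteq> 0" "t\<^sup>2 = 1 / u" "norm t ^ 2 = 1 / norm u" "norm t ^ 2 < \<rho>" "\<phi> t = (u, v)"
proof -
  have u0: "u \<noteq> 0" using assms(1) by (auto simp: unramified_iff')
  have b: "1 / u \<in> ball 0 \<rho>"
    using assms(2) u0 \<rho> by (simp add: norm_divide divide_less_eq mult.commute)
  define t where "t = u * m (1 / u) / v"
  have v: "v\<^sup>2 = cubic x u" "v \<noteq> 0" using assms(1) by (auto simp: unramified_iff)
  have t2: "t\<^sup>2 = 1 / u"
    unfolding t_def power_divide v(1) cubic_inverse[OF u0 b] power_mult_distrib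
    using nz[OF b] u0 by (simp add: power2_eq_square power3_eq_cube)
  have nt: "norm t ^ 2 = 1 / norm u" by (simp add: norm_power[symmetric] t2 norm_divide)
  have t0: "t \<noteq> 0" using v(2) nz[OF b] u0 by (simp add: t_def)
  have "m (t\<^sup>2) / t ^ 3 = v"
  proof -
    have "t * v = u * m (1 / u)" using v(2) by (simp add: t_def)
    moreover have "t ^ 3 = t\<^sup>2 * t" by (simp add: power2_eq_square power3_eq_cube)
    ultimately have "v * t ^ 3 = m (t\<^sup>2)" using u0 by (simp add: t2 mult.commute)
    then show ?thesis using t0 by (simp add: divide_eq_eq)
  qed
  then have "\<phi> t = (u, v)" using t2 u0 by (simp add: infinity_chart_map_def)
  then show ?thesis using that t0 t2 nt b by (simp add: norm_divide)
qed

lemma chart_deriv: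
  assumes "norm t ^ 2 < \<rho>" "t \<noteq> 0"
  shows "((\<lambda>t. fst (\<phi> t)) has_field_derivative - 2 / t ^ 3) (at t)"
    and "\<exists>d. ((\<lambda>t. snd (\<phi> t)) has_field_derivative d) (at t)"
proof -
  show "((\<lambda>t. fst (\<phi> t)) has_field_derivative - 2 / t ^ 3) (at t)"
    unfolding infinity_chart_map_def fst_conv using assms(2)
    by (auto intro!: derivative_eq_intros simp: field_simps power2_eq_square power3_eq_cube)
  have "(m has_field_derivative deriv m (t\<^sup>2)) (at (t\<^sup>2))"
    using m in_ball[OF assms(1)] by (meson holomorphic_derivI open_ball)
  moreover have "((\<lambda>t. t\<^sup>2) has_field_derivative 2 * t) (at t)"
    by (auto intro!: derivative_eq_intros)
  ultimately have m': "((\<lambda>t. m (t\<^sup>2)) has_field_derivative deriv m (t\<^sup>2) * (2 * t)) (at t)"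
    by (rule DERIV_chain2)
  have t3: "((\<lambda>t. t ^ 3) has_field_derivative 3 * t\<^sup>2) (at t)"
    by (auto intro!: derivative_eq_intros)
  show "\<exists>d. ((\<lambda>t. snd (\<phi> t)) has_field_derivative d) (at t)"
    unfolding infinity_chart_map_def snd_conv using DERIV_divide[OF m' t3] assms(2) by auto
qed

lemma open_domain: "open {t :: complex. norm t ^ 2 < \<rho> \<and> t \<noteq> 0}"
  by (intro open_Collect_conj open_Collect_less open_Collect_neq continuous_intros)

lemma curve_deriv_chart:
  assumes "norm t ^ 2 < \<rho>" "t \<noteq> 0" "curve_deriv x g D (\<phi> t)"
  shows "((\<lambda>t. g (\<phi> t)) has_field_derivative D * (- 2 / t ^ 3)) (at t)"
proof -
  obtain d where "((\<lambda>t. snd (\<phi> t)) has_field_derivative d) (at t)" using chart_deriv(2)[OF assms(1,2)] by blast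
  moreover have "\<forall>\<^sub>F s in nhds t. \<phi> s \<in> affine_curve x"
    unfolding eventually_nhds
    by (rule exI[of _ "{t. norm t ^ 2 < \<rho> \<and> t \<noteq> 0}"])
       (use assms open_domain chart_unramified unramified_subset in blast)
  ultimately show ?thesis by (rule curve_deriv_param[OF assms(3) chart_deriv(1)[OF assms(1,2)]])
qed

end

section \<open>Growth of a primitive and independence of the periods\<close>

lemma punctured_ball_constant:
  fixes F G :: "complex \<Rightarrow> complex"
  assumes "\<And>t. t \<in> ball 0 r - {0} \<Longrightarrow> (F has_field_derivative k t) (at t)"
    and "\<And>t. t \<in> ball 0 r - {0} \<Longrightarrow> (G has_field_derivative k t) (at t)"
  obtains \<kappa> where "\<And>t. t \<in> ball 0 r - {0} \<Longrightarrow> F t = G t + \<kappa>"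
proof -
  have "((\<lambda>t. F t - G t) has_field_derivative 0) (at t)" if "t \<in> ball 0 r - {0}" for t
    using DERIV_diff[OF assms(1)[OF that] assms(2)[OF that]] by simp
  moreover have "connected (ball (0 :: complex) r - {0})"
    by (rule connected_punctured_ball) simp
  ultimately have "(\<lambda>t. F t - G t) constant_on (ball 0 r - {0})"
    by (intro has_field_derivative_0_imp_constant_on) auto
  then obtain \<kappa> where "\<And>t. t \<in> ball 0 r - {0} \<Longrightarrow> F t - G t = \<kappa>" by (auto simp: constant_on_def)
  then show ?thesis using that[of \<kappa>] by (simp add: algebra_simps eq_diff_eq)
qed

text \<open>In the chart the form is \<open>k t dt\<close> with \<open>k\<close> holomorphic also at
  the centre. The given primitive, known only off the centre, differs by a constant from a primitive
  on the full disc, since the punctured disc is connected.\<close>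

lemma primitive_bounded:
  assumes x: "x \<notin> {0, 1}" and e: "e \<in> {0, 1, x}"
    and g: "\<And>P. P \<in> unramified x \<Longrightarrow> curve_deriv x g (basic_form \<alpha> \<beta> P) P"
  shows "\<exists>B r. r > 0 \<and> (\<forall>u v. (u, v) \<in> unramified x \<longrightarrow> norm (u - e) < r \<longrightarrow> norm (g (u, v)) \<le> B)"
proof -
  obtain \<rho> m where mm: "\<rho> > 0" "ball e \<rho> \<inter> {0, 1, x} = {e}" "m holomorphic_on ball e \<rho>"
    "\<And>u. u \<in> ball e \<rho> \<Longrightarrow> m u \<noteq> 0" "\<And>u. u \<in> ball e \<rho> \<Longrightarrow> (u - e) * (m u)\<^sup>2 = cubic x u"
    using ramification_chart[OF x e] by blast
  interpret ramification_data x e \<rho> m by unfold_locales (use mm in auto)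
  define k where "k t = 2 * (\<alpha> + \<beta> * (e + t\<^sup>2)) / m (e + t\<^sup>2)" for t
  have sq: "e + t\<^sup>2 \<in> ball e \<rho>" if "t \<in> ball 0 (sqrt \<rho>)" for t
    using that in_ball[of t] norm_less_sqrt by simp
  have mc: "(\<lambda>t. m (e + t\<^sup>2)) holomorphic_on ball 0 (sqrt \<rho>)"
    by (rule holomorphic_on_compose_gen[OF _ mm(3), unfolded o_def]) (auto intro!: holomorphic_intros sq)
  have "k holomorphic_on ball 0 (sqrt \<rho>)"
    unfolding k_def by (intro holomorphic_intros mc) (use mm(4) sq in auto)
  then obtain F where F: "\<And>t. t \<in> ball 0 (sqrt \<rho>) \<Longrightarrow> (F has_field_derivative k t) (at t within ball 0 (sqrt \<rho>))"
    using holomorphic_convex_primitive'[OF convex_ball open_ball] by blast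
  have F': "(F has_field_derivative k t) (at t)" if "t \<in> ball 0 (sqrt \<rho>)" for t
    using F[OF that] unfolding at_within_open[OF that open_ball] .
  have gk: "((\<lambda>t. g (\<phi> t)) has_field_derivative k t) (at t)" if "t \<in> ball 0 (sqrt \<rho>) - {0}" for t
  proof -
    have t: "norm t ^ 2 < \<rho>" "t \<noteq> 0" using that norm_less_sqrt by auto
    have "basic_form \<alpha> \<beta> (\<phi> t) * (2 * t) = k t"
      using t(2) mm(4)[OF in_ball[OF t(1)]] by (simp add: basic_form_def ramified_chart_def k_def)
    then show ?thesis using curve_deriv_chart[OF t g[OF chart_unramified[OF t]]] by simp
  qed
  obtain \<kappa> where \<kappa>: "\<And>t. t \<in> ball 0 (sqrt \<rho>) - {0} \<Longrightarrow> g (\<phi> t) = F t + \<kappa>"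
  proof -
    have "(F has_field_derivative k t) (at t)" if "t \<in> ball 0 (sqrt \<rho>) - {0}" for t
      using F' that by blast
    from punctured_ball_constant[OF gk this] show ?thesis using that by blast
  qed
  have "F holomorphic_on ball 0 (sqrt \<rho>)"
    unfolding holomorphic_on_open[OF open_ball] using F' by blast
  moreover have "sqrt \<rho> / 2 < sqrt \<rho>" using \<rho> by simp
  ultimately obtain B where B: "\<And>t. norm (t - 0) \<le> sqrt \<rho> / 2 \<Longrightarrow> norm (F t) \<le> B"
    by (rule compact_norm_bound) blast
  \<comment> \<open>As \<open>norm t ^ 2 = norm (u - e)\<close>, the radius
    \<open>\<rho> / 4\<close> in \<open>u\<close> corresponds to half the radius of the disc in
    \<open>t\<close>.\<close>
  have "norm (g (u, v)) \<le> B + norm \<kappa>" if uv: "(u, v) \<in> unramified x" "norm (u - e) < \<rho> / 4" for u v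
  proof -
    obtain t where t: "t \<noteq> 0" "norm t ^ 2 = norm (u - e)" "\<phi> t = (u, v)"
      using chart_onto[OF uv(1)] uv(2) \<rho> by auto
    have "norm t ^ 2 < (sqrt \<rho> / 2) ^ 2" using t(2) uv(2) \<rho> by (simp add: power_divide)
    then have nt: "norm t < sqrt \<rho> / 2" by (rule power2_less_imp_less) (use \<rho> in simp)
    moreover have "0 < sqrt \<rho>" using \<rho> by simp
    ultimately have "norm t < sqrt \<rho>" by linarith
    then have "g (u, v) = F t + \<kappa>" using \<kappa>[of t] t by simp
    moreover have "norm (F t) \<le> B" using B[of t] nt by simp
    ultimately show ?thesis using norm_triangle_ineq[of "F t" \<kappa>] by simp
  qed
  then show ?thesis using \<rho> by (intro exI[of _ "B + norm \<kappa>"] exI[of _ "\<rho> / 4"]) auto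
qed

lemma primitive_growth:
  assumes g: "\<And>P. P \<in> unramified x \<Longrightarrow> curve_deriv x g (basic_form \<alpha> \<beta> P) P"
  shows "\<exists>C R. \<forall>u v. (u, v) \<in> unramified x \<longrightarrow> norm u > R \<longrightarrow> norm (g (u, v) * v) \<le> C * norm u ^ 2"
proof -
  obtain \<rho> m F where mm: "\<rho> > 0" "m holomorphic_on ball 0 \<rho>"
    "\<And>s. s \<in> ball 0 \<rho> \<Longrightarrow> m s \<noteq> 0" "\<And>s. s \<in> ball 0 \<rho> \<Longrightarrow> (m s)\<^sup>2 = (1 - s) * (1 - x * s)"
    and F: "\<And>t. t \<in> ball 0 (sqrt \<rho>) - {0} \<Longrightarrow> (F has_field_derivative - 2 * (\<alpha> + \<beta> / t\<^sup>2) / m (t\<^sup>2)) (at t)"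
    and bnd: "\<exists>C. \<forall>t. 0 < norm t \<and> norm t \<le> sqrt \<rho> / 2 \<longrightarrow> norm (F t) \<le> C / norm t"
    using infinity_primitive[of x \<alpha> \<beta>] by metis
  interpret infinity_data x \<rho> m by unfold_locales (use mm in auto)
  obtain C where C: "\<And>t. 0 < norm t \<and> norm t \<le> sqrt \<rho> / 2 \<Longrightarrow> norm (F t) \<le> C / norm t"
    using bnd by blast
  have gk: "((\<lambda>t. g (\<phi> t)) has_field_derivative - 2 * (\<alpha> + \<beta> / t\<^sup>2) / m (t\<^sup>2)) (at t)"
    if "t \<in> ball 0 (sqrt \<rho>) - {0}" for t
  proof -
    have t: "norm t ^ 2 < \<rho>" "t \<noteq> 0" using that norm_less_sqrt by auto
    have "basic_form \<alpha> \<beta> (\<phi> t) * (- 2 / t ^ 3) = - 2 * (\<alpha> + \<beta> / t\<^sup>2) / m (t\<^sup>2)"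
    proof -
      have gen: "A / (M / T) * (- 2 / T) = - 2 * A / M" if "T \<noteq> 0" "M \<noteq> 0" for A M T :: complex
        using that by (simp add: field_simps)
      have "\<alpha> + \<beta> * (1 / t\<^sup>2) = \<alpha> + \<beta> / t\<^sup>2" by simp
      then show ?thesis
        unfolding basic_form_def infinity_chart_map_def fst_conv snd_conv
        by (simp only:) (rule gen; use t(2) mm(3)[OF in_ball[OF t(1)]] in simp)
    qed
    then show ?thesis using curve_deriv_chart[OF t g[OF chart_unramified[OF t]]] by simp
  qed
  obtain \<kappa> where \<kappa>: "\<And>t. t \<in> ball 0 (sqrt \<rho>) - {0} \<Longrightarrow> g (\<phi> t) = F t + \<kappa>"
    using punctured_ball_constant[OF gk F] by blast
  obtain B where B: "\<And>s. norm (s - 0) \<le> \<rho> / 2 \<Longrightarrow> norm (m s) \<le> B"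
    by (rule compact_norm_bound[OF mm(2), of "\<rho> / 2"]) (use \<rho> in auto)
  \<comment> \<open>The bound \<open>4 / \<rho>\<close> places \<open>t\<close> in the half disc
    where \<open>F\<close> is controlled; the bound 1 gives \<open>norm t \<le> 1\<close>, which
    absorbs the constant \<open>\<kappa>\<close>.\<close>
  define R where "R = max 1 (4 / \<rho>)"
  have "norm (g (u, v) * v) \<le> ((\<bar>C\<bar> + norm \<kappa>) * \<bar>B\<bar>) * norm u ^ 2"
    if uv: "(u, v) \<in> unramified x" "norm u > R" for u v
  proof -
    have R: "norm u > 1" "norm u > 4 / \<rho>" using uv(2) by (auto simp: R_def)
    then have "norm u > 1 / \<rho>" using \<rho> by (smt (verit) divide_right_mono)
    from chart_onto[OF uv(1) this] obtain t where
      t: "t \<noteq> 0" "t\<^sup>2 = 1 / u" "norm t ^ 2 = 1 / norm u" "norm t ^ 2 < \<rho>" "\<phi> t = (u, v)" by blast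
    have "0 < norm u" using R(1) by linarith
    then have "1 / norm u < \<rho> / 4" using R(2) \<rho> by (simp add: divide_less_eq mult.commute)
    then have "norm t ^ 2 < \<rho> / 4" using t(3) by simp
    then have "norm t ^ 2 < (sqrt \<rho> / 2) ^ 2" using \<rho> by (simp add: power_divide)
    then have nt: "norm t < sqrt \<rho> / 2" by (rule power2_less_imp_less) (use \<rho> in simp)
    have nt1: "norm t \<le> 1"
    proof -
      have "norm t ^ 2 \<le> 1 ^ 2" using t(3) R(1) \<open>0 < norm u\<close> by (simp add: divide_le_eq)
      then show ?thesis by (rule power2_le_imp_le) simp
    qed
    have t0: "norm t > 0" using t(1) by simp
    have "t \<in> ball 0 (sqrt \<rho>) - {0}" using t(1,4) norm_less_sqrt by simp
    then have gt: "g (u, v) = F t + \<kappa>" using \<kappa>[of t] t(5) by simp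
    have "norm (F t) \<le> \<bar>C\<bar> / norm t"
      using C[of t] t0 nt by (smt (verit) divide_right_mono)
    moreover have "norm \<kappa> \<le> norm \<kappa> / norm t" using nt1 t0 by (simp add: pos_le_divide_eq mult_left_le)
    ultimately have n1: "norm (g (u, v)) \<le> (\<bar>C\<bar> + norm \<kappa>) / norm t"
      unfolding gt using norm_triangle_ineq[of "F t" \<kappa>] by (simp add: add_divide_distrib)
    have "norm (t\<^sup>2) \<le> \<rho> / 2" using \<open>norm t ^ 2 < \<rho> / 4\<close> \<rho> by (simp add: norm_power)
    then have "norm (m (t\<^sup>2)) \<le> \<bar>B\<bar>" using B[of "t\<^sup>2"] by simp
    moreover have "v = m (t\<^sup>2) / t ^ 3" using t(5) by (simp add: infinity_chart_map_def)
    ultimately have n2: "norm v \<le> \<bar>B\<bar> / norm t ^ 3" using t0 by (simp add: norm_divide norm_power divide_right_mono)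
    have "norm (g (u, v)) * norm v \<le> ((\<bar>C\<bar> + norm \<kappa>) / norm t) * (\<bar>B\<bar> / norm t ^ 3)"
      by (intro mult_mono n1 n2) (use t0 in auto)
    also have "\<dots> = ((\<bar>C\<bar> + norm \<kappa>) * \<bar>B\<bar>) * (1 / norm t ^ 2) ^ 2"
      using t0 by (simp add: field_simps power2_eq_square power3_eq_cube)
    also have "1 / norm t ^ 2 = norm u" using t(3) by simp
    finally show ?thesis by (simp add: norm_mult)
  qed
  then show ?thesis by blast
qed

text \<open>If both basic periods vanished, the form would have a global primitive, whose odd part
  violates \<open>odd_function_zero\<close>.\<close>

lemma basic_periods_independent:
  assumes x: "x \<notin> {0, 1}" and ab: "surface_loop x a" "surface_loop x b" "homology_basis x a b"
    and zero: "loop_period (basic_form \<alpha> \<beta>) a = 0" "loop_period (basic_form \<alpha> \<beta>) b = 0"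
  shows "\<alpha> = 0 \<and> \<beta> = 0"
proof -
  obtain U H where "patched_form x (basic_form \<alpha> \<beta>) U H" using basic_form_patched[OF x] by blast
  then interpret patched_form x "basic_form \<alpha> \<beta>" U H .
  have cp: "curve_path c" if "surface_loop x c" for c
    using that by (auto simp: curve_path_def surface_loop_def)
  have pp: "path_prim c 1 = loop_period (basic_form \<alpha> \<beta>) c" for c
    by (simp add: path_prim_def loop_period_def)
  \<comment> \<open>A closed path is a 1-cycle, hence homologous to an integral combination of
    \<open>a\<close> and \<open>b\<close>, on which the form has period zero.\<close>
  have closed: "path_prim c 1 = 0" if c: "curve_path c" "pathfinish c = pathstart c" for c
  proof -
    have im: "path_image c \<subseteq> affine_curve x" "path c"
      using c(1) unramified_subset valid_path_imp_path by (auto simp: curve_path_def)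
    have "chain_boundary 1 (loop_chain c) = 0"
    proof -
      have "singular_face 1 0 (path_simplex c 0 1) = singular_face 1 1 (path_simplex c 0 1)"
        using c(2) by (auto simp: singular_face_def path_simplex_def simplical_face_def standard_simplex_0
            pathfinish_def pathstart_def standard_simplex_def fun_eq_iff restrict_def)
      then show ?thesis by (simp add: loop_chain_eq chain_boundary_of)
    qed
    then have "singular_relcycle 1 (surface x) {} (loop_chain c)"
      using singular_simplex_path[OF im(2,1), of 0 1] by (simp add: singular_cycle loop_chain_eq singular_chain_of)
    then obtain mn where "homologous_rel 1 (surface x) {} (loop_chain c)
        (frag_cmul (fst mn) (loop_chain a) + frag_cmul (snd mn) (loop_chain b))"
      using ab(3) unfolding homology_basis_def by blast
    from path_prim_homologous[OF c(1) cp[OF ab(1)] cp[OF ab(2)] this] show ?thesis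
      using zero by (simp add: pp)
  qed
  obtain g where g: "\<And>P. P \<in> unramified x \<Longrightarrow> curve_deriv x g (basic_form \<alpha> \<beta> P) P"
    using global_primitive[OF closed] by blast
  define h where "h P = g P - g (fst P, - snd P)" for P
  have hd: "curve_deriv x h (2 * basic_form \<alpha> \<beta> (u, v)) (u, v)" if uv: "(u, v) \<in> unramified x" for u v
  proof -
    have "curve_deriv x g (basic_form \<alpha> \<beta> (u, - v)) (u, - v)"
      using g unramified_involution uv by blast
    from curve_deriv_diff[OF g[OF uv] curve_deriv_involution[OF this]]
    show ?thesis by (simp add: h_def[abs_def] basic_form_def)
  qed
  obtain C R where C: "\<And>u v. (u, v) \<in> unramified x \<Longrightarrow> norm u > R \<Longrightarrow> norm (g (u, v) * v) \<le> C * norm u ^ 2"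
    using primitive_growth[OF g] by blast
  have S: "finite {0, 1, x}" "{0, 1, x} \<subseteq> {0, 1, x}" by auto
  have h0: "h (u, v) = 0" if uv: "(u, v) \<in> unramified x" for u v
  proof (rule odd_function_zero[OF x S, of h R "2 * C"])
    show "u \<notin> {0, 1, x}" using uv by (simp add: unramified_iff')
  next
    fix e assume e: "e \<in> {0, 1, x}"
    obtain B r where B: "r > 0" "\<And>u v. (u, v) \<in> unramified x \<Longrightarrow> norm (u - e) < r \<Longrightarrow> norm (g (u, v)) \<le> B"
      using primitive_bounded[OF x e g] by blast
    have "norm (h (u, v)) \<le> B + B" if "(u, v) \<in> unramified x" "norm (u - e) < r" for u v
      using norm_triangle_ineq4[of "g (u, v)" "g (u, - v)"] B(2)[of u v] B(2)[of u "- v"] that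
      by (simp add: h_def unramified_involution)
    then show "\<exists>B r. r > 0 \<and> (\<forall>u v. (u, v) \<in> unramified x \<longrightarrow> u \<notin> {0, 1, x} \<longrightarrow> norm (u - e) < r \<longrightarrow> norm (h (u, v)) \<le> B)"
      using B(1) by blast
  next
    fix u v assume uv: "(u, v) \<in> unramified x" "norm u > R"
    have "norm (g (u, v) * v - g (u, - v) * v) \<le> norm (g (u, v) * v) + norm (g (u, - v) * v)"
      by (rule norm_triangle_ineq4)
    also have "norm (g (u, - v) * v) = norm (g (u, - v) * (- v))" by simp
    also have "norm (g (u, v) * v) + \<dots> \<le> C * norm u ^ 2 + C * norm u ^ 2"
      using uv by (intro add_mono C) (simp_all add: unramified_involution)
    finally show "norm (h (u, v) * v) \<le> 2 * C * norm u ^ 2" by (simp add: h_def left_diff_distrib)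
  qed (use uv hd in \<open>auto simp: h_def\<close>)
  \<comment> \<open>The odd part of the primitive has derivative
    \<open>2 * basic_form \<alpha> \<beta>\<close> and vanishes identically, so the linear function
    \<open>\<alpha> + \<beta> * u\<close> is zero away from the branch points.\<close>
  have num: "\<alpha> + \<beta> * u = 0" if u: "u \<notin> {0, 1, x}" for u
  proof -
    have un: "(u, csqrt (cubic x u)) \<in> unramified x" using u by (simp add: unramified_iff')
    have "curve_deriv x h 0 (u, csqrt (cubic x u))"
    proof (rule curve_deriv_transform[OF curve_deriv_const[of x 0]])
      have "\<forall>\<^sub>F P in at (u, csqrt (cubic x u)) within affine_curve x. P \<in> unramified x"
        using openin_unramified[of x] un unfolding openin_open eventually_at_topological by blast
      then show "\<forall>\<^sub>F P in at (u, csqrt (cubic x u)) within affine_curve x. 0 = h P"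
        by eventually_elim (use h0 in force)
    qed (use un unramified_subset h0[OF un] in auto)
    from curve_deriv_unique_branch[OF un hd[OF un] this]
    have "basic_form \<alpha> \<beta> (u, csqrt (cubic x u)) = 0" by simp
    then show ?thesis using unramified_snd[OF un] by (simp add: basic_form_def)
  qed
  obtain u1 where u1: "u1 \<notin> {0, 1, x}"
    using ex_new_if_finite[OF infinite_UNIV_char_0 S(1)] by blast
  obtain u2 where u2: "u2 \<notin> {0, 1, x, u1}"
    using ex_new_if_finite[OF infinite_UNIV_char_0, of "{0, 1, x, u1}"] by blast
  have "\<alpha> + \<beta> * u1 = \<alpha> + \<beta> * u2" using num[OF u1] num[of u2] u2 by simp
  then have "\<beta> * (u1 - u2) = 0" by (simp add: right_diff_distrib)
  then have "\<beta> = 0" using u2 by auto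
  then show ?thesis using num[OF u1] by simp
qed

section \<open>Differentials of the second kind\<close>

lemma limitin_surface_Some:
  assumes lim: "(\<phi> \<longlongrightarrow> P) (at 0)" and P: "P \<in> affine_curve x"
    and ev: "\<forall>\<^sub>F t in at 0. \<phi> t \<in> affine_curve x"
  shows "limitin (surface x) (\<lambda>t. Some (\<phi> t)) (Some P) (at (0::complex))"
  unfolding limitin_def
proof (intro conjI allI impI)
  show "Some P \<in> topspace (surface x)" using P by (simp add: topspace_surface)
  fix U assume U: "openin (surface x) U \<and> Some P \<in> U"
  then obtain T where T: "open T" "{P. Some P \<in> U} = affine_curve x \<inter> T"
    using openin_surface_vimage[of x U] by (auto simp: openin_open)
  have "P \<in> T" using U T(2) by blast
  from topological_tendstoD[OF lim T(1) this] ev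
  show "\<forall>\<^sub>F t in at 0. Some (\<phi> t) \<in> U"
    by eventually_elim (use T(2) in blast)
qed

lemma limitin_surface_None:
  assumes lim: "\<And>R. \<forall>\<^sub>F t in at 0. norm (fst (\<phi> t)) > R"
    and ev: "\<forall>\<^sub>F t in at 0. \<phi> t \<in> affine_curve x"
  shows "limitin (surface x) (\<lambda>t. Some (\<phi> t)) None (at (0::complex))"
  unfolding limitin_def
proof (intro conjI allI impI)
  show "None \<in> topspace (surface x)" by (simp add: topspace_surface)
  fix U assume U: "openin (surface x) U \<and> None \<in> U"
  then obtain C where C: "compactin (top_of_set (affine_curve x)) C" "U = insert None (Some ` (affine_curve x - C))"
    unfolding surface_def openin_Alexandroff_compactification by auto
  have "compact C" using C(1) by (simp add: compactin_subtopology)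
  then have "bounded C" by (rule compact_imp_bounded)
  then obtain R where R: "\<And>P. P \<in> C \<Longrightarrow> norm P \<le> R" unfolding bounded_iff by blast
  from lim[of R] ev show "\<forall>\<^sub>F t in at 0. Some (\<phi> t) \<in> U"
  proof eventually_elim
    case (elim t)
    have "norm (fst (\<phi> t)) \<le> norm (\<phi> t)" using norm_fst_le[of "fst (\<phi> t)" "snd (\<phi> t)"] by simp
    then have "\<phi> t \<notin> C" using R[of "\<phi> t"] elim(1) by force
    then show ?case using elim(2) C(2) by blast
  qed
qed

lemma eventually_punctured: "r > 0 \<Longrightarrow> \<forall>\<^sub>F t in at (0::complex). t \<in> ball 0 r - {0}"
  unfolding eventually_at by (intro exI[of _ r]) auto

context ramification_data
begin

text \<open>This makes the explicit chart a legitimate instance of the quantifier over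
  parametrizations in \<open>holomorphic_differential_on\<close>.\<close>

lemma local_param_chart:
  assumes r: "r > 0" "r\<^sup>2 \<le> \<rho>"
  shows "local_param x (Some (e, 0)) \<phi> r"
proof -
  have t: "norm t ^ 2 < \<rho> \<and> t \<noteq> 0" if "t \<in> ball 0 r - {0}" for t :: complex
  proof -
    have "norm t ^ 2 < r ^ 2" using that by (intro power_strict_mono) auto
    then show ?thesis using r(2) that by simp
  qed
  have op: "open (ball 0 r - {0 :: complex})" by auto
  have hol: "(\<lambda>t. fst (\<phi> t)) holomorphic_on (ball 0 r - {0})" "(\<lambda>t. snd (\<phi> t)) holomorphic_on (ball 0 r - {0})"
    unfolding holomorphic_on_open[OF op] using chart_deriv t by blast+
  have inj: "inj_on \<phi> (ball 0 r - {0})"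
  proof (rule inj_onI)
    fix s t assume st: "s \<in> ball 0 r - {0}" "t \<in> ball 0 r - {0}" "\<phi> s = \<phi> t"
    then have "s\<^sup>2 = t\<^sup>2" "s * m (e + s\<^sup>2) = t * m (e + t\<^sup>2)" by (auto simp: ramified_chart_def)
    moreover have "m (e + t\<^sup>2) \<noteq> 0" using nz[OF in_ball] t[OF st(2)] by blast
    ultimately show "s = t" by simp
  qed
  have img: "\<phi> ` (ball 0 r - {0}) \<subseteq> unramified x" using chart_unramified t by blast
  have "e \<in> {0, 1, x}" using e by blast
  then have eP: "(e, 0) \<in> affine_curve x" by (auto simp: affine_curve_iff)
  have "isCont (\<lambda>t. fst (\<phi> t)) 0" "isCont (\<lambda>t. snd (\<phi> t)) 0"
    using chart_deriv[of 0] \<rho> DERIV_isCont by fastforce+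
  then have "((\<lambda>t. (fst (\<phi> t), snd (\<phi> t))) \<longlongrightarrow> (fst (\<phi> 0), snd (\<phi> 0))) (at 0)"
    unfolding isCont_def by (rule tendsto_Pair)
  then have "(\<phi> \<longlongrightarrow> (e, 0)) (at 0)" by (simp add: ramified_chart_def[abs_def])
  moreover have "\<forall>\<^sub>F t in at 0. \<phi> t \<in> affine_curve x"
    using eventually_punctured[OF r(1)] by eventually_elim (use img unramified_subset in blast)
  ultimately show ?thesis
    unfolding local_param_def using r(1) hol inj img limitin_surface_Some[OF _ eP] by blast
qed

end

context infinity_data
begin

lemma local_param_chart:
  assumes r: "r > 0" "r\<^sup>2 \<le> \<rho>"
  shows "local_param x None \<phi> r"
proof -
  have t: "norm t ^ 2 < \<rho> \<and> t \<noteq> 0" if "t \<in> ball 0 r - {0}" for t :: complex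
  proof -
    have "norm t ^ 2 < r ^ 2" using that by (intro power_strict_mono) auto
    then show ?thesis using r(2) that by simp
  qed
  have op: "open (ball 0 r - {0 :: complex})" by auto
  have hol: "(\<lambda>t. fst (\<phi> t)) holomorphic_on (ball 0 r - {0})" "(\<lambda>t. snd (\<phi> t)) holomorphic_on (ball 0 r - {0})"
    unfolding holomorphic_on_open[OF op] using chart_deriv t by blast+
  have inj: "inj_on \<phi> (ball 0 r - {0})"
  proof (rule inj_onI)
    fix s t assume st: "s \<in> ball 0 r - {0}" "t \<in> ball 0 r - {0}" "\<phi> s = \<phi> t"
    have st0: "s \<noteq> 0" "t \<noteq> 0" using st by auto
    have "1 / s\<^sup>2 = 1 / t\<^sup>2" "m (s\<^sup>2) / s ^ 3 = m (t\<^sup>2) / t ^ 3"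
      using st(3) by (auto simp: infinity_chart_map_def)
    then have s2: "s\<^sup>2 = t\<^sup>2" and s3: "m (s\<^sup>2) / s ^ 3 = m (s\<^sup>2) / t ^ 3" by auto
    have "m (s\<^sup>2) \<noteq> 0" using nz[OF in_ball] t[OF st(1)] by blast
    then have "s ^ 3 = t ^ 3" using s3 st0 by simp
    then have "s * s\<^sup>2 = t * s\<^sup>2" using s2 by (simp add: power3_eq_cube power2_eq_square)
    then show "s = t" using st0 by simp
  qed
  have img: "\<phi> ` (ball 0 r - {0}) \<subseteq> unramified x" using chart_unramified t by blast
  have "\<forall>\<^sub>F t in at 0. norm (fst (\<phi> t)) > R" for R
  proof -
    have "1 / sqrt (\<bar>R\<bar> + 1) > 0" by simp
    from eventually_punctured[OF this] show ?thesis
    proof eventually_elim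
      case (elim t)
      have t0: "norm t > 0" "norm t < 1 / sqrt (\<bar>R\<bar> + 1)" using elim by auto
      then have "norm t ^ 2 < (1 / sqrt (\<bar>R\<bar> + 1)) ^ 2" by (intro power_strict_mono) auto
      then have "norm t ^ 2 < 1 / (\<bar>R\<bar> + 1)" by (simp add: power_divide)
      then have "\<bar>R\<bar> + 1 < 1 / norm t ^ 2" using t0(1) by (simp add: field_simps)
      then show ?case by (simp add: infinity_chart_map_def norm_divide norm_power)
    qed
  qed
  moreover have "\<forall>\<^sub>F t in at 0. \<phi> t \<in> affine_curve x"
    using eventually_punctured[OF r(1)] by eventually_elim (use img unramified_subset in blast)
  ultimately show ?thesis
    unfolding local_param_def using r(1) hol inj img limitin_surface_None by blast
qed

end

lemma local_param_branch:
  assumes r: "r > 0" and w: "w holomorphic_on ball u r" "\<And>z. z \<in> ball u r \<Longrightarrow> (z, w z) \<in> unramified x"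
  shows "local_param x (Some (u, w u)) (\<lambda>t. (u + t, w (u + t))) r"
proof -
  have b: "u + t \<in> ball u r" if "t \<in> ball 0 r" for t using that by (simp add: dist_norm)
  have wh: "(\<lambda>t. w (u + t)) holomorphic_on ball 0 r"
    by (rule holomorphic_on_compose_gen[OF _ w(1), unfolded o_def]) (auto intro!: holomorphic_intros b)
  have "isCont (\<lambda>t. w (u + t)) 0"
    using wh r by (meson centre_in_ball continuous_on_eq_continuous_at holomorphic_on_imp_continuous_on open_ball)
  then have "((\<lambda>t. w (u + t)) \<longlongrightarrow> w u) (at 0)" unfolding isCont_def by simp
  moreover have "((\<lambda>t. u + t) \<longlongrightarrow> u) (at 0)" by (auto intro!: tendsto_eq_intros)
  ultimately have lim: "((\<lambda>t. (u + t, w (u + t))) \<longlongrightarrow> (u, w u)) (at 0)" by (intro tendsto_Pair)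
  have img: "(\<lambda>t. (u + t, w (u + t))) ` (ball 0 r - {0}) \<subseteq> unramified x" using w(2) b by blast
  have ev: "\<forall>\<^sub>F t in at 0. (u + t, w (u + t)) \<in> affine_curve x"
    using eventually_punctured[OF r] by eventually_elim (use w(2) b unramified_subset in blast)
  have "(u, w u) \<in> affine_curve x" using w(2)[of u] r unramified_subset by auto
  from limitin_surface_Some[OF lim this ev] show ?thesis
    unfolding local_param_def using r img wh
    by (auto simp: inj_on_def intro!: holomorphic_intros intro: holomorphic_on_subset)
qed

text \<open>A chart says nothing about the value of \<open>f\<close> at its own centre, so
  holomorphy at \<open>P\<close> is read off from a chart centred at a different nearby
  point.\<close>

lemma second_kind_holomorphic:
  assumes f: "holomorphic_differential_on x (topspace (surface x) - {Some Q}) f"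
    and P: "P \<in> unramified x - {Q}"
  shows "\<exists>D. curve_deriv x f D P"
proof -
  let ?M = "unramified x - {Q}"
  obtain u0 v0 where uv: "P = (u0, v0)" by (cases P)
  have opM: "openin (top_of_set (affine_curve x)) ?M"
  proof -
    have "?M = unramified x \<inter> (- {Q})" by blast
    moreover have "open (- {Q})" by (intro open_Compl closed_singleton)
    ultimately show ?thesis using openin_unramified[of x] by (metis openin_Int_open)
  qed
  obtain \<rho> w where w: "\<rho> > 0" "w holomorphic_on ball u0 \<rho>" "w u0 = v0"
    "\<And>u. u \<in> ball u0 \<rho> \<Longrightarrow> (w u)\<^sup>2 = cubic x u" "\<And>u. u \<in> ball u0 \<rho> \<Longrightarrow> w u \<noteq> 0"
    "\<And>u. u \<in> ball u0 \<rho> \<Longrightarrow> (u, w u) \<in> ?M"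
    by (rule local_graph[OF P[unfolded uv] _ opM]) blast+
  \<comment> \<open>The shifted centre: \<open>u0\<close> lies at distance \<open>\<rho> / 4\<close>
    from it, inside the disc of radius \<open>\<rho> / 2\<close> and away from the puncture.\<close>
  define u1 where "u1 = u0 + of_real (\<rho> / 4)"
  have d: "dist u0 u1 = \<rho> / 4" using w(1) by (simp add: u1_def dist_norm)
  have sub: "ball u1 (\<rho> / 2) \<subseteq> ball u0 \<rho>"
  proof
    fix z assume "z \<in> ball u1 (\<rho> / 2)"
    then show "z \<in> ball u0 \<rho>" using dist_triangle[of u0 z u1] d w(1) by simp
  qed
  let ?\<phi> = "\<lambda>t. (u1 + t, w (u1 + t))"
  have lp: "local_param x (Some (u1, w u1)) ?\<phi> (\<rho> / 2)"
  proof (rule local_param_branch)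
    show "w holomorphic_on ball u1 (\<rho> / 2)" by (rule holomorphic_on_subset[OF w(2) sub])
    show "(z, w z) \<in> unramified x" if "z \<in> ball u1 (\<rho> / 2)" for z using w(6) sub that by blast
  qed (use w(1) in simp)
  have b: "u1 + t \<in> ball u0 \<rho>" if "t \<in> ball 0 (\<rho> / 2)" for t
    using sub that by (force simp: dist_norm)
  have inS: "Some (z, w z) \<in> topspace (surface x) - {Some Q}" if "z \<in> ball u0 \<rho>" for z
    using w(6)[OF that] unramified_subset by (auto simp: topspace_surface)
  have "u1 \<in> ball u0 \<rho>" using d w(1) by simp
  then obtain g where g: "g holomorphic_on ball 0 (\<rho> / 2)"
    "\<And>t. t \<in> ball 0 (\<rho> / 2) - {0} \<Longrightarrow> f (?\<phi> t) * deriv (\<lambda>s. fst (?\<phi> s)) t = g t"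
    using f[unfolded holomorphic_differential_on_def, rule_format, OF inS[of u1], of ?\<phi> "\<rho> / 2"] lp inS b by blast
  have "deriv (\<lambda>s. fst (?\<phi> s)) t = 1" for t
    by (rule DERIV_imp_deriv) (auto intro!: derivative_eq_intros)
  then have fg: "f (z, w z) = g (z - u1)" if "z \<in> ball u1 (\<rho> / 2) - {u1}" for z
    using g(2)[of "z - u1"] that by (auto simp: dist_norm norm_minus_commute)
  have "u0 - u1 \<in> ball 0 (\<rho> / 2)" unfolding mem_ball_0 using d w(1) unfolding dist_norm by linarith
  then have "(g has_field_derivative deriv g (u0 - u1)) (at (u0 - u1))"
    using g(1) by (meson holomorphic_derivI open_ball)
  then have "((\<lambda>z. g (z - u1)) has_field_derivative deriv g (u0 - u1) * 1) (at u0)"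
    by (rule DERIV_chain2) (auto intro!: derivative_eq_intros)
  then have "((\<lambda>z. f (z, w z)) has_field_derivative deriv g (u0 - u1) * 1) (at u0)"
  proof (rule has_field_derivative_transform_within_open)
    show "u0 \<in> ball u1 (\<rho> / 2) - {u1}" using d w(1) by (auto simp: dist_commute)
  qed (use fg in auto)
  then have "curve_deriv x f (deriv g (u0 - u1) * 1) (u0, w u0)"
  proof (rule curve_derivI_branch)
    have w0: "w u0 \<noteq> 0" using w(1) w(5)[of u0] by simp
    show "\<forall>\<^sub>F P in at (u0, w u0) within affine_curve x. f P = f (fst P, w (fst P))"
    proof (rule eventually_mono[OF eventually_on_branch[OF w(2,1) w0]])
      fix P assume "fst P \<in> ball u0 \<rho> \<and> snd P = w (fst P)"
      then show "f P = f (fst P, w (fst P))" by (cases P) simp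
    qed (rule w(4))
    show "(u0, w u0) \<in> affine_curve x" using w(1) w(4)[of u0] by (simp add: affine_curve_iff)
  qed
  then show ?thesis using uv w(3) by auto
qed

text \<open>In the chart \<open>f du = g dt\<close> with \<open>du = 2 * t dt\<close> and
  \<open>v = t * m u\<close>, hence \<open>f * v = g * m / 2\<close> with \<open>g\<close> and
  \<open>m\<close> holomorphic.\<close>

lemma second_kind_bounded_ramified:
  assumes x: "x \<notin> {0, 1}" and e: "e \<in> {0, 1, x}" and Q: "Q \<in> unramified x"
    and f: "holomorphic_differential_on x (topspace (surface x) - {Some Q}) f"
  shows "\<exists>B r. r > 0 \<and> (\<forall>u v. (u, v) \<in> unramified x \<longrightarrow> norm (u - e) < r \<longrightarrow> norm (f (u, v) * v) \<le> B)"
proof -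
  obtain \<rho> m where mm: "\<rho> > 0" "ball e \<rho> \<inter> {0, 1, x} = {e}" "m holomorphic_on ball e \<rho>"
    "\<And>u. u \<in> ball e \<rho> \<Longrightarrow> m u \<noteq> 0" "\<And>u. u \<in> ball e \<rho> \<Longrightarrow> (u - e) * (m u)\<^sup>2 = cubic x u"
    using ramification_chart[OF x e] by blast
  interpret ramification_data x e \<rho> m by unfold_locales (use mm in auto)
  have "fst Q \<noteq> e" using Q assms(2) by (cases Q) (auto simp: unramified_iff')
  then have dQ: "norm (fst Q - e) > 0" by simp
  \<comment> \<open>Since \<open>u - e = t\<^sup>2\<close>, the second bound keeps the pole
    \<open>Q\<close> out of the chart.\<close>
  define r where "r = sqrt (min \<rho> (norm (fst Q - e)))"
  have r: "r > 0" "r\<^sup>2 \<le> \<rho>" "r\<^sup>2 \<le> norm (fst Q - e)" using mm(1) dQ by (auto simp: r_def)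
  have t: "norm t ^ 2 < r\<^sup>2" if "t \<in> ball 0 r" for t :: complex
    using that by (intro power_strict_mono) auto
  have inS: "Some (\<phi> t) \<in> topspace (surface x) - {Some Q}" if "t \<in> ball 0 r - {0}" for t
  proof -
    have tt: "norm t ^ 2 < r\<^sup>2" using t that by blast
    have "\<phi> t \<in> unramified x" using chart_unramified tt r(2) that by auto
    moreover have "\<phi> t \<noteq> Q"
    proof
      assume "\<phi> t = Q"
      then have "fst Q - e = t\<^sup>2" by (auto simp: ramified_chart_def)
      then show False using tt r(3) by (simp add: norm_power)
    qed
    ultimately show ?thesis using unramified_subset by (auto simp: topspace_surface)
  qed
  have "Some (e, 0) \<in> topspace (surface x) - {Some Q}"
    using assms(2) Q by (auto simp: topspace_surface affine_curve_iff unramified_iff)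
  from f[unfolded holomorphic_differential_on_def, rule_format, OF this, of \<phi> r] local_param_chart[OF r(1,2)] inS
  obtain g where g: "g holomorphic_on ball 0 r"
    "\<And>t. t \<in> ball 0 r - {0} \<Longrightarrow> f (\<phi> t) * deriv (\<lambda>s. fst (\<phi> s)) t = g t" by blast
  have "r / 2 < r" using r(1) by simp
  then obtain Bg where Bg: "\<And>z. norm (z - 0) \<le> r / 2 \<Longrightarrow> norm (g z) \<le> Bg"
    using compact_norm_bound[OF g(1)] by blast
  have "\<rho> / 2 < \<rho>" using mm(1) by simp
  then obtain Bm where Bm: "\<And>z. norm (z - e) \<le> \<rho> / 2 \<Longrightarrow> norm (m z) \<le> Bm"
    using compact_norm_bound[OF mm(3)] by blast
  have "norm (f (u, v) * v) \<le> \<bar>Bg\<bar> * \<bar>Bm\<bar>" if uv: "(u, v) \<in> unramified x" "norm (u - e) < r\<^sup>2 / 4" for u v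
  proof -
    have "norm (u - e) < \<rho>" using uv(2) r(2) mm(1) by linarith
    from chart_onto[OF uv(1) this] obtain t where tt: "t \<noteq> 0" "norm t ^ 2 = norm (u - e)" "\<phi> t = (u, v)" by blast
    have "norm t ^ 2 < (r / 2) ^ 2" using tt(2) uv(2) by (simp add: power_divide)
    then have nt: "norm t < r / 2" by (rule power2_less_imp_less) (use r(1) in simp)
    then have tb: "t \<in> ball 0 r - {0}" using tt(1) r(1) by simp
    have "norm t ^ 2 < \<rho>" using t[of t] tb r(2) by simp
    from DERIV_imp_deriv[OF chart_deriv(1)[OF this]] g(2)[OF tb] have "f (u, v) * (2 * t) = g t" using tt(3) by simp
    moreover have "v = t * m u" "u = e + t\<^sup>2" using tt(3) by (auto simp: ramified_chart_def)
    ultimately have "f (u, v) * v * 2 = g t * m u" by (simp add: algebra_simps)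
    then have "norm (f (u, v) * v) * 2 = norm (g t) * norm (m u)" by (metis norm_mult norm_numeral)
    moreover have "norm (g t) * norm (m u) \<le> \<bar>Bg\<bar> * \<bar>Bm\<bar>"
    proof (intro mult_mono)
      show "norm (g t) \<le> \<bar>Bg\<bar>" using Bg[of t] nt by simp
      have "norm (u - e) \<le> \<rho> / 2" using uv(2) r(2) mm(1) by linarith
      then show "norm (m u) \<le> \<bar>Bm\<bar>" using Bm[of u] by simp
    qed auto
    moreover have "norm (f (u, v) * v) \<ge> 0" by simp
    ultimately show ?thesis by linarith
  qed
  then show ?thesis using r(1) by (intro exI[of _ "\<bar>Bg\<bar> * \<bar>Bm\<bar>"] exI[of _ "r\<^sup>2 / 4"]) auto
qed

text \<open>Here \<open>du = - 2 / t ^ 3 dt\<close> and \<open>v = m (t\<^sup>2) / t ^ 3\<close>, so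
  the powers of \<open>t\<close> cancel and \<open>f * v = - g * m / 2\<close> is bounded.\<close>

lemma second_kind_bounded_infinity:
  assumes f: "holomorphic_differential_on x (topspace (surface x) - {Some Q}) f"
  shows "\<exists>B R. \<forall>u v. (u, v) \<in> unramified x \<longrightarrow> norm u > R \<longrightarrow> norm (f (u, v) * v) \<le> B"
proof -
  obtain \<rho> m where mm: "\<rho> > 0" "m holomorphic_on ball 0 \<rho>"
    "\<And>s. s \<in> ball 0 \<rho> \<Longrightarrow> m s \<noteq> 0" "\<And>s. s \<in> ball 0 \<rho> \<Longrightarrow> (m s)\<^sup>2 = (1 - s) * (1 - x * s)"
    using infinity_chart by blast
  interpret infinity_data x \<rho> m by unfold_locales (use mm in auto)
  have q: "norm (fst Q) + 1 > 0" using norm_ge_zero[of "fst Q"] by linarith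
  \<comment> \<open>The second bound forces \<open>norm u > norm (fst Q) + 1\<close> inside the
    chart, so the pole is avoided.\<close>
  define r where "r = sqrt (min \<rho> (1 / (norm (fst Q) + 1)))"
  have r: "r > 0" "r\<^sup>2 \<le> \<rho>" "r\<^sup>2 \<le> 1 / (norm (fst Q) + 1)" using mm(1) q by (auto simp: r_def)
  have t: "norm t ^ 2 < r\<^sup>2" if "t \<in> ball 0 r" for t :: complex
    using that by (intro power_strict_mono) auto
  have inS: "Some (\<phi> t) \<in> topspace (surface x) - {Some Q}" if tb: "t \<in> ball 0 r - {0}" for t
  proof -
    have tt: "norm t ^ 2 < r\<^sup>2" using t tb by blast
    have "\<phi> t \<in> unramified x" using chart_unramified tt r(2) tb by auto
    moreover have "\<phi> t \<noteq> Q"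
    proof
      assume "\<phi> t = Q"
      then have "norm (fst Q) * norm t ^ 2 = 1"
        using tb by (auto simp: infinity_chart_map_def norm_divide norm_power)
      moreover have "norm t ^ 2 * (norm (fst Q) + 1) < 1"
        using tt r(3) q by (simp add: pos_less_divide_eq[symmetric])
      ultimately show False using zero_le_power2[of "norm t"] by (simp add: algebra_simps)
    qed
    ultimately show ?thesis using unramified_subset by (auto simp: topspace_surface)
  qed
  have "None \<in> topspace (surface x) - {Some Q}" by (auto simp: topspace_surface)
  from f[unfolded holomorphic_differential_on_def, rule_format, OF this, of \<phi> r] local_param_chart[OF r(1,2)] inS
  obtain g where g: "g holomorphic_on ball 0 r"
    "\<And>t. t \<in> ball 0 r - {0} \<Longrightarrow> f (\<phi> t) * deriv (\<lambda>s. fst (\<phi> s)) t = g t" by blast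
  have "r / 2 < r" using r(1) by simp
  then obtain Bg where Bg: "\<And>z. norm (z - 0) \<le> r / 2 \<Longrightarrow> norm (g z) \<le> Bg"
    using compact_norm_bound[OF g(1)] by blast
  have "\<rho> / 2 < \<rho>" using mm(1) by simp
  then obtain Bm where Bm: "\<And>z. norm (z - 0) \<le> \<rho> / 2 \<Longrightarrow> norm (m z) \<le> Bm"
    using compact_norm_bound[OF mm(2)] by blast
  have "norm (f (u, v) * v) \<le> \<bar>Bg\<bar> * \<bar>Bm\<bar>" if uv: "(u, v) \<in> unramified x" "norm u > 4 / r\<^sup>2" for u v
  proof -
    have r2: "r\<^sup>2 > 0" using r(1) by simp
    have u0: "norm u > 0" using uv(2) r2 by (smt (verit) divide_pos_pos)
    have iu: "1 / norm u < r\<^sup>2 / 4" using uv(2) u0 r2 by (simp add: divide_less_eq mult.commute)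
    then have "1 / norm u < \<rho>" using r(2) mm(1) by linarith
    then have "norm u > 1 / \<rho>" using u0 mm(1) by (simp add: divide_less_eq mult.commute)
    from chart_onto[OF uv(1) this] obtain t where
      tt: "t \<noteq> 0" "t\<^sup>2 = 1 / u" "norm t ^ 2 = 1 / norm u" "norm t ^ 2 < \<rho>" "\<phi> t = (u, v)" by blast
    have "norm t ^ 2 < (r / 2) ^ 2" using tt(3) iu by (simp add: power_divide)
    then have nt: "norm t < r / 2" by (rule power2_less_imp_less) (use r(1) in simp)
    then have tb: "t \<in> ball 0 r - {0}" using tt(1) r(1) by simp
    from DERIV_imp_deriv[OF chart_deriv(1)[OF tt(4,1)]] g(2)[OF tb]
    have fg: "f (u, v) * (- 2 / t ^ 3) = g t" using tt(5) by simp
    have vt: "v = m (t\<^sup>2) / t ^ 3" using tt(5) by (simp add: infinity_chart_map_def)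
    have gen: "F * (M / T) * (- 2) = F * (- 2 / T) * M" for F M T :: complex
      by (simp add: divide_inverse mult_ac)
    have "f (u, v) * v * (- 2) = g t * m (t\<^sup>2)"
      using gen[of "f (u, v)" "m (t\<^sup>2)" "t ^ 3"] unfolding fg vt[symmetric] .
    then have "norm (f (u, v) * v) * 2 = norm (g t) * norm (m (t\<^sup>2))" by (metis norm_minus_cancel norm_mult norm_numeral)
    moreover have "norm (g t) * norm (m (t\<^sup>2)) \<le> \<bar>Bg\<bar> * \<bar>Bm\<bar>"
    proof (intro mult_mono)
      show "norm (g t) \<le> \<bar>Bg\<bar>" using Bg[of t] nt by simp
      have "norm (t\<^sup>2) \<le> \<rho> / 2" using iu tt(3) r(2) mm(1) by (simp add: norm_power)
      then show "norm (m (t\<^sup>2)) \<le> \<bar>Bm\<bar>" using Bm[of "t\<^sup>2"] by simp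
    qed auto
    moreover have "norm (f (u, v) * v) \<ge> 0" by simp
    ultimately show ?thesis by linarith
  qed
  then show ?thesis by blast
qed

section \<open>Removing the pole by an explicit function\<close>

lemma holomorphic_factor_zero:
  assumes h: "h holomorphic_on ball a r" and r: "r > 0" and z: "h a = 0"
  obtains \<psi> where "\<psi> holomorphic_on ball a r" "\<And>u. u \<in> ball a r \<Longrightarrow> h u = (u - a) * \<psi> u" "\<psi> a = deriv h a"
proof (rule that)
  show "(\<lambda>u. if u = a then deriv h a else (h u - h a) / (u - a)) holomorphic_on ball a r"
    by (rule pole_lemma_open[OF h open_ball])
qed (use z in auto)

lemma bounded_by_compactness:
  fixes f :: "complex \<Rightarrow> complex"
  assumes "f holomorphic_on ball a r" "r > 0"
  obtains B where "\<And>u. norm (u - a) \<le> r / 2 \<Longrightarrow> norm (f u) \<le> B"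
  using compact_norm_bound[OF assms(1), of "r / 2"] assms(2) by auto

text \<open>A differential \<open>f du\<close> of the second kind equals \<open>- dG\<close> up to \<open>(\<kappa> + c\<^sub>1 u / 2) du / v\<close>, if
  \<open>G\<close> has the right principal part at \<open>Q = (y, v)\<close> and no pole at \<open>(y, -v)\<close>.\<close>

locale second_kind_data =
  fixes x y :: complex and Q :: "complex \<times> complex" and n :: nat and f :: "complex \<times> complex \<Rightarrow> complex"
    and c1 c2 \<mu> :: complex and r :: real and w \<psi> :: "complex \<Rightarrow> complex"
  assumes x: "x \<notin> {0, 1}" and Q: "Q \<in> unramified x" and y: "y = fst Q"
    and f: "holomorphic_differential_on x (topspace (surface x) - {Some Q}) f"
    and asym: "(\<lambda>P. f P - 1 / (fst P - fst Q) ^ (n + 2)) \<in> O[at Q within affine_curve x](\<lambda>_. 1)"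
    and \<mu>: "2 * (of_nat n + 1) * \<mu> = 1"
    and r: "r > 0" and w: "w holomorphic_on ball y r" "w y = snd Q"
      "\<And>u. u \<in> ball y r \<Longrightarrow> (w u)\<^sup>2 = cubic x u" "\<And>u. u \<in> ball y r \<Longrightarrow> w u \<noteq> 0"
    and \<psi>: "\<psi> holomorphic_on ball y r"
      "\<And>u. u \<in> ball y r - {y} \<Longrightarrow> \<mu> / (u - y) ^ (n + 1) - (c1 * w u / (u - y) + c2 * w u / (u - y)\<^sup>2) = \<psi> u"
begin

text \<open>On the sheet opposite to \<open>Q\<close> the polar parts cancel and
  \<open>\<psi>\<close> remains, which explains the value at \<open>u = y\<close>. On the sheet
  through \<open>Q\<close> the pole is \<open>2 * \<mu> / (u - y) ^ (n + 1)\<close>, and the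
  condition on \<open>\<mu>\<close> makes its derivative
  \<open>- 1 / (u - y) ^ (n + 2)\<close>.\<close>

definition G :: "complex \<times> complex \<Rightarrow> complex" where
  "G P = (if fst P = y then \<psi> y
     else c1 * (snd P / (fst P - y)) + c2 * (snd P / (fst P - y)\<^sup>2) + \<mu> / (fst P - y) ^ (n + 1))"

text \<open>The Taylor coefficients of the cubic at \<open>y\<close>:
  \<open>cubic x (y + s) = p0 + p1 * s + p2 * s\<^sup>2 + s ^ 3\<close>.\<close>

definition p0 where "p0 = cubic x y"
definition p1 where "p1 = 3 * y\<^sup>2 - 2 * (1 + x) * y + x"
definition p2 where "p2 = 3 * y - (1 + x)"

text \<open>\<open>E = v dG/du - c\<^sub>1 u / 2\<close>, expanded in powers of \<open>u - y\<close>.\<close>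

definition E :: "complex \<times> complex \<Rightarrow> complex" where
  "E P = (- c1 * y / 2 - c2 / 2) + (- c1 * p1 / 2 - c2 * p2) / (fst P - y)
     + (- c1 * p0 - 3 / 2 * c2 * p1) / (fst P - y)\<^sup>2 + (- 2 * c2 * p0) / (fst P - y) ^ 3
     - ((of_nat n + 1) * \<mu>) * snd P / (fst P - y) ^ (n + 2)"

lemma curve_deriv_inverse_power:
  assumes "fst P \<noteq> y" "k > 0"
  shows "curve_deriv x (\<lambda>P. c / (fst P - y) ^ k) (- of_nat k * c / (fst P - y) ^ (k + 1)) P"
proof -
  obtain j where j: "k = Suc j" using assms(2) by (cases k) auto
  have nz: "fst P - y \<noteq> 0" using assms(1) by simp
  have "((\<lambda>u. (u - y) ^ k) has_field_derivative of_nat k * (u - y) ^ (k - 1)) (at u)" for u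
    by (auto intro!: derivative_eq_intros)
  from DERIV_divide[OF DERIV_const this] nz
  have "((\<lambda>u. c / (u - y) ^ k) has_field_derivative
      (0 * (fst P - y) ^ k - c * (of_nat k * (fst P - y) ^ (k - 1))) / ((fst P - y) ^ k * (fst P - y) ^ k)) (at (fst P))"
    by simp
  moreover have "(0 * (fst P - y) ^ k - c * (of_nat k * (fst P - y) ^ (k - 1))) / ((fst P - y) ^ k * (fst P - y) ^ k)
      = - of_nat k * c / (fst P - y) ^ (k + 1)"
  proof -
    have gen: "(0 * (s * q) - c * (N * q)) / (s * q * (s * q)) = - N * c / (s * (s * q))"
      if "s \<noteq> 0" "q \<noteq> 0" for s q N :: complex
      using that by (simp add: field_simps)
    have e: "(fst P - y) ^ k = (fst P - y) * (fst P - y) ^ j" "(fst P - y) ^ (k - 1) = (fst P - y) ^ j"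
      "(fst P - y) ^ (k + 1) = (fst P - y) * ((fst P - y) * (fst P - y) ^ j)" by (simp_all add: j)
    show ?thesis unfolding e by (rule gen) (use nz in auto)
  qed
  ultimately have "((\<lambda>u. c / (u - y) ^ k) has_field_derivative - of_nat k * c / (fst P - y) ^ (k + 1)) (at (fst P))"
    by simp
  from curve_deriv_compose[OF curve_deriv_fst this] show ?thesis by simp
qed

text \<open>The only part of \<open>v dG/du\<close> that grows linearly comes from
  \<open>c1 * v / s\<close> with \<open>s = u - y\<close>: the top terms \<open>- c1 * s\<close> and
  \<open>3 / 2 * c1 * s\<close> add up to \<open>c1 * s / 2\<close>. This is the origin of the
  coefficient \<open>c1 / 2\<close> of \<open>u du / v\<close>.\<close>

lemma curve_deriv_G:
  assumes P: "P \<in> unramified x" "fst P \<noteq> y"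
  shows "curve_deriv x G ((E P + c1 / 2 * fst P) / snd P) P"
proof -
  obtain u v where uv: "P = (u, v)" by (cases P)
  define s where "s = u - y"
  have s0: "s \<noteq> 0" using P(2) uv by (simp add: s_def)
  have u: "u = s + y" by (simp add: s_def)
  have v: "v\<^sup>2 = cubic x u" "v \<noteq> 0" using P(1) uv by (auto simp: unramified_iff)
  define d where "d = (3 * u\<^sup>2 - 2 * (1 + x) * u + x) / (2 * v)"
  have dv: "curve_deriv x snd d P" using curve_deriv_snd P(1) uv unfolding d_def by blast
  have q: "curve_deriv x (\<lambda>P. snd P * (c / (fst P - y) ^ k)) (v * (- of_nat k * c / s ^ (k + 1)) + d * (c / s ^ k)) P"
    if "k > 0" for k c
    using curve_deriv_mult[OF dv curve_deriv_inverse_power[OF P(2) that]] uv by (simp add: s_def)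
  let ?D = "((v * (- of_nat 1 * c1 / s ^ (1 + 1)) + d * (c1 / s ^ 1)) +
      (v * (- of_nat 2 * c2 / s ^ (2 + 1)) + d * (c2 / s ^ 2))) + (- of_nat (n + 1) * \<mu> / s ^ (n + 1 + 1))"
  have "curve_deriv x (\<lambda>P. (snd P * (c1 / (fst P - y) ^ 1) + snd P * (c2 / (fst P - y) ^ 2)) + \<mu> / (fst P - y) ^ (n + 1)) ?D P"
    using curve_deriv_add[OF curve_deriv_add[OF q[of 1 c1] q[of 2 c2]] curve_deriv_inverse_power[OF P(2), of "n + 1" \<mu>]] uv
    by (simp add: s_def)
  then have "curve_deriv x G ?D P"
  proof (rule curve_deriv_transform)
    have "open {P :: complex \<times> complex. fst P \<noteq> y}"
      by (intro open_Collect_neq continuous_intros)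
    then have "\<forall>\<^sub>F P' in at P within affine_curve x. fst P' \<noteq> y"
      using P(2) unfolding eventually_at_topological by blast
    then show "\<forall>\<^sub>F P in at P within affine_curve x. (snd P * (c1 / (fst P - y) ^ 1) + snd P * (c2 / (fst P - y) ^ 2)) + \<mu> / (fst P - y) ^ (n + 1) = G P"
      by eventually_elim (simp add: G_def mult.commute)
    show "(snd P * (c1 / (fst P - y) ^ 1) + snd P * (c2 / (fst P - y) ^ 2)) + \<mu> / (fst P - y) ^ (n + 1) = G P"
      using P(2) by (simp add: G_def mult.commute)
  qed (use P(1) unramified_subset in blast)
  moreover have "?D = (E P + c1 / 2 * fst P) / snd P"
  proof -
    have vv: "v * v = p0 + p1 * s + p2 * s\<^sup>2 + s ^ 3"
      using v(1) unfolding u p0_def p1_def p2_def by (simp add: power2_eq_square power3_eq_cube algebra_simps)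
    have dv2: "d * v = (p1 + 2 * p2 * s + 3 * s\<^sup>2) / 2"
      using v(2) unfolding d_def u p1_def p2_def by (simp add: field_simps power2_eq_square)
    have "?D * v = (- c1 * (v * v) / s\<^sup>2 + c1 * (d * v) / s) + (- 2 * c2 * (v * v) / s ^ 3 + c2 * (d * v) / s\<^sup>2)
        - ((of_nat n + 1) * \<mu>) * v / s ^ (n + 2)"
    proof -
      have "- of_nat (n + 1) * \<mu> / s ^ (n + 1 + 1) * v = - (((of_nat n + 1) * \<mu>) * v / s ^ (n + 2))"
      proof -
        have "- of_nat (n + 1) * \<mu> / T * v = - (((of_nat n + 1) * \<mu>) * v / T)" for T
          by (simp add: minus_divide_left algebra_simps)
        then show ?thesis by (simp only: add.assoc one_add_one)
      qed
      moreover have "((v * (- of_nat 1 * c1 / s ^ (1 + 1)) + d * (c1 / s ^ 1)) + (v * (- of_nat 2 * c2 / s ^ (2 + 1)) + d * (c2 / s ^ 2))) * v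
          = (- c1 * (v * v) / s\<^sup>2 + c1 * (d * v) / s) + (- 2 * c2 * (v * v) / s ^ 3 + c2 * (d * v) / s\<^sup>2)"
        by (simp add: algebra_simps power2_eq_square power3_eq_cube)
      ultimately show ?thesis by (simp only: distrib_right diff_conv_add_uminus)
    qed
    also have "\<dots> = E P + c1 / 2 * fst P"
    proof -
      have "- c1 * (v * v) / s\<^sup>2 + c1 * (d * v) / s = - c1 * p0 / s\<^sup>2 - c1 * p1 / 2 / s + c1 * s / 2"
        unfolding vv dv2 using s0 by (simp add: field_simps power2_eq_square power3_eq_cube)
      moreover have "- 2 * c2 * (v * v) / s ^ 3 + c2 * (d * v) / s\<^sup>2
          = - 2 * c2 * p0 / s ^ 3 - 3 / 2 * c2 * p1 / s\<^sup>2 - c2 * p2 / s - c2 / 2"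
        unfolding vv dv2 using s0 by (simp add: field_simps power2_eq_square power3_eq_cube)
      ultimately show ?thesis
        unfolding E_def uv fst_conv snd_conv s_def[symmetric]
        by (simp only:) (simp add: u algebra_simps add_divide_distrib diff_divide_distrib)
    qed
    finally show ?thesis using v(2) uv by (simp add: eq_divide_eq)
  qed
  ultimately show ?thesis by simp
qed

text \<open>With this \<open>h\<close>, away from \<open>u = y\<close>, the form
  \<open>f du + dG\<close> is \<open>(h + c1 / 2 * u) du / v\<close>. Proving \<open>h\<close>
  constant is therefore the same as reducing \<open>f du\<close> to a basic form modulo exact
  forms.\<close>

definition h :: "complex \<times> complex \<Rightarrow> complex" where
  "h P = f P * snd P + E P"

lemma curve_deriv_E:
  assumes P: "P \<in> unramified x" "fst P \<noteq> y"
  shows "\<exists>D. curve_deriv x E D P"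
proof -
  obtain u v where uv: "P = (u, v)" by (cases P)
  have dv: "\<exists>d. curve_deriv x snd d P" using curve_deriv_snd P(1) uv by blast
  have k: "\<exists>D. curve_deriv x (\<lambda>P. c / (fst P - y) ^ k) D P" if "k > 0" for k c
    using curve_deriv_inverse_power[OF P(2) that] by blast
  define c where "c = (of_nat n + 1) * \<mu>"
  have "\<exists>D. curve_deriv x (\<lambda>P. snd P * (c / (fst P - y) ^ (n + 2))) D P"
    using dv k[of "n + 2" c] curve_deriv_mult by fastforce
  moreover have "\<exists>D. curve_deriv x (\<lambda>P. A + B / (fst P - y) ^ 1 + C / (fst P - y) ^ 2 + F / (fst P - y) ^ 3) D P" for A B C F
    using k[of 1 B] k[of 2 C] k[of 3 F] curve_deriv_add curve_deriv_const by (meson zero_less_numeral zero_less_one)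
  ultimately have "\<exists>D. curve_deriv x (\<lambda>P. (- c1 * y / 2 - c2 / 2) + (- c1 * p1 / 2 - c2 * p2) / (fst P - y) ^ 1
     + (- c1 * p0 - 3 / 2 * c2 * p1) / (fst P - y) ^ 2 + (- 2 * c2 * p0) / (fst P - y) ^ 3
     - snd P * (c / (fst P - y) ^ (n + 2))) D P"
    using curve_deriv_diff by blast
  moreover have "E = (\<lambda>P. (- c1 * y / 2 - c2 / 2) + (- c1 * p1 / 2 - c2 * p2) / (fst P - y) ^ 1
     + (- c1 * p0 - 3 / 2 * c2 * p1) / (fst P - y) ^ 2 + (- 2 * c2 * p0) / (fst P - y) ^ 3
     - snd P * (c / (fst P - y) ^ (n + 2)))"
    by (auto simp: E_def c_def fun_eq_iff mult.commute)
  ultimately show ?thesis by simp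
qed

lemma curve_deriv_f: "P \<in> unramified x \<Longrightarrow> P \<noteq> Q \<Longrightarrow> \<exists>D. curve_deriv x f D P"
  using second_kind_holomorphic[OF f] by blast

lemma curve_deriv_h:
  assumes "P \<in> unramified x" "fst P \<noteq> y"
  shows "\<exists>D. curve_deriv x h D P"
proof -
  obtain u v where uv: "P = (u, v)" by (cases P)
  obtain d where d: "curve_deriv x snd d P" using curve_deriv_snd assms(1) uv by blast
  have "P \<noteq> Q" using assms(2) y by auto
  then obtain D where D: "curve_deriv x f D P" using curve_deriv_f assms(1) by blast
  obtain D' where "curve_deriv x E D' P" using curve_deriv_E[OF assms] by blast
  from curve_deriv_add[OF curve_deriv_mult[OF D d] this] show ?thesis
    unfolding h_def[abs_def] by blast
qed

lemma E_bounded_near: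
  assumes "e \<noteq> y"
  shows "\<exists>B d. d > 0 \<and> (\<forall>P\<in>affine_curve x. norm (fst P - e) < d \<longrightarrow> norm (E P) \<le> B)"
proof -
  define d where "d = norm (y - e) / 2"
  have d: "d > 0" using assms by (simp add: d_def)
  let ?K = "{P \<in> affine_curve x. norm (fst P) \<le> norm e + d} \<inter> {P. norm (fst P - e) \<le> d}"
  have "closed {P :: complex \<times> complex. norm (fst P - e) \<le> d}"
    by (intro closed_Collect_le continuous_intros)
  then have "compact ?K" by (rule compact_Int_closed[OF compact_curve_part])
  moreover have ne: "fst P - y \<noteq> 0" if "P \<in> ?K" for P
    using that d by (auto simp: d_def norm_minus_commute)
  then have "continuous_on ?K E"
    unfolding E_def[abs_def] by (intro continuous_intros) auto
  ultimately have "bounded (E ` ?K)" by (intro compact_imp_bounded compact_continuous_image)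
  then obtain B where B: "\<And>z. z \<in> E ` ?K \<Longrightarrow> norm z \<le> B" unfolding bounded_iff by blast
  have "norm (E P) \<le> B" if "P \<in> affine_curve x" "norm (fst P - e) < d" for P
  proof -
    have "norm (fst P) \<le> norm e + d"
      using that(2) norm_triangle_ineq2[of "fst P" e] by linarith
    then show ?thesis using that by (intro B imageI) auto
  qed
  with d show ?thesis by blast
qed

text \<open>All terms but the last are polynomials in \<open>1 / (u - y)\<close>. In the last one
  \<open>v\<close> grows at most like \<open>norm u ^ 2\<close>, which the exponent
  \<open>n + 2 \<ge> 2\<close> compensates.\<close>

lemma E_bounded_infinity:
  "\<exists>B R. \<forall>u v. (u, v) \<in> unramified x \<longrightarrow> norm u > R \<longrightarrow> norm (E (u, v)) \<le> B"
proof -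
  define A0 A1 A2 A3 A4 where "A0 = - c1 * y / 2 - c2 / 2" and "A1 = - c1 * p1 / 2 - c2 * p2"
    and "A2 = - c1 * p0 - 3 / 2 * c2 * p1" and "A3 = - 2 * c2 * p0" and "A4 = (of_nat n + 1) * \<mu>"
  define R where "R = 2 * norm y + norm x + 2"
  have "norm (E (u, v)) \<le> norm A0 + norm A1 + norm A2 + norm A3 + norm A4 * 8"
    if uv: "(u, v) \<in> unramified x" "norm u > R" for u v
  proof -
    define s where "s = u - y"
    have R: "norm u \<ge> 2" "norm u \<ge> norm x" "norm y \<le> norm u / 2"
      using uv(2) norm_ge_zero[of x] norm_ge_zero[of y] unfolding R_def by linarith+
    have s: "norm s \<ge> norm u / 2" using norm_triangle_ineq2[of u y] R(3) unfolding s_def by linarith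
    then have s1: "norm s \<ge> 1" using R(1) by linarith
    have sk: "norm (a / s ^ k) \<le> norm a" for a :: complex and k
    proof -
      have "1 \<le> norm s ^ k" using s1 by (rule one_le_power)
      then show ?thesis by (simp add: norm_divide norm_power divide_le_eq mult_le_cancel_left1)
    qed
    have "norm v \<le> 2 * norm u ^ 2"
      using uv(1) unramified_subset R by (intro norm_snd_le[of u v x]) auto
    also have "\<dots> \<le> 2 * (2 * norm s) ^ 2" using s by (intro mult_left_mono power_mono) auto
    finally have "norm v \<le> 8 * norm s ^ 2" by (simp add: power_mult_distrib)
    then have v8: "norm (v / s\<^sup>2) \<le> 8" using s1 by (simp add: norm_divide norm_power divide_le_eq)
    have "norm (A4 * (v / s\<^sup>2) / s ^ n) \<le> norm (A4 * (v / s\<^sup>2))" by (rule sk)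
    also have "\<dots> \<le> norm A4 * 8" unfolding norm_mult using v8 by (intro mult_left_mono) auto
    finally have t4: "norm (A4 * (v / s\<^sup>2) / s ^ n) \<le> norm A4 * 8" .
    have "E (u, v) = A0 + A1 / s ^ 1 + A2 / s ^ 2 + A3 / s ^ 3 - A4 * (v / s\<^sup>2) / s ^ n"
      unfolding E_def fst_conv snd_conv s_def[symmetric] A0_def A1_def A2_def A3_def A4_def by (simp add: power_add power2_eq_square mult_ac)
    also have "norm \<dots> \<le> norm A0 + norm (A1 / s ^ 1) + norm (A2 / s ^ 2) + norm (A3 / s ^ 3) + norm (A4 * (v / s\<^sup>2) / s ^ n)"
      by (intro norm_triangle_le norm_triangle_le_diff add_mono order_refl)
    also have "\<dots> \<le> norm A0 + norm A1 + norm A2 + norm A3 + norm A4 * 8"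
      by (intro add_mono order_refl sk t4)
    finally show ?thesis .
  qed
  then show ?thesis by blast
qed

lemma opposite_point: "u \<in> ball y r \<Longrightarrow> (u, - w u) \<in> unramified x" "u \<in> ball y r \<Longrightarrow> (u, w u) \<in> unramified x"
  using w(3,4) by (auto simp: unramified_iff)

lemma G_branches:
  assumes "u \<in> ball y r"
  shows "G (u, - w u) = \<psi> u" "u \<noteq> y \<Longrightarrow> G (u, w u) = 2 * \<mu> / (u - y) ^ (n + 1) - \<psi> u"
proof -
  show "G (u, - w u) = \<psi> u"
  proof (cases "u = y")
    case False
    then show ?thesis using \<psi>(2)[of u] assms by (simp add: G_def algebra_simps)
  qed (simp add: G_def)
  assume "u \<noteq> y"
  then have "\<psi> u = \<mu> / (u - y) ^ (n + 1) - (c1 * w u / (u - y) + c2 * w u / (u - y)\<^sup>2)"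
    using \<psi>(2)[of u] assms by simp
  moreover have "2 * \<mu> / (u - y) ^ (n + 1) = \<mu> / (u - y) ^ (n + 1) + \<mu> / (u - y) ^ (n + 1)"
    by (simp add: add_divide_distrib[symmetric])
  ultimately show "G (u, w u) = 2 * \<mu> / (u - y) ^ (n + 1) - \<psi> u"
    using \<open>u \<noteq> y\<close> by (simp add: G_def del: power_Suc)
qed

lemma w_deriv: "u \<in> ball y r \<Longrightarrow> (w has_field_derivative deriv w u) (at u)"
  using w(1) by (meson holomorphic_derivI open_ball)

lemma psi_deriv: "u \<in> ball y r \<Longrightarrow> (\<psi> has_field_derivative deriv \<psi> u) (at u)"
  using \<psi>(1) by (meson holomorphic_derivI open_ball)

lemma punctured_ball_nbhd:
  assumes "u \<in> ball y r - {y}"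
  shows "\<forall>\<^sub>F z in nhds u. z \<in> ball y r - {y}"
  unfolding eventually_nhds using assms by (intro exI[of _ "ball y r - {y}"]) auto

text \<open>The derivative of \<open>G\<close> along the opposite branch is computed twice, by
  \<open>curve_deriv_G\<close> and from \<open>G = \<psi>\<close>; it has no pole at
  \<open>y\<close>.\<close>

lemma dG_opposite:
  assumes u: "u \<in> ball y r - {y}"
  shows "(E (u, - w u) + c1 / 2 * u) / (- w u) = deriv \<psi> u"
proof -
  have un: "(u, - w u) \<in> unramified x" using opposite_point u by blast
  have "curve_deriv x G ((E (u, - w u) + c1 / 2 * u) / (- w u)) (u, - w u)"
    using curve_deriv_G[OF un] u by simp
  moreover have "((\<lambda>u. - w u) has_field_derivative - deriv w u) (at u)"
    using w_deriv u by (intro DERIV_minus) auto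
  moreover have "\<forall>\<^sub>F z in nhds u. (z, - w z) \<in> affine_curve x"
    using punctured_ball_nbhd[OF u] by eventually_elim (use opposite_point unramified_subset in blast)
  ultimately have "((\<lambda>z. G (z, - w z)) has_field_derivative (E (u, - w u) + c1 / 2 * u) / (- w u)) (at u)"
    by (rule curve_deriv_branch)
  moreover have "((\<lambda>z. G (z, - w z)) has_field_derivative deriv \<psi> u) (at u)"
  proof (rule has_field_derivative_transform_within_open[OF psi_deriv open_ball])
    show "\<psi> z = G (z, - w z)" if "z \<in> ball y r" for z using G_branches(1)[OF that] by simp
  qed (use u in auto)
  ultimately show ?thesis by (rule DERIV_unique)
qed

text \<open>The same comparison on the branch through \<open>Q\<close> shows the principal part
  \<open>- 1 / (u - y) ^ (n + 2)\<close>, which is opposite to that of \<open>f\<close>.\<close>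

lemma dG_at_pole:
  assumes u: "u \<in> ball y r - {y}"
  shows "(E (u, w u) + c1 / 2 * u) / w u = - 1 / (u - y) ^ (n + 2) - deriv \<psi> u"
proof -
  have un: "(u, w u) \<in> unramified x" using opposite_point u by blast
  have uy: "u \<noteq> y" "u \<in> ball y r" using u by auto
  have "curve_deriv x G ((E (u, w u) + c1 / 2 * u) / w u) (u, w u)"
    using curve_deriv_G[OF un] u by simp
  moreover have "\<forall>\<^sub>F z in nhds u. (z, w z) \<in> affine_curve x"
    using punctured_ball_nbhd[OF u] by eventually_elim (use opposite_point unramified_subset in blast)
  ultimately have "((\<lambda>z. G (z, w z)) has_field_derivative (E (u, w u) + c1 / 2 * u) / w u) (at u)"
    using w_deriv[OF uy(2)] by (intro curve_deriv_branch)
  moreover have "((\<lambda>z. G (z, w z)) has_field_derivative - 1 / (u - y) ^ (n + 2) - deriv \<psi> u) (at u)"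
  proof (rule has_field_derivative_transform_within_open)
    have "curve_deriv x (\<lambda>P. 2 * \<mu> / (fst P - y) ^ (n + 1)) (- of_nat (n + 1) * (2 * \<mu>) / (fst (u, w u) - y) ^ (n + 1 + 1)) (u, w u)"
      by (rule curve_deriv_inverse_power) (use uy in auto)
    moreover have "\<forall>\<^sub>F z in nhds u. (z, w z) \<in> affine_curve x" by fact
    ultimately have "((\<lambda>z. 2 * \<mu> / (fst (z, w z) - y) ^ (n + 1)) has_field_derivative
        - of_nat (n + 1) * (2 * \<mu>) / (fst (u, w u) - y) ^ (n + 1 + 1)) (at u)"
      using w_deriv[OF uy(2)] by (intro curve_deriv_branch)
    moreover have "- of_nat (n + 1) * (2 * \<mu>) = - 1" using \<mu> by (simp add: algebra_simps)
    ultimately have "((\<lambda>z. 2 * \<mu> / (z - y) ^ (n + 1)) has_field_derivative - 1 / (u - y) ^ (n + 2)) (at u)"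
      by simp
    then show "((\<lambda>z. 2 * \<mu> / (z - y) ^ (n + 1) - \<psi> z) has_field_derivative - 1 / (u - y) ^ (n + 2) - deriv \<psi> u) (at u)"
      by (intro DERIV_diff psi_deriv uy(2))
    show "open (ball y r - {y})" by auto
    show "2 * \<mu> / (z - y) ^ (n + 1) - \<psi> z = G (z, w z)" if "z \<in> ball y r - {y}" for z
      using G_branches(2)[of z] that by auto
  qed (use u in auto)
  ultimately show ?thesis by (rule DERIV_unique)
qed

lemma branch_cases:
  assumes "(u, v) \<in> unramified x" "u \<in> ball y r"
  shows "v = w u \<or> v = - w u"
  using assms w(3)[of u] by (auto simp: unramified_iff power2_eq_iff[symmetric])

lemma bounded_at_opposite:
  "\<exists>B d. d > 0 \<and> (\<forall>u. norm (u - y) < d \<longrightarrow> norm (f (u, - w u)) \<le> B)"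
proof -
  have "isCont (\<lambda>u. f (u, - w u)) y"
  proof -
    have yr: "y \<in> ball y r" using r by simp
    have "(y, - w y) \<noteq> Q" using w(2) w(4)[OF yr] by (cases Q) auto
    then obtain D where D: "curve_deriv x f D (y, - w y)"
      using curve_deriv_f opposite_point(1)[OF yr] by blast
    have "((\<lambda>u. - w u) has_field_derivative - deriv w y) (at y)"
      using w_deriv[OF yr] by (rule DERIV_minus)
    moreover have "\<forall>\<^sub>F z in nhds y. (z, - w z) \<in> affine_curve x"
      unfolding eventually_nhds
      by (intro exI[of _ "ball y r"]) (use r opposite_point(1) unramified_subset[of x] in auto)
    ultimately show ?thesis using D by (intro DERIV_isCont[OF curve_deriv_branch])
  qed
  then obtain d where d: "d > 0" "\<And>u. dist u y < d \<Longrightarrow> dist (f (u, - w u)) (f (y, - w y)) < 1"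
    unfolding continuous_at_eps_delta by (meson zero_less_one)
  have "norm (f (u, - w u)) \<le> norm (f (y, - w y)) + 1" if "norm (u - y) < d" for u
    using d(2)[of u] that norm_triangle_ineq2[of "f (u, - w u)" "f (y, - w y)"] by (simp add: dist_norm)
  with d(1) show ?thesis by blast
qed

lemma bounded_at_pole:
  "\<exists>B d. d > 0 \<and> (\<forall>u. u \<noteq> y \<longrightarrow> norm (u - y) < d \<longrightarrow> norm (f (u, w u) - 1 / (u - y) ^ (n + 2)) \<le> B)"
proof -
  obtain B where "\<forall>\<^sub>F P in at Q within affine_curve x. norm (f P - 1 / (fst P - fst Q) ^ (n + 2)) \<le> B * norm (1 :: complex)"
    by (rule landau_o.bigE[OF asym])
  then obtain d where d: "d > 0"
    "\<And>P. P \<in> affine_curve x \<Longrightarrow> P \<noteq> Q \<Longrightarrow> dist P Q < d \<Longrightarrow> norm (f P - 1 / (fst P - fst Q) ^ (n + 2)) \<le> B"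
    unfolding eventually_at by auto
  have "isCont (\<lambda>u. (u, w u)) y"
    using DERIV_isCont[OF w_deriv[of y]] r by (intro continuous_Pair continuous_ident) auto
  then obtain d' where d': "d' > 0" "\<And>u. dist u y < d' \<Longrightarrow> dist (u, w u) (y, w y) < d"
    unfolding continuous_at_eps_delta using d(1) by meson
  have Qy: "Q = (y, w y)" using w(2) y by simp
  have "norm (f (u, w u) - 1 / (u - y) ^ (n + 2)) \<le> B" if "u \<noteq> y" "norm (u - y) < min d' r" for u
  proof -
    have "(u, w u) \<in> affine_curve x"
      using opposite_point(2)[of u] that(2) unramified_subset by (auto simp: dist_norm norm_minus_commute)
    moreover have "dist (u, w u) Q < d" unfolding Qy using d'(2)[of u] that(2) by (simp add: dist_norm)
    ultimately show ?thesis using d(2)[of "(u, w u)"] that(1) Qy by auto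
  qed
  then show ?thesis using d'(1) r by (intro exI[of _ B] exI[of _ "min d' r"]) auto
qed

text \<open>On the sheet through \<open>Q\<close> the poles of \<open>f * v\<close> and of
  \<open>E\<close> cancel by \<open>dG_at_pole\<close>; on the other sheet neither of them is
  singular.\<close>

lemma h_bounded_at_pole:
  "\<exists>B d. d > 0 \<and> (\<forall>u v. (u, v) \<in> unramified x \<longrightarrow> u \<noteq> y \<longrightarrow> norm (u - y) < d \<longrightarrow> norm (h (u, v)) \<le> B)"
proof -
  obtain B1 d1 where 1: "d1 > 0" "\<And>u. norm (u - y) < d1 \<Longrightarrow> norm (f (u, - w u)) \<le> B1"
    using bounded_at_opposite by blast
  obtain B2 d2 where 2: "d2 > 0"
    "\<And>u. u \<noteq> y \<Longrightarrow> norm (u - y) < d2 \<Longrightarrow> norm (f (u, w u) - 1 / (u - y) ^ (n + 2)) \<le> B2"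
    using bounded_at_pole by blast
  obtain Bw where Bw: "\<And>u. norm (u - y) \<le> r / 2 \<Longrightarrow> norm (w u) \<le> Bw"
    using bounded_by_compactness[OF w(1) r] by blast
  have "deriv \<psi> holomorphic_on ball y r" using \<psi>(1) by (intro holomorphic_deriv) auto
  from bounded_by_compactness[OF this r] obtain Bp where
    Bp: "\<And>u. norm (u - y) \<le> r / 2 \<Longrightarrow> norm (deriv \<psi> u) \<le> Bp" by blast
  define C where "C = (\<bar>B1\<bar> + \<bar>B2\<bar>) * \<bar>Bw\<bar> + \<bar>Bp\<bar> * \<bar>Bw\<bar> + norm (c1 / 2) * (norm y + r)"
  define d where "d = min (min d1 d2) (r / 2)"
  have d: "d > 0" using 1 2 r by (simp add: d_def)
  have "norm (h (u, v)) \<le> C" if uv: "(u, v) \<in> unramified x" "u \<noteq> y" "norm (u - y) < d" for u v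
  proof -
    have b: "u \<in> ball y r - {y}" "u \<in> ball y r" "norm (u - y) \<le> r / 2" "norm (u - y) < d1" "norm (u - y) < d2"
      using uv r by (auto simp: d_def dist_norm norm_minus_commute)
    have ww: "w u \<noteq> 0" using w(4) b(2) .
    have "norm u \<le> norm y + r" using b(3) r norm_triangle_ineq2[of u y] by linarith
    then have cu: "norm (c1 / 2 * u) \<le> norm (c1 / 2) * (norm y + r)"
      unfolding norm_mult by (intro mult_left_mono) auto
    have pw: "norm (deriv \<psi> u * w u) \<le> \<bar>Bp\<bar> * \<bar>Bw\<bar>"
      unfolding norm_mult using Bp[OF b(3)] Bw[OF b(3)] by (intro mult_mono) auto
    consider "v = w u" | "v = - w u" using branch_cases[OF uv(1) b(2)] by blast
    then show ?thesis
    proof cases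
      case 1
      have "E (u, w u) = (- 1 / (u - y) ^ (n + 2) - deriv \<psi> u) * w u - c1 / 2 * u"
        unfolding dG_at_pole[OF b(1), symmetric] using ww by simp
      then have "h (u, v) = (f (u, w u) - 1 / (u - y) ^ (n + 2)) * w u - deriv \<psi> u * w u - c1 / 2 * u"
        unfolding 1 h_def fst_conv snd_conv by (simp only: minus_divide_left[symmetric]) (simp add: left_diff_distrib)
      also have "norm \<dots> \<le> norm ((f (u, w u) - 1 / (u - y) ^ (n + 2)) * w u) + norm (deriv \<psi> u * w u) + norm (c1 / 2 * u)"
        by (intro norm_triangle_le_diff add_mono order_refl)
      also have "\<dots> \<le> (\<bar>B1\<bar> + \<bar>B2\<bar>) * \<bar>Bw\<bar> + \<bar>Bp\<bar> * \<bar>Bw\<bar> + norm (c1 / 2) * (norm y + r)"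
      proof (intro add_mono pw cu)
        show "norm ((f (u, w u) - 1 / (u - y) ^ (n + 2)) * w u) \<le> (\<bar>B1\<bar> + \<bar>B2\<bar>) * \<bar>Bw\<bar>"
          unfolding norm_mult using 2(2)[OF uv(2) b(5)] Bw[OF b(3)] by (intro mult_mono) auto
      qed
      finally show ?thesis by (simp add: C_def)
    next
      case v: 2
      have "E (u, - w u) = deriv \<psi> u * (- w u) - c1 / 2 * u"
        unfolding dG_opposite[OF b(1), symmetric] using ww by simp
      then have "h (u, v) = - (f (u, - w u) * w u) - deriv \<psi> u * w u - c1 / 2 * u"
        unfolding v h_def by (simp add: algebra_simps)
      also have "norm \<dots> \<le> norm (- (f (u, - w u) * w u)) + norm (deriv \<psi> u * w u) + norm (c1 / 2 * u)"
        by (intro norm_triangle_le_diff add_mono order_refl)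
      also have "\<dots> \<le> (\<bar>B1\<bar> + \<bar>B2\<bar>) * \<bar>Bw\<bar> + \<bar>Bp\<bar> * \<bar>Bw\<bar> + norm (c1 / 2) * (norm y + r)"
      proof (intro add_mono pw cu)
        show "norm (- (f (u, - w u) * w u)) \<le> (\<bar>B1\<bar> + \<bar>B2\<bar>) * \<bar>Bw\<bar>"
          unfolding norm_minus_cancel norm_mult using 1(2)[OF b(4)] Bw[OF b(3)] by (intro mult_mono) auto
      qed
      finally show ?thesis by (simp add: C_def)
    qed
  qed
  with d show ?thesis by blast
qed

text \<open>\<open>h\<close> is bounded near the branch points, over \<open>u = y\<close> and at
  infinity, so \<open>bounded_function_constant\<close> applies with \<open>y\<close> as an
  additional exceptional point.\<close>

lemma h_constant:
  obtains \<kappa> where "\<And>u v. (u, v) \<in> unramified x \<Longrightarrow> u \<noteq> y \<Longrightarrow> h (u, v) = \<kappa>"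
proof -
  obtain B1 R1 where 1: "\<And>u v. (u, v) \<in> unramified x \<Longrightarrow> norm u > R1 \<Longrightarrow> norm (f (u, v) * v) \<le> B1"
    using second_kind_bounded_infinity[OF f] by blast
  obtain B2 R2 where 2: "\<And>u v. (u, v) \<in> unramified x \<Longrightarrow> norm u > R2 \<Longrightarrow> norm (E (u, v)) \<le> B2"
    using E_bounded_infinity by blast
  have inf: "norm (h (u, v)) \<le> B1 + B2" if "(u, v) \<in> unramified x" "norm u > max R1 R2" for u v
    unfolding h_def snd_conv using that by (intro norm_triangle_le add_mono 1 2) auto
  have bnd: "\<exists>B d. d > 0 \<and> (\<forall>u v. (u, v) \<in> unramified x \<longrightarrow> u \<notin> {0, 1, x, y} \<longrightarrow> norm (u - e) < d \<longrightarrow> norm (h (u, v)) \<le> B)"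
    if "e \<in> {0, 1, x, y}" for e
  proof (cases "e = y")
    case True
    then show ?thesis using h_bounded_at_pole by blast
  next
    case False
    then have e: "e \<in> {0, 1, x}" using that by blast
    obtain Bf df where F: "df > 0" "\<And>u v. (u, v) \<in> unramified x \<Longrightarrow> norm (u - e) < df \<Longrightarrow> norm (f (u, v) * v) \<le> Bf"
    proof -
      from second_kind_bounded_ramified[OF x e Q f] show thesis using that by meson
    qed
    obtain BE dE where EE: "dE > 0" "\<And>P. P \<in> affine_curve x \<Longrightarrow> norm (fst P - e) < dE \<Longrightarrow> norm (E P) \<le> BE"
      using E_bounded_near[OF False] by blast
    have "norm (h (u, v)) \<le> Bf + BE" if "(u, v) \<in> unramified x" "norm (u - e) < min df dE" for u v
      unfolding h_def snd_conv
      by (intro norm_triangle_le add_mono F EE) (use that unramified_subset in auto)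
    then show ?thesis using F(1) EE(1) by (intro exI[of _ "Bf + BE"] exI[of _ "min df dE"]) auto
  qed
  obtain \<kappa> where k: "\<And>u v. (u, v) \<in> unramified x \<Longrightarrow> u \<notin> {0, 1, x, y} \<Longrightarrow> h (u, v) = \<kappa>"
  proof (rule bounded_function_constant[OF x _ _ _ bnd])
    show "norm (h (u, v)) \<le> B1 + B2" if "(u, v) \<in> unramified x" "norm u > max R1 R2" for u v
      using inf that .
    show "\<exists>D. curve_deriv x h D (u, v)" if "(u, v) \<in> unramified x" "u \<notin> {0, 1, x, y}" for u v
      using curve_deriv_h[OF that(1)] that(2) by simp
  qed auto
  show ?thesis
  proof (rule that)
    show "h (u, v) = \<kappa>" if "(u, v) \<in> unramified x" "u \<noteq> y" for u v
      using k[OF that(1)] that by (auto simp: unramified_iff')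
  qed
qed

text \<open>Away from \<open>u = y\<close> this restates that \<open>h\<close> is constant. The
  point opposite to \<open>Q\<close> needs an argument of its own, because the formula for
  \<open>dG\<close> divides by \<open>u - y\<close> there; both sides are continuous along the
  branch, so the identity extends to it.\<close>

lemma exact_modulo_basic:
  obtains \<kappa> where "\<And>P. P \<in> unramified x - {Q} \<Longrightarrow> curve_deriv x G (basic_form \<kappa> (c1 / 2) P - f P) P"
proof -
  obtain \<kappa> where k: "\<And>u v. (u, v) \<in> unramified x \<Longrightarrow> u \<noteq> y \<Longrightarrow> h (u, v) = \<kappa>"
    using h_constant by blast
  have off: "(E (u, v) + c1 / 2 * u) / v = basic_form \<kappa> (c1 / 2) (u, v) - f (u, v)"
    if uv: "(u, v) \<in> unramified x" "u \<noteq> y" for u v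
  proof -
    have "v \<noteq> 0" using uv(1) by (simp add: unramified_iff)
    moreover have "\<kappa> = f (u, v) * v + E (u, v)" using k[OF uv] by (simp add: h_def)
    ultimately show ?thesis by (simp add: basic_form_def field_simps)
  qed
  have yr: "y \<in> ball y r" using r by simp
  let ?O = "(y, - w y)"
  have oQ: "?O \<noteq> Q" "?O \<in> unramified x" "w y \<noteq> 0"
    using w(2) w(4)[OF yr] opposite_point(1)[OF yr] by (cases Q; auto)+
  have ev: "\<forall>\<^sub>F z in nhds y. (z, - w z) \<in> affine_curve x"
    unfolding eventually_nhds
    by (intro exI[of _ "ball y r"]) (use r opposite_point(1) unramified_subset[of x] in auto)
  have dw: "((\<lambda>u. - w u) has_field_derivative - deriv w y) (at y)"
    using w_deriv[OF yr] by (rule DERIV_minus)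
  obtain D where D: "curve_deriv x f D ?O" using curve_deriv_f oQ by blast
  obtain D' where D': "curve_deriv x (basic_form \<kappa> (c1 / 2)) D' ?O"
    using curve_form.holo[OF curve_form_basic] oQ(2) unfolding curve_holomorphic_def by blast
  have "isCont (\<lambda>u. basic_form \<kappa> (c1 / 2) (u, - w u) - f (u, - w u)) y"
    by (intro continuous_diff DERIV_isCont[OF curve_deriv_branch[OF D' dw ev]] DERIV_isCont[OF curve_deriv_branch[OF D dw ev]])
  then have l1: "((\<lambda>u. basic_form \<kappa> (c1 / 2) (u, - w u) - f (u, - w u)) \<longlongrightarrow> basic_form \<kappa> (c1 / 2) ?O - f ?O) (at y)"
    by (simp add: isCont_def)
  have "isCont (deriv \<psi>) y"
    using \<psi>(1) yr by (meson continuous_on_eq_continuous_at holomorphic_deriv holomorphic_on_imp_continuous_on open_ball)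
  then have "(deriv \<psi> \<longlongrightarrow> deriv \<psi> y) (at y)" by (simp add: isCont_def)
  moreover have "\<forall>\<^sub>F u in at y. deriv \<psi> u = basic_form \<kappa> (c1 / 2) (u, - w u) - f (u, - w u)"
  proof -
    have "\<forall>\<^sub>F u in at y. u \<in> ball y r - {y}"
      unfolding eventually_at using r by (intro exI[of _ r]) (auto simp: dist_commute)
    then show ?thesis
    proof eventually_elim
      case (elim u)
      then have "u \<noteq> y" "u \<in> ball y r" by auto
      from off[OF opposite_point(1)[OF this(2)] this(1)] dG_opposite[OF elim] show ?case by simp
    qed
  qed
  ultimately have "((\<lambda>u. basic_form \<kappa> (c1 / 2) (u, - w u) - f (u, - w u)) \<longlongrightarrow> deriv \<psi> y) (at y)"
    by (rule Lim_transform_eventually)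
  from tendsto_unique[OF _ l1 this] have dy: "basic_form \<kappa> (c1 / 2) ?O - f ?O = deriv \<psi> y" by simp
  have "curve_deriv x G (deriv \<psi> y) (y, (\<lambda>u. - w u) y)"
  proof (rule curve_derivI_branch)
    show "((\<lambda>u. G (u, - w u)) has_field_derivative deriv \<psi> y) (at y)"
    proof (rule has_field_derivative_transform_within_open[OF psi_deriv open_ball])
      show "\<psi> z = G (z, - w z)" if "z \<in> ball y r" for z using G_branches(1)[OF that] by simp
    qed (use yr in auto)
    show "(y, - w y) \<in> affine_curve x" using oQ(2) unramified_subset by blast
    have "\<forall>\<^sub>F P in at (y, - w y) within affine_curve x. fst P \<in> ball y r \<and> snd P = - w (fst P)"
      
    proof (rule eventually_on_branch)
      show "(\<lambda>u. - w u) holomorphic_on ball y r" using w(1) by (rule holomorphic_on_minus)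
      show "(- w u)\<^sup>2 = cubic x u" if "u \<in> ball y r" for u using w(3)[OF that] by simp
    qed (use r oQ(3) in auto)
    then show "\<forall>\<^sub>F P in at (y, - w y) within affine_curve x. G P = G (fst P, - w (fst P))"
    proof eventually_elim
      case (elim P)
      then show ?case by (cases P) simp
    qed
  qed
  then have opp: "curve_deriv x G (basic_form \<kappa> (c1 / 2) ?O - f ?O) ?O" using dy by simp
  show ?thesis
  proof (rule that)
    fix P assume P: "P \<in> unramified x - {Q}"
    obtain u v where uv: "P = (u, v)" by (cases P)
    show "curve_deriv x G (basic_form \<kappa> (c1 / 2) P - f P) P"
    proof (cases "u = y")
      case True
      have "v = w y \<or> v = - w y" using branch_cases[of u v] P uv True yr by blast
      moreover have "Q = (y, w y)" using w(2) y by simp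
      ultimately have "P = ?O" using P uv True by auto
      then show ?thesis using opp by simp
    next
      case False
      then show ?thesis using curve_deriv_G[of P] off[of u v] P uv by simp
    qed
  qed
qed

text \<open>On a representative that avoids \<open>Q\<close> the exact form \<open>dG\<close>
  integrates to 0. The basic form left over has no pole at \<open>Q\<close>, so homology invariance
  replaces the representative by the given loop, even if that loop runs through
  \<open>Q\<close>.\<close>

lemma second_kind_period:
  obtains \<kappa> where "\<And>c I. surface_loop x c \<Longrightarrow> has_period x {Q} f c I \<Longrightarrow> I = loop_period (basic_form \<kappa> (c1 / 2)) c"
proof -
  obtain \<kappa> where k: "\<And>P. P \<in> unramified x - {Q} \<Longrightarrow> curve_deriv x G (basic_form \<kappa> (c1 / 2) P - f P) P"
    using exact_modulo_basic by blast
  obtain U H where "patched_form x (basic_form \<kappa> (c1 / 2)) U H" using basic_form_patched[OF x] by blast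
  then interpret patched_form x "basic_form \<kappa> (c1 / 2)" U H .
  show ?thesis
  proof (rule that)
    fix c I assume c: "surface_loop x c" and "has_period x {Q} f c I"
    then obtain c' where c': "surface_loop x c'" "path_image c' \<inter> {Q} = {}" "homologous_loops x c' c" "has_loop_integral f I c'"
      unfolding has_period_def by blast
    have "(curve_integrand (\<lambda>P. basic_form \<kappa> (c1 / 2) P - f P) c' has_integral G (c' 1) - G (c' 0)) {0..1}"
    proof (rule curve_integral_primitive)
      show "valid_path c'" using c'(1) by (simp add: surface_loop_def)
      fix t :: real assume "t \<in> {0..1}"
      then have "c' t \<in> unramified x - {Q}" using c'(1,2) by (auto simp: surface_loop_def path_image_def)
      then show "c' t \<in> affine_curve x \<and> curve_deriv x G (basic_form \<kappa> (c1 / 2) (c' t) - f (c' t)) (c' t)"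
        using k unramified_subset by blast
    qed auto
    moreover have "c' 1 = c' 0" using c'(1) by (simp add: surface_loop_def pathfinish_def pathstart_def)
    moreover have "(curve_integrand f c' has_integral I) {0..1}" using c'(4) by (simp add: has_loop_integral_iff)
    ultimately have "((\<lambda>t. curve_integrand (\<lambda>P. basic_form \<kappa> (c1 / 2) P - f P) c' t + curve_integrand f c' t) has_integral 0 + I) {0..1}"
      by (intro has_integral_add) auto
    moreover have "(\<lambda>t. curve_integrand (\<lambda>P. basic_form \<kappa> (c1 / 2) P - f P) c' t + curve_integrand f c' t) = curve_integrand (basic_form \<kappa> (c1 / 2)) c'"
      by (auto simp: curve_integrand_def fun_eq_iff algebra_simps)
    ultimately have "I = path_prim c' 1" by (simp add: path_prim_def integral_unique)
    moreover have "path_prim c' 1 = of_int 1 * path_prim c 1 + of_int 0 * path_prim c 1"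
      by (rule path_prim_homologous) (use c c' in \<open>auto simp: curve_path_def surface_loop_def homologous_loops_def\<close>)
    ultimately show "I = loop_period (basic_form \<kappa> (c1 / 2)) c" by (simp add: path_prim_def loop_period_def)
  qed
qed

end

text \<open>The unknown \<open>\<kappa>\<close> is eliminated by the vanishing a-period, which says
  \<open>\<kappa> * A = - (c1 / 2) * PA\<close>. Multiplying the b-period by \<open>A\<close> avoids
  a division.\<close>

lemma (in second_kind_data) second_kind_period_product:
  assumes ab: "surface_loop x a" "surface_loop x b" and per: "has_period x {Q} f a 0" "has_period x {Q} f b I"
  shows "loop_period (power_form 0 x) a * I = c1 / 2 *
    (loop_period (power_form 0 x) a * loop_period (basic_form 0 1) b - loop_period (power_form 0 x) b * loop_period (basic_form 0 1) a)"
proof -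
  obtain \<kappa> where k: "\<And>c I. surface_loop x c \<Longrightarrow> has_period x {Q} f c I \<Longrightarrow> I = loop_period (basic_form \<kappa> (c1 / 2)) c"
    using second_kind_period by blast
  define A B PA PB where "A = loop_period (power_form 0 x) a" and "B = loop_period (power_form 0 x) b"
    and "PA = loop_period (basic_form 0 1) a" and "PB = loop_period (basic_form 0 1) b"
  have "0 = \<kappa> * A + c1 / 2 * PA" "I = \<kappa> * B + c1 / 2 * PB"
    unfolding A_def B_def PA_def PB_def
    using k[OF ab(1) per(1)] k[OF ab(2) per(2)]
      loop_period_basic[OF ab(1), of \<kappa> "c1 / 2"] loop_period_basic[OF ab(2), of \<kappa> "c1 / 2"] by metis+
  then have "A * I = (\<kappa> * A) * B + c1 / 2 * (A * PB)" "\<kappa> * A = - (c1 / 2 * PA)"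
    by (simp_all add: algebra_simps eq_neg_iff_add_eq_0)
  then have "A * I = - (c1 / 2 * PA) * B + c1 / 2 * (A * PB)" by (simp only:)
  then have "A * I = c1 / 2 * (A * PB - B * PA)" by (simp add: algebra_simps)
  then show ?thesis by (simp add: A_def B_def PA_def PB_def)
qed

text \<open>With \<open>\<mu> = 1 / 2\<close> the pole at the opposite point is simple;
  \<open>c1 = 1 / (2 * v)\<close> cancels its residue, and no second-order term is needed.\<close>

lemma second_kind_period_0:
  assumes x: "x \<notin> {0, 1}" and yv: "(y, v) \<in> unramified x" and ab: "surface_loop x a" "surface_loop x b"
    and f: "normalized_second_kind 0 x a (y, v) f" and per: "has_period x {(y, v)} f b I"
  shows "loop_period (power_form 0 x) a * I = 1 / (4 * v) *
    (loop_period (power_form 0 x) a * loop_period (basic_form 0 1) b - loop_period (power_form 0 x) b * loop_period (basic_form 0 1) a)"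
proof -
  obtain r w where w: "r > 0" "w holomorphic_on ball y r" "w y = v"
    "\<And>u. u \<in> ball y r \<Longrightarrow> (w u)\<^sup>2 = cubic x u" "\<And>u. u \<in> ball y r \<Longrightarrow> w u \<noteq> 0"
    by (rule unramified_nbhd[OF yv]) blast
  have v: "v \<noteq> 0" using yv by (simp add: unramified_iff)
  have "(\<lambda>u. 1 / 2 - 1 / (2 * v) * w u) holomorphic_on ball y r" using w(2) by (intro holomorphic_intros)
  moreover have "1 / 2 - 1 / (2 * v) * w y = 0" using w(3) v by simp
  ultimately obtain \<psi> where psi: "\<psi> holomorphic_on ball y r"
    "\<And>u. u \<in> ball y r \<Longrightarrow> 1 / 2 - 1 / (2 * v) * w u = (u - y) * \<psi> u"
    using holomorphic_factor_zero[OF _ w(1)] by metis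
  interpret second_kind_data x y "(y, v)" 0 f "1 / (2 * v)" 0 "1 / 2" r w \<psi>
  proof
    show "1 / 2 / (u - y) ^ (0 + 1) - (1 / (2 * v) * w u / (u - y) + 0 * w u / (u - y)\<^sup>2) = \<psi> u" if "u \<in> ball y r - {y}" for u
    proof -
      have "1 / 2 / (u - y) - 1 / (2 * v) * w u / (u - y) = (1 / 2 - 1 / (2 * v) * w u) / (u - y)"
        by (rule diff_divide_distrib[symmetric])
      also have "\<dots> = \<psi> u" using psi(2)[of u] that by simp
      finally show ?thesis by simp
    qed
  qed (use x yv f w psi in \<open>auto simp: normalized_second_kind_def\<close>)
  have "has_period x {(y, v)} f a 0" using assms(5) by (simp add: normalized_second_kind_def)
  from second_kind_period_product[OF ab this per] show ?thesis by simp
qed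

lemma second_kind_period_1:
  assumes x: "x \<notin> {0, 1}" and yv: "(y, v) \<in> unramified x" and ab: "surface_loop x a" "surface_loop x b"
    and f: "normalized_second_kind 1 x a (y, v) f" and per: "has_period x {(y, v)} f b I"
  shows "loop_period (power_form 0 x) a * I = - (3 * y\<^sup>2 - 2 * (1 + x) * y + x) / (16 * v ^ 3) *
    (loop_period (power_form 0 x) a * loop_period (basic_form 0 1) b - loop_period (power_form 0 x) b * loop_period (basic_form 0 1) a)"
proof -
  obtain r w where w: "r > 0" "w holomorphic_on ball y r" "w y = v"
    "\<And>u. u \<in> ball y r \<Longrightarrow> (w u)\<^sup>2 = cubic x u" "\<And>u. u \<in> ball y r \<Longrightarrow> w u \<noteq> 0"
    by (rule unramified_nbhd[OF yv]) blast
  have v: "v \<noteq> 0" using yv by (simp add: unramified_iff)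
  define q where "q = 3 * y\<^sup>2 - 2 * (1 + x) * y + x"
  \<comment> \<open>For \<open>n = 1\<close> the function \<open>h\<close> must vanish to second
    order at \<open>y\<close>. The coefficient \<open>1 / (4 * v)\<close> gives
    \<open>h y = 0\<close>, and this \<open>c1\<close> solves
    \<open>1 / (4 * v) * (q / (2 * v)) + c1 * v = 0\<close>, which gives
    \<open>deriv h y = 0\<close>.\<close>
  define c1 where "c1 = - q / (8 * v ^ 3)"
  define h where "h u = 1 / 4 - (1 / (4 * v) + c1 * (u - y)) * w u" for u
  have yr: "y \<in> ball y r" using w(1) by simp
  have "h holomorphic_on ball y r" unfolding h_def using w(2) v by (intro holomorphic_intros) auto
  moreover have "h y = 0" using w(3) v by (simp add: h_def)
  ultimately obtain \<psi>1 where psi1: "\<psi>1 holomorphic_on ball y r" "\<And>u. u \<in> ball y r \<Longrightarrow> h u = (u - y) * \<psi>1 u" "\<psi>1 y = deriv h y"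
    using holomorphic_factor_zero[OF _ w(1)] by metis
  have "(w has_field_derivative q / (2 * w y)) (at y)"
    unfolding q_def by (rule branch_deriv[OF w(2,4,5) yr])
  then have "(h has_field_derivative 0 - ((1 / (4 * v) + c1 * (y - y)) * (q / (2 * w y)) + c1 * w y)) (at y)"
    unfolding h_def by (auto intro!: derivative_eq_intros)
  moreover have "0 - ((1 / (4 * v) + c1 * (y - y)) * (q / (2 * w y)) + c1 * w y) = 0"
    using v w(3) by (simp add: c1_def field_simps power3_eq_cube)
  ultimately have "\<psi>1 y = 0" using psi1(3) by (simp add: DERIV_imp_deriv)
  then obtain \<psi> where psi: "\<psi> holomorphic_on ball y r" "\<And>u. u \<in> ball y r \<Longrightarrow> \<psi>1 u = (u - y) * \<psi> u"
    using holomorphic_factor_zero[OF psi1(1) w(1)] by metis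
  interpret second_kind_data x y "(y, v)" 1 f c1 "1 / (4 * v)" "1 / 4" r w \<psi>
  proof
    show "1 / 4 / (u - y) ^ (1 + 1) - (c1 * w u / (u - y) + 1 / (4 * v) * w u / (u - y)\<^sup>2) = \<psi> u" if "u \<in> ball y r - {y}" for u
    proof -
      have s: "u - y \<noteq> 0" using that by auto
      have gen: "1 / 4 / (s * s) - (c1 * W / s + k * W / (s * s)) = (1 / 4 - (k + c1 * s) * W) / (s * s)" if "s \<noteq> 0" for s k W
        using that by (simp add: divide_simps) (simp add: algebra_simps)
      have "1 / 4 / (u - y) ^ (1 + 1) - (c1 * w u / (u - y) + 1 / (4 * v) * w u / (u - y)\<^sup>2) = h u / ((u - y) * (u - y))"
        using gen[OF s, of "w u" "1 / (4 * v)"] by (simp add: h_def power2_eq_square)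
      also have "h u = (u - y) * ((u - y) * \<psi> u)" using psi1(2)[of u] psi(2)[of u] that by simp
      finally show ?thesis using s by simp
    qed
  qed (use x yv f w psi in \<open>auto simp: normalized_second_kind_def\<close>)
  have "c1 / 2 = - q / (16 * v ^ 3)" by (simp add: c1_def)
  moreover have "has_period x {(y, v)} f a 0" using assms(5) by (simp add: normalized_second_kind_def)
  ultimately show ?thesis
    using second_kind_period_product[OF ab _ per] unfolding q_def by (simp only:)
qed

text \<open>Continuity of the root is enough: \<open>v z - v x = (p z - p x) / (v z + v x)\<close>,
  and the denominator tends to \<open>2 * v x\<close>, which is nonzero.\<close>

lemma square_root_derivative:
  fixes v p :: "complex \<Rightarrow> complex"
  assumes X: "open X" "x \<in> X" and cont: "continuous_on X v" and sq: "\<And>z. z \<in> X \<Longrightarrow> (v z)\<^sup>2 = p z"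
    and nz: "v x \<noteq> 0" and p: "(p has_field_derivative D) (at x)"
  shows "(v has_field_derivative D / (2 * v x)) (at x)"
  unfolding has_field_derivative_iff
proof (rule Lim_transform_eventually)
  have vx: "(v \<longlongrightarrow> v x) (at x)"
    using cont X by (metis continuous_on_eq_continuous_at isCont_def)
  then have sum: "((\<lambda>z. v z + v x) \<longlongrightarrow> v x + v x) (at x)" by (intro tendsto_intros)
  moreover have "((\<lambda>z. (p z - p x) / (z - x)) \<longlongrightarrow> D) (at x)"
    using p by (simp add: has_field_derivative_iff)
  ultimately show "((\<lambda>z. (p z - p x) / (z - x) / (v z + v x)) \<longlongrightarrow> D / (2 * v x)) (at x)"
    using nz tendsto_divide[of "\<lambda>z. (p z - p x) / (z - x)" D "at x" "\<lambda>z. v z + v x" "v x + v x"] by (simp add: mult_2[symmetric])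
  have "\<forall>\<^sub>F z in at x. z \<in> X" using X by (simp add: eventually_at_in_open')
  moreover have "\<forall>\<^sub>F z in at x. v z + v x \<noteq> 0"
    using tendsto_imp_eventually_ne[OF sum, of 0] nz by simp
  ultimately show "\<forall>\<^sub>F z in at x. (p z - p x) / (z - x) / (v z + v x) = (v z - v x) / (z - x)"
  proof eventually_elim
    case (elim z)
    have "p z - p x = (v z - v x) * (v z + v x)"
      using sq[OF elim(1)] sq[OF X(2)] by (simp add: power2_eq_square algebra_simps)
    then show ?case using elim(2) by simp
  qed
qed

context loop_family
begin

text \<open>The derivatives of \<open>F\<close> are supplied in whatever explicit form is at hand;
  uniqueness identifies them with those of \<open>C * per 0\<close>.\<close>

lemma picard_fuchs_multiple:
  assumes F: "\<And>x. x \<in> X \<Longrightarrow> F x = C * per 0 x" "\<And>x. x \<in> X \<Longrightarrow> (F has_field_derivative F1 x) (at x)"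
    "\<And>x. x \<in> X \<Longrightarrow> (F1 has_field_derivative F2 x) (at x)" and x: "x \<in> X"
  shows "x * (x - 1) * F2 x + (2 * x - 1) * F1 x + F x / 4 = 0"
proof -
  have 1: "F1 z = C * (per 1 z / 2)" if z: "z \<in> X" for z
  proof (rule DERIV_unique[OF F(2)[OF z]])
    show "(F has_field_derivative C * (per 1 z / 2)) (at z)"
      by (rule has_field_derivative_transform_within_open[OF DERIV_cmult[OF per_deriv_0[OF z]] X(1) z]) (simp add: F(1))
  qed
  have 2: "F2 x = C * (3 / 2 * per 2 x / 2)"
  proof (rule DERIV_unique[OF F(3)[OF x]])
    show "(F1 has_field_derivative C * (3 / 2 * per 2 x / 2)) (at x)"
      by (rule has_field_derivative_transform_within_open[OF DERIV_cmult[OF DERIV_cdivide[OF per_deriv_1[OF x]]] X(1) x]) (simp add: 1)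
  qed
  have "x * (x - 1) * F2 x + (2 * x - 1) * F1 x + F x / 4
      = C * (x * (x - 1) * (3 / 4 * per 2 x) + (2 * x - 1) * (per 1 x / 2) + per 0 x / 4)"
    unfolding 1[OF x] 2 F(1)[OF x] by (simp add: algebra_simps)
  then show ?thesis unfolding picard_fuchs[OF x] by simp
qed

end

section \<open>The coefficients \<open>L\<close> and the explicit equations for \<open>n = 0\<close>
  and \<open>n = 1\<close>\<close>

lemma sum_weighted_partitions:
  "sum F (weighted_partitions 0) = F (\<lambda>_. 0)"
  "sum F (weighted_partitions 1) = F ((\<lambda>_. 0)(1 := 1))"
  "sum F (weighted_partitions 2) = F ((\<lambda>_. 0)(1 := 2)) + F ((\<lambda>_. 0)(2 := 1))"
  "sum F (weighted_partitions 3) = F ((\<lambda>_. 0)(1 := 3)) + F ((\<lambda>_. 0)(1 := 1, 2 := 1)) + F ((\<lambda>_. 0)(3 := 1))"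
proof -
  have I: "{1..2} = {1, 2 :: nat}" "{1..3} = {1, 2, 3 :: nat}" by auto
  note fun_upd_idem [simp]
  have "weighted_partitions 0 = {\<lambda>_. 0}" by (auto simp: weighted_partitions_def)
  then show "sum F (weighted_partitions 0) = F (\<lambda>_. 0)" by simp
  have "weighted_partitions 1 = {(\<lambda>_. 0)(1 := 1)}" by (auto simp: weighted_partitions_def fun_eq_iff)
  then show "sum F (weighted_partitions 1) = F ((\<lambda>_. 0)(1 := 1))" by simp
  have "p = (\<lambda>_. 0)(1 := 2) \<or> p = (\<lambda>_. 0)(2 := 1)" if "p \<in> weighted_partitions 2" for p
  proof -
    have z: "p j = 0" if "j \<notin> {1, 2}" for j using \<open>p \<in> _\<close> that unfolding weighted_partitions_def I by blast
    have "p 1 + 2 * p 2 = 2" using that unfolding weighted_partitions_def I by simp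
    then have "p 1 = 2 \<and> p 2 = 0 \<or> p 1 = 0 \<and> p 2 = 1" by presburger
    moreover have eq: "p = (\<lambda>_. 0)(1 := i, 2 := k)" if "p 1 = i" "p 2 = k" for i k
    proof
      show "p j = ((\<lambda>_. 0)(1 := i, 2 := k)) j" for j using z[of j] that by (cases "j = 1"; cases "j = 2"; simp)
    qed
    ultimately show ?thesis using eq[of 2 0] eq[of 0 1] by auto
  qed
  moreover have "(\<lambda>_. 0)(1 := 2) \<in> weighted_partitions 2" "(\<lambda>_. 0)(2 := 1) \<in> weighted_partitions 2"
    unfolding weighted_partitions_def I by auto
  ultimately have "weighted_partitions 2 = {(\<lambda>_. 0)(1 := 2), (\<lambda>_. 0)(2 := 1)}" by blast
  moreover have "(\<lambda>_ :: nat. 0 :: nat)(1 := 2) \<noteq> (\<lambda>_. 0)(2 := 1 :: nat)" by (auto simp: fun_eq_iff dest: spec[of _ "1 :: nat"])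
  ultimately show "sum F (weighted_partitions 2) = F ((\<lambda>_. 0)(1 := 2)) + F ((\<lambda>_. 0)(2 := 1))" by simp
  have "p = (\<lambda>_. 0)(1 := 3) \<or> p = (\<lambda>_. 0)(1 := 1, 2 := 1) \<or> p = (\<lambda>_. 0)(3 := 1)" if "p \<in> weighted_partitions 3" for p
  proof -
    have z: "p j = 0" if "j \<notin> {1, 2, 3}" for j using \<open>p \<in> _\<close> that unfolding weighted_partitions_def I by blast
    have "p 1 + 2 * p 2 + 3 * p 3 = 3" using that unfolding weighted_partitions_def I by simp
    then have "p 1 = 3 \<and> p 2 = 0 \<and> p 3 = 0 \<or> p 1 = 1 \<and> p 2 = 1 \<and> p 3 = 0 \<or> p 1 = 0 \<and> p 2 = 0 \<and> p 3 = 1" by presburger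
    moreover have eq: "p = (\<lambda>_. 0)(1 := i, 2 := k, 3 := l)" if "p 1 = i" "p 2 = k" "p 3 = l" for i k l
    proof
      show "p j = ((\<lambda>_. 0)(1 := i, 2 := k, 3 := l)) j" for j
        using z[of j] that by (cases "j = 1"; cases "j = 2"; cases "j = 3"; simp)
    qed
    ultimately show ?thesis using eq[of 3 0 0] eq[of 1 1 0] eq[of 0 0 1] by auto
  qed
  moreover have "(\<lambda>_. 0)(1 := 3) \<in> weighted_partitions 3" "(\<lambda>_. 0)(1 := 1, 2 := 1) \<in> weighted_partitions 3"
    "(\<lambda>_. 0)(3 := 1) \<in> weighted_partitions 3"
    unfolding weighted_partitions_def I by auto
  ultimately have "weighted_partitions 3 = {(\<lambda>_. 0)(1 := 3), (\<lambda>_. 0)(1 := 1, 2 := 1), (\<lambda>_. 0)(3 := 1)}" by blast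
  moreover have "(\<lambda>_ :: nat. 0 :: nat)(1 := 3) \<noteq> (\<lambda>_. 0)(1 := 1, 2 := 1 :: nat)" "(\<lambda>_ :: nat. 0 :: nat)(1 := 3) \<noteq> (\<lambda>_. 0)(3 := 1 :: nat)"
    "(\<lambda>_ :: nat. 0 :: nat)(1 := 1, 2 := 1) \<noteq> (\<lambda>_. 0)(3 := 1 :: nat)"
    by (auto simp: fun_eq_iff dest: spec[of _ "1 :: nat"])
  ultimately show "sum F (weighted_partitions 3) = F ((\<lambda>_. 0)(1 := 3)) + F ((\<lambda>_. 0)(1 := 1, 2 := 1)) + F ((\<lambda>_. 0)(3 := 1))"
    by (simp add: add.assoc)
qed

text \<open>The series with coefficients \<open>L_coeff l x y / fact l\<close> is the exponential of
  the series with coefficients \<open>Sigma_sum k x y / (2 * k)\<close>, that is, the Taylor series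
  of \<open>v(y) / v(u)\<close> at \<open>u = y\<close>. For \<open>n \<le> 1\<close> the equation
  involves it up to index \<open>n + 2 = 3\<close>.\<close>

lemma L_coeff_small:
  "L_coeff 0 x y = 1"
  "L_coeff 1 x y = Sigma_sum 1 x y / 2"
  "L_coeff 2 x y = (Sigma_sum 1 x y)\<^sup>2 / 4 + Sigma_sum 2 x y / 2"
  "L_coeff 3 x y = Sigma_sum 1 x y ^ 3 / 8 + 3 / 4 * Sigma_sum 1 x y * Sigma_sum 2 x y + Sigma_sum 3 x y"
proof -
  have I: "{1..2} = {1, 2 :: nat}" "{1..3} = {1, 2, 3 :: nat}" by auto
  show "L_coeff 0 x y = 1" unfolding L_coeff_def sum_weighted_partitions by simp
  show "L_coeff 1 x y = Sigma_sum 1 x y / 2" unfolding L_coeff_def sum_weighted_partitions by simp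
  show "L_coeff 2 x y = (Sigma_sum 1 x y)\<^sup>2 / 4 + Sigma_sum 2 x y / 2"
    unfolding L_coeff_def sum_weighted_partitions I by (simp add: fact_numeral)
  show "L_coeff 3 x y = Sigma_sum 1 x y ^ 3 / 8 + 3 / 4 * Sigma_sum 1 x y * Sigma_sum 2 x y + Sigma_sum 3 x y"
    unfolding L_coeff_def sum_weighted_partitions I by (simp add: fact_numeral)
qed

text \<open>Multiplying by \<open>L_coeff 1 x y\<close> and writing \<open>g\<close> for
  \<open>1 / (x - y)\<close> clears the denominators other than \<open>x\<close> and
  \<open>x - 1\<close>, so that the comparison with the Picard-Fuchs equation becomes a polynomial
  identity.\<close>

lemma E_rhs_0:
  fixes x y d :: complex
  assumes xy: "x \<noteq> y" and L: "L_coeff 1 x y \<noteq> 0"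
  defines "g \<equiv> 1 / (x - y)"
  shows "E_rhs 0 x y d * L_coeff 1 x y = - d\<^sup>2 * L_coeff 2 x y - d * (1 / x + 1 / (x - 1) - g) * L_coeff 1 x y + d * g\<^sup>2
    - (3 * g\<^sup>2 - 2 * g * (1 / x + 1 / (x - 1)) + (1 / (x - 1) - 1 / x)) / 4"
proof -
  define L1 L2 u v where "L1 = L_coeff 1 x y" and "L2 = L_coeff 2 x y" and "u = 1 / x" and "v = 1 / (x - 1)"
  have g: "1 / (y - x) = - g" "2 / (y - x) = - 2 * g" "3 / (y - x)\<^sup>2 = 3 * g\<^sup>2"
    using xy by (simp_all add: g_def power2_commute[of y x] minus_divide_right power_divide)
  have L0: "L1 \<noteq> 0" using L by (simp add: L1_def)
  have "E_rhs 0 x y d = - d\<^sup>2 * (L2 / L1) - d * (u + v + - g) + d * (1 / (((x - y)\<^sup>2) * L1))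
      - 1 / (4 * L1) * (- 2 * g * (u + v) + 3 * g\<^sup>2 + v - u)"
    unfolding E_rhs_def Let_def g[symmetric] L1_def L2_def u_def v_def by (simp add: L_coeff_small(1) numeral_2_eq_2)
  also have "1 / (((x - y)\<^sup>2) * L1) = g\<^sup>2 / L1" using xy by (simp add: g_def power_divide)
  finally have E: "E_rhs 0 x y d = - d\<^sup>2 * (L2 / L1) - d * (u + v + - g) + d * (g\<^sup>2 / L1)
      - 1 / (4 * L1) * (- 2 * g * (u + v) + 3 * g\<^sup>2 + v - u)" .
  have "E_rhs 0 x y d * L1 = - d\<^sup>2 * L2 - d * (u + v - g) * L1 + d * g\<^sup>2 - (3 * g\<^sup>2 - 2 * g * (u + v) + (v - u)) / 4"
    unfolding E using L0 by (simp add: field_simps)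
  then show ?thesis by (simp only: L1_def L2_def u_def v_def)
qed

lemma E_rhs_1:
  fixes x y d :: complex
  assumes xy: "x \<noteq> y" and L: "L_coeff 2 x y \<noteq> 0"
  defines "g \<equiv> 1 / (x - y)"
  shows "E_rhs 1 x y d * L_coeff 2 x y = - d\<^sup>2 * L_coeff 3 x y - d * (1 / x + 1 / (x - 1) - g) * L_coeff 2 x y
    + 2 * d * (g ^ 3 + L_coeff 1 x y * g\<^sup>2) + (1 / x + 1 / (x - 1) - 2 * g) * g\<^sup>2 / 2 - g ^ 3 / 2
    - L_coeff 1 x y * (3 * g\<^sup>2 - 2 * g * (1 / x + 1 / (x - 1)) + (1 / (x - 1) - 1 / x)) / 4"
proof -
  define L1 L2 L3 u v s where "L1 = L_coeff 1 x y" and "L2 = L_coeff 2 x y" and "L3 = L_coeff 3 x y"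
    and "u = 1 / x" and "v = 1 / (x - 1)" and "s = x - y"
  have s0: "s \<noteq> 0" using xy by (simp add: s_def)
  have g: "1 / (y - x) = - g" "2 / (y - x) = - 2 * g" "3 / (y - x)\<^sup>2 = 3 * g\<^sup>2"
    using xy by (simp_all add: g_def power2_commute[of y x] minus_divide_right power_divide)
  have gs: "g = 1 / s" by (simp add: g_def s_def)
  have L0: "L2 \<noteq> 0" using L by (simp add: L2_def)
  have set: "{0..1} = {0, 1 :: nat}" "{0..<1} = {0 :: nat}" "{1..<1} = ({} :: nat set)" by auto
  have num: "1 + 1 = (2 :: nat)" "1 + 2 = (3 :: nat)" by auto
  have "E_rhs 1 x y d = - d\<^sup>2 * (L3 / L2) - d * (u + v + - g) + d * (2 / (s ^ 3 * L2)) * (1 + L1 * s)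
      + (u + v + - 2 * g) / (2 * s ^ 2 * L2) - 1 / (2 * s ^ 3 * L2)
      - L1 / (4 * L2) * (- 2 * g * (u + v) + 3 * g\<^sup>2 + v - u)"
    unfolding E_rhs_def Let_def g[symmetric] L1_def L2_def L3_def u_def v_def s_def set num
    by (simp add: L_coeff_small(1))
  also have "d * (2 / (s ^ 3 * L2)) * (1 + L1 * s) = 2 * d * (g ^ 3 + L1 * g\<^sup>2) / L2"
    using s0 L0 unfolding gs by (simp add: field_simps power2_eq_square power3_eq_cube)
  also have "(u + v + - 2 * g) / (2 * s ^ 2 * L2) = (u + v - 2 * g) * g\<^sup>2 / 2 / L2"
    using s0 L0 unfolding gs by (simp add: field_simps power2_eq_square)
  also have "1 / (2 * s ^ 3 * L2) = g ^ 3 / 2 / L2"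
    using s0 L0 unfolding gs by (simp add: power_divide)
  finally have E: "E_rhs 1 x y d = - d\<^sup>2 * (L3 / L2) - d * (u + v + - g) + 2 * d * (g ^ 3 + L1 * g\<^sup>2) / L2
      + (u + v - 2 * g) * g\<^sup>2 / 2 / L2 - g ^ 3 / 2 / L2
      - L1 / (4 * L2) * (- 2 * g * (u + v) + 3 * g\<^sup>2 + v - u)" .
  have "E_rhs 1 x y d * L2 = - d\<^sup>2 * L3 - d * (u + v - g) * L2 + 2 * d * (g ^ 3 + L1 * g\<^sup>2) + (u + v - 2 * g) * g\<^sup>2 / 2
     - g ^ 3 / 2 - L1 * (3 * g\<^sup>2 - 2 * g * (u + v) + (v - u)) / 4"
    unfolding E using L0 by (simp add: field_simps)
  then show ?thesis by (simp only: L1_def L2_def L3_def u_def v_def)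
qed

text \<open>Each of the three summands contributes through \<open>y\<close>; the extra term
  \<open>(1 / (x - y x)) ^ (k + 1)\<close> appears because the branch point \<open>x\<close> moves
  as well.\<close>

lemma Sigma_sum_deriv:
  assumes y: "(y has_field_derivative d) (at x)" and ne: "y x \<notin> {0, 1, x}" and k: "k > 0"
  shows "((\<lambda>x. Sigma_sum k x (y x)) has_field_derivative
    of_nat k * (Sigma_sum (k + 1) x (y x) * d - (1 / (x - y x)) ^ (k + 1))) (at x)"
proof -
  obtain j where j: "k = Suc j" using k by (cases k) auto
  have q: "((\<lambda>z. 1 / F z ^ k) has_field_derivative - of_nat k * F' * (1 / F x ^ (k + 1))) (at x)"
    if "(F has_field_derivative F') (at x)" "F x \<noteq> 0" for F F'
  proof -
    have "((\<lambda>z. 1 / F z ^ k) has_field_derivative (0 * F x ^ k - 1 * (of_nat k * (F x ^ (k - 1) * F'))) / (F x ^ k * F x ^ k)) (at x)"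
      using that by (auto intro!: derivative_eq_intros)
    moreover have "(0 * F x ^ k - 1 * (of_nat k * (F x ^ (k - 1) * F'))) / (F x ^ k * F x ^ k) = - of_nat k * F' * (1 / F x ^ (k + 1))"
    proof -
      have "(0 * (s * t) - 1 * (N * (t * F'))) / (s * t * (s * t)) = - N * F' * (1 / (s * (s * t)))"
        if "s \<noteq> 0" "t \<noteq> 0" for s t N :: complex
        using that by (simp add: field_simps)
      from this[of "F x" "F x ^ j" "of_nat k"] that(2) show ?thesis by (simp add: j)
    qed
    ultimately show ?thesis by simp
  qed
  have d: "((\<lambda>x. - y x) has_field_derivative - d) (at x)" "((\<lambda>x. 1 - y x) has_field_derivative 0 - d) (at x)"
    "((\<lambda>x. x - y x) has_field_derivative 1 - d) (at x)"
    by (intro derivative_intros y)+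
  have "((\<lambda>x. Sigma_sum k x (y x)) has_field_derivative - of_nat k * (- d) * (1 / (- y x) ^ (k + 1))
     + - of_nat k * (0 - d) * (1 / (1 - y x) ^ (k + 1)) + - of_nat k * (1 - d) * (1 / (x - y x) ^ (k + 1))) (at x)"
    unfolding Sigma_sum_def by (intro DERIV_add q d) (use ne in auto)
  moreover have "- N * (- d) * \<alpha> + - N * (0 - d) * \<beta> + - N * (1 - d) * \<gamma> = N * ((\<alpha> + \<beta> + \<gamma>) * d - \<gamma>)" for N \<alpha> \<beta> \<gamma> :: complex
    by (simp add: algebra_simps)
  ultimately show ?thesis unfolding Sigma_sum_def power_one_over by (simp only:)
qed

text \<open>The logarithmic derivative of \<open>1 / v\<close> is minus half that of
  \<open>cubic x (y x)\<close>, and the three factors of the cubic give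
  \<open>1 / (x - y x) - Sigma_sum 1 x (y x) * d\<close>.\<close>

lemma inverse_root_deriv:
  assumes X: "open X" "x \<in> X" and cont: "continuous_on X v" and un: "\<And>z. z \<in> X \<Longrightarrow> (y z, v z) \<in> unramified z"
    and y: "(y has_field_derivative d) (at x)"
  shows "((\<lambda>z. 1 / v z) has_field_derivative (Sigma_sum 1 x (y x) * d - 1 / (x - y x)) / 2 * (1 / v x)) (at x)"
proof -
  have sq: "(v z)\<^sup>2 = cubic z (y z)" "v z \<noteq> 0" if "z \<in> X" for z
    using un[OF that] by (auto simp: unramified_iff)
  have ne: "y x \<noteq> 0" "y x \<noteq> 1" "y x \<noteq> x" using un[OF X(2)] by (auto simp: unramified_iff')
  define D where "D = (d * (y x - 1) + y x * d) * (y x - x) + y x * (y x - 1) * (d - 1)"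
  have "((\<lambda>z. cubic z (y z)) has_field_derivative D) (at x)"
    unfolding D_def by (rule derivative_eq_intros y refl)+ (simp add: algebra_simps)
  from square_root_derivative[OF X cont sq(1) sq(2)[OF X(2)] this]
  have "(v has_field_derivative D / (2 * v x)) (at x)" .
  from DERIV_divide[OF DERIV_const this sq(2)[OF X(2)], of 1]
  have "((\<lambda>z. 1 / v z) has_field_derivative (0 * v x - 1 * (D / (2 * v x))) / (v x * v x)) (at x)" .
  moreover have "D = v x * v x * (1 / (x - y x) - Sigma_sum 1 x (y x) * d)"
  proof -
    have gen: "(d * B + A * d) * C + A * B * (d - 1) = A * B * C * (- (1 / C) - (- (1 / A) - 1 / B - 1 / C) * d)"
      if "A \<noteq> 0" "B \<noteq> 0" "C \<noteq> 0" for A B C :: complex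
      using that by (simp add: field_simps)
    have s: "1 / (c - y x) = - (1 / (y x - c))" for c by (metis minus_diff_eq minus_divide_right)
    have "Sigma_sum 1 x (y x) = - (1 / y x) - 1 / (y x - 1) - 1 / (y x - x)"
      unfolding Sigma_sum_def power_one_right s by simp
    with s show ?thesis
      using gen[of "y x" "y x - 1" "y x - x"] ne sq(1)[OF X(2)] by (simp add: D_def power2_eq_square)
  qed
  moreover have "(0 * V - 1 * (V * V * (s - t) / (2 * V))) / (V * V) = (t - s) / 2 * (1 / V)" if "V \<noteq> 0" for V s t :: complex
    using that by (simp add: field_simps)
  ultimately show ?thesis using sq(2)[OF X(2)] by (simp only: not_False_eq_True)
qed

text \<open>For \<open>z = x - 1\<close> this divides the Picard-Fuchs equation by
  \<open>x * (x - 1)\<close>: \<open>2 * x - 1\<close> becomes \<open>1 / x + 1 / (x - 1)\<close>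
  and the constant becomes \<open>1 / (x - 1) - 1 / x\<close>, the combinations that occur in
  \<open>E_rhs\<close>.\<close>

lemma partial_fractions:
  fixes x z M m s :: complex
  assumes "x \<noteq> 0" "z \<noteq> 0"
  shows "M + (1 / x + 1 / z) * m + (1 / z - 1 / x) * s / 4 = (x * z * M + (x + z) * m + (x - z) * s / 4) / (x * z)"
proof -
  have "1 / x + 1 / z = (x + z) / (x * z)" "1 / z - 1 / x = (x - z) / (x * z)" "M = x * z * M / (x * z)"
    using assms by (simp_all add: add_divide_distrib diff_divide_distrib)
  then have "M + (1 / x + 1 / z) * m + (1 / z - 1 / x) * s / 4
      = x * z * M / (x * z) + (x + z) / (x * z) * m + (x - z) / (x * z) * s / 4"
    by metis
  moreover have "P / k + A / k * m + B / k * s / 4 = (P + A * m + B * s / 4) / k" for P A B k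
    by (simp add: add_divide_distrib mult.commute)
  ultimately show ?thesis by (simp only:)
qed

section \<open>The equations for the selected point\<close>

locale wave_family = a: loop_family \<X> a for \<X> a +
  fixes y0 v :: "complex \<Rightarrow> complex"
  assumes y0: "y0 holomorphic_on \<X>" and v: "continuous_on \<X> v"
    and unr: "\<And>x. x \<in> \<X> \<Longrightarrow> (y0 x, v x) \<in> unramified x"
begin

abbreviation S :: "nat \<Rightarrow> complex \<Rightarrow> complex" where
  "S k x \<equiv> Sigma_sum k x (y0 x)"

abbreviation g :: "complex \<Rightarrow> complex" where
  "g x \<equiv> 1 / (x - y0 x)"

abbreviation d :: "complex \<Rightarrow> complex" where
  "d \<equiv> deriv y0"

text \<open>The logarithmic derivative of \<open>1 / v\<close> along the family.\<close>

abbreviation m0 :: "complex \<Rightarrow> complex" where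
  "m0 x \<equiv> (S 1 x * d x - g x) / 2"

text \<open>The factor in the derivative of \<open>S 1 / v\<close>, which is
  \<open>m1 / v\<close>.\<close>

abbreviation m1 :: "complex \<Rightarrow> complex" where
  "m1 x \<equiv> S 2 x * d x - (g x)\<^sup>2 + S 1 x * m0 x"

lemma y0_nz: "x \<in> \<X> \<Longrightarrow> y0 x \<notin> {0, 1, x}"
  using unr by (auto simp: unramified_iff')

lemma v_nz: "x \<in> \<X> \<Longrightarrow> v x \<noteq> 0"
  using unr by (auto simp: unramified_iff)

lemma y0_deriv: "x \<in> \<X> \<Longrightarrow> (y0 has_field_derivative d x) (at x)"
  using y0 a.X(1) by (rule holomorphic_derivI)

lemma d_deriv: "x \<in> \<X> \<Longrightarrow> (d has_field_derivative deriv d x) (at x)"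
  using holomorphic_deriv[OF y0 a.X(1)] a.X(1) by (rule holomorphic_derivI)

lemma S1_deriv: "x \<in> \<X> \<Longrightarrow> (S 1 has_field_derivative S 2 x * d x - (g x)\<^sup>2) (at x)"
  using Sigma_sum_deriv[OF y0_deriv y0_nz, of x 1] by (simp add: numeral_2_eq_2)

lemma S2_deriv: "x \<in> \<X> \<Longrightarrow> (S 2 has_field_derivative 2 * (S 3 x * d x - g x ^ 3)) (at x)"
  using Sigma_sum_deriv[OF y0_deriv y0_nz, of x 2] by simp

lemma g_deriv:
  assumes "x \<in> \<X>"
  shows "(g has_field_derivative (d x - 1) * (g x)\<^sup>2) (at x)"
proof -
  have ne: "x - y0 x \<noteq> 0" using y0_nz[OF assms] by auto
  have "(g has_field_derivative (0 * (x - y0 x) - 1 * (1 - d x)) / ((x - y0 x) * (x - y0 x))) (at x)"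
    by (intro DERIV_divide DERIV_const DERIV_diff DERIV_ident y0_deriv assms ne)
  moreover have "(0 * s - 1 * (1 - t)) / (s * s) = (t - 1) * (1 / s)\<^sup>2" for s t :: complex
    by (simp add: power2_eq_square)
  ultimately show ?thesis by (simp only:)
qed

lemma inverse_v_deriv: "x \<in> \<X> \<Longrightarrow> ((\<lambda>z. 1 / v z) has_field_derivative m0 x * (1 / v x)) (at x)"
  by (rule inverse_root_deriv[OF a.X(1) _ v unr y0_deriv])

lemma m0_deriv:
  assumes "x \<in> \<X>"
  shows "(m0 has_field_derivative ((S 2 x * d x - (g x)\<^sup>2) * d x + deriv d x * S 1 x - (d x - 1) * (g x)\<^sup>2) / 2) (at x)"
  by (intro DERIV_cdivide DERIV_diff DERIV_mult S1_deriv d_deriv g_deriv assms)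

lemma wave_number_equation:
  assumes C: "\<And>x. x \<in> \<X> \<Longrightarrow> 1 / v x = C * a.per 0 x"
  shows "satisfies_E 0 \<X> y0"
  unfolding satisfies_E_def
proof (intro ballI impI)
  fix x assume x: "x \<in> \<X>" and L: "L_coeff (0 + 1) x (y0 x) \<noteq> 0"
  define D where "D x = ((S 2 x * d x - (g x)\<^sup>2) * d x + deriv d x * S 1 x - (d x - 1) * (g x)\<^sup>2) / 2" for x
  have "x * (x - 1) * (D x * (1 / v x) + m0 x * (1 / v x) * m0 x) + (2 * x - 1) * (m0 x * (1 / v x)) + (1 / v x) / 4 = 0"
  proof (rule a.picard_fuchs_multiple[OF C inverse_v_deriv _ x])
    fix x assume x: "x \<in> \<X>"
    show "((\<lambda>x. m0 x * (1 / v x)) has_field_derivative D x * (1 / v x) + m0 x * (1 / v x) * m0 x) (at x)"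
      using DERIV_mult[OF m0_deriv[OF x] inverse_v_deriv[OF x]] by (simp only: D_def)
  qed
  \<comment> \<open>Both derivatives of \<open>1 / v\<close> are multiples of \<open>1 / v\<close>,
    so this factor splits off and an equation without square roots remains.\<close>
  moreover have "X' * (D' * V + m * V * m) + Y' * (m * V) + V / 4 = V * (X' * (D' + m\<^sup>2) + Y' * m + 1 / 4)"
    for X' Y' D' V m :: complex
    by (simp add: algebra_simps power2_eq_square)
  ultimately have "(1 / v x) * (x * (x - 1) * (D x + (m0 x)\<^sup>2) + (2 * x - 1) * m0 x + 1 / 4) = 0"
    by (simp only:)
  then have pf: "x * (x - 1) * (D x + (m0 x)\<^sup>2) + (2 * x - 1) * m0 x + 1 / 4 = 0"
    using v_nz[OF x] by simp
  have x01: "x \<noteq> 0" "x - 1 \<noteq> 0" using a.X(2) x by auto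
  have eq: "D x + (m0 x)\<^sup>2 + (1 / x + 1 / (x - 1)) * m0 x + (1 / (x - 1) - 1 / x) / 4 = 0"
  proof -
    have s: "x + (x - 1) = 2 * x - 1" "(x - (x - 1)) / 4 = 1 / 4" by simp_all
    show ?thesis
      using partial_fractions[OF x01, of "D x + (m0 x)\<^sup>2" "m0 x" 1] unfolding s pf div_0 mult_1_right .
  qed
  have ne: "x \<noteq> y0 x" using y0_nz[OF x] by auto
  have L1: "L_coeff 1 x (y0 x) \<noteq> 0" using L by simp
  \<comment> \<open>A polynomial identity in free variables, with \<open>s1 / 2\<close> in the place
    of \<open>L_coeff 1\<close> and \<open>s1\<^sup>2 / 4 + s2 / 2\<close> in that of
    \<open>L_coeff 2\<close>; \<open>E'\<close> is the second derivative of
    \<open>y0\<close>.\<close>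
  have key: "E' * (s1 / 2) = - d'\<^sup>2 * (s1\<^sup>2 / 4 + s2 / 2) - d' * (p + q - g') * (s1 / 2) + d' * g'\<^sup>2
      - (3 * g'\<^sup>2 - 2 * g' * (p + q) + (q - p)) / 4"
    if "((s2 * d' - g'\<^sup>2) * d' + E' * s1 - (d' - 1) * g'\<^sup>2) / 2 + ((s1 * d' - g') / 2)\<^sup>2
      + (p + q) * ((s1 * d' - g') / 2) + (q - p) / 4 = 0" for E' s1 s2 d' g' p q :: complex
    using that by (simp add: power2_eq_square algebra_simps add_divide_distrib diff_divide_distrib) algebra
  have "deriv d x * L_coeff 1 x (y0 x) = E_rhs 0 x (y0 x) (d x) * L_coeff 1 x (y0 x)"
    unfolding E_rhs_0[OF ne L1] unfolding L_coeff_small by (rule key[OF eq[unfolded D_def]])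
  then show "deriv d x = E_rhs 0 x (y0 x) (d x)" using L1 by simp
qed

text \<open>The same scheme as for the wave number, with \<open>S 1 / v\<close> in place of
  \<open>1 / v\<close>: its first derivative is \<open>m1 / v\<close> and its second
  \<open>(T + m0 * m1) / v\<close>, where \<open>T\<close> is the derivative of
  \<open>m1\<close>.\<close>

lemma frequency_equation:
  assumes C: "\<And>x. x \<in> \<X> \<Longrightarrow> S 1 x * (1 / v x) = C * a.per 0 x"
  shows "satisfies_E 1 \<X> y0"
  unfolding satisfies_E_def
proof (intro ballI impI)
  fix x assume x: "x \<in> \<X>" and L: "L_coeff (1 + 1) x (y0 x) \<noteq> 0"
  define D where "D x = ((S 2 x * d x - (g x)\<^sup>2) * d x + deriv d x * S 1 x - (d x - 1) * (g x)\<^sup>2) / 2" for x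
  define T where "T x = 2 * (S 3 x * d x - g x ^ 3) * d x + deriv d x * S 2 x - 2 * ((d x - 1) * (g x)\<^sup>2) * g x
    + ((S 2 x * d x - (g x)\<^sup>2) * m0 x + D x * S 1 x)" for x
  have m1_deriv: "(m1 has_field_derivative T x) (at x)" if x: "x \<in> \<X>" for x
  proof -
    have "((\<lambda>x. (g x)\<^sup>2) has_field_derivative 2 * ((d x - 1) * (g x)\<^sup>2) * g x) (at x)"
      using DERIV_power[OF g_deriv[OF x], of 2] by (simp add: mult_ac)
    from DERIV_add[OF DERIV_diff[OF DERIV_mult[OF S2_deriv[OF x] d_deriv[OF x]] this] DERIV_mult[OF S1_deriv[OF x] m0_deriv[OF x]]]
    show ?thesis by (simp only: T_def D_def)
  qed
  have "x * (x - 1) * (T x * (1 / v x) + m0 x * (1 / v x) * m1 x) + (2 * x - 1) * (m1 x * (1 / v x)) + S 1 x * (1 / v x) / 4 = 0"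
  proof (rule a.picard_fuchs_multiple[OF C _ _ x])
    fix x assume x: "x \<in> \<X>"
    show "((\<lambda>x. S 1 x * (1 / v x)) has_field_derivative m1 x * (1 / v x)) (at x)"
      using DERIV_mult[OF S1_deriv[OF x] inverse_v_deriv[OF x]] by (simp only: distrib_right distrib_left mult_ac)
    show "((\<lambda>x. m1 x * (1 / v x)) has_field_derivative T x * (1 / v x) + m0 x * (1 / v x) * m1 x) (at x)"
      by (rule DERIV_mult[OF m1_deriv[OF x] inverse_v_deriv[OF x]])
  qed
  moreover have "X' * (T' * V + m * V * M) + Y' * (M * V) + s * V / 4 = V * (X' * (T' + m * M) + Y' * M + s / 4)"
    for X' Y' T' V m M s :: complex
    by (simp add: algebra_simps)
  ultimately have "(1 / v x) * (x * (x - 1) * (T x + m0 x * m1 x) + (2 * x - 1) * m1 x + S 1 x / 4) = 0"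
    by (simp only:)
  then have pf: "x * (x - 1) * (T x + m0 x * m1 x) + (2 * x - 1) * m1 x + S 1 x / 4 = 0"
    using v_nz[OF x] by (simp only: mult_eq_0_iff divide_eq_0_iff one_neq_zero) simp
  have x01: "x \<noteq> 0" "x - 1 \<noteq> 0" using a.X(2) x by auto
  have eq: "T x + m0 x * m1 x + (1 / x + 1 / (x - 1)) * m1 x + (1 / (x - 1) - 1 / x) * S 1 x / 4 = 0"
  proof -
    have s: "x + (x - 1) = 2 * x - 1" "(x - (x - 1)) * S 1 x / 4 = S 1 x / 4" by simp_all
    show ?thesis
      using partial_fractions[OF x01, of "T x + m0 x * m1 x" "m1 x" "S 1 x"] unfolding s pf div_0 .
  qed
  have ne: "x \<noteq> y0 x" using y0_nz[OF x] by auto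
  have L2: "L_coeff 2 x (y0 x) \<noteq> 0" using L by (simp add: numeral_2_eq_2)
  have key: "E' * (s1\<^sup>2 / 4 + s2 / 2) = - d'\<^sup>2 * (s1 ^ 3 / 8 + 3 / 4 * s1 * s2 + s3) - d' * (p + q - g') * (s1\<^sup>2 / 4 + s2 / 2)
      + 2 * d' * (g' ^ 3 + s1 / 2 * g'\<^sup>2) + (p + q - 2 * g') * g'\<^sup>2 / 2 - g' ^ 3 / 2
      - s1 / 2 * (3 * g'\<^sup>2 - 2 * g' * (p + q) + (q - p)) / 4"
    if "2 * (s3 * d' - g' ^ 3) * d' + E' * s2 - 2 * ((d' - 1) * g'\<^sup>2) * g'
    + ((s2 * d' - g'\<^sup>2) * ((s1 * d' - g') / 2) + ((s2 * d' - g'\<^sup>2) * d' + E' * s1 - (d' - 1) * g'\<^sup>2) / 2 * s1)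
      + (s1 * d' - g') / 2 * (s2 * d' - g'\<^sup>2 + s1 * ((s1 * d' - g') / 2))
      + (p + q) * (s2 * d' - g'\<^sup>2 + s1 * ((s1 * d' - g') / 2)) + (q - p) * s1 / 4 = 0" for E' s1 s2 s3 d' g' p q :: complex
  proof -
    \<comment> \<open>The difference of the two sides is half of the Picard-Fuchs
      expression.\<close>
    have "E' * (s1\<^sup>2 / 4 + s2 / 2) - (- d'\<^sup>2 * (s1 ^ 3 / 8 + 3 / 4 * s1 * s2 + s3) - d' * (p + q - g') * (s1\<^sup>2 / 4 + s2 / 2)
      + 2 * d' * (g' ^ 3 + s1 / 2 * g'\<^sup>2) + (p + q - 2 * g') * g'\<^sup>2 / 2 - g' ^ 3 / 2
      - s1 / 2 * (3 * g'\<^sup>2 - 2 * g' * (p + q) + (q - p)) / 4)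
      = (2 * (s3 * d' - g' ^ 3) * d' + E' * s2 - 2 * ((d' - 1) * g'\<^sup>2) * g'
    + ((s2 * d' - g'\<^sup>2) * ((s1 * d' - g') / 2) + ((s2 * d' - g'\<^sup>2) * d' + E' * s1 - (d' - 1) * g'\<^sup>2) / 2 * s1)
      + (s1 * d' - g') / 2 * (s2 * d' - g'\<^sup>2 + s1 * ((s1 * d' - g') / 2))
      + (p + q) * (s2 * d' - g'\<^sup>2 + s1 * ((s1 * d' - g') / 2)) + (q - p) * s1 / 4) / 2"
      by (simp add: power2_eq_square power3_eq_cube algebra_simps add_divide_distrib diff_divide_distrib)
    then show ?thesis unfolding that by simp
  qed
  have "deriv d x * L_coeff 2 x (y0 x) = E_rhs 1 x (y0 x) (d x) * L_coeff 2 x (y0 x)"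
    unfolding E_rhs_1[OF ne L2] unfolding L_coeff_small by (rule key[OF eq[unfolded T_def D_def]])
  then show "deriv d x = E_rhs 1 x (y0 x) (d x)" using L2 by simp
qed

end

section \<open>From canonical bases and constant periods to the two equations\<close>

lemma consistent_loop_families:
  assumes "open \<X>" "\<X> \<subseteq> - {0, 1}" "consistent_canonical_bases \<X> a b"
  shows "loop_family \<X> a" "loop_family \<X> b"
  using assms unfolding consistent_canonical_bases_def canonical_basis_def
  by (unfold_locales; fast)+

theorem proposition1:
  fixes \<X> :: "complex set"
    and a b :: "complex \<Rightarrow> real \<Rightarrow> complex \<times> complex"
    and \<omega> :: "complex \<Rightarrow> complex \<times> complex \<Rightarrow> complex"
    and W :: "nat \<Rightarrow> complex \<Rightarrow> complex \<times> complex \<Rightarrow> complex"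
    and Q0 :: "complex \<Rightarrow> complex \<times> complex"
    and \<tau> U V z0 c y0 :: "complex \<Rightarrow> complex"
  assumes "open \<X>" and "simply_connected \<X>" and "\<X> \<subseteq> - {0, 1}"
    and "consistent_canonical_bases \<X> a b"
    and "\<And>x. x \<in> \<X> \<Longrightarrow> normalized_holomorphic x (a x) (\<omega> x)"
    and "\<And>x. x \<in> \<X> \<Longrightarrow> has_period x {} (\<omega> x) (b x) (\<tau> x)"
    and "continuous_on \<X> Q0"
    and "\<And>x. x \<in> \<X> \<Longrightarrow> Q0 x \<in> unramified x"
    and "\<And>x. y0 x = fst (Q0 x)"
    and "y0 holomorphic_on \<X>"
    and "\<And>n x. x \<in> \<X> \<Longrightarrow> n \<in> {0, 1} \<Longrightarrow> normalized_second_kind n x (a x) (Q0 x) (W n x)"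
    and "\<And>x. x \<in> \<X> \<Longrightarrow>
           \<exists>I. has_period x {Q0 x} (W 0 x) (b x) I \<and> U x = - 1 / (2 * of_real pi * \<i>) * I"
    and "\<And>x. x \<in> \<X> \<Longrightarrow>
           \<exists>I. has_period x {Q0 x} (W 1 x) (b x) I \<and> V x = - 1 / (of_real pi * \<i>) * I"
    and "continuous_on \<X> z0" and "continuous_on \<X> c"
    and "\<And>x X Y. x \<in> \<X> \<Longrightarrow> theta (\<tau> x) (X * U x + Y * V x + z0 x) \<noteq> 0 \<Longrightarrow>
           boussinesq_at (boussinesq_wave (\<tau> x) (U x) (V x) (z0 x) (c x)) X Y"
  shows "(U constant_on \<X> \<longrightarrow> satisfies_E 0 \<X> y0) \<and>
         (V constant_on \<X> \<longrightarrow> satisfies_E 1 \<X> y0)"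
proof -
  define v where "v x = snd (Q0 x)" for x
  have Q0: "Q0 x = (y0 x, v x)" for x by (simp add: v_def assms(9))
  have fam: "loop_family \<X> a" "loop_family \<X> b"
    using consistent_loop_families[OF assms(1,3,4)] .
  interpret wave_family \<X> a y0 v
  proof (intro wave_family.intro wave_family_axioms.intro fam)
    show "continuous_on \<X> v" unfolding v_def[abs_def] by (intro continuous_on_snd assms(7))
    show "(y0 x, v x) \<in> unramified x" if "x \<in> \<X>" for x using assms(8)[OF that] Q0 by simp
  qed (rule assms(10))
  interpret b: loop_family \<X> b by (rule fam)
  define p where "p x = loop_period (basic_form 0 1) (a x)" for x
  define q where "q x = loop_period (basic_form 0 1) (b x)" for x
  obtain K where K: "\<And>x. x \<in> \<X> \<Longrightarrow> a.per 0 x * q x - b.per 0 x * p x = K"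
    using legendre_constant[OF fam simply_connected_imp_connected[OF assms(2)]] unfolding p_def q_def by metis
  have K0: "K \<noteq> 0" if x: "x \<in> \<X>" for x
  proof
    assume "K = 0"
    have basis: "surface_loop x (a x)" "surface_loop x (b x)" "homology_basis x (a x) (b x)"
      using assms(4) x by (auto simp: consistent_canonical_bases_def canonical_basis_def)
    have x01: "x \<notin> {0, 1}" using assms(3) x by blast
    have per: "loop_period (basic_form \<alpha> \<beta>) (a x) = \<alpha> * a.per 0 x + \<beta> * p x"
      "loop_period (basic_form \<alpha> \<beta>) (b x) = \<alpha> * b.per 0 x + \<beta> * q x" for \<alpha> \<beta>
      unfolding p_def q_def using loop_period_basic[OF basis(1)] loop_period_basic[OF basis(2)] by metis+
    note ind = basic_periods_independent[OF x01 basis, unfolded per]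
    \<comment> \<open>If the determinant vanishes, the coefficient pairs \<open>(- p, A)\<close> and
      \<open>(- q, B)\<close>, with A and B the periods of \<open>du / v\<close>, give forms whose
      two periods are both 0. Independence then makes all four basic periods 0, and
      \<open>du / v\<close> itself contradicts independence.\<close>
    have det: "a.per 0 x * q x = b.per 0 x * p x" using K[OF x] \<open>K = 0\<close> by simp
    have "- p x = 0 \<and> a.per 0 x = 0" by (rule ind) (use det in \<open>simp_all add: algebra_simps\<close>)
    moreover have "- q x = 0 \<and> b.per 0 x = 0" by (rule ind) (use det in \<open>simp_all add: algebra_simps\<close>)
    ultimately show False using ind[of 1 0] by simp
  qed
  have x01: "x \<notin> {0, 1}" if "x \<in> \<X>" for x using assms(3) that by blast
  have "satisfies_E 0 \<X> y0" if "U constant_on \<X>"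
  proof -
    obtain C where C: "\<And>x. x \<in> \<X> \<Longrightarrow> U x = C" using \<open>U constant_on \<X>\<close> by (auto simp: constant_on_def)
    \<comment> \<open>Combines \<open>A * I = K / (4 * v)\<close> with the definition of
      \<open>U\<close>, which gives I as \<open>- 2 * pi * i * C\<close>.\<close>
    have "1 / v x = 4 * (- 2 * of_real pi * \<i> * C) / K * a.per 0 x" if x: "x \<in> \<X>" for x
    proof -
      obtain I where I: "has_period x {Q0 x} (W 0 x) (b x) I" "U x = - 1 / (2 * of_real pi * \<i>) * I"
        using assms(12)[OF x] by blast
      have IC: "I = - 2 * of_real pi * \<i> * C" using I(2) C[OF x] by (auto simp: field_simps)
      have "a.per 0 x * I = 1 / (4 * v x) * K"
        using second_kind_period_0[OF x01[OF x] unr[OF x] a.loop[OF x] b.loop[OF x], of "W 0 x" I] assms(11)[OF x, of 0] I(1) K[OF x]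
        by (simp add: Q0 p_def q_def)
      then have "1 / v x = 4 * I / K * a.per 0 x" using K0[OF x] v_nz[OF x] by (simp add: field_simps)
      then show ?thesis unfolding IC .
    qed
    then show ?thesis by (rule wave_number_equation)
  qed
  moreover have "satisfies_E 1 \<X> y0" if "V constant_on \<X>"
  proof -
    obtain C where C: "\<And>x. x \<in> \<X> \<Longrightarrow> V x = C" using \<open>V constant_on \<X>\<close> by (auto simp: constant_on_def)
    have "S 1 x * (1 / v x) = 16 * (- of_real pi * \<i> * C) / K * a.per 0 x" if x: "x \<in> \<X>" for x
    proof -
      obtain I where I: "has_period x {Q0 x} (W 1 x) (b x) I" "V x = - 1 / (of_real pi * \<i>) * I"
        using assms(13)[OF x] by blast
      have IC: "I = - of_real pi * \<i> * C" using I(2) C[OF x] by (auto simp: field_simps)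
      define r where "r = 3 * (y0 x)\<^sup>2 - 2 * (1 + x) * y0 x + x"
      have "a.per 0 x * I = - r / (16 * v x ^ 3) * K"
        using second_kind_period_1[OF x01[OF x] unr[OF x] a.loop[OF x] b.loop[OF x], of "W 1 x" I] assms(11)[OF x, of 1] I(1) K[OF x]
        by (simp add: Q0 p_def q_def r_def)
      \<comment> \<open>\<open>S 1\<close> is minus the logarithmic derivative of the cubic with
        respect to \<open>u\<close> at \<open>y0\<close>, and \<open>r\<close> is the derivative of
        the cubic. The coefficient \<open>- r / (16 * v ^ 3)\<close> thus becomes
        \<open>S 1 / (16 * v)\<close>.\<close>
      moreover have "- r = S 1 x * (v x)\<^sup>2"
      proof -
        have s: "1 / (k - y0 x) = - (1 / (y0 x - k))" for k by (metis minus_diff_eq minus_divide_right)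
        have S: "S 1 x = - (1 / y0 x) - 1 / (y0 x - 1) - 1 / (y0 x - x)"
          unfolding Sigma_sum_def power_one_right s by simp
        have "(- (1 / A) - 1 / B - 1 / D) * (A * B * D) = - (B * D + A * D + A * B)"
          if "A \<noteq> 0" "B \<noteq> 0" "D \<noteq> 0" for A B D :: complex
          using that by (simp add: field_simps)
        from this[of "y0 x" "y0 x - 1" "y0 x - x"] y0_nz[OF x]
        have "S 1 x * cubic x (y0 x) = - r" unfolding S r_def by (simp add: algebra_simps power2_eq_square)
        moreover have "(v x)\<^sup>2 = cubic x (y0 x)" using unr[OF x] by (simp add: unramified_iff)
        ultimately show ?thesis by simp
      qed
      ultimately have "a.per 0 x * I = S 1 x * (v x)\<^sup>2 / (16 * v x ^ 3) * K" by simp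
      then have "S 1 x * (1 / v x) = 16 * I / K * a.per 0 x"
        using K0[OF x] v_nz[OF x] by (simp add: field_simps power2_eq_square power3_eq_cube)
      then show ?thesis unfolding IC .
    qed
    then show ?thesis by (rule frequency_equation)
  qed
  ultimately show ?thesis by blast
qed

end
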